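(* Let $\mathcal W_\alpha$ be an irreducible ordinary $V$-module and let $v_1,\ldots,v_n\in V$ be quasiprimary vectors of weights $\mathrm{wt}(v_i)$ inserted at $z_1,\ldots,z_n$. Then $$\mathcal F_\alpha^{(1)}(\boldsymbol v,\boldsymbol z)=Z_{\alpha'}^{\mathrm{Zhu}}(\boldsymbol v,\boldsymbol\zeta;q)\prod_{i=1}^nd\zeta_i^{\mathrm{wt}(v_i)},$$ where $\zeta_i=\log Z_i$ with $Z_i=\dfrac{z_i-W_{-1}}{z_i-W_1}$ for $i=1,\ldots,n$, and $\alpha'$ labels the contragredient module of $\mathcal W_\alpha$.
   Context: $V=(V,Y,\mathbf 1,\omega)$ is a simple vertex operator algebra over $\mathbb C$ of strong CFT type ($V=\bigoplus_{n\ge0}V_n$, $\dim V_n<\infty$, $V_0=\mathbb C\mathbf 1$, $L(1)V_1=0$), isomorphic to its contragredient module; $Y(\omega,z)=\sum_nL(n)z^{-n-2}$; homogeneous $v$ is quasiprimary if $L(1)v=0$. $\langle\cdot,\cdot\rangle$ is the unique non-degenerate invariant bilinear form on $V$ with $\langle\mathbf 1,\mathbf 1\rangle=1$. **Modules.** $\{(Y_\alpha,\mathcal W_\alpha)\}_{\alpha\in\mathcal A}$ are the inequivalent irreducible ordinary $V$-modules, $\mathcal W_0=V$, $\mathcal W_\alpha=\bigoplus_{n\ge0}\mathcal W_{\alpha,n+h_\alpha}$ with finite-dimensional $L(0)$-eigenspaces of weight $n+h_\alpha$, $h_\alpha\in\mathbb C$. $\mathcal W_{\alpha'}$ is the contragredient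 module, $\langle\cdot,\cdot\rangle$ also the canonical pairing. With $N^\gamma_{\alpha\beta}$ the dimension of the space of intertwining operators of type $\binom{\gamma}{\alpha\ \beta}$, it is assumed that $N^\gamma_{\alpha0}=\delta_{\alpha\gamma}$, $N^0_{\alpha\beta}=\delta_{\alpha\beta'}$. The intertwiners are normalized by $\mathcal Y^\alpha_{\alpha0}(v_\alpha,z)u=e^{zL(-1)}Y_\alpha(u,-z)v_\alpha$ and $\langle u,\mathcal Y^0_{\alpha\alpha'}(v_\alpha,z)v_{\alpha'}\rangle=\langle\mathcal Y^\alpha_{\alpha0}(e^{zL(1)}(-z^{-2})^{L(0)}v_\alpha,z^{-1})u,v_{\alpha'}\rangle$. **Genus zero.** For $v_\alpha\in\mathcal W_\alpha$, $v_{\alpha'}\in\mathcal W_{\alpha'}$, $$Z^{(0)}(v_\alpha,y_1;\boldsymbol v,\boldsymbol z;v_{\alpha'},y_2)=\langle\mathbf 1,\mathcal Y^0_{\alpha\alpha'}(v_\alpha,y_1)Y_{\alpha'}(v_1,z_1)\cdots Y_{\alpha'}(v_n,z_n)\mathcal Y^{\alpha'}_{\alpha'0}(v_{\alpha'},y_2)\mathbf 1\rangle,$$ and $(y_1-y_2)^{2h_\alpha}Z^{(0)}$ is identified with its extension to a rational function. **Genus one.** Schottky parameters $W_1,W_{-1},q$ ($|q|<1$) and $w_1=\frac{W_1-qW_{-1}}{1-q}$, $w_{-1}=\frac{W_{-1}-qW_1}{1-q}$, $\rho=-\frac{q(W_{-1}-W_1)^2}{(1-q)^2}=-\frac{q(w_{-1}-w_1)^2}{(1+q)^2}$,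 so that $\rho^{h_\alpha}=\left(-q/(1+q)^2\right)^{h_\alpha}(w_{-1}-w_1)^{2h_\alpha}$. Define $$\mathcal F_\alpha^{(1)}(\boldsymbol v,\boldsymbol z)=\sum_{m\ge0}\rho^{m+h_\alpha}\sum_{b\in\mathcal W_{\alpha,m+h_\alpha}}Z^{(0)}(b,w_1;\boldsymbol v,\boldsymbol z;b',w_{-1})\prod_{i=1}^ndz_i^{\mathrm{wt}(v_i)},$$ with $\{b\}$ a homogeneous basis of $\mathcal W_\alpha$ and $\{b'\}$ the dual basis of $\mathcal W_{\alpha'}$. Powers with exponent $h_\alpha$ are formal: $(w_{-1}-w_1)^{2h_\alpha}$ is identified with $(w_1-w_{-1})^{2h_\alpha}$, and the factor $(-1)^{h_\alpha}$ coming from $(-z^{-2})^{L(0)}$ is taken so that $(-1)^{h_\alpha}(-q)^{h_\alpha}=q^{h_\alpha}$. **Zhu trace function.** $$Z_{\alpha}^{\mathrm{Zhu}}(\boldsymbol v,\boldsymbol\zeta;q)=\mathrm{tr}_{\mathcal W_\alpha}Y_\alpha(e^{\mathrm{wt}(v_1)\zeta_1}v_1,e^{\zeta_1})\cdots Y_\alpha(e^{\mathrm{wt}(v_n)\zeta_n}v_n,e^{\zeta_n})q^{L(0)}.$$ The identity is understood formally in $q$. *)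

theory Defs
  imports
    "HOL-Analysis.Analysis"
    "HOL-Library.Poly_Mapping"
    "HOL-Library.Function_Algebras"
    "HOL-Computational_Algebra.Formal_Power_Series"
begin

text \<open>
  All vector spaces are subspaces of one complex vector space (a type 'u with an explicit scalar
  multiplication), so that families of modules can be quantified over. This loses no generality:
  take the direct sum of all the spaces involved. A field \<open>Y(v,z)w = \<Sum>\<^sub>n v\<^sub>n w z\<^sup>-\<^sup>n\<^sup>-\<^sup>1\<close> is given by its modes,
  \<open>mode M v n w = v\<^sub>n w\<close>; values outside the carriers are irrelevant.
\<close>

record 'u vmod =
  carr :: "'u set"
  mode :: "'u \<Rightarrow> int \<Rightarrow> 'u \<Rightarrow> 'u"

record 'u voa = "'u vmod" +
  vac :: 'u
  conf :: 'u

definition vir :: "('u, 'x) voa_scheme \<Rightarrow> ('u, 'y) vmod_scheme \<Rightarrow> int \<Rightarrow> 'u \<Rightarrow> 'u" where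
  "vir V M n = mode M (conf V) (n + 1)"

text \<open>The operator \<open>(v\<^sub>1)\<^bsub>k 1\<^esub> \<cdots> (v\<^sub>n)\<^bsub>k n\<^esub>\<close>.\<close>

definition mode_prod ::
  "('u, 'x) vmod_scheme \<Rightarrow> nat \<Rightarrow> (nat \<Rightarrow> 'u) \<Rightarrow> (nat \<Rightarrow> int) \<Rightarrow> 'u \<Rightarrow> 'u" where
  "mode_prod M n v k w = foldr (\<lambda>i. mode M (v i) (k i)) [1..<Suc n] w"


section \<open>Rational extension of Laurent expansions\<close>

definition peval ::
  "(complex \<Rightarrow> 'r) \<Rightarrow> ((nat \<Rightarrow>\<^sub>0 nat) \<Rightarrow>\<^sub>0 complex) \<Rightarrow> (nat \<Rightarrow> 'r) \<Rightarrow> 'r::comm_ring_1" where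
  "peval \<phi> P x =
     (\<Sum>m\<in>Poly_Mapping.keys P. \<phi> (Poly_Mapping.lookup P m) *
        (\<Prod>i\<in>Poly_Mapping.keys m. x i ^ Poly_Mapping.lookup m i))"

definition radially_ordered :: "nat set \<Rightarrow> (nat \<Rightarrow> complex) set" where
  "radially_ordered I =
     {x. (\<forall>i\<in>I. x i \<noteq> 0) \<and> (\<forall>i\<in>I. \<forall>j\<in>I. i < j \<longrightarrow> norm (x j) < norm (x i))}"

text \<open>
  The family \<open>t x k\<close>, \<open>k \<in> \<int>\<^sup>I\<close>, is the family of terms of a multiple series in the variables \<open>x\<^sub>i\<close>,
  \<open>i \<in> I\<close>. If on the radially ordered domain it converges to a rational function \<open>P/Q\<close>, then
  \<open>rat_ext \<phi> I t \<xi>\<close> is the value of that rational function at \<open>\<xi>\<close>, provided it is regular there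
  (some representation has denominator a unit at \<open>\<xi>\<close>). The point \<open>\<xi>\<close> has coordinates in a
  \<open>\<complex>\<close>-algebra with structure map \<open>\<phi>\<close>: below \<open>\<complex>\<close> itself, or \<open>\<complex>[[q]]\<close>.
\<close>

definition rat_ext ::
  "(complex \<Rightarrow> 'r) \<Rightarrow> nat set \<Rightarrow> ((nat \<Rightarrow> complex) \<Rightarrow> (nat \<Rightarrow> int) \<Rightarrow> complex)
     \<Rightarrow> (nat \<Rightarrow> 'r) \<Rightarrow> 'r::comm_ring_1" where
  "rat_ext \<phi> I t \<xi> =
     (THE r. \<exists>P Q.
        (\<forall>x\<in>radially_ordered I. \<exists>s.
            (t x has_sum s) (PiE I (\<lambda>_. UNIV)) \<and> peval id Q x * s = peval id P x) \<and>
        peval \<phi> Q \<xi> dvd 1 \<and> r * peval \<phi> Q \<xi> = peval \<phi> P \<xi>)"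


section \<open>Vertex operator algebras and modules\<close>

locale complex_space = vector_space scale
  for scale :: "complex \<Rightarrow> 'u::ab_group_add \<Rightarrow> 'u" (infixr \<open>\<odot>\<close> 75)
begin

definition lin_on :: "(complex \<Rightarrow> 'b::ab_group_add \<Rightarrow> 'b) \<Rightarrow> 'u set \<Rightarrow> ('u \<Rightarrow> 'b) \<Rightarrow> bool" where
  "lin_on sc S f \<longleftrightarrow>
     (\<forall>x\<in>S. \<forall>y\<in>S. f (x + y) = f x + f y) \<and> (\<forall>c. \<forall>x\<in>S. f (c \<odot> x) = sc c (f x))"

definition fin_dim :: "'u set \<Rightarrow> bool" where
  "fin_dim S \<longleftrightarrow> (\<exists>B. finite B \<and> S \<subseteq> span B)"

definition wspace :: "('u, 'x) voa_scheme \<Rightarrow> ('u, 'y) vmod_scheme \<Rightarrow> complex \<Rightarrow> 'u set" where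
  "wspace V M \<mu> = {w \<in> carr M. vir V M 0 w = \<mu> \<odot> w}"

text \<open>The last conjunct is the Jacobi identity in components (Borcherds identity). All sums have
  finite support by the truncation condition.\<close>

definition weak_module :: "('u, 'x) voa_scheme \<Rightarrow> ('u, 'y) vmod_scheme \<Rightarrow> bool" where
  "weak_module V M \<longleftrightarrow>
     subspace (carr M) \<and>
     (\<forall>v\<in>carr V. \<forall>w\<in>carr M. \<forall>n. mode M v n w \<in> carr M) \<and>
     (\<forall>v\<in>carr V. \<forall>n. lin_on scale (carr M) (mode M v n)) \<and>
     (\<forall>w\<in>carr M. \<forall>n. lin_on scale (carr V) (\<lambda>v. mode M v n w)) \<and>
     (\<forall>v\<in>carr V. \<forall>w\<in>carr M. \<exists>N. \<forall>n\<ge>N. mode M v n w = 0) \<and>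
     (\<forall>w\<in>carr M. \<forall>n. mode M (vac V) n w = (if n = -1 then w else 0)) \<and>
     (\<forall>u\<in>carr V. \<forall>v\<in>carr V. \<forall>w\<in>carr M. \<forall>l m n.
        Sum_any (\<lambda>i::nat. (of_int m gchoose i) \<odot>
            mode M (mode V u (l + int i) v) (m + n - int i) w) =
        Sum_any (\<lambda>i::nat. ((-1) ^ i * (of_int l gchoose i)) \<odot>
            (mode M u (m + l - int i) (mode M v (n + int i) w)
             - ((-1) powi l) \<odot> mode M v (n + l - int i) (mode M u (m + int i) w))))"

definition is_voa :: "('u, 'x) voa_scheme \<Rightarrow> bool" where
  "is_voa V \<longleftrightarrow>
     vac V \<in> carr V \<and> conf V \<in> carr V \<and> weak_module V V \<and>
     (\<forall>u\<in>carr V. mode V u (-1) (vac V) = u \<and> (\<forall>n\<ge>0. mode V u n (vac V) = 0)) \<and>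
     (\<exists>c. \<forall>w\<in>carr V. \<forall>m n.
        vir V V m (vir V V n w) - vir V V n (vir V V m w) =
        of_int (m - n) \<odot> vir V V (m + n) w +
        (if m + n = 0 then (of_int (m ^ 3 - m) / 12 * c) \<odot> w else 0)) \<and>
     (\<forall>u\<in>carr V. \<forall>w\<in>carr V. \<forall>n.
        mode V (vir V V (-1) u) n w = (- of_int n) \<odot> mode V u (n - 1) w) \<and>
     carr V = span (\<Union>n::int. wspace V V (of_int n)) \<and>
     (\<forall>n::int. fin_dim (wspace V V (of_int n))) \<and>
     (\<exists>N. \<forall>n<N. wspace V V (of_int n) = {0})"

definition strong_CFT_type :: "('u, 'x) voa_scheme \<Rightarrow> bool" where
  "strong_CFT_type V \<longleftrightarrow>
     carr V = span (\<Union>n::nat. wspace V V (of_nat n)) \<and>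
     (\<forall>n::nat. fin_dim (wspace V V (of_nat n))) \<and>
     wspace V V 0 = span {vac V} \<and>
     (\<forall>v\<in>wspace V V 1. vir V V 1 v = 0)"

definition quasiprimary :: "('u, 'x) voa_scheme \<Rightarrow> nat \<Rightarrow> 'u \<Rightarrow> bool" where
  "quasiprimary V k v \<longleftrightarrow> v \<in> wspace V V (of_nat k) \<and> vir V V 1 v = 0"

definition ordinary_module ::
  "('u, 'x) voa_scheme \<Rightarrow> ('u, 'y) vmod_scheme \<Rightarrow> complex \<Rightarrow> bool" where
  "ordinary_module V M h \<longleftrightarrow>
     weak_module V M \<and>
     carr M = span (\<Union>n::nat. wspace V M (h + of_nat n)) \<and>
     (\<forall>n::nat. fin_dim (wspace V M (h + of_nat n))) \<and>
     wspace V M h \<noteq> {0}"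

definition irreducible_mod :: "('u, 'x) voa_scheme \<Rightarrow> ('u, 'y) vmod_scheme \<Rightarrow> bool" where
  "irreducible_mod V M \<longleftrightarrow>
     carr M \<noteq> {0} \<and>
     (\<forall>S. subspace S \<and> S \<subseteq> carr M \<and> (\<forall>v\<in>carr V. \<forall>n. \<forall>w\<in>S. mode M v n w \<in> S)
        \<longrightarrow> S = {0} \<or> S = carr M)"

definition isomorphic_mod ::
  "('u, 'x) voa_scheme \<Rightarrow> ('u, 'y) vmod_scheme \<Rightarrow> ('u, 'z) vmod_scheme \<Rightarrow> bool" where
  "isomorphic_mod V M N \<longleftrightarrow>
     (\<exists>f. bij_betw f (carr M) (carr N) \<and> lin_on scale (carr M) f \<and>
        (\<forall>v\<in>carr V. \<forall>n. \<forall>w\<in>carr M. f (mode M v n w) = mode N v n (f w)))"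

text \<open>The restricted dual \<open>\<Oplus>\<^sub>\<mu> (M\<^sub>\<mu>)\<^sup>*\<close>; functionals are normalised to vanish off the carrier.\<close>

definition graded_dual ::
  "('u, 'x) voa_scheme \<Rightarrow> ('u, 'y) vmod_scheme \<Rightarrow> ('u \<Rightarrow> complex) set" where
  "graded_dual V M =
     {f. lin_on (*) (carr M) f \<and> (\<forall>w. w \<notin> carr M \<longrightarrow> f w = 0) \<and>
         finite {\<mu>. \<exists>w\<in>wspace V M \<mu>. f w \<noteq> 0}}"

text \<open>\<open>M'\<close> is the contragredient of \<open>M\<close> with canonical pairing \<open>f\<close>: \<open>w' \<mapsto> \<langle>\<cdot>,w'\<rangle>\<close> identifies \<open>M'\<close> with the
  restricted dual, and the last conjunct is the coefficient of \<open>z\<^sup>-\<^sup>n\<^sup>-\<^sup>1\<close> in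
  \<open>\<langle>w, Y'(v,z)w'\<rangle> = \<langle>Y(e\<^bsup>zL(1)\<^esup>(-z\<^sup>-\<^sup>2)\<^bsup>L(0)\<^esup>v, z\<^sup>-\<^sup>1)w, w'\<rangle>\<close> for \<open>v\<close> of weight \<open>k\<close>, where \<open>L(1)\<^sup>j v = 0\<close> for
  \<open>j > k\<close> by the grading of \<open>V\<close>.\<close>

definition contragredient_pairing ::
  "('u, 'x) voa_scheme \<Rightarrow> ('u, 'y) vmod_scheme \<Rightarrow> ('u, 'z) vmod_scheme
     \<Rightarrow> ('u \<Rightarrow> 'u \<Rightarrow> complex) \<Rightarrow> bool" where
  "contragredient_pairing V M M' f \<longleftrightarrow>
     (\<forall>w'\<in>carr M'. lin_on (*) (carr M) (\<lambda>w. f w w')) \<and>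
     (\<forall>w\<in>carr M. lin_on (*) (carr M') (f w)) \<and>
     bij_betw (\<lambda>w' w. if w \<in> carr M then f w w' else 0) (carr M') (graded_dual V M) \<and>
     (\<forall>k. \<forall>v\<in>wspace V V (of_nat k). \<forall>w\<in>carr M. \<forall>w'\<in>carr M'. \<forall>n.
        f w (mode M' v n w') =
        (\<Sum>j\<le>k. (-1) ^ k / fact j *
           f (mode M ((vir V V 1 ^^ j) v) (2 * int k - int j - n - 2) w) w'))"


section \<open>Intertwining operators\<close>

text \<open>Intertwining operators of type \<open>(M3; M1 M2)\<close>, \<open>\<Y>(w,z)x = \<Sum>\<^bsub>s\<in>\<complex>\<^esub> w\<^sub>s x z\<^sup>-\<^sup>s\<^sup>-\<^sup>1\<close> with \<open>Y w s x = w\<^sub>s x\<close>,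
  extended by zero off the carriers so that their space is a space of functions.\<close>

definition intertwiners ::
  "('u, 'x) voa_scheme \<Rightarrow> ('u, 'y) vmod_scheme \<Rightarrow> ('u, 'y) vmod_scheme \<Rightarrow> ('u, 'y) vmod_scheme
     \<Rightarrow> ('u \<Rightarrow> complex \<Rightarrow> 'u \<Rightarrow> 'u) set" where
  "intertwiners V M3 M1 M2 =
     {Y. (\<forall>w s x. w \<notin> carr M1 \<or> x \<notin> carr M2 \<longrightarrow> Y w s x = 0) \<and>
         (\<forall>w\<in>carr M1. \<forall>x\<in>carr M2. \<forall>s. Y w s x \<in> carr M3) \<and>
         (\<forall>w\<in>carr M1. \<forall>s. lin_on scale (carr M2) (Y w s)) \<and>
         (\<forall>x\<in>carr M2. \<forall>s. lin_on scale (carr M1) (\<lambda>w. Y w s x)) \<and>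
         (\<forall>w\<in>carr M1. \<forall>x\<in>carr M2. \<exists>r. \<forall>s. Re s > r \<longrightarrow> Y w s x = 0) \<and>
         (\<forall>u\<in>carr V. \<forall>w\<in>carr M1. \<forall>x\<in>carr M2. \<forall>l m s.
            Sum_any (\<lambda>i::nat. (of_int m gchoose i) \<odot>
                Y (mode M1 u (l + int i) w) (of_int m + s - of_nat i) x) =
            Sum_any (\<lambda>i::nat. ((-1) ^ i * (of_int l gchoose i)) \<odot>
                (mode M3 u (m + l - int i) (Y w (s + of_nat i) x)
                 - ((-1) powi l) \<odot> Y w (s + of_int l - of_nat i) (mode M2 u (m + int i) x)))) \<and>
         (\<forall>w\<in>carr M1. \<forall>x\<in>carr M2. \<forall>s.
            Y (vir V M1 (-1) w) s x = (- s) \<odot> Y w (s - 1) x)}"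

definition fscale ::
  "complex \<Rightarrow> ('u \<Rightarrow> complex \<Rightarrow> 'u \<Rightarrow> 'u) \<Rightarrow> ('u \<Rightarrow> complex \<Rightarrow> 'u \<Rightarrow> 'u)" where
  "fscale c Y = (\<lambda>w s x. c \<odot> Y w s x)"

text \<open>\<open>N\<close> is the fusion rule, i.e. the (finite) dimension of the space of intertwining operators.\<close>

definition fusion_rule ::
  "('u, 'x) voa_scheme \<Rightarrow> ('u, 'y) vmod_scheme \<Rightarrow> ('u, 'y) vmod_scheme \<Rightarrow> ('u, 'y) vmod_scheme
     \<Rightarrow> nat \<Rightarrow> bool" where
  "fusion_rule V M3 M1 M2 N \<longleftrightarrow>
     (\<exists>B. finite B \<and> card B = N \<and> \<not> module.dependent fscale B \<and>
          module.span fscale B = intertwiners V M3 M1 M2)"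

text \<open>\<open>\<Y>(w,z)u = e\<^bsup>zL(-1)\<^esup>Y(u,-z)w\<close>: coefficient of \<open>z\<^sup>-\<^sup>s\<^sup>-\<^sup>1\<close>.\<close>

definition creative_normalized ::
  "('u, 'x) voa_scheme \<Rightarrow> ('u, 'y) vmod_scheme \<Rightarrow> ('u \<Rightarrow> complex \<Rightarrow> 'u \<Rightarrow> 'u) \<Rightarrow> bool" where
  "creative_normalized V M Y \<longleftrightarrow>
     (\<forall>w\<in>carr M. \<forall>u\<in>carr V.
        (\<forall>k::int. Y w (of_int k) u =
           Sum_any (\<lambda>j::nat. ((-1) powi (k + int j + 1) / fact j) \<odot>
               (vir V M (-1) ^^ j) (mode M u (k + int j) w))) \<and>
        (\<forall>s. s \<notin> \<int> \<longrightarrow> Y w s u = 0))"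

text \<open>\<open>\<langle>u, \<Y>\<^sup>0(w,z)w'\<rangle> = \<langle>\<Y>(e\<^bsup>zL(1)\<^esup>(-z\<^sup>-\<^sup>2)\<^bsup>L(0)\<^esup>w, z\<^sup>-\<^sup>1)u, w'\<rangle>\<close>: coefficient of \<open>z\<^sup>-\<^sup>s\<^sup>-\<^sup>1\<close> for \<open>w\<close> of weight \<open>\<mu>\<close>.
  Here \<open>\<kappa>\<close> is a logarithm of \<open>-1\<close> fixing the powers \<open>(-1)\<^sup>\<mu> = exp (\<kappa> \<mu>)\<close>.\<close>

definition pairing_normalized ::
  "('u, 'x) voa_scheme \<Rightarrow> complex \<Rightarrow> ('u, 'y) vmod_scheme \<Rightarrow> ('u, 'y) vmod_scheme
     \<Rightarrow> ('u \<Rightarrow> 'u \<Rightarrow> complex) \<Rightarrow> ('u \<Rightarrow> 'u \<Rightarrow> complex)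
     \<Rightarrow> ('u \<Rightarrow> complex \<Rightarrow> 'u \<Rightarrow> 'u) \<Rightarrow> ('u \<Rightarrow> complex \<Rightarrow> 'u \<Rightarrow> 'u) \<Rightarrow> bool" where
  "pairing_normalized V \<kappa> M M' fV fM Y Y0 \<longleftrightarrow>
     (\<forall>\<mu>. \<forall>w\<in>wspace V M \<mu>. \<forall>w'\<in>carr M'. \<forall>u\<in>carr V. \<forall>s.
        fV u (Y0 w s w') =
        Sum_any (\<lambda>j::nat. exp (\<kappa> * \<mu>) / fact j *
          fM (Y ((vir V M 1 ^^ j) w) (2 * \<mu> - of_nat j - s - 2) u) w'))"

end


section \<open>The family of irreducible modules\<close>

text \<open>Labels \<open>\<alpha>\<close>, modules \<open>\<W>\<^sub>\<alpha>\<close>, lowest weights \<open>h\<^sub>\<alpha>\<close>, contragredient labels \<open>\<alpha>'\<close>, canonical pairings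
  \<open>\<W>\<^sub>\<alpha> \<times> \<W>\<^bsub>\<alpha>'\<^esub> \<rightarrow> \<complex>\<close>, a logarithm of \<open>-1\<close>, and intertwiners \<open>intw D \<gamma> \<alpha> \<beta>\<close> of type \<open>(\<gamma>; \<alpha> \<beta>)\<close>.\<close>

record ('a, 'u) rep_data =
  VA :: "'u voa"
  labels :: "'a set"
  Wmod :: "'a \<Rightarrow> 'u vmod"
  lowest :: "'a \<Rightarrow> complex"
  dual :: "'a \<Rightarrow> 'a"
  pairing :: "'a \<Rightarrow> 'u \<Rightarrow> 'u \<Rightarrow> complex"
  log_minus1 :: complex
  intw :: "'a \<Rightarrow> 'a \<Rightarrow> 'a \<Rightarrow> 'u \<Rightarrow> complex \<Rightarrow> 'u \<Rightarrow> 'u"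

context complex_space
begin

text \<open>\<open>V\<close> is isomorphic to its contragredient since \<open>dual D 0 = 0\<close>; then \<open>pairing D 0\<close> is an
  invariant non-degenerate form on \<open>V\<close>, determined by its value on the vacuum.\<close>

definition rep_theory :: "('a::zero, 'u) rep_data \<Rightarrow> bool" where
  "rep_theory D \<longleftrightarrow>
     is_voa (VA D) \<and> strong_CFT_type (VA D) \<and> irreducible_mod (VA D) (VA D) \<and>
     0 \<in> labels D \<and> Wmod D 0 = vmod.truncate (VA D) \<and>
     (\<forall>\<alpha>\<in>labels D. ordinary_module (VA D) (Wmod D \<alpha>) (lowest D \<alpha>) \<and>
        irreducible_mod (VA D) (Wmod D \<alpha>)) \<and>
     (\<forall>\<alpha>\<in>labels D. \<forall>\<beta>\<in>labels D.
        isomorphic_mod (VA D) (Wmod D \<alpha>) (Wmod D \<beta>) \<longrightarrow> \<alpha> = \<beta>) \<and>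
     (\<forall>(M :: 'u vmod) h. ordinary_module (VA D) M h \<and> irreducible_mod (VA D) M \<longrightarrow>
        (\<exists>\<alpha>\<in>labels D. isomorphic_mod (VA D) (Wmod D \<alpha>) M)) \<and>
     (\<forall>\<alpha>\<in>labels D. dual D \<alpha> \<in> labels D \<and>
        contragredient_pairing (VA D) (Wmod D \<alpha>) (Wmod D (dual D \<alpha>)) (pairing D \<alpha>)) \<and>
     dual D 0 = 0 \<and> pairing D 0 (vac (VA D)) (vac (VA D)) = 1 \<and>
     (\<forall>\<alpha>\<in>labels D. \<forall>\<gamma>\<in>labels D.
        fusion_rule (VA D) (Wmod D \<gamma>) (Wmod D \<alpha>) (Wmod D 0) (if \<alpha> = \<gamma> then 1 else 0)) \<and>
     (\<forall>\<alpha>\<in>labels D. \<forall>\<beta>\<in>labels D.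
        fusion_rule (VA D) (Wmod D 0) (Wmod D \<alpha>) (Wmod D \<beta>) (if \<alpha> = dual D \<beta> then 1 else 0)) \<and>
     exp (log_minus1 D) = -1 \<and>
     (\<forall>\<alpha>\<in>labels D.
        intw D \<alpha> \<alpha> 0 \<in> intertwiners (VA D) (Wmod D \<alpha>) (Wmod D \<alpha>) (Wmod D 0) \<and>
        creative_normalized (VA D) (Wmod D \<alpha>) (intw D \<alpha> \<alpha> 0) \<and>
        intw D 0 \<alpha> (dual D \<alpha>) \<in>
          intertwiners (VA D) (Wmod D 0) (Wmod D \<alpha>) (Wmod D (dual D \<alpha>)) \<and>
        pairing_normalized (VA D) (log_minus1 D) (Wmod D \<alpha>) (Wmod D (dual D \<alpha>))
          (pairing D 0) (pairing D \<alpha>) (intw D \<alpha> \<alpha> 0) (intw D 0 \<alpha> (dual D \<alpha>)))"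

text \<open>\<open>B m\<close> is a basis of \<open>\<W>\<^bsub>\<alpha>,m+h\<^esub>\<close> and \<open>b \<mapsto> B' b\<close> gives the dual basis of \<open>\<W>\<^bsub>\<alpha>'\<^esub>\<close>.\<close>

definition dual_bases ::
  "('a, 'u) rep_data \<Rightarrow> 'a \<Rightarrow> (nat \<Rightarrow> 'u set) \<Rightarrow> ('u \<Rightarrow> 'u) \<Rightarrow> bool" where
  "dual_bases D \<alpha> B B' \<longleftrightarrow>
     (\<forall>m. independent (B m) \<and>
          span (B m) = wspace (VA D) (Wmod D \<alpha>) (lowest D \<alpha> + of_nat m)) \<and>
     (\<forall>m. \<forall>b\<in>B m. B' b \<in> carr (Wmod D (dual D \<alpha>)) \<and>
          (\<forall>l. \<forall>c\<in>B l. pairing D \<alpha> c (B' b) = (if c = b then 1 else 0)))"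


section \<open>Genus zero\<close>

text \<open>
  The terms of the series \<open>(y\<^sub>1-y\<^sub>2)\<^bsup>2h\<^esup> Z\<^sup>(\<^sup>0\<^sup>)(b,y\<^sub>1; v,z; b',y\<^sub>2)\<close> with \<open>x\<^sub>0 = y\<^sub>1\<close>, \<open>x\<^sub>i = z\<^sub>i\<close>, \<open>x\<^bsub>n+1\<^esub> = y\<^sub>2\<close>.
  By the normalisation of the intertwiners only the powers \<open>y\<^sub>1\<^bsup>-2h+p\<^esup>\<close> and \<open>y\<^sub>2\<^sup>p\<close> with \<open>p\<close> an integer
  occur in \<open>Z\<^sup>(\<^sup>0\<^sup>)\<close>, i.e. the modes \<open>b\<^sub>s\<close> with \<open>s = 2h + k\<^sub>0\<close>, and \<open>(y\<^sub>1-y\<^sub>2)\<^bsup>2h\<^esup> y\<^sub>1\<^bsup>-2h\<^esup>\<close> is expanded as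
  \<open>(1-y\<^sub>2/y\<^sub>1)\<^bsup>2h\<^esup>\<close>, binomially in \<open>y\<^sub>2/y\<^sub>1\<close>, which is the principal value for \<open>\<bar>y\<^sub>2\<bar> < \<bar>y\<^sub>1\<bar>\<close>.
\<close>

definition genus0_terms ::
  "('a::zero, 'u) rep_data \<Rightarrow> 'a \<Rightarrow> nat \<Rightarrow> (nat \<Rightarrow> 'u) \<Rightarrow> 'u \<Rightarrow> 'u
     \<Rightarrow> (nat \<Rightarrow> complex) \<Rightarrow> (nat \<Rightarrow> int) \<Rightarrow> complex" where
  "genus0_terms D \<alpha> n v b b' x k =
     (1 - x (n + 1) / x 0) powr (2 * lowest D \<alpha>) *
     pairing D 0 (vac (VA D))
       (intw D 0 \<alpha> (dual D \<alpha>) b (2 * lowest D \<alpha> + of_int (k 0))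
         (mode_prod (Wmod D (dual D \<alpha>)) n v k
           (intw D (dual D \<alpha>) (dual D \<alpha>) 0 b' (of_int (k (n + 1))) (vac (VA D))))) *
     (\<Prod>i\<in>{0..n+1}. x i powi (- k i - 1))"


section \<open>Genus one\<close>

text \<open>The point \<open>(w\<^sub>1, z\<^sub>1, \<dots>, z\<^sub>n, w\<^bsub>-1\<^esub>)\<close> and \<open>\<rho>\<close> as power series in \<open>q\<close>; \<open>Wp = W\<^sub>1\<close>, \<open>Wm = W\<^bsub>-1\<^esub>\<close>.\<close>

definition schottky_point ::
  "complex \<Rightarrow> complex \<Rightarrow> nat \<Rightarrow> (nat \<Rightarrow> complex) \<Rightarrow> nat \<Rightarrow> complex fps" where
  "schottky_point Wp Wm n z i =
     (if i = 0 then (fps_const Wp - fps_X * fps_const Wm) / (1 - fps_X)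
      else if i = n + 1 then (fps_const Wm - fps_X * fps_const Wp) / (1 - fps_X)
      else fps_const (z i))"

definition schottky_rho :: "complex \<Rightarrow> complex \<Rightarrow> complex fps" where
  "schottky_rho Wp Wm = - (fps_X * fps_const (Wm - Wp) ^ 2) / (1 - fps_X) ^ 2"

text \<open>\<open>q\<^sup>h G(q)\<close> as a formal series with complex exponents: exponent \<open>\<mapsto>\<close> coefficient.\<close>

definition q_shift :: "complex \<Rightarrow> complex fps \<Rightarrow> complex \<Rightarrow> complex" where
  "q_shift h G \<mu> = (\<Sum>k\<in>{k. \<mu> = h + of_nat k}. fps_nth G k)"

text \<open>
  The coefficient of \<open>q\<^sup>\<mu>\<close> in \<open>\<F>\<^sub>\<alpha>\<^sup>(\<^sup>1\<^sup>)(v,z)\<close>, the differentials \<open>dz\<^sub>i\<close> being evaluated on tangent vectors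
  (complex numbers). In \<open>\<rho>\<^sup>h = (-q)\<^sup>h (1+q)\<^bsup>-2h\<^esup> (w\<^bsub>-1\<^esub>-w\<^sub>1)\<^bsup>2h\<^esup>\<close> the first factor is \<open>(-1)\<^bsup>-h\<^esup> q\<^sup>h\<close> with the
  same power \<open>(-1)\<^sup>h\<close> as in the normalisation of the intertwiners, and the last factor is absorbed
  in \<open>genus0_terms\<close>.
\<close>

definition genus1 ::
  "('a::zero, 'u) rep_data \<Rightarrow> 'a \<Rightarrow> (nat \<Rightarrow> 'u set) \<Rightarrow> ('u \<Rightarrow> 'u) \<Rightarrow> complex \<Rightarrow> complex \<Rightarrow> nat
     \<Rightarrow> (nat \<Rightarrow> 'u) \<Rightarrow> (nat \<Rightarrow> nat) \<Rightarrow> (nat \<Rightarrow> complex) \<Rightarrow> (nat \<Rightarrow> complex) \<Rightarrow> complex \<Rightarrow> complex" where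
  "genus1 D \<alpha> B B' Wp Wm n v wt z dz \<mu> =
     q_shift (lowest D \<alpha>)
       (fps_const (exp (- log_minus1 D * lowest D \<alpha>)) * fps_binomial (- 2 * lowest D \<alpha>) *
        suminf (\<lambda>m. schottky_rho Wp Wm ^ m *
          (\<Sum>b\<in>B m. rat_ext fps_const {0..n+1} (genus0_terms D \<alpha> n v b (B' b))
                      (schottky_point Wp Wm n z)))) \<mu> *
     (\<Prod>i\<in>{1..n}. dz i ^ wt i)"


section \<open>Zhu trace functions\<close>

definition wproj ::
  "('u, 'x) voa_scheme \<Rightarrow> ('u, 'y) vmod_scheme \<Rightarrow> complex \<Rightarrow> 'u \<Rightarrow> 'u" where
  "wproj V M \<mu> w =
     (THE u. u \<in> wspace V M \<mu> \<and> w - u \<in> span (\<Union>\<nu>\<in>- {\<mu>}. wspace V M \<nu>))"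

text \<open>The trace over \<open>M\<^sub>\<mu>\<close> of the diagonal block of \<open>T\<close>, so that
  \<open>tr\<^sub>M T q\<^bsup>L(0)\<^esup> = \<Sum>\<^sub>\<mu> wtrace V M \<mu> T q\<^sup>\<mu>\<close>.\<close>

definition wtrace ::
  "('u, 'x) voa_scheme \<Rightarrow> ('u, 'y) vmod_scheme \<Rightarrow> complex \<Rightarrow> ('u \<Rightarrow> 'u) \<Rightarrow> complex" where
  "wtrace V M \<mu> T =
     (let B = (SOME B. independent B \<and> span B = wspace V M \<mu>)
      in \<Sum>b\<in>B. representation B (wproj V M \<mu> (T b)) b)"

text \<open>The coefficient of \<open>q\<^sup>\<mu>\<close>. It is a Laurent series in \<open>x\<^sub>i = e\<^bsup>\<zeta> i\<^esup>\<close>, convergent for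
  \<open>\<bar>x\<^sub>1\<bar> > \<dots> > \<bar>x\<^sub>n\<bar> > 0\<close>, and is identified with its extension to a rational function of the \<open>x\<^sub>i\<close>.\<close>

definition zhu_trace ::
  "('u, 'x) voa_scheme \<Rightarrow> ('u, 'y) vmod_scheme \<Rightarrow> nat \<Rightarrow> (nat \<Rightarrow> 'u) \<Rightarrow> (nat \<Rightarrow> nat)
     \<Rightarrow> (nat \<Rightarrow> complex) \<Rightarrow> complex \<Rightarrow> complex" where
  "zhu_trace V M n v wt \<zeta> \<mu> =
     rat_ext id {1..n}
       (\<lambda>x k. wtrace V M \<mu> (mode_prod M n (\<lambda>i. x i ^ wt i \<odot> v i) k) *
              (\<Prod>i\<in>{1..n}. x i powi (- k i - 1)))
       (\<lambda>i. exp (\<zeta> i))"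

end

end

theory Submission
  imports Defs "HOL-Complex_Analysis.Complex_Analysis"
begin

text \<open>
  Write \<open>M\<close> for \<open>\<W>\<^sub>\<alpha>\<close>, \<open>M'\<close> for its contragredient and \<open>h\<close> for the lowest weight. Both sides of the theorem are
  expressed by one family of bilinear forms on \<open>M \<times> M'\<close>: the rational functions
  \<open>H\<^sub>X(\<phi>,\<psi>) = \<langle>\<phi>, Y(v\<^sub>1,X\<^sub>1) \<dots> Y(v\<^sub>n,X\<^sub>n) \<psi>\<rangle>\<close> (constants \<open>corr\<close> and \<open>pair_corr\<close>). They exist because the modes of the
  first field can be moved to the two sides, which gives a recursion on the number of fields
  (\<open>rat_on_corr\<close>, \<open>has_sum_corr\<close>). The coefficient of \<open>q\<^bsup>h+N\<^esup>\<close> of the trace function is, up to the factor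
  \<open>\<Prod> Z\<^sub>i\<^bsup>wt\<^esup>\<close>, the trace of \<open>H\<^sub>Z\<close> over level \<open>N\<close>, i.e. \<open>\<Sum> H\<^sub>Z(b,b')\<close> over dual bases (\<open>zhu_trace_value\<close>).

  On the genus zero side, translate the right insertion to \<open>0\<close>; then the left insertion is at \<open>1/t\<close> with
  \<open>t = 1/(w\<^sub>1 - w\<^sub>-\<^sub>1)\<close>. The normalisation of the intertwiners writes the left insertion as a combination of the
  functionals \<open>\<langle>L(1)\<^sup>j b, L(1)\<^sup>p \<cdot>\<rangle>\<close>, and summing over \<open>p\<close> is a special conformal transformation of the points. So
  \<open>Z\<^sup>(\<^sup>0\<^sup>)(b,b')\<close> is a known power of \<open>t\<close>, times Jacobian factors, times
  \<open>H\<^sub>X(e\<^bsup>-L(1)\<^esup> b, e\<^bsup>-L(1)\<^esup> b')\<close>, where \<open>X\<^sub>i = (Z\<^sub>i - q)/(1 - q Z\<^sub>i)\<close> (\<open>sphere_corr_value\<close>,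
  \<open>sphere_corr_twist\<close>).

  As \<open>q\<close> varies, \<open>X\<close> moves along a one-parameter family of Moebius maps, starting at \<open>Z\<close>. Hence the form \<open>\<Theta>\<^sub>q\<close>, which
  is \<open>H\<^sub>X\<close> with its Jacobian factors, satisfies \<open>(1-q\<^sup>2) \<Theta>' = \<Delta>\<Theta> - \<nabla>\<Theta>\<close>, where \<open>\<Delta>\<close> and \<open>\<nabla>\<close> are the actions of
  \<open>L(-1)\<close> and \<open>L(1)\<close> on the two arguments (\<open>cayley_flow\<close>). Conjugating with \<open>e\<^bsup>-L(1)\<^esup>\<close> turns \<open>\<Delta> - \<nabla>\<close> into \<open>\<Delta>\<close> plus
  twice the action of \<open>L(0)\<close>, which is a scalar on each level, so that the Taylor coefficients of these traces in \<open>q\<close> can be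
  computed (\<open>flow_trace_coefficients\<close>). After this the theorem has become an identity between traces of an
  arbitrary bilinear form \<open>\<beta>\<close>, here \<open>\<beta> = H\<^sub>Z\<close>: a binomial sum of traces of powers of \<open>\<Delta>\<close> applied to
  \<open>\<beta>(e\<^bsup>-L(1)\<^esup> \<cdot>, e\<^bsup>-L(1)\<^esup> \<cdot>)\<close> over the levels up to \<open>N\<close> is the trace of \<open>\<beta>\<close> over level \<open>N\<close>
  (\<open>sewing_identity\<close>). It follows by replacing \<open>e\<^bsup>-L(1)\<^esup>\<close> by \<open>e\<^bsup>-s L(1)\<^esup>\<close> and letting \<open>s\<close> go from \<open>1\<close> to \<open>0\<close>.
\<close>

section \<open>Rational functions of several variables\<close>

definition mono_eval :: "(nat \<Rightarrow>\<^sub>0 nat) \<Rightarrow> (nat \<Rightarrow> 'r) \<Rightarrow> 'r::comm_ring_1" where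
  "mono_eval m x = (\<Prod>i\<in>Poly_Mapping.keys m. x i ^ Poly_Mapping.lookup m i)"

definition polyf :: "((nat \<Rightarrow> complex) \<Rightarrow> complex) \<Rightarrow> bool" where
  "polyf F \<longleftrightarrow> (\<exists>P. \<forall>x. peval id P x = F x)"

lemma mono_eval_superset:
  assumes "finite A" "Poly_Mapping.keys m \<subseteq> A"
  shows "mono_eval m x = (\<Prod>i\<in>A. x i ^ Poly_Mapping.lookup m i)"
  unfolding mono_eval_def
  by (rule prod.mono_neutral_left) (use assms in \<open>auto simp: in_keys_iff\<close>)

lemma mono_eval_add: "mono_eval (m + m') x = mono_eval m x * mono_eval m' x"
proof -
  let ?A = "Poly_Mapping.keys m \<union> Poly_Mapping.keys m'"
  have "Poly_Mapping.keys (m + m') \<subseteq> ?A" by (rule keys_add)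
  then show ?thesis
    by (subst (1 2 3) mono_eval_superset[where A = ?A])
       (auto simp: lookup_add power_add prod.distrib)
qed

lemma peval_superset:
  assumes "finite A" "Poly_Mapping.keys P \<subseteq> A"
  shows "peval id P x = (\<Sum>m\<in>A. Poly_Mapping.lookup P m * mono_eval m x)"
  unfolding peval_def mono_eval_def[symmetric] id_apply
  by (rule sum.mono_neutral_left) (use assms in \<open>auto simp: in_keys_iff\<close>)

lemma polyf_add: assumes "polyf F" "polyf G" shows "polyf (\<lambda>x. F x + G x)"
proof -
  from assms obtain P Q where *: "\<And>x. peval id P x = F x" "\<And>x. peval id Q x = G x"
    unfolding polyf_def by blast
  let ?A = "Poly_Mapping.keys P \<union> Poly_Mapping.keys Q"
  have sub: "Poly_Mapping.keys (P + Q) \<subseteq> ?A" by (rule keys_add)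
  have "peval id (P + Q) x = F x + G x" for x
    unfolding *[symmetric] using sub
    by (subst (1 2 3) peval_superset[where A = ?A])
       (auto simp: lookup_add ring_distribs sum.distrib)
  then show ?thesis unfolding polyf_def by blast
qed

lemma polyf_monom: "polyf (\<lambda>x. c * mono_eval m x)"
  unfolding polyf_def
  by (rule exI[of _ "Poly_Mapping.single m c"]) (auto simp: peval_def mono_eval_def)

lemma polyf_const [intro]: "polyf (\<lambda>_. c)"
  using polyf_monom[of c 0] by (simp add: mono_eval_def)

lemma polyf_var [intro]: "polyf (\<lambda>x. x i)"
  using polyf_monom[of 1 "Poly_Mapping.single i 1"] by (simp add: mono_eval_def)

lemma polyf_sum: "(\<And>a. a \<in> A \<Longrightarrow> polyf (F a)) \<Longrightarrow> polyf (\<lambda>x. \<Sum>a\<in>A. F a x)"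
  by (induction A rule: infinite_finite_induct) (auto intro: polyf_add)

lemma polyf_mult: assumes "polyf F" "polyf G" shows "polyf (\<lambda>x. F x * G x)"
proof -
  from assms obtain P Q where *: "\<And>x. peval id P x = F x" "\<And>x. peval id Q x = G x"
    unfolding polyf_def by blast
  have "F x * G x = (\<Sum>m\<in>Poly_Mapping.keys P. \<Sum>m'\<in>Poly_Mapping.keys Q.
      (Poly_Mapping.lookup P m * Poly_Mapping.lookup Q m') * mono_eval (m + m') x)" for x
    by (simp add: *[symmetric] peval_superset[OF finite_keys order_refl] sum_product mono_eval_add mult_ac)
  moreover have "polyf (\<lambda>x. \<Sum>m\<in>Poly_Mapping.keys P. \<Sum>m'\<in>Poly_Mapping.keys Q.
      (Poly_Mapping.lookup P m * Poly_Mapping.lookup Q m') * mono_eval (m + m') x)"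
    by (intro polyf_sum polyf_monom)
  ultimately show ?thesis by simp
qed

lemma polyf_diff: assumes "polyf F" "polyf G" shows "polyf (\<lambda>x. F x - G x)"
  using polyf_add[OF assms(1) polyf_mult[OF polyf_const[of "-1"] assms(2)]] by simp

text \<open>Along a holomorphic family of points a polynomial function is holomorphic, so the identity
  theorem in one variable, applied on complex lines, gives the principle in several variables.\<close>

lemma polyf_holomorphic:
  assumes "polyf F" "\<And>i. (\<lambda>t. X t i) holomorphic_on S"
  shows "(\<lambda>t. F (X t)) holomorphic_on S"
proof -
  from assms(1) obtain P where P: "\<And>x. F x = peval id P x" unfolding polyf_def by metis
  show ?thesis
    unfolding P peval_def by (intro holomorphic_intros assms(2))
qed

text \<open>On the line from a radially ordered point to \<open>x\<close> the function vanishes near the starting point, because the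
  radially ordered points form an open set in the coordinates of \<open>I\<close>.\<close>

lemma polyf_eq_0I:
  assumes F: "polyf F" and I: "finite I" and zero: "\<And>x. x \<in> radially_ordered I \<Longrightarrow> F x = 0"
  shows "F x = 0"
proof -
  \<comment> \<open>a radially ordered base point\<close>
  define x0 :: "nat \<Rightarrow> complex" where "x0 = (\<lambda>i. 1 / of_nat (Suc i))"
  define X where "X = (\<lambda>t::complex. \<lambda>i. x0 i + t * (x i - x0 i))"
  have hol: "(\<lambda>t. F (X t)) holomorphic_on UNIV"
    by (rule polyf_holomorphic[OF F]) (auto simp: X_def intro!: holomorphic_intros)
  have cont: "isCont (\<lambda>t. X t i) 0" for i unfolding X_def by (intro continuous_intros)
  have lim: "((\<lambda>t. X t i) \<longlongrightarrow> X 0 i) (nhds 0)" for i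
    using cont[of i] tendsto_at_iff_tendsto_nhds[of "\<lambda>t. X t i" 0] unfolding isCont_def by blast
  have X0: "X 0 i = x0 i" for i by (simp add: X_def)
  have "\<forall>\<^sub>F t in nhds 0. \<forall>i\<in>I. X t i \<noteq> 0"
  proof (intro eventually_ball_finite[OF I] ballI)
    fix i
    have "X 0 i \<noteq> 0" by (simp add: X0 x0_def del: of_nat_Suc)
    then show "\<forall>\<^sub>F t in nhds 0. X t i \<noteq> 0"
      by (rule tendsto_imp_eventually_ne[OF lim])
  qed
  moreover have "\<forall>\<^sub>F t in nhds 0. \<forall>i\<in>I. \<forall>j\<in>I. i < j \<longrightarrow> norm (X t j) < norm (X t i)"
  proof (intro eventually_ball_finite[OF I] ballI)
    fix i j
    show "\<forall>\<^sub>F t in nhds 0. i < j \<longrightarrow> norm (X t j) < norm (X t i)"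
    proof (cases "i < j")
      case True
      have "((\<lambda>t. norm (X t i) - norm (X t j)) \<longlongrightarrow> norm (X 0 i) - norm (X 0 j)) (nhds 0)"
        by (intro tendsto_intros lim)
      moreover have "norm (X 0 i) - norm (X 0 j) > 0"
        using True by (simp add: X0 x0_def norm_divide frac_less2 del: of_nat_Suc)
      ultimately have "\<forall>\<^sub>F t in nhds 0. 0 < norm (X t i) - norm (X t j)"
        by (rule order_tendstoD(1))
      then show ?thesis by (auto elim: eventually_mono)
    qed simp
  qed
  ultimately have "\<forall>\<^sub>F t in nhds 0. F (X t) = 0"
    by eventually_elim (rule zero, auto simp: radially_ordered_def)
  then have "(\<lambda>t. F (X t)) has_fps_expansion 0" by (simp add: has_fps_expansion_0_iff)
  from has_fps_expansion_0_analytic_continuation[OF this hol open_UNIV connected_UNIV, of 1]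
  have "F (X 1) = 0" by simp
  then show ?thesis by (simp add: X_def)
qed

text \<open>Regularity on \<open>U\<close> is part of the notion: one representation \<open>P/Q\<close> serves all points of \<open>U\<close>, as the definition
  of \<open>rat_ext\<close> requires.\<close>

definition rat_on :: "(nat \<Rightarrow> complex) set \<Rightarrow> ((nat \<Rightarrow> complex) \<Rightarrow> complex) \<Rightarrow> bool" where
  "rat_on U R \<longleftrightarrow> (\<exists>P Q. polyf P \<and> polyf Q \<and> (\<forall>x\<in>U. Q x \<noteq> 0 \<and> R x = P x / Q x))"

lemma rat_onE:
  assumes "rat_on U R"
  obtains P Q where "polyf P" "polyf Q" "\<And>x. x \<in> U \<Longrightarrow> Q x \<noteq> 0" "\<And>x. x \<in> U \<Longrightarrow> R x = P x / Q x"
  using assms unfolding rat_on_def by blast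

lemma rat_onI:
  "polyf P \<Longrightarrow> polyf Q \<Longrightarrow> (\<And>x. x \<in> U \<Longrightarrow> Q x \<noteq> 0) \<Longrightarrow> (\<And>x. x \<in> U \<Longrightarrow> R x = P x / Q x) \<Longrightarrow> rat_on U R"
  unfolding rat_on_def by blast

lemma rat_on_cong: "(\<And>x. x \<in> U \<Longrightarrow> R x = R' x) \<Longrightarrow> rat_on U R \<longleftrightarrow> rat_on U R'"
  unfolding rat_on_def by simp

lemma rat_on_subset: "rat_on U R \<Longrightarrow> U' \<subseteq> U \<Longrightarrow> rat_on U' R"
  unfolding rat_on_def by blast

named_theorems rat_intros

lemma rat_on_polyf: "polyf F \<Longrightarrow> rat_on U F"
  by (rule rat_onI[of F "\<lambda>_. 1"]) auto

lemma rat_on_const [rat_intros]: "rat_on U (\<lambda>_. c)" by (rule rat_on_polyf) auto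
lemma rat_on_var [rat_intros]: "rat_on U (\<lambda>x. x i)" by (rule rat_on_polyf) auto

lemma rat_on_add [rat_intros]: assumes "rat_on U R" "rat_on U S" shows "rat_on U (\<lambda>x. R x + S x)"
proof -
  obtain P Q where 1: "polyf P" "polyf Q" "\<And>x. x \<in> U \<Longrightarrow> Q x \<noteq> 0" "\<And>x. x \<in> U \<Longrightarrow> R x = P x / Q x"
    using assms(1) by (rule rat_onE) blast
  obtain P' Q' where 2: "polyf P'" "polyf Q'" "\<And>x. x \<in> U \<Longrightarrow> Q' x \<noteq> 0" "\<And>x. x \<in> U \<Longrightarrow> S x = P' x / Q' x"
    using assms(2) by (rule rat_onE) blast
  show ?thesis
    by (rule rat_onI[of "\<lambda>x. P x * Q' x + P' x * Q x" "\<lambda>x. Q x * Q' x"])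
       (use 1 2 in \<open>auto intro!: polyf_add polyf_mult simp: field_simps\<close>)
qed

lemma rat_on_mult [rat_intros]: assumes "rat_on U R" "rat_on U S" shows "rat_on U (\<lambda>x. R x * S x)"
proof -
  obtain P Q where 1: "polyf P" "polyf Q" "\<And>x. x \<in> U \<Longrightarrow> Q x \<noteq> 0" "\<And>x. x \<in> U \<Longrightarrow> R x = P x / Q x"
    using assms(1) by (rule rat_onE) blast
  obtain P' Q' where 2: "polyf P'" "polyf Q'" "\<And>x. x \<in> U \<Longrightarrow> Q' x \<noteq> 0" "\<And>x. x \<in> U \<Longrightarrow> S x = P' x / Q' x"
    using assms(2) by (rule rat_onE) blast
  show ?thesis
    by (rule rat_onI[of "\<lambda>x. P x * P' x" "\<lambda>x. Q x * Q' x"])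
       (use 1 2 in \<open>auto intro!: polyf_mult\<close>)
qed

lemma rat_on_inverse: assumes "rat_on U R" "\<And>x. x \<in> U \<Longrightarrow> R x \<noteq> 0" shows "rat_on U (\<lambda>x. inverse (R x))"
proof -
  obtain P Q where 1: "polyf P" "polyf Q" "\<And>x. x \<in> U \<Longrightarrow> Q x \<noteq> 0" "\<And>x. x \<in> U \<Longrightarrow> R x = P x / Q x"
    using assms(1) by (rule rat_onE) blast
  show ?thesis
    by (rule rat_onI[of Q P]) (use 1 assms(2) in \<open>auto\<close>)
qed

lemma rat_on_minus [rat_intros]: "rat_on U R \<Longrightarrow> rat_on U (\<lambda>x. - R x)"
  using rat_on_mult[OF rat_on_const[of U "-1"], of R] by simp

lemma rat_on_diff [rat_intros]: "rat_on U R \<Longrightarrow> rat_on U S \<Longrightarrow> rat_on U (\<lambda>x. R x - S x)"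
  using rat_on_add[OF _ rat_on_minus, of U R S] by simp

lemma rat_on_divide: "rat_on U R \<Longrightarrow> rat_on U S \<Longrightarrow> (\<And>x. x \<in> U \<Longrightarrow> S x \<noteq> 0) \<Longrightarrow> rat_on U (\<lambda>x. R x / S x)"
  unfolding divide_inverse by (intro rat_on_mult rat_on_inverse)

lemma rat_on_sum [rat_intros]: "(\<And>a. a \<in> A \<Longrightarrow> rat_on U (F a)) \<Longrightarrow> rat_on U (\<lambda>x. \<Sum>a\<in>A. F a x)"
  by (induction A rule: infinite_finite_induct) (auto intro: rat_intros)

lemma rat_on_prod [rat_intros]: "(\<And>a. a \<in> A \<Longrightarrow> rat_on U (F a)) \<Longrightarrow> rat_on U (\<lambda>x. \<Prod>a\<in>A. F a x)"
  by (induction A rule: infinite_finite_induct) (auto intro: rat_intros)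

lemma rat_on_power [rat_intros]: "rat_on U R \<Longrightarrow> rat_on U (\<lambda>x. R x ^ n)"
  by (induction n) (auto intro: rat_intros)

lemma rat_on_powi: "rat_on U R \<Longrightarrow> (\<And>x. x \<in> U \<Longrightarrow> R x \<noteq> 0) \<Longrightarrow> rat_on U (\<lambda>x. R x powi n)"
  unfolding power_int_def by (cases "n \<ge> 0") (auto intro!: rat_on_power rat_on_inverse)

lemma rat_on_compose:
  assumes R: "rat_on U R" and s: "\<And>i. rat_on U' (\<lambda>x. \<sigma> x i)" and sub: "\<And>x. x \<in> U' \<Longrightarrow> \<sigma> x \<in> U"
  shows "rat_on U' (\<lambda>x. R (\<sigma> x))"
proof -
  obtain P Q where 1: "polyf P" "polyf Q" "\<And>x. x \<in> U \<Longrightarrow> Q x \<noteq> 0" "\<And>x. x \<in> U \<Longrightarrow> R x = P x / Q x"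
    using R by (rule rat_onE) blast
  have *: "rat_on U' (\<lambda>x. F (\<sigma> x))" if F: "polyf F" for F
  proof -
    from F obtain P where P: "\<And>x. F x = peval id P x" unfolding polyf_def by metis
    show ?thesis unfolding P peval_def by (intro rat_intros s)
  qed
  have "rat_on U' (\<lambda>x. P (\<sigma> x) / Q (\<sigma> x))"
    using 1 sub by (intro rat_on_divide *) auto
  then show ?thesis
    by (subst rat_on_cong[of _ _ "\<lambda>x. P (\<sigma> x) / Q (\<sigma> x)"]) (use 1 sub in auto)
qed

text \<open>Cross-multiplication reduces this to the vanishing of a polynomial on the radially ordered points.\<close>

lemma rat_on_eqI:
  assumes R: "rat_on U R" and S: "rat_on U S" and I: "finite I" "radially_ordered I \<subseteq> U"
    and eq: "\<And>x. x \<in> radially_ordered I \<Longrightarrow> R x = S x" and x: "x \<in> U"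
  shows "R x = S x"
proof -
  obtain P Q where 1: "polyf P" "polyf Q" "\<And>x. x \<in> U \<Longrightarrow> Q x \<noteq> 0" "\<And>x. x \<in> U \<Longrightarrow> R x = P x / Q x"
    using R by (rule rat_onE) blast
  obtain P' Q' where 2: "polyf P'" "polyf Q'" "\<And>x. x \<in> U \<Longrightarrow> Q' x \<noteq> 0" "\<And>x. x \<in> U \<Longrightarrow> S x = P' x / Q' x"
    using S by (rule rat_onE) blast
  have "P x * Q' x - P' x * Q x = 0"
  proof (rule polyf_eq_0I[where F = "\<lambda>x. P x * Q' x - P' x * Q x", OF _ I(1)])
    fix x assume "x \<in> radially_ordered I"
    with eq[of x] I(2) have "x \<in> U" "R x = S x" by auto
    with 1(3)[of x] 2(3)[of x] show "P x * Q' x - P' x * Q x = 0"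
      by (simp add: 1(4) 2(4) frac_eq_eq)
  qed (intro polyf_diff polyf_mult 1 2)
  with 1(3)[OF x] 2(3)[OF x] show ?thesis by (simp add: 1(4)[OF x] 2(4)[OF x] frac_eq_eq)
qed

lemma rat_on_holomorphic:
  assumes R: "rat_on U R" and hol: "\<And>i. (\<lambda>t. X t i) holomorphic_on S" and sub: "\<And>t. t \<in> S \<Longrightarrow> X t \<in> U"
  shows "(\<lambda>t. R (X t)) holomorphic_on S"
proof -
  obtain P Q where 1: "polyf P" "polyf Q" "\<And>x. x \<in> U \<Longrightarrow> Q x \<noteq> 0" "\<And>x. x \<in> U \<Longrightarrow> R x = P x / Q x"
    using R by (rule rat_onE) blast
  have "(\<lambda>t. P (X t) / Q (X t)) holomorphic_on S"
    by (rule holomorphic_on_divide[OF polyf_holomorphic[OF 1(1) hol] polyf_holomorphic[OF 1(2) hol]])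
       (use 1(3) sub in auto)
  then show ?thesis by (rule holomorphic_transform) (use 1(4) sub in auto)
qed

subsection \<open>Values of the rational extension\<close>

lemma peval_has_fps_expansion:
  fixes X :: "complex \<Rightarrow> nat \<Rightarrow> complex"
  assumes "\<And>i. (\<lambda>q. X q i) has_fps_expansion \<xi> i"
  shows "(\<lambda>q. peval id P (X q)) has_fps_expansion peval fps_const P \<xi>"
  unfolding peval_def id_apply
  by (intro has_fps_expansion_sum has_fps_expansion_mult has_fps_expansion_const
      has_fps_expansion_prod has_fps_expansion_power assms)

text \<open>The defining property of \<open>rat_ext\<close> determines a unique value: two representations of the
  same sum satisfy \<open>P Q' = P' Q\<close> on the radially ordered points, hence everywhere.\<close>

lemma rat_ext_complex:
  assumes I: "finite I" "radially_ordered I \<subseteq> U" and R: "rat_on U R"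
    and sum: "\<And>x. x \<in> radially_ordered I \<Longrightarrow> (t x has_sum R x) (PiE I (\<lambda>_. UNIV))" and \<xi>: "\<xi> \<in> U"
  shows "rat_ext id I t \<xi> = R \<xi>"
proof -
  obtain P Q where 1: "polyf P" "polyf Q" "\<And>x. x \<in> U \<Longrightarrow> Q x \<noteq> 0" "\<And>x. x \<in> U \<Longrightarrow> R x = P x / Q x"
    using R by (rule rat_onE) blast
  obtain p q where pq: "\<And>x. peval id p x = P x" "\<And>x. peval id q x = Q x"
    using 1(1,2) unfolding polyf_def by blast
  show ?thesis unfolding rat_ext_def
  proof (rule the_equality)
    show "\<exists>P Q. (\<forall>x\<in>radially_ordered I. \<exists>s. (t x has_sum s) (PiE I (\<lambda>_. UNIV)) \<and> peval id Q x * s = peval id P x) \<and>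
        peval id Q \<xi> dvd 1 \<and> R \<xi> * peval id Q \<xi> = peval id P \<xi>"
    proof (rule exI[of _ p], rule exI[of _ q], intro conjI ballI)
      fix x assume x: "x \<in> radially_ordered I"
      with I(2) have "x \<in> U" by auto
      then show "\<exists>s. (t x has_sum s) (PiE I (\<lambda>_. UNIV)) \<and> peval id q x * s = peval id p x"
        using 1(3,4)[of x] sum[OF x] by (intro exI[of _ "R x"]) (simp add: pq)
    qed (use 1(3,4)[OF \<xi>] in \<open>auto simp: pq dvd_field_iff\<close>)
  next
    fix r assume "\<exists>P Q. (\<forall>x\<in>radially_ordered I. \<exists>s. (t x has_sum s) (PiE I (\<lambda>_. UNIV)) \<and> peval id Q x * s = peval id P x) \<and>
        peval id Q \<xi> dvd 1 \<and> r * peval id Q \<xi> = peval id P \<xi>"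
    then obtain p' q' where pq': "\<And>x. x \<in> radially_ordered I \<Longrightarrow> \<exists>s. (t x has_sum s) (PiE I (\<lambda>_. UNIV)) \<and> peval id q' x * s = peval id p' x"
        "peval id q' \<xi> dvd 1" "r * peval id q' \<xi> = peval id p' \<xi>"
      by blast
    have "peval id q' \<xi> * P \<xi> - peval id p' \<xi> * Q \<xi> = 0"
    proof (rule polyf_eq_0I[where F = "\<lambda>\<xi>. peval id q' \<xi> * P \<xi> - peval id p' \<xi> * Q \<xi>", OF _ I(1)])
      fix x assume x: "x \<in> radially_ordered I"
      then have "peval id q' x * R x = peval id p' x"
        using pq'(1)[OF x] sum[OF x] has_sum_unique by metis
      moreover have "x \<in> U" using x I(2) by auto
      ultimately show "peval id q' x * P x - peval id p' x * Q x = 0"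
        using 1(3,4)[of x] by (simp add: field_simps)
    qed (intro polyf_diff polyf_mult 1; auto simp: polyf_def)
    moreover have "R \<xi> * Q \<xi> = P \<xi>" using 1(3,4)[OF \<xi>] by simp
    moreover have "peval id q' \<xi> * Q \<xi> * (r - R \<xi>) = (r * peval id q' \<xi>) * Q \<xi> - peval id q' \<xi> * (R \<xi> * Q \<xi>)"
      by (simp add: algebra_simps)
    ultimately have "peval id q' \<xi> * Q \<xi> * (r - R \<xi>) = 0" using pq'(3) by simp
    moreover have "peval id q' \<xi> \<noteq> 0" using pq'(2) by auto
    ultimately show "r = R \<xi>" using 1(3)[OF \<xi>] by simp
  qed
qed

text \<open>At a point over \<open>\<complex>[[q]]\<close> that is the expansion of a curve \<open>X q\<close> in the regular set, the value is the expansion of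
  \<open>R\<close> along the curve: the identities between polynomials that define \<open>rat_ext\<close> may be expanded in \<open>q\<close>.\<close>

lemma rat_ext_fps:
  fixes X :: "complex \<Rightarrow> nat \<Rightarrow> complex"
  assumes I: "finite I" "radially_ordered I \<subseteq> U" and R: "rat_on U R"
    and sum: "\<And>x. x \<in> radially_ordered I \<Longrightarrow> (t x has_sum R x) (PiE I (\<lambda>_. UNIV))"
    and X: "\<And>i. (\<lambda>q. X q i) has_fps_expansion \<xi> i" and U: "\<forall>\<^sub>F q in nhds 0. X q \<in> U"
    and r: "(\<lambda>q. R (X q)) has_fps_expansion r"
  shows "rat_ext fps_const I t \<xi> = r"
proof -
  obtain P Q where 1: "polyf P" "polyf Q" "\<And>x. x \<in> U \<Longrightarrow> Q x \<noteq> 0" "\<And>x. x \<in> U \<Longrightarrow> R x = P x / Q x"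
    using R by (rule rat_onE) blast
  obtain p q where pq: "\<And>x. peval id p x = P x" "\<And>x. peval id q x = Q x"
    using 1(1,2) unfolding polyf_def by blast
  have X0: "X 0 \<in> U" using U by (rule eventually_nhds_x_imp_x)
  have unit_iff: "F dvd 1 \<longleftrightarrow> F $ 0 \<noteq> 0" for F :: "complex fps"
    by (simp add: fps_is_unit_iff)
  note pX = peval_has_fps_expansion[where X = X and \<xi> = \<xi>, OF X]
  have const: "peval fps_const F \<xi> $ 0 = peval id F (X 0)" for F
    using has_fps_expansion_imp_0_eq_fps_nth_0[OF pX[of F]] by simp
  have r_eq: "r * peval fps_const q \<xi> = peval fps_const p \<xi>"
  proof -
    have "(\<lambda>w. R (X w) * peval id q (X w)) has_fps_expansion r * peval fps_const q \<xi>"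
      by (intro has_fps_expansion_mult r pX)
    moreover have "\<forall>\<^sub>F w in nhds 0. R (X w) * peval id q (X w) = peval id p (X w)"
      using U by eventually_elim (use 1 in \<open>auto simp: pq\<close>)
    ultimately have "(\<lambda>w. peval id p (X w)) has_fps_expansion r * peval fps_const q \<xi>"
      by (subst has_fps_expansion_cong[OF _ refl, symmetric])
    then show ?thesis using pX[of p] by (rule fps_expansion_unique_complex)
  qed
  show ?thesis unfolding rat_ext_def
  proof (rule the_equality)
    show "\<exists>P Q. (\<forall>x\<in>radially_ordered I. \<exists>s. (t x has_sum s) (PiE I (\<lambda>_. UNIV)) \<and> peval id Q x * s = peval id P x) \<and>
        peval fps_const Q \<xi> dvd 1 \<and> r * peval fps_const Q \<xi> = peval fps_const P \<xi>"
    proof (rule exI[of _ p], rule exI[of _ q], intro conjI ballI)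
      fix x assume x: "x \<in> radially_ordered I"
      with I(2) have "x \<in> U" by auto
      then show "\<exists>s. (t x has_sum s) (PiE I (\<lambda>_. UNIV)) \<and> peval id q x * s = peval id p x"
        using 1(3,4)[of x] sum[OF x] by (intro exI[of _ "R x"]) (simp add: pq)
    qed (use 1(3)[OF X0] r_eq in \<open>auto simp: unit_iff const pq\<close>)
  next
    fix r' assume "\<exists>P Q. (\<forall>x\<in>radially_ordered I. \<exists>s. (t x has_sum s) (PiE I (\<lambda>_. UNIV)) \<and> peval id Q x * s = peval id P x) \<and>
        peval fps_const Q \<xi> dvd 1 \<and> r' * peval fps_const Q \<xi> = peval fps_const P \<xi>"
    then obtain p' q' where pq': "\<And>x. x \<in> radially_ordered I \<Longrightarrow> \<exists>s. (t x has_sum s) (PiE I (\<lambda>_. UNIV)) \<and> peval id q' x * s = peval id p' x"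
        "peval fps_const q' \<xi> dvd 1" "r' * peval fps_const q' \<xi> = peval fps_const p' \<xi>"
      by blast
    have zero: "peval id q' x * P x - peval id p' x * Q x = 0" for x
    proof (rule polyf_eq_0I[where F = "\<lambda>\<xi>. peval id q' \<xi> * P \<xi> - peval id p' \<xi> * Q \<xi>", OF _ I(1)])
      fix x assume x: "x \<in> radially_ordered I"
      then have "peval id q' x * R x = peval id p' x"
        using pq'(1)[OF x] sum[OF x] has_sum_unique by metis
      moreover have "x \<in> U" using x I(2) by auto
      ultimately show "peval id q' x * P x - peval id p' x * Q x = 0"
        using 1(3,4)[of x] by (simp add: field_simps)
    qed (intro polyf_diff polyf_mult 1; auto simp: polyf_def)
    have "peval fps_const q' \<xi> * peval fps_const p \<xi> = peval fps_const p' \<xi> * peval fps_const q \<xi>"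
    proof (rule fps_expansion_unique_complex)
      show "(\<lambda>w. peval id q' (X w) * peval id p (X w)) has_fps_expansion peval fps_const q' \<xi> * peval fps_const p \<xi>"
        by (intro has_fps_expansion_mult pX)
      have "(\<lambda>w. peval id p' (X w) * peval id q (X w)) has_fps_expansion peval fps_const p' \<xi> * peval fps_const q \<xi>"
        by (intro has_fps_expansion_mult pX)
      then show "(\<lambda>w. peval id q' (X w) * peval id p (X w)) has_fps_expansion peval fps_const p' \<xi> * peval fps_const q \<xi>"
        using zero by (simp add: pq)
    qed
    moreover have "peval fps_const q' \<xi> * peval fps_const q \<xi> * (r' - r)
        = (r' * peval fps_const q' \<xi>) * peval fps_const q \<xi> - peval fps_const q' \<xi> * (r * peval fps_const q \<xi>)"
      by (simp add: algebra_simps)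
    ultimately have "peval fps_const q' \<xi> * peval fps_const q \<xi> * (r' - r) = 0"
      unfolding r_eq pq'(3) by simp
    moreover have "peval fps_const q' \<xi> \<noteq> 0" "peval fps_const q \<xi> \<noteq> 0"
      using pq'(2) const[of q] 1(3)[OF X0] by (auto simp: pq unit_iff)
    ultimately show "r' = r" by simp
  qed
qed

section \<open>Multiple series\<close>

lemma has_sum_times:
  fixes f :: "'i \<Rightarrow> complex" and g :: "'j \<Rightarrow> complex"
  assumes f: "(f has_sum a) A" and g: "(g has_sum b) B"
  shows "((\<lambda>(x,y). f x * g y) has_sum a * b) (A \<times> B)"
proof -
  have nf: "(\<lambda>x. norm (f x)) summable_on A" and ng: "(\<lambda>y. norm (g y)) summable_on B"
    using f g by (auto simp: summable_on_iff_abs_summable_on_complex[symmetric] intro: has_sum_imp_summable)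
  have "(\<lambda>p. norm (case p of (x, y) \<Rightarrow> f x * g y)) summable_on A \<times> B"
  proof (rule iffD2[OF Infinite_Sum.abs_summable_on_Sigma_iff], intro conjI ballI)
    fix x assume "x \<in> A"
    show "(\<lambda>y. norm (case (x, y) of (x, y) \<Rightarrow> f x * g y)) summable_on B"
      using summable_on_cmult_right[OF ng, of "norm (f x)"] by (simp add: norm_mult)
  next
    have "(\<Sum>\<^sub>\<infinity>y\<in>B. norm (f x * g y)) = norm (f x) * (\<Sum>\<^sub>\<infinity>y\<in>B. norm (g y))" for x
      by (simp add: norm_mult infsum_cmult_right[OF ng])
    moreover have "(\<lambda>x. norm (f x) * (\<Sum>\<^sub>\<infinity>y\<in>B. norm (g y))) summable_on A"
      by (intro summable_on_cmult_left nf)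
    ultimately show "(\<lambda>x. norm (\<Sum>\<^sub>\<infinity>y\<in>B. norm (case (x, y) of (x, y) \<Rightarrow> f x * g y))) summable_on A"
      by (simp add: abs_mult infsum_nonneg)
  qed
  then have "(\<lambda>(x,y). f x * g y) summable_on A \<times> B"
    by (simp add: summable_on_iff_abs_summable_on_complex)
  moreover have "((\<lambda>y. f x * g y) has_sum f x * b) B" for x
    by (intro has_sum_cmult_right g)
  moreover have "((\<lambda>x. f x * b) has_sum a * b) A"
    by (intro has_sum_cmult_left f)
  ultimately show ?thesis
    by (intro has_sum_SigmaI) auto
qed

lemma has_sum_sum:
  fixes f :: "'f \<Rightarrow> 'i \<Rightarrow> complex"
  assumes "\<And>j. j \<in> J \<Longrightarrow> (f j has_sum s j) A"
  shows "((\<lambda>x. \<Sum>j\<in>J. f j x) has_sum (\<Sum>j\<in>J. s j)) A"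
  using assms by (induction J rule: infinite_finite_induct) (auto intro: has_sum_add)

text \<open>The series that arise by moving one mode past another: a one-variable series times a
  multiple series whose indices are shifted by an amount depending on the first index.\<close>

lemma has_sum_twisted_product:
  fixes c :: "'i \<Rightarrow> complex" and T :: "'k \<Rightarrow> complex"
  assumes c: "(c has_sum e) A" and T: "(T has_sum s) K" and \<sigma>: "\<And>a. bij_betw (\<sigma> a) K K"
  shows "((\<lambda>(a,\<kappa>). c a * T (\<sigma> a \<kappa>)) has_sum e * s) (A \<times> K)"
proof -
  have img: "\<sigma> a ` K = K" and inj: "inj_on (\<sigma> a) K" for a
    using \<sigma>[of a] by (auto simp: bij_betw_def)
  have "bij_betw (\<lambda>(a,\<kappa>). (a, \<sigma> a \<kappa>)) (A \<times> K) (A \<times> K)"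
    unfolding bij_betw_def
  proof
    show "inj_on (\<lambda>(a, \<kappa>). (a, \<sigma> a \<kappa>)) (A \<times> K)" using inj by (auto simp: inj_on_def)
    show "(\<lambda>(a, \<kappa>). (a, \<sigma> a \<kappa>)) ` (A \<times> K) = A \<times> K"
    proof safe
      fix a \<kappa> assume a: "a \<in> A" "\<kappa> \<in> K"
      then obtain \<kappa>' where "\<kappa>' \<in> K" "\<kappa> = \<sigma> a \<kappa>'" using img[of a] by blast
      with a show "(a, \<kappa>) \<in> (\<lambda>(a, \<kappa>). (a, \<sigma> a \<kappa>)) ` (A \<times> K)" by force
    qed (use img in auto)
  qed
  from has_sum_reindex_bij_betw[OF this, of "\<lambda>(a,\<kappa>). c a * T \<kappa>"] has_sum_times[OF c T]
  show ?thesis by (simp add: case_prod_unfold)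
qed

lemma has_sum_PiE_insert:
  fixes t :: "('i \<Rightarrow> 'k) \<Rightarrow> complex"
  assumes "i \<notin> S"
  shows "(t has_sum s) (PiE (insert i S) (\<lambda>_. UNIV)) \<longleftrightarrow>
    ((\<lambda>(a,\<kappa>). t (\<kappa>(i := a))) has_sum s) (UNIV \<times> PiE S (\<lambda>_. UNIV))"
proof -
  have "inj_on (\<lambda>(a,\<kappa>). \<kappa>(i := a)) (UNIV \<times> PiE S (\<lambda>_. UNIV :: 'k set))"
    by (rule inj_combinator[OF assms])
  then have "bij_betw (\<lambda>(a,\<kappa>). \<kappa>(i := a)) (UNIV \<times> PiE S (\<lambda>_. UNIV :: 'k set)) (PiE (insert i S) (\<lambda>_. UNIV))"
    by (simp add: bij_betw_def PiE_insert_eq)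
  from has_sum_reindex_bij_betw[OF this, of t] show ?thesis by (simp add: case_prod_unfold)
qed

lemma bij_betw_PiE_shift:
  fixes d :: int
  assumes "l \<in> S"
  shows "bij_betw (\<lambda>\<kappa>. \<kappa>(l := \<kappa> l + d)) (PiE S (\<lambda>_. UNIV)) (PiE S (\<lambda>_. UNIV))"
  by (rule bij_betwI[of _ _ _ "\<lambda>\<kappa>. \<kappa>(l := \<kappa> l - d)"])
     (use assms in \<open>auto simp: PiE_iff extensional_def\<close>)

text \<open>A power series that converges in a disc converges absolutely inside it; \<open>has_sum\<close> needs this stronger form.\<close>

lemma has_sum_powser:
  fixes a :: "nat \<Rightarrow> complex"
  assumes "\<And>y. norm y < r \<Longrightarrow> (\<lambda>n. a n * y ^ n) sums f y" "norm y < r"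
  shows "((\<lambda>n. a n * y ^ n) has_sum f y) UNIV"
proof (rule norm_summable_imp_has_sum)
  obtain R where R: "norm y < R" "R < r" using assms(2) dense by blast
  then have R': "norm (complex_of_real R) = R" using order.strict_trans1[OF norm_ge_zero R(1)] by simp
  have "summable (\<lambda>n. a n * of_real R ^ n)"
    using assms(1)[of "of_real R"] R R' by (simp add: sums_iff)
  then show "summable (\<lambda>n. norm (a n * y ^ n))" by (rule powser_insidea) (use R R' in simp)
qed (use assms in auto)

lemma negative_binomial_sums:
  fixes y a :: complex
  assumes "norm y < 1"
  shows "((\<lambda>n. ((a + of_nat n - 1) gchoose n) * y ^ n) has_sum (1 - y) powr (- a)) UNIV"
proof (rule has_sum_powser[OF _ assms])
  fix y :: complex assume "norm y < 1"
  then have "(\<lambda>n. ((- a) gchoose n) * (- y) ^ n) sums (1 + (- y)) powr (- a)"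
    by (intro gen_binomial_complex) simp
  moreover have "((- a) gchoose n) * (- y) ^ n = ((a + of_nat n - 1) gchoose n) * y ^ n" for n
  proof -
    have "(-1) ^ n * (- y) ^ n = y ^ n" by (simp flip: power_mult_distrib)
    then show ?thesis by (simp add: gbinomial_minus mult_ac)
  qed
  ultimately show "(\<lambda>n. ((a + of_nat n - 1) gchoose n) * y ^ n) sums (1 - y) powr (- a)" by simp
qed

lemma negative_binomial_sums_nat:
  fixes y :: complex
  assumes "norm y < 1"
  shows "((\<lambda>n. of_nat ((n + j) choose j) * y ^ n) has_sum (1 / (1 - y)) ^ Suc j) UNIV"
proof -
  have ne: "1 - y \<noteq> 0" using assms by auto
  have "(of_nat (Suc j) + of_nat n - 1 :: complex) gchoose n = of_nat ((n + j) choose j)" for n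
  proof -
    have "(of_nat (Suc j) + of_nat n - 1 :: complex) = of_nat (n + j)" by simp
    then have "(of_nat (Suc j) + of_nat n - 1 :: complex) gchoose n = of_nat ((n + j) choose n)"
      by (simp only: binomial_gbinomial)
    also have "(n + j) choose n = (n + j) choose j" by (metis add_diff_cancel_left' binomial_symmetric le_add1)
    finally show ?thesis .
  qed
  moreover have "(1 - y) powr (- of_nat (Suc j)) = (1 / (1 - y)) ^ Suc j"
    using ne by (simp add: powr_minus powr_nat' power_divide divide_inverse power_inverse del: of_nat_Suc power_Suc)
  ultimately show ?thesis
    using negative_binomial_sums[OF assms, of "of_nat (Suc j)"] by simp
qed

lemma has_sum_int_nonneg:
  assumes "((\<lambda>n. f (int n)) has_sum s) (UNIV :: nat set)"
  shows "((\<lambda>k. if k \<ge> 0 then f k else 0) has_sum (s::complex)) UNIV"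
proof -
  have "(f has_sum s) (range int)"
    using has_sum_reindex[of int UNIV f s] assms by (simp add: o_def)
  also have "?this \<longleftrightarrow> ((\<lambda>k. if k \<ge> 0 then f k else 0) has_sum s) UNIV"
  proof (rule has_sum_cong_neutral)
    fix k :: int assume "k \<in> UNIV - range int"
    then show "(if k \<ge> 0 then f k else 0) = 0" by (metis DiffE nonneg_int_cases rangeI)
  qed auto
  finally show ?thesis .
qed

lemma has_sum_int_neg:
  assumes "((\<lambda>n. f (- 1 - int n)) has_sum s) (UNIV :: nat set)"
  shows "((\<lambda>k. if k < 0 then f k else 0) has_sum (s::complex)) UNIV"
proof -
  have inj: "inj (\<lambda>n. - 1 - int n)" by (auto simp: inj_def)
  have "(f has_sum s) (range (\<lambda>n. - 1 - int n))"
    using has_sum_reindex[OF inj, of f s] assms by (simp add: o_def)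
  also have "?this \<longleftrightarrow> ((\<lambda>k. if k < 0 then f k else 0) has_sum s) UNIV"
  proof (rule has_sum_cong_neutral)
    fix k :: int assume k: "k \<in> UNIV - range (\<lambda>n. - 1 - int n)"
    have "k \<ge> 0"
    proof (rule ccontr)
      assume "\<not> k \<ge> 0"
      then have "k = - 1 - int (nat (- 1 - k))" by simp
      with k show False by blast
    qed
    then show "(if k < 0 then f k else 0) = 0" by simp
  qed auto
  finally show ?thesis .
qed

text \<open>The two expansions of \<open>1/(x-y)\<^bsup>j+1\<^esup>\<close>, indexed by the mode \<open>k\<close> that is moved: its non-negative values give the
  expansion in the region where \<open>x\<close> dominates, its negative values the one where \<open>y\<close> dominates.\<close>

lemma has_sum_nonneg_modes:
  assumes xy: "norm y < norm (x::complex)"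
  shows "((\<lambda>k::int. if k \<ge> 0 then (of_int k gchoose j) * y powi (k - int j) * x powi (- k - 1) else 0)
           has_sum (1 / (x - y)) ^ Suc j) UNIV"
proof (rule has_sum_int_nonneg)
  have x: "x \<noteq> 0" using xy by auto
  let ?f = "\<lambda>n. (of_int (int n) gchoose j) * y powi (int n - int j) * x powi (- int n - 1)"
  have "((\<lambda>n. of_nat ((n + j) choose j) * (y / x) ^ n) has_sum (1 / (1 - y / x)) ^ Suc j) UNIV"
    by (rule negative_binomial_sums_nat) (use xy x in \<open>simp add: norm_divide\<close>)
  then have "((\<lambda>n. (1/x) ^ Suc j * (of_nat ((n + j) choose j) * (y / x) ^ n)) has_sum (1/x) ^ Suc j * (1 / (1 - y / x)) ^ Suc j) UNIV"
    by (rule has_sum_cmult_right)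
  also have "(1/x) ^ Suc j * (1 / (1 - y / x)) ^ Suc j = (1 / (x - y)) ^ Suc j"
    unfolding power_mult_distrib[symmetric] using x by (simp add: field_simps)
  also have "(\<lambda>n. (1/x) ^ Suc j * (of_nat ((n + j) choose j) * (y / x) ^ n)) = (\<lambda>n. ?f (n + j))"
  proof
    fix n
    have "(of_int (int (n + j)) gchoose j :: complex) = of_nat ((n + j) choose j)"
      by (simp only: binomial_gbinomial of_int_of_nat_eq)
    moreover have "y powi (int (n + j) - int j) = y ^ n" by simp
    moreover have "x powi (- int (n + j) - 1) = (1/x) ^ Suc j * (1/x) ^ n"
    proof -
      have "- int (n + j) - 1 = - int (Suc j + n)" by simp
      then show ?thesis by (simp only: power_int_minus power_int_of_nat power_add power_one_over) (simp add: field_simps)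
    qed
    ultimately show "(1/x) ^ Suc j * (of_nat ((n + j) choose j) * (y / x) ^ n) = ?f (n + j)"
      by (simp only: ) (simp add: power_divide)
  qed
  finally have "((\<lambda>n. ?f (n + j)) has_sum (1 / (x - y)) ^ Suc j) UNIV" .
  then have "(?f has_sum (1 / (x - y)) ^ Suc j) (range (\<lambda>n. n + j))"
    by (subst has_sum_reindex) (auto simp: o_def)
  also have "?this \<longleftrightarrow> (?f has_sum (1 / (x - y)) ^ Suc j) UNIV"
  proof (rule has_sum_cong_neutral)
    fix n :: nat assume "n \<in> UNIV - range (\<lambda>n. n + j)"
    then have "n < j" by (metis DiffE UNIV_I le_add_diff_inverse2 linorder_not_less rangeI)
    then have "(of_int (int n) gchoose j :: complex) = 0"
      by (metis binomial_eq_0 binomial_gbinomial of_int_of_nat_eq of_nat_0)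
    then show "?f n = 0" by simp
  qed auto
  finally show "(?f has_sum (1 / (x - y)) ^ Suc j) UNIV" .
qed

lemma has_sum_neg_modes:
  assumes xy: "norm x < norm (y::complex)"
  shows "((\<lambda>k::int. if k < 0 then (of_int k gchoose j) * y powi (k - int j) * x powi (- k - 1) else 0)
           has_sum - ((1 / (x - y)) ^ Suc j)) UNIV"
proof (rule has_sum_int_neg)
  have y: "y \<noteq> 0" using xy by auto
  have "((\<lambda>n. of_nat ((n + j) choose j) * (x / y) ^ n) has_sum (1 / (1 - x / y)) ^ Suc j) UNIV"
    by (rule negative_binomial_sums_nat) (use xy y in \<open>simp add: norm_divide\<close>)
  then have "((\<lambda>n. ((-1) ^ j * (1/y) ^ Suc j) * (of_nat ((n + j) choose j) * (x / y) ^ n))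
       has_sum ((-1) ^ j * (1/y) ^ Suc j) * (1 / (1 - x / y)) ^ Suc j) UNIV"
    by (rule has_sum_cmult_right)
  also have "((-1) ^ j * (1/y) ^ Suc j) * (1 / (1 - x / y)) ^ Suc j = - ((1 / (x - y)) ^ Suc j)"
  proof -
    have "((-1) ^ j * (1/y) ^ Suc j) * (1 / (1 - x / y)) ^ Suc j = - ((-1) ^ Suc j * ((1/y) ^ Suc j * (1 / (1 - x / y)) ^ Suc j))"
      by simp
    also have "(1/y) ^ Suc j * (1 / (1 - x / y)) ^ Suc j = (1 / (y - x)) ^ Suc j"
      unfolding power_mult_distrib[symmetric] using y by (simp add: field_simps)
    also have "(-1) ^ Suc j * (1 / (y - x)) ^ Suc j = (- 1 * (1 / (y - x))) ^ Suc j"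
      by (simp only: power_mult_distrib)
    also have "- 1 * (1 / (y - x)) = 1 / (x - y)" by (metis minus_diff_eq minus_divide_right mult_minus1)
    finally show ?thesis .
  qed
  also have "(\<lambda>n. ((-1) ^ j * (1/y) ^ Suc j) * (of_nat ((n + j) choose j) * (x / y) ^ n)) =
     (\<lambda>n. (of_int (-1 - int n) gchoose j) * y powi (-1 - int n - int j) * x powi (- (-1 - int n) - 1))"
  proof
    fix n
    have "(of_int (-1 - int n) gchoose j :: complex) = (-1) ^ j * of_nat ((n + j) choose j)"
    proof -
      have "(of_int (-1 - int n) :: complex) = - of_nat (Suc n)" by simp
      then have "(of_int (-1 - int n) gchoose j :: complex) = (-1) ^ j * ((of_nat (Suc n) + of_nat j - 1) gchoose j)"
        by (simp only: gbinomial_minus)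
      also have "(of_nat (Suc n) + of_nat j - 1 :: complex) = of_nat (n + j)" by simp
      finally show ?thesis by (simp only: binomial_gbinomial)
    qed
    moreover have "y powi (-1 - int n - int j) = (1/y) ^ Suc j * (1/y) ^ n"
    proof -
      have "-1 - int n - int j = - int (Suc j + n)" by simp
      then show ?thesis by (simp only: power_int_minus power_int_of_nat power_add power_one_over) (simp add: field_simps)
    qed
    moreover have "x powi (- (-1 - int n) - 1) = x ^ n" by simp
    ultimately show "((-1) ^ j * (1/y) ^ Suc j) * (of_nat ((n + j) choose j) * (x / y) ^ n) =
      (of_int (-1 - int n) gchoose j) * y powi (-1 - int n - int j) * x powi (- (-1 - int n) - 1)"
      by (simp only: ) (simp add: power_divide)
  qed
  finally show "((\<lambda>n. (of_int (-1 - int n) gchoose j) * y powi (-1 - int n - int j) * x powi (- (-1 - int n) - 1))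
     has_sum - ((1 / (x - y)) ^ Suc j)) UNIV" .
qed

lemma has_sum_single_index:
  "((\<lambda>k. if k = a then c else 0) has_sum (c::complex)) UNIV"
  by (rule has_sum_finite_neutralI[of "{a}"]) auto

section \<open>Modes on a module\<close>

lemma Sum_any_bounded:
  assumes "\<And>i. i \<ge> N \<Longrightarrow> g i = 0"
  shows "Sum_any g = (\<Sum>i<N::nat. g i)"
  by (rule Sum_any.expand_superset) (use assms in \<open>auto simp: not_less[symmetric]\<close>)

context complex_space
begin

lemma lin_onD:
  assumes "lin_on sc S f"
  shows "x \<in> S \<Longrightarrow> y \<in> S \<Longrightarrow> f (x + y) = f x + f y" "x \<in> S \<Longrightarrow> f (c \<odot> x) = sc c (f x)"
  using assms by (auto simp: lin_on_def)

lemma lin_on_complex_zero: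
  assumes "lin_on (*) S f" "subspace S" shows "f 0 = (0::complex)"
  using lin_onD(2)[OF assms(1) subspace_0[OF assms(2)], of 0] by simp

lemma lin_on_complex_sum:
  assumes "lin_on (*) S f" "subspace S" "\<And>a. a \<in> A \<Longrightarrow> g a \<in> S"
  shows "f (\<Sum>a\<in>A. g a) = (\<Sum>a\<in>A. f (g a) :: complex)"
  using assms(3)
  by (induction A rule: infinite_finite_induct)
     (auto simp: lin_on_complex_zero[OF assms(1,2)] lin_onD(1)[OF assms(1)] subspace_sum[OF assms(2)])

lemma lin_on_complex_diff:
  assumes "lin_on (*) S f" "subspace S" "x \<in> S" "y \<in> S"
  shows "f (x - y) = f x - (f y::complex)"
proof -
  have "x - y = x + (-1) \<odot> y" by simp
  then show ?thesis using assms by (simp only: lin_onD subspace_scale[OF assms(2)]) simp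
qed

lemma lin_on_comp:
  assumes "lin_on (*) S f" "lin_on scale S g" "\<And>x. x \<in> S \<Longrightarrow> g x \<in> S"
  shows "lin_on (*) S (\<lambda>x. f (g x) :: complex)"
  using assms unfolding lin_on_def by simp

end

locale voa_space = complex_space scale
  for scale :: "complex \<Rightarrow> 'u::ab_group_add \<Rightarrow> 'u" (infixr \<open>\<odot>\<close> 75) +
  fixes V :: "'u voa"
  assumes voa: "is_voa V" and cft: "strong_CFT_type V"
begin

lemma V_module: "weak_module V V" using voa by (simp add: is_voa_def)
lemma vac_in: "vac V \<in> carr V" and conf_in: "conf V \<in> carr V"
  using voa unfolding is_voa_def by blast+

context
  fixes M :: "('u, 'y) vmod_scheme"
  assumes M: "weak_module V M"
begin

lemma carr_subspace: "subspace (carr M)" using M by (simp add: weak_module_def)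

lemma mode_closed: "v \<in> carr V \<Longrightarrow> w \<in> carr M \<Longrightarrow> mode M v n w \<in> carr M"
  using M by (simp add: weak_module_def)

lemma mode_lin: "v \<in> carr V \<Longrightarrow> lin_on scale (carr M) (mode M v n)"
  using M by (simp add: weak_module_def)

lemma mode_lin_left: "w \<in> carr M \<Longrightarrow> lin_on scale (carr V) (\<lambda>v. mode M v n w)"
  using M by (simp add: weak_module_def)

lemma mode_add: "v \<in> carr V \<Longrightarrow> w \<in> carr M \<Longrightarrow> w' \<in> carr M \<Longrightarrow> mode M v n (w + w') = mode M v n w + mode M v n w'"
  and mode_scale: "v \<in> carr V \<Longrightarrow> w \<in> carr M \<Longrightarrow> mode M v n (c \<odot> w) = c \<odot> mode M v n w"
  using lin_onD[OF mode_lin] by auto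

lemma mode_add_left: "w \<in> carr M \<Longrightarrow> v \<in> carr V \<Longrightarrow> v' \<in> carr V \<Longrightarrow> mode M (v + v') n w = mode M v n w + mode M v' n w"
  and mode_scale_left: "w \<in> carr M \<Longrightarrow> v \<in> carr V \<Longrightarrow> mode M (c \<odot> v) n w = c \<odot> mode M v n w"
  using lin_onD[OF mode_lin_left] by auto

lemma mode_zero: "v \<in> carr V \<Longrightarrow> mode M v n 0 = 0"
  using mode_scale[of v 0 n 0] subspace_0[OF carr_subspace] by simp

lemma mode_sum: "v \<in> carr V \<Longrightarrow> (\<And>a. a \<in> A \<Longrightarrow> g a \<in> carr M) \<Longrightarrow> mode M v n (\<Sum>a\<in>A. g a) = (\<Sum>a\<in>A. mode M v n (g a))"
  by (induction A rule: infinite_finite_induct) (auto simp: mode_zero mode_add subspace_sum[OF carr_subspace])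

lemma mode_diff: "v \<in> carr V \<Longrightarrow> w \<in> carr M \<Longrightarrow> w' \<in> carr M \<Longrightarrow> mode M v n (w - w') = mode M v n w - mode M v n w'"
  using mode_add[of v w "(-1) \<odot> w'" n] mode_scale[of v w' n "-1"] subspace_scale[OF carr_subspace, of w' "-1"] by simp

lemma mode_truncation: "v \<in> carr V \<Longrightarrow> w \<in> carr M \<Longrightarrow> \<exists>N::nat. \<forall>n\<ge>N. mode M v (int n) w = 0"
proof -
  assume "v \<in> carr V" "w \<in> carr M"
  then obtain N :: int where "\<And>n. n \<ge> N \<Longrightarrow> mode M v n w = 0"
    using M unfolding weak_module_def by meson
  then show ?thesis by (intro exI[of _ "nat N"]) auto
qed

lemma vac_mode: "w \<in> carr M \<Longrightarrow> mode M (vac V) n w = (if n = -1 then w else 0)"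
  using M by (simp add: weak_module_def)

lemma borcherds:
  "u \<in> carr V \<Longrightarrow> v \<in> carr V \<Longrightarrow> w \<in> carr M \<Longrightarrow>
     Sum_any (\<lambda>i::nat. (of_int m gchoose i) \<odot> mode M (mode V u (l + int i) v) (m + n - int i) w) =
     Sum_any (\<lambda>i::nat. ((-1) ^ i * (of_int l gchoose i)) \<odot>
            (mode M u (m + l - int i) (mode M v (n + int i) w)
             - ((-1) powi l) \<odot> mode M v (n + l - int i) (mode M u (m + int i) w)))"
  using M unfolding weak_module_def by blast

end

context
  fixes M :: "('u, 'y) vmod_scheme"
  assumes M: "weak_module V M"
begin

lemma mode_zero_left: "w \<in> carr M \<Longrightarrow> mode M 0 n w = 0"
  using mode_scale_left[OF M, of w 0 0 n] subspace_0[OF carr_subspace[OF V_module]] by simp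

text \<open>The Borcherds identity with \<open>l = 0\<close>.\<close>

lemma commutator:
  assumes u: "u \<in> carr V" and v: "v \<in> carr V" and w: "w \<in> carr M"
    and N: "\<And>i. i \<ge> N \<Longrightarrow> mode V u (int i) v = 0"
  shows "mode M u m (mode M v n w) = mode M v n (mode M u m w) +
    (\<Sum>i<N. (of_int m gchoose i) \<odot> mode M (mode V u (int i) v) (m + n - int i) w)"
proof -
  have "Sum_any (\<lambda>i::nat. (of_int m gchoose i) \<odot> mode M (mode V u (0 + int i) v) (m + n - int i) w)
      = (\<Sum>i<N. (of_int m gchoose i) \<odot> mode M (mode V u (int i) v) (m + n - int i) w)"
    by (subst Sum_any_bounded[of N]) (auto simp: N mode_zero_left[OF w])
  moreover have "Sum_any (\<lambda>i::nat. ((-1) ^ i * (of_int 0 gchoose i)) \<odot>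
            (mode M u (m + 0 - int i) (mode M v (n + int i) w)
             - ((-1) powi 0) \<odot> mode M v (n + 0 - int i) (mode M u (m + int i) w)))
      = mode M u m (mode M v n w) - mode M v n (mode M u m w)"
    by (subst Sum_any_bounded[of 1]) (auto simp: gbinomial_0_left)
  ultimately show ?thesis
    using borcherds[OF M u v w, of m 0 n] by (simp add: algebra_simps)
qed

end

lemma vir_in: "weak_module V M \<Longrightarrow> w \<in> carr M \<Longrightarrow> vir V M n w \<in> carr M"
  unfolding vir_def by (rule mode_closed) (auto simp: conf_in)

lemma vir_add: "weak_module V M \<Longrightarrow> w \<in> carr M \<Longrightarrow> w' \<in> carr M \<Longrightarrow> vir V M n (w + w') = vir V M n w + vir V M n w'"
  and vir_scale: "weak_module V M \<Longrightarrow> w \<in> carr M \<Longrightarrow> vir V M n (c \<odot> w) = c \<odot> vir V M n w"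
  and vir_zero: "weak_module V M \<Longrightarrow> vir V M n 0 = 0"
  unfolding vir_def by (auto simp: mode_add mode_scale mode_zero conf_in)

lemma vir_lin: "weak_module V M \<Longrightarrow> lin_on scale (carr M) (vir V M n)"
  unfolding vir_def by (rule mode_lin) (auto simp: conf_in)

lemma vac_create: "u \<in> carr V \<Longrightarrow> mode V u (-1) (vac V) = u"
  and vac_annihilate: "u \<in> carr V \<Longrightarrow> n \<ge> 0 \<Longrightarrow> mode V u n (vac V) = 0"
  using voa unfolding is_voa_def by auto

lemma virasoro_V: "\<exists>c. \<forall>w\<in>carr V. \<forall>m n.
        vir V V m (vir V V n w) - vir V V n (vir V V m w) =
        of_int (m - n) \<odot> vir V V (m + n) w +
        (if m + n = 0 then (of_int (m ^ 3 - m) / 12 * c) \<odot> w else 0)"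
  using voa unfolding is_voa_def by blast

lemma translation_V: "u \<in> carr V \<Longrightarrow> w \<in> carr V \<Longrightarrow> mode V (vir V V (-1) u) n w = (- of_int n) \<odot> mode V u (n - 1) w"
  using voa unfolding is_voa_def by blast

lemma vir_vac: "n \<ge> -1 \<Longrightarrow> vir V V n (vac V) = 0"
  unfolding vir_def by (rule vac_annihilate) (auto simp: conf_in)

lemma conf_vir: "vir V V (-2) (vac V) = conf V"
  unfolding vir_def using vac_create[OF conf_in] by simp

lemma conf_weight: "vir V V 0 (conf V) = 2 \<odot> conf V" and conf_primary: "vir V V 1 (conf V) = 0"
proof -
  obtain c where c: "\<And>w m n. w \<in> carr V \<Longrightarrow> vir V V m (vir V V n w) - vir V V n (vir V V m w) =
        of_int (m - n) \<odot> vir V V (m + n) w + (if m + n = 0 then (of_int (m ^ 3 - m) / 12 * c) \<odot> w else 0)"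
    using virasoro_V by meson
  show "vir V V 0 (conf V) = 2 \<odot> conf V"
    using c[OF vac_in, of 0 "-2"] by (simp add: conf_vir vir_vac vir_zero[OF V_module])
  show "vir V V 1 (conf V) = 0"
    using c[OF vac_in, of 1 "-2"] by (simp add: conf_vir vir_vac vir_zero[OF V_module])
qed

lemma mode_conf: "mode V (conf V) 0 = vir V V (-1)" "mode V (conf V) 1 = vir V V 0" "mode V (conf V) 2 = vir V V 1"
  by (simp_all add: vir_def fun_eq_iff)

lemma vir_minus1_V: "u \<in> carr V \<Longrightarrow> vir V V (-1) u = mode V u (-2) (vac V)"
  using translation_V[of u "vac V" "-1"] vac_create[of "vir V V (-1) u"] vir_in[OF V_module, of u "-1"] vac_in by simp

text \<open>Translation covariance on a module is the Borcherds identity with second vector the vacuum.\<close>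

lemma translation:
  assumes M: "weak_module V M" and u: "u \<in> carr V" and w: "w \<in> carr M"
  shows "mode M (vir V V (-1) u) n w = (- of_int n) \<odot> mode M u (n - 1) w"
proof -
  have c2: "((-1) ^ i * (of_int (-2) gchoose i)) = (of_nat (Suc i) :: complex)" for i
  proof -
    have "(of_int (-2) gchoose i :: complex) = (-1) ^ i * ((2 + of_nat i - 1) gchoose i)"
      using gbinomial_minus[of "2::complex" i] by simp
    also have "(2 + of_nat i - 1 :: complex) = of_nat (Suc i)" by simp
    finally show ?thesis
      by (simp only: binomial_gbinomial[symmetric] mult.assoc[symmetric] power_add[symmetric] mult_2[symmetric]) simp
  qed
  have cm: "mode M u k w \<in> carr M" for k by (rule mode_closed[OF M u w])
  have vm: "mode M (vac V) k x = (if k = -1 then x else 0)" if "x \<in> carr M" for x k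
    by (rule vac_mode[OF M that])
  define N where "N = nat \<bar>n\<bar> + 2"
  have "Sum_any (\<lambda>i::nat. (of_int 0 gchoose i) \<odot> mode M (mode V u (-2 + int i) (vac V)) (0 + n - int i) w)
      = mode M (vir V V (-1) u) n w"
    by (subst Sum_any_bounded[of 1]) (auto simp: gbinomial_0_left vir_minus1_V[OF u])
  also have "Sum_any (\<lambda>i::nat. (of_int 0 gchoose i) \<odot> mode M (mode V u (-2 + int i) (vac V)) (0 + n - int i) w)
      = Sum_any (\<lambda>i::nat. ((-1) ^ i * (of_int (-2) gchoose i)) \<odot>
            (mode M u (0 + -2 - int i) (mode M (vac V) (n + int i) w)
             - ((-1) powi (-2)) \<odot> mode M (vac V) (n + -2 - int i) (mode M u (0 + int i) w)))"
    by (rule borcherds[OF M u vac_in w])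
  also have "\<dots> = Sum_any (\<lambda>i::nat. if int i = \<bar>n - 1\<bar> - (if n < 0 then 2 else 0) then (- of_int n) \<odot> mode M u (n - 1) w else 0)"
  proof (rule Sum_any.cong)
    fix i :: nat
    show "((-1) ^ i * (of_int (-2) gchoose i)) \<odot>
            (mode M u (0 + -2 - int i) (mode M (vac V) (n + int i) w)
             - ((-1) powi (-2)) \<odot> mode M (vac V) (n + -2 - int i) (mode M u (0 + int i) w))
        = (if int i = \<bar>n - 1\<bar> - (if n < 0 then 2 else 0) then (- of_int n) \<odot> mode M u (n - 1) w else 0)"
      unfolding c2 vm[OF w] vm[OF cm]
    proof (cases "n < 0")
      case True
      then show "of_nat (Suc i) \<odot> (mode M u (0 + - 2 - int i) (if n + int i = - 1 then w else 0) -
          (- 1) powi - 2 \<odot> (if n + - 2 - int i = - 1 then mode M u (0 + int i) w else 0)) =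
         (if int i = \<bar>n - 1\<bar> - (if n < 0 then 2 else 0) then - of_int n \<odot> mode M u (n - 1) w else 0)"
      proof (cases "int i = - 1 - n")
        case eq: True
        then have n: "n = - 1 - int i" by simp
        show ?thesis unfolding n by (simp add: mode_zero[OF M u] scale_left_distrib)
      qed (auto simp: mode_zero[OF M u])
    next
      case False
      then show "of_nat (Suc i) \<odot> (mode M u (0 + - 2 - int i) (if n + int i = - 1 then w else 0) -
          (- 1) powi - 2 \<odot> (if n + - 2 - int i = - 1 then mode M u (0 + int i) w else 0)) =
         (if int i = \<bar>n - 1\<bar> - (if n < 0 then 2 else 0) then - of_int n \<odot> mode M u (n - 1) w else 0)"
      proof (cases "int i = n - 1")
        case eq: True
        then have n: "n = 1 + int i" by simp
        show ?thesis unfolding n by (simp add: mode_zero[OF M u] scale_left_distrib scale_left_diff_distrib)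
      qed (use False in \<open>auto simp: mode_zero[OF M u]\<close>)
    qed
  qed
  also have "\<dots> = (- of_int n) \<odot> mode M u (n - 1) w"
  proof (cases "n = 0")
    case True
    then show ?thesis by (simp add: Sum_any.expand_superset[of "{}"])
  next
    case False
    define i0 where "i0 = nat (\<bar>n - 1\<bar> - (if n < 0 then 2 else 0))"
    have "int i0 = \<bar>n - 1\<bar> - (if n < 0 then 2 else 0)" using False by (auto simp: i0_def)
    then have "(int i = \<bar>n - 1\<bar> - (if n < 0 then 2 else 0)) = (i = i0)" for i
      by (metis of_nat_eq_iff)
    then show ?thesis by simp
  qed
  finally show ?thesis ..
qed

lemma wspaceD: "w \<in> wspace V M \<mu> \<Longrightarrow> w \<in> carr M" "w \<in> wspace V M \<mu> \<Longrightarrow> vir V M 0 w = \<mu> \<odot> w"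
  by (auto simp: wspace_def)

lemma subspace_wspace: "weak_module V M \<Longrightarrow> subspace (wspace V M \<mu>)"
  unfolding wspace_def
  by (rule subspaceI)
     (auto simp: vir_add vir_scale vir_zero scale_right_distrib mult.commute
        intro: subspace_0 subspace_add subspace_scale carr_subspace)

text \<open>For \<open>m \<le> 2\<close> the binomial coefficients vanish beyond \<open>i = 2\<close>, which gives sums of fixed length.\<close>

lemma conf_commutator:
  assumes M: "weak_module V M" and v: "v \<in> carr V" and w: "w \<in> carr M"
    and m: "m \<in> {0, 1, 2}"
  shows "mode M (conf V) m (mode M v n w) = mode M v n (mode M (conf V) m w) +
    (\<Sum>i<3. (of_int m gchoose i) \<odot> mode M (mode V (conf V) (int i) v) (m + n - int i) w)"
proof -
  obtain N where N: "\<And>i. i \<ge> N \<Longrightarrow> mode V (conf V) (int i) v = 0"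
    using mode_truncation[OF V_module conf_in v] by auto
  define N' where "N' = max N 3"
  have "mode M (conf V) m (mode M v n w) = mode M v n (mode M (conf V) m w) +
    (\<Sum>i<N'. (of_int m gchoose i) \<odot> mode M (mode V (conf V) (int i) v) (m + n - int i) w)"
    by (rule commutator[OF M conf_in v w]) (use N N'_def in auto)
  also have "(\<Sum>i<N'. (of_int m gchoose i) \<odot> mode M (mode V (conf V) (int i) v) (m + n - int i) w) =
    (\<Sum>i<3. (of_int m gchoose i) \<odot> mode M (mode V (conf V) (int i) v) (m + n - int i) w)"
  proof (rule sum.mono_neutral_right)
    show "\<forall>i\<in>{..<N'} - {..<3}. (of_int m gchoose i) \<odot> mode M (mode V (conf V) (int i) v) (m + n - int i) w = 0"
    proof
      fix i assume i: "i \<in> {..<N'} - {..<3}"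
      define k where "k = nat m"
      have k: "of_int m = (of_nat k :: complex)" "k < i" using m i by (auto simp: k_def)
      have "(of_int m gchoose i :: complex) = 0"
        unfolding k(1) binomial_gbinomial[symmetric] using k(2) by (simp add: binomial_eq_0)
      then show "(of_int m gchoose i) \<odot> mode M (mode V (conf V) (int i) v) (m + n - int i) w = 0" by simp
    qed
  qed (auto simp: N'_def)
  finally show ?thesis .
qed

lemma gchoose_small:
  "((0::complex) gchoose 0) = 1" "((0::complex) gchoose 1) = 0" "((0::complex) gchoose 2) = 0"
  "((1::complex) gchoose 0) = 1" "((1::complex) gchoose 1) = 1" "((1::complex) gchoose 2) = 0"
  "((2::complex) gchoose 0) = 1" "((2::complex) gchoose 1) = 2" "((2::complex) gchoose 2) = 1"
  by (simp_all add: gbinomial_prod_rev numeral_2_eq_2)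

lemma vir_mode_minus1:
  assumes M: "weak_module V M" and v: "v \<in> carr V" and w: "w \<in> carr M"
  shows "vir V M (-1) (mode M v n w) = mode M v n (vir V M (-1) w) + (- of_int n) \<odot> mode M v (n - 1) w"
  using conf_commutator[OF M v w, of 0 n]
  by (simp add: vir_def[symmetric] numeral_3_eq_3 mode_conf gchoose_small[unfolded numeral_2_eq_2] translation[OF M v w] flip: vir_def)
     (simp add: vir_def)

lemma vir_mode_0:
  assumes M: "weak_module V M" and v: "v \<in> wspace V V c" and w: "w \<in> carr M"
  shows "vir V M 0 (mode M v n w) = mode M v n (vir V M 0 w) + (c - of_int n - 1) \<odot> mode M v n w"
proof -
  note v' = wspaceD[OF v]
  have "vir V M 0 (mode M v n w) = mode M v n (vir V M 0 w) +
      (mode M (vir V V (-1) v) (1 + n) w + mode M (vir V V 0 v) n w)"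
    using conf_commutator[OF M v'(1) w, of 1 n]
    by (simp add: vir_def[of V M] numeral_3_eq_3 gchoose_small[unfolded numeral_2_eq_2] mode_conf)
  also have "mode M (vir V V (-1) v) (1 + n) w + mode M (vir V V 0 v) n w = (c - of_int n - 1) \<odot> mode M v n w"
    by (simp add: translation[OF M v'(1) w] v'(2) mode_scale_left[OF M w v'(1)] algebra_simps)
  finally show ?thesis .
qed

lemma vir_mode_1:
  assumes M: "weak_module V M" and v: "v \<in> wspace V V c" "vir V V 1 v = 0" and w: "w \<in> carr M"
  shows "vir V M 1 (mode M v n w) = mode M v n (vir V M 1 w) + (2 * c - of_int n - 2) \<odot> mode M v (n + 1) w"
proof -
  note v' = wspaceD[OF v(1)]
  have "vir V M 1 (mode M v n w) = mode M v n (vir V M 1 w) +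
      (mode M (vir V V (-1) v) (2 + n) w + 2 \<odot> mode M (vir V V 0 v) (1 + n) w)"
    using conf_commutator[OF M v'(1) w, of 2 n] v(2)
    by (simp add: vir_def[of V M] numeral_3_eq_3 gchoose_small[unfolded numeral_2_eq_2 One_nat_def] mode_conf mode_zero_left[OF M w])
  also have "mode M (vir V V (-1) v) (2 + n) w + 2 \<odot> mode M (vir V V 0 v) (1 + n) w = (2 * c - of_int n - 2) \<odot> mode M v (n + 1) w"
    by (simp add: translation[OF M v'(1) w] v'(2) mode_scale_left[OF M w v'(1)] algebra_simps)
  finally show ?thesis .
qed

lemma conf_wspace: "conf V \<in> wspace V V 2"
  by (simp add: wspace_def conf_in conf_weight)

lemma vir_commute:
  assumes M: "weak_module V M" and w: "w \<in> carr M"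
  shows "vir V M 1 (vir V M (-1) w) = vir V M (-1) (vir V M 1 w) + 2 \<odot> vir V M 0 w"
    and "vir V M 0 (vir V M (-1) w) = vir V M (-1) (vir V M 0 w) + vir V M (-1) w"
    and "vir V M 0 (vir V M 1 w) = vir V M 1 (vir V M 0 w) - vir V M 1 w"
  using vir_mode_1[OF M conf_wspace conf_primary w, of 0] vir_mode_0[OF M conf_wspace w, of 0]
    vir_mode_0[OF M conf_wspace w, of 2]
  by (simp_all add: vir_def)

lemma mode_wspace:
  assumes M: "weak_module V M" and v: "v \<in> wspace V V c" and w: "w \<in> wspace V M \<mu>"
  shows "mode M v n w \<in> wspace V M (\<mu> + c - of_int n - 1)"
  using vir_mode_0[OF M v wspaceD(1)[OF w], of n] wspaceD[OF v] wspaceD[OF w]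
  by (simp add: wspace_def mode_closed[OF M] mode_scale[OF M] algebra_simps)

lemma vir_wspace:
  assumes M: "weak_module V M" and w: "w \<in> wspace V M \<mu>"
  shows "vir V M 1 w \<in> wspace V M (\<mu> - 1)" "vir V M (-1) w \<in> wspace V M (\<mu> + 1)"
  using mode_wspace[OF M conf_wspace w, of 2] mode_wspace[OF M conf_wspace w, of 0]
  by (simp_all add: vir_def add.commute)

text \<open>Applying \<open>L(0) - c\<^sub>b\<close> to a vanishing sum removes the summand with index \<open>b\<close>, which gives an induction.\<close>

lemma wspace_independent:
  assumes M: "weak_module V M" and "finite A" "inj_on c A" "\<And>a. a \<in> A \<Longrightarrow> x a \<in> wspace V M (c a)" "(\<Sum>a\<in>A. x a) = 0"
    and "a \<in> A"
  shows "x a = 0"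
  using assms(2-)
proof (induction A arbitrary: x a rule: finite_induct)
  case (insert b A)
  have xM: "x a \<in> carr M" if "a \<in> insert b A" for a using insert.prems(2)[OF that] by (simp add: wspace_def)
  have "vir V M 0 (\<Sum>a\<in>insert b A. x a) = (\<Sum>a\<in>insert b A. c a \<odot> x a)"
    unfolding vir_def using xM insert.prems(2)
    by (subst mode_sum[OF M conf_in]) (auto simp: wspace_def vir_def intro!: sum.cong)
  then have "(\<Sum>a\<in>insert b A. c a \<odot> x a) - c b \<odot> (\<Sum>a\<in>insert b A. x a) = 0"
    using insert.prems(3) by (simp add: vir_zero[OF M])
  then have "(\<Sum>a\<in>A. (c a - c b) \<odot> x a) = 0"
    using insert.hyps by (simp add: scale_sum_right scale_right_distrib scale_left_diff_distrib sum_subtractf)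
  moreover have "(c a - c b) \<odot> x a \<in> wspace V M (c a)" if "a \<in> A" for a
    by (rule subspace_scale[OF subspace_wspace[OF M]]) (use insert.prems(2) that in auto)
  ultimately have *: "(c a - c b) \<odot> x a = 0" if "a \<in> A" for a
    using insert.IH[of "\<lambda>a. (c a - c b) \<odot> x a" a] insert.prems(1) that by auto
  have xA: "x a = 0" if "a \<in> A" for a
  proof -
    have "c a \<noteq> c b" using insert.prems(1) insert.hyps(2) that by (auto simp: inj_on_def)
    then show ?thesis using *[OF that] by simp
  qed
  moreover have "x b = 0" using insert.prems(3) insert.hyps xA by simp
  ultimately show ?case using insert.prems(4) by auto
qed simp

end

section \<open>Matrix elements of products of fields\<close>

definition config :: "nat set \<Rightarrow> (nat \<Rightarrow> complex) set" where
  "config I = {x. inj_on x I \<and> (\<forall>i\<in>I. x i \<noteq> 0)}"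

lemma radial_config: "radially_ordered I \<subseteq> config I"
proof
  fix x assume x: "x \<in> radially_ordered I"
  have "x i \<noteq> x j" if "i \<in> I" "j \<in> I" "i \<noteq> j" for i j
    using x that by (cases i j rule: linorder_cases) (force simp: radially_ordered_def)+
  with x show "x \<in> config I" by (auto simp: config_def radially_ordered_def inj_on_def)
qed

definition vprod :: "('u, 'x) vmod_scheme \<Rightarrow> nat list \<Rightarrow> (nat \<Rightarrow> 'u) \<Rightarrow> (nat \<Rightarrow> int) \<Rightarrow> 'u \<Rightarrow> 'u" where
  "vprod M js v k w = foldr (\<lambda>i. mode M (v i) (k i)) js w"

lemma vprod_simps [simp]:
  "vprod M [] v k w = w" "vprod M (i # js) v k w = mode M (v i) (k i) (vprod M js v k w)"
  by (simp_all add: vprod_def)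

lemma vprod_cong:
  "(\<And>i. i \<in> set js \<Longrightarrow> v i = v' i) \<Longrightarrow> (\<And>i. i \<in> set js \<Longrightarrow> k i = k' i) \<Longrightarrow> vprod M js v k w = vprod M js v' k' w"
  by (induction js) auto

definition laurent_monom :: "nat set \<Rightarrow> (nat \<Rightarrow> complex) \<Rightarrow> (nat \<Rightarrow> int) \<Rightarrow> complex" where
  "laurent_monom I x k = (\<Prod>i\<in>I. x i powi (- k i - 1))"

lemma laurent_monom_insert: "finite I \<Longrightarrow> i \<notin> I \<Longrightarrow> laurent_monom (insert i I) x (\<kappa>(i := a)) = x i powi (- a - 1) * laurent_monom I x \<kappa>"
proof -
  assume I: "finite I" "i \<notin> I"
  have "(\<Prod>j\<in>I. x j powi (- (\<kappa>(i := a)) j - 1)) = laurent_monom I x \<kappa>"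
    unfolding laurent_monom_def by (rule prod.cong) (use I in auto)
  with I show ?thesis by (simp add: laurent_monom_def del: fun_upd_apply) (simp add: laurent_monom_def)
qed

text \<open>Moving a mode past the field at \<open>x\<^sub>l\<close> shifts the mode index of that field; the monomial compensates by a power of
  \<open>x\<^sub>l\<close>.\<close>

lemma laurent_monom_shift:
  assumes "finite I" "l \<in> I" "x l \<noteq> 0"
  shows "x l powi d * laurent_monom I x (\<kappa>(l := \<kappa> l + d)) = laurent_monom I x \<kappa>"
proof -
  have I: "I = insert l (I - {l})" using assms(2) by auto
  have "laurent_monom I x (\<kappa>(l := \<kappa> l + d)) = x l powi (- (\<kappa> l + d) - 1) * laurent_monom (I - {l}) x \<kappa>"
    by (subst I, subst laurent_monom_insert) (use assms in auto)
  moreover have "laurent_monom I x \<kappa> = x l powi (- \<kappa> l - 1) * laurent_monom (I - {l}) x \<kappa>"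
    using laurent_monom_insert[of "I - {l}" l x \<kappa> "\<kappa> l"] I assms(1) by simp
  moreover have "x l powi d * x l powi (- (\<kappa> l + d) - 1) = x l powi (- \<kappa> l - 1)"
    using assms(3) by (simp flip: power_int_add)
  ultimately show ?thesis by (metis mult.assoc)
qed

context voa_space
begin

context
  fixes M :: "('u, 'y) vmod_scheme"
  assumes M: "weak_module V M"
begin

lemma vprod_closed: "(\<And>l. l \<in> set js \<Longrightarrow> v l \<in> carr V) \<Longrightarrow> w \<in> carr M \<Longrightarrow> vprod M js v k w \<in> carr M"
  by (induction js) (auto intro: mode_closed[OF M])

lemma vprod_add: "(\<And>l. l \<in> set js \<Longrightarrow> v l \<in> carr V) \<Longrightarrow> w \<in> carr M \<Longrightarrow> w' \<in> carr M \<Longrightarrow>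
    vprod M js v k (w + w') = vprod M js v k w + vprod M js v k w'"
  by (induction js) (auto simp: mode_add[OF M] vprod_closed)

lemma vprod_scale: "(\<And>l. l \<in> set js \<Longrightarrow> v l \<in> carr V) \<Longrightarrow> w \<in> carr M \<Longrightarrow>
    vprod M js v k (c \<odot> w) = c \<odot> vprod M js v k w"
  by (induction js) (auto simp: mode_scale[OF M] vprod_closed)

lemma vprod_zero: "(\<And>l. l \<in> set js \<Longrightarrow> v l \<in> carr V) \<Longrightarrow> vprod M js v k 0 = 0"
  by (induction js) (auto simp: mode_zero[OF M])

lemma vprod_lin: "(\<And>l. l \<in> set js \<Longrightarrow> v l \<in> carr V) \<Longrightarrow> lin_on scale (carr M) (vprod M js v k)"
  by (auto simp: lin_on_def vprod_add vprod_scale)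

lemma vprod_upd_add:
  assumes "distinct js" "l \<in> set js" "\<And>l. l \<in> set js \<Longrightarrow> v l \<in> carr V" "w \<in> carr M" "a \<in> carr V" "b \<in> carr V"
  shows "vprod M js (v(l := a + b)) k w = vprod M js (v(l := a)) k w + vprod M js (v(l := b)) k w"
  using assms
proof (induction js)
  case (Cons i js)
  show ?case
  proof (cases "l = i")
    case True
    with Cons.prems have "vprod M js (v(l := c)) k w = vprod M js v k w" for c
      by (intro vprod_cong) auto
    moreover have "vprod M js v k w \<in> carr M" by (rule vprod_closed) (use Cons.prems in auto)
    ultimately show ?thesis using True Cons.prems by (simp add: mode_add_left[OF M] fun_upd_same del: fun_upd_apply)
  next
    case False
    then have "vprod M js (v(l := c)) k w \<in> carr M" if "c \<in> carr V" for c
      by (intro vprod_closed) (use Cons.prems that in auto)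
    with False show ?thesis using Cons by (simp del: fun_upd_apply add: fun_upd_other mode_add[OF M])
  qed
qed simp

lemma vprod_upd_scale:
  assumes "distinct js" "l \<in> set js" "\<And>l. l \<in> set js \<Longrightarrow> v l \<in> carr V" "w \<in> carr M" "a \<in> carr V"
  shows "vprod M js (v(l := c \<odot> a)) k w = c \<odot> vprod M js (v(l := a)) k w"
  using assms
proof (induction js)
  case (Cons i js)
  show ?case
  proof (cases "l = i")
    case True
    with Cons.prems have "vprod M js (v(l := c)) k w = vprod M js v k w" for c
      by (intro vprod_cong) auto
    moreover have "vprod M js v k w \<in> carr M" by (rule vprod_closed) (use Cons.prems in auto)
    ultimately show ?thesis using True Cons.prems by (simp add: mode_scale_left[OF M] fun_upd_same del: fun_upd_apply)
  next
    case False
    then have "vprod M js (v(l := a)) k w \<in> carr M"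
      by (intro vprod_closed) (use Cons.prems in auto)
    with False show ?thesis using Cons by (simp del: fun_upd_apply add: fun_upd_other mode_scale[OF M])
  qed
qed simp

text \<open>Iterated commutator formula: a mode acts on a product of fields as a derivation.\<close>

lemma commutator_vprod:
  assumes "distinct js" "u \<in> carr V" "\<And>l. l \<in> set js \<Longrightarrow> v l \<in> carr V" "w \<in> carr M"
    and "\<And>l i. l \<in> set js \<Longrightarrow> i \<ge> N \<Longrightarrow> mode V u (int i) (v l) = 0"
  shows "mode M u m (vprod M js v k w) = vprod M js v k (mode M u m w) +
    (\<Sum>l\<in>set js. \<Sum>j<N. (of_int m gchoose j) \<odot>
       vprod M js (v(l := mode V u (int j) (v l))) (k(l := k l + (m - int j))) w)"
  using assms
proof (induction js)
  case (Cons i js)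
  let ?X = "vprod M js v k w"
  let ?Y = "\<lambda>l j. vprod M js (v(l := mode V u (int j) (v l))) (k(l := k l + (m - int j))) w"
  have uv: "mode V u j (v l) \<in> carr V" if "l \<in> set (i # js)" for l j
    by (rule mode_closed[OF V_module]) (use Cons.prems that in auto)
  have X: "?X \<in> carr M" by (rule vprod_closed) (use Cons.prems in auto)
  have X': "vprod M js v k (mode M u m w) \<in> carr M"
    by (rule vprod_closed) (use Cons.prems mode_closed[OF M] in auto)
  have Y: "?Y l j \<in> carr M" if "l \<in> set js" for l j
    by (rule vprod_closed) (use Cons.prems uv that in auto)
  have "mode M u m (mode M (v i) (k i) ?X) = mode M (v i) (k i) (mode M u m ?X) +
      (\<Sum>j<N. (of_int m gchoose j) \<odot> mode M (mode V u (int j) (v i)) (m + k i - int j) ?X)"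
    by (rule commutator[OF M]) (use Cons.prems X in auto)
  also have "mode M u m ?X = vprod M js v k (mode M u m w) + (\<Sum>l\<in>set js. \<Sum>j<N. (of_int m gchoose j) \<odot> ?Y l j)"
    by (rule Cons.IH) (use Cons.prems in auto)
  also have "mode M (v i) (k i) \<dots> = mode M (v i) (k i) (vprod M js v k (mode M u m w)) +
      (\<Sum>l\<in>set js. \<Sum>j<N. (of_int m gchoose j) \<odot> mode M (v i) (k i) (?Y l j))"
  proof -
    let ?Z = "\<lambda>l. \<Sum>j<N. (of_int m gchoose j) \<odot> ?Y l j"
    have vi: "v i \<in> carr V" using Cons.prems by simp
    have Z: "?Z l \<in> carr M" if "l \<in> set js" for l
      by (intro subspace_sum subspace_scale carr_subspace[OF M] Y that)
    have "mode M (v i) (k i) (?Z l) = (\<Sum>j<N. (of_int m gchoose j) \<odot> mode M (v i) (k i) (?Y l j))" if "l \<in> set js" for l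
      using Y[OF that] by (subst mode_sum[OF M vi]) (auto simp: mode_scale[OF M vi] intro: subspace_scale carr_subspace[OF M])
    moreover have "(\<Sum>l\<in>set js. ?Z l) \<in> carr M" by (intro subspace_sum carr_subspace[OF M] Z)
    ultimately show ?thesis using X' Z by (simp add: mode_add[OF M vi] mode_sum[OF M vi])
  qed
  also have "(\<Sum>l\<in>set js. \<Sum>j<N. (of_int m gchoose j) \<odot> mode M (v i) (k i) (?Y l j)) =
     (\<Sum>l\<in>set js. \<Sum>j<N. (of_int m gchoose j) \<odot>
       vprod M (i # js) (v(l := mode V u (int j) (v l))) (k(l := k l + (m - int j))) w)"
    using Cons.prems(1) by (intro sum.cong refl) auto
  also have "(\<Sum>j<N. (of_int m gchoose j) \<odot> mode M (mode V u (int j) (v i)) (m + k i - int j) ?X) =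
     (\<Sum>j<N. (of_int m gchoose j) \<odot> vprod M (i # js) (v(i := mode V u (int j) (v i))) (k(i := k i + (m - int j))) w)"
  proof (intro sum.cong refl)
    fix j
    have "vprod M js (v(i := mode V u (int j) (v i))) (k(i := k i + (m - int j))) w = ?X"
      by (rule vprod_cong) (use Cons.prems(1) in auto)
    then show "(of_int m gchoose j) \<odot> mode M (mode V u (int j) (v i)) (m + k i - int j) ?X =
      (of_int m gchoose j) \<odot> vprod M (i # js) (v(i := mode V u (int j) (v i))) (k(i := k i + (m - int j))) w"
      by (simp add: algebra_simps)
  qed
  finally show ?case using Cons.prems(1) by (simp add: add_ac fun_upd_same del: fun_upd_apply)
qed simp

end

end

locale graded_module = voa_space scale V
  for scale :: "complex \<Rightarrow> 'u::ab_group_add \<Rightarrow> 'u" (infixr \<open>\<odot>\<close> 75) and V :: "'u voa" +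
  fixes M :: "'u vmod" and h :: complex
  assumes M: "weak_module V M" and graded: "carr M = span (\<Union>n::nat. wspace V M (h + of_nat n))"
begin

abbreviation lev :: "nat \<Rightarrow> 'u set" where "lev n \<equiv> wspace V M (h + of_nat n)"

lemma level_decomposition:
  assumes "w \<in> carr M"
  shows "\<exists>N g. (\<forall>n. g n \<in> lev n) \<and> w = (\<Sum>n<N::nat. g n)"
  using assms unfolding graded
proof (induction rule: span_induct_alt)
  case base
  show ?case by (intro exI[of _ 0] exI[of _ "\<lambda>_. 0"]) (auto intro: subspace_0 subspace_wspace[OF M])
next
  case (step c x y)
  then obtain N g where g: "\<And>n. g n \<in> lev n" "y = (\<Sum>n<N. g n)" by blast
  from step obtain m where m: "x \<in> lev m" by blast
  define g' where "g' = (\<lambda>n. (if n < N then g n else 0) + (if n = m then c \<odot> x else 0))"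
  have "g' n \<in> lev n" for n
    using g(1) m by (auto simp: g'_def intro!: subspace_add subspace_scale subspace_0 subspace_wspace[OF M])
  moreover have "c \<odot> x + y = (\<Sum>n<N + Suc m. g' n)"
  proof -
    have "(\<Sum>n<N + Suc m. g' n) = (\<Sum>n<N + Suc m. if n < N then g n else 0) + (\<Sum>n<N + Suc m. if n = m then c \<odot> x else 0)"
      unfolding g'_def by (rule sum.distrib)
    also have "(\<Sum>n<N + Suc m. if n < N then g n else 0) = (\<Sum>n<N. g n)"
      by (rule sum.mono_neutral_cong_right) auto
    also have "(\<Sum>n<N + Suc m. if n = m then c \<odot> x else 0) = c \<odot> x" by (simp add: sum.delta)
    finally show ?thesis using g(2) by simp
  qed
  ultimately show ?case by blast
qed

text \<open>An eigenvector of any other weight would be linearly independent of its own components in the levels.\<close>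

lemma wspace_trivial:
  assumes "\<And>n::nat. \<mu> \<noteq> h + of_nat n" shows "wspace V M \<mu> = {0}"
proof -
  have "w = 0" if w: "w \<in> wspace V M \<mu>" for w
  proof -
    obtain N g where g: "\<And>n. g n \<in> lev n" "w = (\<Sum>n<N::nat. g n)"
      using level_decomposition[of w] w by (auto simp: wspace_def)
    define A where "A = insert None (Some ` {..<N})"
    define x where "x = (\<lambda>a. case a of None \<Rightarrow> (-1) \<odot> w | Some n \<Rightarrow> g n)"
    define c where "c = (\<lambda>a::nat option. case a of None \<Rightarrow> \<mu> | Some n \<Rightarrow> h + of_nat n)"
    have "x None = 0"
    proof (rule wspace_independent[OF M, of A c x])
      show "inj_on c A" using assms by (auto simp: c_def A_def inj_on_def split: option.splits)
      show "x a \<in> wspace V M (c a)" if "a \<in> A" for a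
        using g(1) subspace_scale[OF subspace_wspace[OF M] w, of "-1"] by (auto simp: x_def c_def split: option.splits)
      show "(\<Sum>a\<in>A. x a) = 0"
        unfolding A_def by (subst sum.insert) (auto simp: x_def sum.reindex g(2))
    qed (auto simp: A_def)
    then show "w = 0" by (simp add: x_def)
  qed
  then show ?thesis using subspace_0[OF subspace_wspace[OF M]] by auto
qed

lemma V_induct [consumes 1, case_names hom zero add scale]:
  assumes "v \<in> carr V"
    and "\<And>c v. v \<in> wspace V V (of_nat c) \<Longrightarrow> P v" "P 0"
    and "\<And>v w. v \<in> carr V \<Longrightarrow> w \<in> carr V \<Longrightarrow> P v \<Longrightarrow> P w \<Longrightarrow> P (v + w)"
    and "\<And>c v. v \<in> carr V \<Longrightarrow> P v \<Longrightarrow> P (c \<odot> v)"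
  shows "P v"
proof -
  have V: "carr V = span (\<Union>n::nat. wspace V V (of_nat n))" using cft by (simp add: strong_CFT_type_def)
  note sub = carr_subspace[OF V_module]
  have "v \<in> carr V \<and> P v"
    using assms(1) unfolding V
  proof (induction rule: span_induct_alt)
    case base
    then show ?case using assms(3) subspace_0[OF sub] by (simp add: V)
  next
    case (step c x y)
    then obtain n where n: "x \<in> wspace V V (of_nat n)" by blast
    then have "x \<in> carr V" by (simp add: wspace_def)
    with step assms(2)[OF n] show ?case
      using assms(4)[of "c \<odot> x" y] assms(5)[of x c] subspace_add[OF sub] subspace_scale[OF sub]
      by (simp add: V)
  qed
  then show ?thesis ..
qed

subsection \<open>Functionals on the restricted dual\<close>

text \<open>Functionals vanishing on all high levels; they take the place of vectors of the contragredient
  module, so that no adjoint of a mode has to be computed.\<close>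

definition dualvec :: "('u \<Rightarrow> complex) \<Rightarrow> bool" where
  "dualvec \<theta> \<longleftrightarrow> lin_on (*) (carr M) \<theta> \<and> (\<exists>N. \<forall>n\<ge>N. \<forall>w\<in>lev n. \<theta> w = 0)"

lemma dualvec_lin: "dualvec \<theta> \<Longrightarrow> lin_on (*) (carr M) \<theta>" by (simp add: dualvec_def)

lemma dualvec_add: "dualvec \<theta> \<Longrightarrow> x \<in> carr M \<Longrightarrow> y \<in> carr M \<Longrightarrow> \<theta> (x + y) = \<theta> x + \<theta> y"
  and dualvec_scale: "dualvec \<theta> \<Longrightarrow> x \<in> carr M \<Longrightarrow> \<theta> (c \<odot> x) = c * \<theta> x"
  using lin_onD[OF dualvec_lin] by auto

lemma dualvec_zero: "dualvec \<theta> \<Longrightarrow> \<theta> 0 = 0"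
  by (rule lin_on_complex_zero[OF dualvec_lin carr_subspace[OF M]])

lemma dualvec_sum: "dualvec \<theta> \<Longrightarrow> (\<And>a. a \<in> A \<Longrightarrow> g a \<in> carr M) \<Longrightarrow> \<theta> (\<Sum>a\<in>A. g a) = (\<Sum>a\<in>A. \<theta> (g a))"
  by (rule lin_on_complex_sum[OF dualvec_lin carr_subspace[OF M]])

text \<open>The mode \<open>v(-1-a)\<close> of a field of weight \<open>c\<close> raises the level by \<open>c + a\<close>, hence leaves the finitely many levels that
  the functional sees.\<close>

lemma dualvec_truncation:
  assumes \<theta>: "dualvec \<theta>" and v: "v \<in> carr V"
  shows "\<exists>K. \<forall>a\<ge>K. \<forall>w\<in>carr M. \<theta> (mode M v (- 1 - int a) w) = 0"
  using v
proof (induction rule: V_induct)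
  case (hom c v)
  have v: "v \<in> carr V" using hom by (simp add: wspace_def)
  obtain N where N: "\<And>n w. n \<ge> N \<Longrightarrow> w \<in> lev n \<Longrightarrow> \<theta> w = 0" using \<theta> by (auto simp: dualvec_def)
  have "\<theta> (mode M v (- 1 - int a) w) = 0" if a: "a \<ge> N" and w: "w \<in> carr M" for a w
  proof -
    obtain L g where g: "\<And>n. g n \<in> lev n" "w = (\<Sum>n<L::nat. g n)"
      using level_decomposition[OF w] by blast
    have "\<theta> (mode M v (- 1 - int a) (g n)) = 0" for n
    proof (rule N)
      have "mode M v (- 1 - int a) (g n) \<in> wspace V M ((h + of_nat n) + of_nat c - of_int (- 1 - int a) - 1)"
        by (rule mode_wspace[OF M hom g(1)])
      also have "(h + of_nat n) + of_nat c - of_int (- 1 - int a) - 1 = h + of_nat (n + c + a)" by simp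
      finally show "mode M v (- 1 - int a) (g n) \<in> lev (n + c + a)" .
    qed (use a in auto)
    moreover have "g n \<in> carr M" for n using g(1) by (simp add: wspace_def)
    ultimately show ?thesis unfolding g(2)
      by (simp add: mode_sum[OF M v] dualvec_sum[OF \<theta>] mode_closed[OF M v])
  qed
  then show ?case by blast
next
  case zero
  show ?case by (simp add: mode_zero_left[OF M] dualvec_zero[OF \<theta>])
next
  case (add v w)
  then obtain K K' where "\<forall>a\<ge>K. \<forall>x\<in>carr M. \<theta> (mode M v (- 1 - int a) x) = 0"
    "\<forall>a\<ge>K'. \<forall>x\<in>carr M. \<theta> (mode M w (- 1 - int a) x) = 0" by blast
  with add(1,2) show ?case
    by (intro exI[of _ "max K K'"]) (simp add: mode_add_left[OF M] dualvec_add[OF \<theta>] mode_closed[OF M])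
next
  case (scale c v)
  then show ?case by (auto simp: mode_scale_left[OF M] dualvec_scale[OF \<theta>] mode_closed[OF M])
qed

lemma dualvec_mode:
  assumes \<theta>: "dualvec \<theta>" and v: "v \<in> carr V"
  shows "dualvec (\<lambda>w. \<theta> (mode M v k w))"
proof -
  have "lin_on (*) (carr M) (\<lambda>w. \<theta> (mode M v k w))"
    by (rule lin_on_comp[OF dualvec_lin[OF \<theta>] mode_lin[OF M v]]) (rule mode_closed[OF M v])
  moreover have "\<exists>N. \<forall>n\<ge>N. \<forall>w\<in>lev n. \<theta> (mode M v k w) = 0"
    using v
  proof (induction rule: V_induct)
    case (hom c v)
    obtain N where N: "\<And>n w. n \<ge> N \<Longrightarrow> w \<in> lev n \<Longrightarrow> \<theta> w = 0" using \<theta> by (auto simp: dualvec_def)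
    have "\<theta> (mode M v k w) = 0" if n: "n \<ge> N + nat \<bar>k\<bar> + 1" and w: "w \<in> lev n" for n w
    proof (rule N)
      have "int n + int c - k - 1 \<ge> 0" using n by simp
      then obtain d where d: "int n + int c - k - 1 = int d" by (rule nonneg_int_cases)
      have "mode M v k w \<in> wspace V M ((h + of_nat n) + of_nat c - of_int k - 1)"
        by (rule mode_wspace[OF M hom w])
      also have "(h + of_nat n) + of_nat c - of_int k - 1 = h + of_int (int n + int c - k - 1)" by simp
      also have "\<dots> = h + of_nat d" unfolding d by simp
      finally show "mode M v k w \<in> lev (nat (int n + int c - k - 1))" unfolding d by simp
    qed (use n in auto)
    then show ?case by blast
  next
    case zero
    show ?case by (simp add: wspaceD mode_zero_left[OF M] dualvec_zero[OF \<theta>])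
  next
    case (add v w)
    then obtain K K' where "\<forall>a\<ge>K. \<forall>x\<in>lev a. \<theta> (mode M v k x) = 0"
      "\<forall>a\<ge>K'. \<forall>x\<in>lev a. \<theta> (mode M w k x) = 0" by blast
    with add(1,2) show ?case
      by (intro exI[of _ "max K K'"]) (auto simp: wspaceD mode_add_left[OF M] dualvec_add[OF \<theta>] mode_closed[OF M])
  next
    case (scale c v)
    then show ?case by (auto simp: wspaceD mode_scale_left[OF M] dualvec_scale[OF \<theta>] mode_closed[OF M])
  qed
  ultimately show ?thesis by (simp add: dualvec_def)
qed

end

section \<open>Rational correlators of fields on one module\<close>

context graded_module
begin

text \<open>The correlator \<open>\<theta>(Y(v\<^sub>i,x\<^sub>i) \<dots> \<psi>)\<close> as a rational function. The creation modes of the first field act on the functional,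
  the annihilation modes are commuted to \<open>\<psi>\<close>, and the commutators with the remaining fields produce the poles at
  \<open>x\<^sub>i = x\<^sub>l\<close>. All three sums are finite under the hypotheses collected in \<open>admissible\<close> below.\<close>

primrec corr :: "nat list \<Rightarrow> ('u \<Rightarrow> complex) \<Rightarrow> (nat \<Rightarrow> 'u) \<Rightarrow> (nat \<Rightarrow> complex) \<Rightarrow> 'u \<Rightarrow> complex" where
  "corr [] \<theta> v x \<psi> = \<theta> \<psi>"
| "corr (i # js) \<theta> v x \<psi> =
     Sum_any (\<lambda>a. x i ^ a * corr js (\<lambda>w. \<theta> (mode M (v i) (- 1 - int a) w)) v x \<psi>) +
     Sum_any (\<lambda>k. (1 / x i) ^ Suc k * corr js \<theta> v x (mode M (v i) (int k) \<psi>)) +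
     (\<Sum>l\<in>set js. Sum_any (\<lambda>j. (1 / (x i - x l)) ^ Suc j * corr js \<theta> (v(l := mode V (v i) (int j) (v l))) x \<psi>))"

definition admissible :: "nat list \<Rightarrow> ('u \<Rightarrow> complex) \<Rightarrow> (nat \<Rightarrow> 'u) \<Rightarrow> 'u \<Rightarrow> bool" where
  "admissible js \<theta> v \<psi> \<longleftrightarrow> dualvec \<theta> \<and> (\<forall>l\<in>set js. v l \<in> carr V) \<and> \<psi> \<in> carr M"

lemma admissible_tail:
  assumes "admissible (i # js) \<theta> v \<psi>"
  shows "admissible js \<theta> v \<psi>" "admissible js (\<lambda>w. \<theta> (mode M (v i) k w)) v \<psi>"
    "admissible js \<theta> v (mode M (v i) k \<psi>)" "l \<in> set js \<Longrightarrow> admissible js \<theta> (v(l := mode V (v i) k (v l))) \<psi>"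
  using assms by (auto simp: admissible_def intro: dualvec_mode mode_closed[OF M] mode_closed[OF V_module])

lemma corr_0_functional:
  assumes "\<And>w. w \<in> carr M \<Longrightarrow> \<theta> w = 0" "\<And>l. l \<in> set js \<Longrightarrow> v l \<in> carr V" "\<psi> \<in> carr M"
  shows "corr js \<theta> v x \<psi> = 0"
  using assms
proof (induction js arbitrary: \<theta> v \<psi>)
  case (Cons i js)
  have "corr js (\<lambda>w. \<theta> (mode M (v i) k w)) v x \<psi> = 0" for k
    by (rule Cons.IH) (use Cons.prems mode_closed[OF M] in auto)
  moreover have "corr js \<theta> v x (mode M (v i) k \<psi>) = 0" for k
    by (rule Cons.IH) (use Cons.prems mode_closed[OF M] in auto)
  moreover have "corr js \<theta> (v(l := mode V (v i) k (v l))) x \<psi> = 0" if "l \<in> set js" for l k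
    by (rule Cons.IH) (use Cons.prems mode_closed[OF V_module] that in auto)
  ultimately show ?case by simp
qed simp

lemma corr_0_vector:
  assumes "\<theta> 0 = 0" "\<And>l. l \<in> set js \<Longrightarrow> v l \<in> carr V"
  shows "corr js \<theta> v x 0 = 0"
  using assms
proof (induction js arbitrary: \<theta> v)
  case (Cons i js)
  have z: "mode M (v i) k 0 = 0" for k by (rule mode_zero[OF M]) (use Cons.prems in auto)
  have "corr js (\<lambda>w. \<theta> (mode M (v i) k w)) v x 0 = 0" for k
    by (rule Cons.IH) (use Cons.prems z in auto)
  moreover have "corr js \<theta> v x 0 = 0" by (rule Cons.IH) (use Cons.prems in auto)
  moreover have "corr js \<theta> (v(l := mode V (v i) k (v l))) x 0 = 0" if "l \<in> set js" for l k
    by (rule Cons.IH) (use Cons.prems mode_closed[OF V_module] that in auto)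
  ultimately show ?case by (simp add: z)
qed simp

lemma corr_0_field:
  assumes "\<theta> 0 = 0" "\<And>l. l \<in> set js \<Longrightarrow> v l \<in> carr V" "\<psi> \<in> carr M" "l \<in> set js" "v l = 0" "distinct js"
  shows "corr js \<theta> v x \<psi> = 0"
  using assms
proof (induction js arbitrary: \<theta> v \<psi> l)
  case (Cons i js)
  have modes: "mode M (v i) k w \<in> carr M" if "w \<in> carr M" for k w
    by (rule mode_closed[OF M]) (use Cons.prems that in auto)
  have z: "mode M (v i) k 0 = 0" for k by (rule mode_zero[OF M]) (use Cons.prems in auto)
  show ?case
  proof (cases "l = i")
    case True
    have zl: "mode M 0 k w = 0" if "w \<in> carr M" for k w by (rule mode_zero_left[OF M that])
    have "corr js (\<lambda>w. \<theta> (mode M (v i) k w)) v x \<psi> = 0" for k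
      by (rule corr_0_functional) (use Cons.prems True zl in auto)
    moreover have "corr js \<theta> v x (mode M (v i) k \<psi>) = 0" for k
      using Cons.prems True zl by (simp add: corr_0_vector)
    moreover have "corr js \<theta> (v(l' := mode V (v i) k (v l'))) x \<psi> = 0" if "l' \<in> set js" for l' k
      by (rule Cons.IH[OF _ _ _ that]) (use Cons.prems True that mode_zero_left[OF V_module] subspace_0[OF carr_subspace[OF V_module]] in auto)
    ultimately show ?thesis by simp
  next
    case False
    then have l: "l \<in> set js" using Cons.prems by auto
    have "corr js (\<lambda>w. \<theta> (mode M (v i) k w)) v x \<psi> = 0" for k
      by (rule Cons.IH[OF _ _ _ l]) (use Cons.prems l z in auto)
    moreover have "corr js \<theta> v x (mode M (v i) k \<psi>) = 0" for k
      by (rule Cons.IH[OF _ _ _ l]) (use Cons.prems l modes in auto)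
    moreover have "corr js \<theta> (v(l' := mode V (v i) k (v l'))) x \<psi> = 0" if "l' \<in> set js" for l' k
      by (rule Cons.IH[OF _ _ _ l])
         (use Cons.prems l that mode_closed[OF V_module] mode_zero[OF V_module] in auto)
    ultimately show ?thesis by simp
  qed
qed simp

text \<open>A common bound \<open>K\<close> for the supports of the three sums in the recursion.\<close>

definition mode_bound :: "nat \<Rightarrow> ('u \<Rightarrow> complex) \<Rightarrow> 'u \<Rightarrow> (nat \<Rightarrow> 'u) \<Rightarrow> nat list \<Rightarrow> 'u \<Rightarrow> bool" where
  "mode_bound K \<theta> u v js \<psi> \<longleftrightarrow>
     (\<forall>a\<ge>K. \<forall>w\<in>carr M. \<theta> (mode M u (- 1 - int a) w) = 0) \<and>
     (\<forall>k\<ge>K. mode M u (int k) \<psi> = 0) \<and> (\<forall>l\<in>set js. \<forall>j\<ge>K. mode V u (int j) (v l) = 0)"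

lemma mode_bound_mono: "mode_bound K \<theta> u v js \<psi> \<Longrightarrow> K \<le> K' \<Longrightarrow> mode_bound K' \<theta> u v js \<psi>"
  by (auto simp: mode_bound_def)

lemma mode_bound_exists:
  assumes "dualvec \<theta>" "u \<in> carr V" "\<And>l. l \<in> set js \<Longrightarrow> v l \<in> carr V" "\<psi> \<in> carr M"
  shows "\<exists>K. mode_bound K \<theta> u v js \<psi>"
proof -
  obtain K1 where 1: "\<forall>a\<ge>K1. \<forall>w\<in>carr M. \<theta> (mode M u (- 1 - int a) w) = 0"
    using dualvec_truncation[OF assms(1,2)] by blast
  obtain K2 where 2: "\<forall>k\<ge>K2. mode M u (int k) \<psi> = 0" using mode_truncation[OF M assms(2,4)] by blast
  have "\<forall>l\<in>set js. \<exists>K. \<forall>j\<ge>K. mode V u (int j) (v l) = 0"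
    using mode_truncation[OF V_module assms(2)] assms(3) by blast
  then obtain K3 where 3: "\<And>l j. l \<in> set js \<Longrightarrow> j \<ge> K3 l \<Longrightarrow> mode V u (int j) (v l) = 0" by metis
  have "K3 l \<le> (\<Sum>l\<in>set js. K3 l)" if "l \<in> set js" for l by (rule member_le_sum) (use that in auto)
  then have "mode_bound (K1 + K2 + (\<Sum>l\<in>set js. K3 l)) \<theta> u v js \<psi>"
    using 1 2 3 unfolding mode_bound_def by (meson add_leE le_trans)
  then show ?thesis ..
qed

lemma corr_Cons:
  assumes adm: "admissible (i # js) \<theta> v \<psi>" and "distinct (i # js)" and K: "mode_bound K \<theta> (v i) v js \<psi>"
  shows "corr (i # js) \<theta> v x \<psi> =
     (\<Sum>a<K. x i ^ a * corr js (\<lambda>w. \<theta> (mode M (v i) (- 1 - int a) w)) v x \<psi>) +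
     (\<Sum>k<K. (1 / x i) ^ Suc k * corr js \<theta> v x (mode M (v i) (int k) \<psi>)) +
     (\<Sum>l\<in>set js. \<Sum>j<K. (1 / (x i - x l)) ^ Suc j * corr js \<theta> (v(l := mode V (v i) (int j) (v l))) x \<psi>)"
proof -
  have \<theta>0: "\<theta> 0 = 0" and v: "\<And>l. l \<in> set js \<Longrightarrow> v l \<in> carr V" and \<psi>: "\<psi> \<in> carr M"
    using adm dualvec_zero by (auto simp: admissible_def)
  have "corr js (\<lambda>w. \<theta> (mode M (v i) (- 1 - int a) w)) v x \<psi> = 0" if "a \<ge> K" for a
    by (rule corr_0_functional) (use K that v \<psi> in \<open>auto simp: mode_bound_def\<close>)
  moreover have "corr js \<theta> v x (mode M (v i) (int k) \<psi>) = 0" if "k \<ge> K" for k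
    using K that corr_0_vector[where \<theta> = \<theta>, OF \<theta>0 v] by (simp add: mode_bound_def)
  moreover have "corr js \<theta> (v(l := mode V (v i) (int j) (v l))) x \<psi> = 0" if "l \<in> set js" "j \<ge> K" for l j
    by (rule corr_0_field[where l = l])
       (use K that \<theta>0 v \<psi> subspace_0[OF carr_subspace[OF V_module]] assms(2) in \<open>auto simp: mode_bound_def\<close>)
  ultimately show ?thesis
    unfolding corr.simps by (intro arg_cong2[where f = "(+)"] sum.cong refl Sum_any_bounded) auto
qed

lemma config_Cons: "x \<in> config (set (i # js)) \<Longrightarrow> x \<in> config (set js)"
  by (auto simp: config_def)

lemma rat_on_corr:
  assumes "distinct js" "admissible js \<theta> v \<psi>"
  shows "rat_on (config (set js)) (\<lambda>x. corr js \<theta> v x \<psi>)"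
  using assms
proof (induction js arbitrary: \<theta> v \<psi>)
  case Nil
  then show ?case by (simp add: rat_on_const)
next
  case (Cons i js)
  note adm = admissible_tail[OF Cons.prems(2)]
  obtain K where K: "mode_bound K \<theta> (v i) v js \<psi>"
    using mode_bound_exists[of \<theta> "v i" js v \<psi>] Cons.prems by (auto simp: admissible_def)
  have IH: "rat_on (config (set (i # js))) (\<lambda>x. corr js \<theta>' v' x \<psi>')" if "admissible js \<theta>' v' \<psi>'" for \<theta>' v' \<psi>'
    by (rule rat_on_subset[OF Cons.IH]) (use Cons.prems that config_Cons in auto)
  have i: "rat_on (config (set (i # js))) (\<lambda>x. 1 / x i)"
    by (intro rat_on_divide rat_intros) (auto simp: config_def)
  have il: "rat_on (config (set (i # js))) (\<lambda>x. 1 / (x i - x l))" if "l \<in> set js" for l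
    by (intro rat_on_divide rat_intros) (use that Cons.prems(1) in \<open>auto simp: config_def inj_on_def\<close>)
  show ?case
    unfolding corr_Cons[OF Cons.prems(2,1) K]
    by (intro rat_on_add rat_on_sum rat_on_mult rat_on_power rat_on_var i il IH adm)
qed

lemma vprod_Cons_upd:
  "distinct (i # js) \<Longrightarrow> vprod N (i # js) v (\<kappa>(i := a)) w = mode N (v i) a (vprod N js v \<kappa> w)"
  using vprod_cong[of js v v "\<kappa>(i := a)" \<kappa> N w] by (simp add: fun_upd_same del: fun_upd_apply) (metis fun_upd_other)

text \<open>In the radially ordered domain the recursion is the expansion of the product of fields in modes: the mode sum of
  the first field against the others is the expansion of \<open>1/(x\<^sub>i - x\<^sub>l)\<^bsup>j+1\<^esup>\<close> with \<open>\<bar>x\<^sub>l\<bar> < \<bar>x\<^sub>i\<bar>\<close>.\<close>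

theorem has_sum_corr:
  assumes "sorted_wrt (<) js" "admissible js \<theta> v \<psi>" "x \<in> radially_ordered (set js)"
  shows "((\<lambda>k. \<theta> (vprod M js v k \<psi>) * laurent_monom (set js) x k) has_sum corr js \<theta> v x \<psi>) (PiE (set js) (\<lambda>_. UNIV))"
  using assms
proof (induction js arbitrary: \<theta> v \<psi>)
  case Nil
  show ?case by (simp add: laurent_monom_def) (rule has_sum_finiteI; simp)
next
  case (Cons i js)
  note adm = admissible_tail[OF Cons.prems(2)]
  have dist: "distinct (i # js)" using Cons.prems(1) strict_sorted_iff by blast
  obtain K where K: "mode_bound K \<theta> (v i) v js \<psi>"
    using mode_bound_exists[of \<theta> "v i" js v \<psi>] Cons.prems by (auto simp: admissible_def)
  let ?S = "set js" let ?P = "PiE (set js) (\<lambda>_. UNIV :: int set)"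
  let ?T = "\<lambda>\<theta> v \<psi> \<kappa>. \<theta> (vprod M js v \<kappa> \<psi>) * laurent_monom ?S x \<kappa>"
  have IH: "(?T \<theta>' v' \<psi>' has_sum corr js \<theta>' v' x \<psi>') ?P" if "admissible js \<theta>' v' \<psi>'" for \<theta>' v' \<psi>'
    by (rule Cons.IH) (use Cons.prems that in \<open>auto simp: radially_ordered_def\<close>)
  have xi: "x i \<noteq> 0" using Cons.prems(3) by (auto simp: radially_ordered_def)
  have xl: "x l \<noteq> 0" "norm (x l) < norm (x i)" if "l \<in> ?S" for l
    using Cons.prems(1,3) that by (auto simp: radially_ordered_def)
  let ?F1 = "\<lambda>b (a,\<kappa>). (if a = - 1 - int b then x i ^ b else 0) * ?T (\<lambda>w. \<theta> (mode M (v i) (- 1 - int b) w)) v \<psi> \<kappa>"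
  let ?F2 = "\<lambda>b (a,\<kappa>). (if a = int b then (1 / x i) ^ Suc b else 0) * ?T \<theta> v (mode M (v i) (int b) \<psi>) \<kappa>"
  let ?c = "\<lambda>l j k. if k \<ge> 0 then (of_int k gchoose j) * x l powi (k - int j) * x i powi (- k - 1) else 0"
  let ?F3 = "\<lambda>l j (a,\<kappa>). ?c l j a * ?T \<theta> (v(l := mode V (v i) (int j) (v l))) \<psi> (\<kappa>(l := \<kappa> l + (a - int j)))"
  have F1: "(?F1 b has_sum x i ^ b * corr js (\<lambda>w. \<theta> (mode M (v i) (- 1 - int b) w)) v x \<psi>) (UNIV \<times> ?P)" for b
    by (rule has_sum_times[OF has_sum_single_index IH]) (rule adm)
  have F2: "(?F2 b has_sum (1 / x i) ^ Suc b * corr js \<theta> v x (mode M (v i) (int b) \<psi>)) (UNIV \<times> ?P)" for b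
    by (rule has_sum_times[OF has_sum_single_index IH]) (rule adm)
  have F3: "(?F3 l j has_sum (1 / (x i - x l)) ^ Suc j * corr js \<theta> (v(l := mode V (v i) (int j) (v l))) x \<psi>) (UNIV \<times> ?P)"
    if "l \<in> ?S" for l j
    by (rule has_sum_twisted_product[OF has_sum_nonneg_modes[OF xl(2)[OF that]] IH bij_betw_PiE_shift[OF that]])
       (rule adm(4)[OF that])
  have "((\<lambda>p. (\<Sum>b<K. ?F1 b p) + (\<Sum>b<K. ?F2 b p) + (\<Sum>l\<in>?S. \<Sum>j<K. ?F3 l j p)) has_sum corr (i # js) \<theta> v x \<psi>) (UNIV \<times> ?P)"
    unfolding corr_Cons[OF Cons.prems(2) dist K]
    by (intro has_sum_add has_sum_sum F1 F2 F3)
  also have "(\<lambda>p. (\<Sum>b<K. ?F1 b p) + (\<Sum>b<K. ?F2 b p) + (\<Sum>l\<in>?S. \<Sum>j<K. ?F3 l j p)) =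
      (\<lambda>(a,\<kappa>). \<theta> (vprod M (i # js) v (\<kappa>(i := a)) \<psi>) * laurent_monom (set (i # js)) x (\<kappa>(i := a)))"
  proof (rule ext)
    fix p :: "int \<times> (nat \<Rightarrow> int)"
    obtain a \<kappa> where p: "p = (a, \<kappa>)" by (cases p)
    let ?X = "vprod M js v \<kappa> \<psi>"
    have v: "v l \<in> carr V" if "l \<in> set (i # js)" for l using Cons.prems(2) that by (auto simp: admissible_def)
    have \<psi>: "\<psi> \<in> carr M" and \<theta>: "dualvec \<theta>" using Cons.prems(2) by (auto simp: admissible_def)
    have X: "?X \<in> carr M" by (rule vprod_closed[OF M]) (use v \<psi> in auto)
    have rhs: "\<theta> (vprod M (i # js) v (\<kappa>(i := a)) \<psi>) * laurent_monom (set (i # js)) x (\<kappa>(i := a)) =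
        \<theta> (mode M (v i) a ?X) * (x i powi (- a - 1) * laurent_monom ?S x \<kappa>)"
      unfolding vprod_Cons_upd[OF dist] using dist by (simp add: laurent_monom_insert del: fun_upd_apply)
    have "(\<Sum>b<K. ?F1 b (a,\<kappa>)) + (\<Sum>b<K. ?F2 b (a,\<kappa>)) + (\<Sum>l\<in>?S. \<Sum>j<K. ?F3 l j (a,\<kappa>)) =
        \<theta> (vprod M (i # js) v (\<kappa>(i := a)) \<psi>) * laurent_monom (set (i # js)) x (\<kappa>(i := a))"
    proof (cases "a < 0")
      case True
      define b where "b = nat (- 1 - a)"
      have ab: "a = - 1 - int b" using True by (simp add: b_def)
      have "(\<Sum>b<K. ?F2 b (a,\<kappa>)) = 0" using True by (intro sum.neutral) auto
      moreover have "(\<Sum>l\<in>?S. \<Sum>j<K. ?F3 l j (a,\<kappa>)) = 0" using True by (intro sum.neutral ballI) simp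
      moreover have "(\<Sum>b'<K. ?F1 b' (a,\<kappa>)) = (\<Sum>b'<K. if b' = b then x i ^ b * (\<theta> (mode M (v i) a ?X) * laurent_monom ?S x \<kappa>) else 0)"
        by (intro sum.cong refl) (auto simp: ab)
      moreover have "\<dots> = x i ^ b * (\<theta> (mode M (v i) a ?X) * laurent_monom ?S x \<kappa>)"
        using K X by (auto simp: mode_bound_def ab not_less)
      moreover have "x i powi (- a - 1) = x i ^ b" by (simp add: ab)
      ultimately show ?thesis unfolding rhs by (simp add: mult_ac)
    next
      case False
      define b where "b = nat a"
      have ab: "a = int b" using False by (simp add: b_def)
      have pw: "x i powi (- a - 1) = (1 / x i) ^ Suc b"
      proof -
        have "- a - 1 = - int (Suc b)" using ab by simp
        then show ?thesis by (simp only: power_int_minus power_int_of_nat power_one_over inverse_eq_divide)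
      qed
      have "(\<Sum>b<K. ?F1 b (a,\<kappa>)) = 0" using False by (intro sum.neutral) auto
      moreover have "(\<Sum>b'<K. ?F2 b' (a,\<kappa>)) = (\<Sum>b'<K. if b' = b then (1 / x i) ^ Suc b * ?T \<theta> v (mode M (v i) a \<psi>) \<kappa> else 0)"
        by (intro sum.cong refl) (auto simp: ab)
      moreover have "\<dots> = (1 / x i) ^ Suc b * ?T \<theta> v (mode M (v i) a \<psi>) \<kappa>"
        using K by (auto simp: mode_bound_def ab not_less vprod_zero[OF M] v dualvec_zero[OF \<theta>])
      moreover have "?F3 l j (a,\<kappa>) = x i powi (- a - 1) * laurent_monom ?S x \<kappa> *
          ((of_int a gchoose j) * \<theta> (vprod M js (v(l := mode V (v i) (int j) (v l))) (\<kappa>(l := \<kappa> l + (a - int j))) \<psi>))"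
        if "l \<in> ?S" for l j
        using False laurent_monom_shift[of ?S l x "a - int j" \<kappa>, symmetric] xl(1)[OF that] that by (simp add: mult_ac)
      moreover have "mode M (v i) a ?X = vprod M js v \<kappa> (mode M (v i) a \<psi>) +
         (\<Sum>l\<in>set js. \<Sum>j<K. (of_int a gchoose j) \<odot>
           vprod M js (v(l := mode V (v i) (int j) (v l))) (\<kappa>(l := \<kappa> l + (a - int j))) \<psi>)"
        by (rule commutator_vprod[OF M]) (use dist v \<psi> K in \<open>auto simp: mode_bound_def\<close>)
      moreover have "vprod M js (v(l := mode V (v i) (int j) (v l))) \<kappa>' \<psi> \<in> carr M" if "l \<in> ?S" for l j \<kappa>'
        by (rule vprod_closed[OF M]) (use v \<psi> that mode_closed[OF V_module] in auto)
      moreover have "vprod M js v \<kappa> (mode M (v i) a \<psi>) \<in> carr M"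
        by (rule vprod_closed[OF M]) (use v \<psi> mode_closed[OF M] in auto)
      ultimately show ?thesis unfolding rhs pw
        by (simp add: dualvec_add[OF \<theta>] dualvec_sum[OF \<theta>] dualvec_scale[OF \<theta>] subspace_sum subspace_scale carr_subspace[OF M]
              sum_distrib_left ring_distribs mult_ac)
    qed
    then show "(\<Sum>b<K. ?F1 b p) + (\<Sum>b<K. ?F2 b p) + (\<Sum>l\<in>?S. \<Sum>j<K. ?F3 l j p) =
        (case p of (a,\<kappa>) \<Rightarrow> \<theta> (vprod M (i # js) v (\<kappa>(i := a)) \<psi>) * laurent_monom (set (i # js)) x (\<kappa>(i := a)))"
      unfolding p by (simp only: prod.case)
  qed
  finally show ?case
    using has_sum_PiE_insert[of i ?S "\<lambda>k. \<theta> (vprod M (i # js) v k \<psi>) * laurent_monom (set (i # js)) x k"] dist by simp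
qed

end

section \<open>Ward identities\<close>

lemma has_field_derivative_reciprocal_power:
  fixes f :: "complex \<Rightarrow> complex"
  assumes "(f has_field_derivative D) (at q)" "f q \<noteq> 0"
  shows "((\<lambda>q. (1 / f q) ^ Suc k) has_field_derivative - (of_nat (Suc k) * (1 / f q) ^ Suc (Suc k) * D)) (at q)"
proof -
  have "((\<lambda>q. 1 / f q) has_field_derivative - ((1 / f q) ^ 2 * D)) (at q)"
    by (rule DERIV_cong[OF DERIV_divide[OF DERIV_const assms(1,2)]])
       (use assms(2) in \<open>simp add: field_simps power2_eq_square\<close>)
  from DERIV_power[OF this, of "Suc k"] show ?thesis
    by (rule DERIV_cong) (simp add: power2_eq_square mult_ac)
qed

lemma sum_shift_derivative:
  fixes g b :: "nat \<Rightarrow> complex"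
  assumes "b K = 0"
  shows "(\<Sum>k<Suc K. of_nat k * (g (Suc k) * b (k - 1))) = (\<Sum>k<Suc K. of_nat (Suc k) * (g (Suc (Suc k)) * b k))"
proof -
  have "(\<Sum>k<Suc K. of_nat k * (g (Suc k) * b (k - 1))) = (\<Sum>k<K. of_nat (Suc k) * (g (Suc (Suc k)) * b k))"
    by (subst sum.lessThan_Suc_shift) simp
  then show ?thesis using assms by simp
qed

context graded_module
begin

text \<open>On the radially ordered domain both sides are sums of the same series; being rational, they agree at all points.\<close>

lemma corr_termwise:
  assumes js: "sorted_wrt (<) js" and adm: "admissible js \<theta> v \<psi>" "\<And>f. f \<in> F \<Longrightarrow> admissible js (\<theta>' f) (v' f) (\<psi>' f)"
    and eq: "\<And>\<kappa>. \<theta> (vprod M js v \<kappa> \<psi>) = (\<Sum>f\<in>F. c f * \<theta>' f (vprod M js (v' f) \<kappa> (\<psi>' f)))"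
    and x: "x \<in> config (set js)"
  shows "corr js \<theta> v x \<psi> = (\<Sum>f\<in>F. c f * corr js (\<theta>' f) (v' f) x (\<psi>' f))"
proof (rule rat_on_eqI[OF _ _ finite_set radial_config _ x])
  have dist: "distinct js" using js strict_sorted_iff by blast
  show "rat_on (config (set js)) (\<lambda>x. corr js \<theta> v x \<psi>)" by (rule rat_on_corr[OF dist adm(1)])
  show "rat_on (config (set js)) (\<lambda>x. \<Sum>f\<in>F. c f * corr js (\<theta>' f) (v' f) x (\<psi>' f))"
    by (intro rat_intros rat_on_corr dist adm(2))
next
  fix x assume x: "x \<in> radially_ordered (set js)"
  have "((\<lambda>\<kappa>. \<Sum>f\<in>F. c f * (\<theta>' f (vprod M js (v' f) \<kappa> (\<psi>' f)) * laurent_monom (set js) x \<kappa>)) has_sum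
     (\<Sum>f\<in>F. c f * corr js (\<theta>' f) (v' f) x (\<psi>' f))) (PiE (set js) (\<lambda>_. UNIV))"
    by (intro has_sum_sum has_sum_cmult_right has_sum_corr js adm(2) x)
  moreover have "(\<Sum>f\<in>F. c f * (\<theta>' f (vprod M js (v' f) \<kappa> (\<psi>' f)) * laurent_monom (set js) x \<kappa>)) =
      \<theta> (vprod M js v \<kappa> \<psi>) * laurent_monom (set js) x \<kappa>" for \<kappa>
    unfolding eq by (simp add: sum_distrib_right mult.assoc)
  ultimately show "corr js \<theta> v x \<psi> = (\<Sum>f\<in>F. c f * corr js (\<theta>' f) (v' f) x (\<psi>' f))"
    using has_sum_unique[OF has_sum_corr[OF js adm(1) x]] by simp
qed

lemma corr_functional_scale:
  assumes js: "sorted_wrt (<) js" and adm: "admissible js \<theta> v \<psi>" "dualvec \<theta>'"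
    and eq: "\<And>w. w \<in> carr M \<Longrightarrow> \<theta> w = c * \<theta>' w" and x: "x \<in> config (set js)"
  shows "corr js \<theta> v x \<psi> = c * corr js \<theta>' v x \<psi>"
proof -
  have "corr js \<theta> v x \<psi> = (\<Sum>f\<in>{()}. c * corr js \<theta>' v x \<psi>)"
    by (rule corr_termwise[OF js adm(1) _ _ x])
       (use adm in \<open>auto simp: admissible_def intro!: eq vprod_closed[OF M]\<close>)
  then show ?thesis by simp
qed

lemma corr_functional_sum:
  assumes js: "sorted_wrt (<) js" and adm: "admissible js \<theta> v \<psi>" "\<And>f. f \<in> F \<Longrightarrow> dualvec (\<theta>' f)"
    and eq: "\<And>w. w \<in> carr M \<Longrightarrow> \<theta> w = (\<Sum>f\<in>F. c f * \<theta>' f w)" and x: "x \<in> config (set js)"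
  shows "corr js \<theta> v x \<psi> = (\<Sum>f\<in>F. c f * corr js (\<theta>' f) v x \<psi>)"
  by (rule corr_termwise[OF js adm(1) _ _ x])
     (use adm in \<open>auto simp: admissible_def intro!: eq vprod_closed[OF M]\<close>)

lemma corr_vector_lin:
  assumes js: "sorted_wrt (<) js" and adm: "admissible js \<theta> v \<psi>" "admissible js \<theta> v \<psi>'" and x: "x \<in> config (set js)"
  shows "corr js \<theta> v x (\<psi> + c \<odot> \<psi>') = corr js \<theta> v x \<psi> + c * corr js \<theta> v x \<psi>'"
proof -
  have "corr js \<theta> v x (\<psi> + c \<odot> \<psi>') = (\<Sum>f\<in>{True,False}. (if f then 1 else c) * corr js \<theta> v x (if f then \<psi> else \<psi>'))"
  proof (rule corr_termwise[OF js _ _ _ x])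
    show "admissible js \<theta> v (\<psi> + c \<odot> \<psi>')"
      using adm by (auto simp: admissible_def intro!: subspace_add subspace_scale carr_subspace[OF M])
    show "\<theta> (vprod M js v \<kappa> (\<psi> + c \<odot> \<psi>')) =
        (\<Sum>f\<in>{True, False}. (if f then 1 else c) * \<theta> (vprod M js v \<kappa> (if f then \<psi> else \<psi>')))" for \<kappa>
      using adm
      by (auto simp: admissible_def vprod_add[OF M] vprod_scale[OF M] dualvec_add dualvec_scale vprod_closed[OF M]
          subspace_scale carr_subspace[OF M])
  qed (use adm in auto)
  then show ?thesis by simp
qed

lemma corr_vector_scale:
  assumes js: "sorted_wrt (<) js" and adm: "admissible js \<theta> v \<psi>" and x: "x \<in> config (set js)"
  shows "corr js \<theta> v x (c \<odot> \<psi>) = c * corr js \<theta> v x \<psi>"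
proof -
  have "admissible js \<theta> v 0" using adm subspace_0[OF carr_subspace[OF M]] by (simp add: admissible_def)
  moreover have "corr js \<theta> v x 0 = 0"
    by (rule corr_0_vector) (use adm dualvec_zero in \<open>auto simp: admissible_def\<close>)
  ultimately show ?thesis using corr_vector_lin[OF js _ adm x, of 0 c] by simp
qed

lemma corr_field_lin:
  assumes js: "sorted_wrt (<) js" and adm: "admissible js \<theta> v \<psi>" and x: "x \<in> config (set js)"
    and l: "l \<in> set js" and ab: "a \<in> carr V" "b \<in> carr V"
  shows "corr js \<theta> (v(l := a + c \<odot> b)) x \<psi> = corr js \<theta> (v(l := a)) x \<psi> + c * corr js \<theta> (v(l := b)) x \<psi>"
proof -
  have dist: "distinct js" using js strict_sorted_iff by blast
  note sV = carr_subspace[OF V_module]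
  have "corr js \<theta> (v(l := a + c \<odot> b)) x \<psi> =
      (\<Sum>f\<in>{True,False}. (if f then 1 else c) * corr js \<theta> (v(l := if f then a else b)) x \<psi>)"
  proof (rule corr_termwise[OF js _ _ _ x])
    show "admissible js \<theta> (v(l := a + c \<odot> b)) \<psi>"
      using adm ab by (auto simp: admissible_def intro!: subspace_add subspace_scale sV)
    show "admissible js \<theta> (v(l := if f then a else b)) \<psi>" for f
      using adm ab by (auto simp: admissible_def)
    have v: "v l \<in> carr V" if "l \<in> set js" for l using adm that by (auto simp: admissible_def)
    have \<psi>: "\<psi> \<in> carr M" and \<theta>: "dualvec \<theta>" using adm by (auto simp: admissible_def)
    have cl: "vprod M js (v(l := a)) \<kappa> \<psi> \<in> carr M" "vprod M js (v(l := b)) \<kappa> \<psi> \<in> carr M" for \<kappa>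
      by (rule vprod_closed[OF M]; use v ab \<psi> in auto)+
    show "\<theta> (vprod M js (v(l := a + c \<odot> b)) \<kappa> \<psi>) =
        (\<Sum>f\<in>{True, False}. (if f then 1 else c) * \<theta> (vprod M js (v(l := if f then a else b)) \<kappa> \<psi>))" for \<kappa>
      using vprod_upd_add[OF M dist l v \<psi> ab(1) subspace_scale[OF sV ab(2), of c], where k = \<kappa>]
        vprod_upd_scale[OF M dist l v \<psi> ab(2), where k = \<kappa> and c = c] cl
      by (simp add: dualvec_add[OF \<theta>] dualvec_scale[OF \<theta>] subspace_scale carr_subspace[OF M] del: fun_upd_apply)
  qed
  then show ?thesis by simp
qed

lemma corr_cong_fields:
  assumes "\<And>l. l \<in> set js \<Longrightarrow> v l = v' l"
  shows "corr js \<theta> v x \<psi> = corr js \<theta> v' x \<psi>"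
  using assms
proof (induction js arbitrary: \<theta> v v' \<psi>)
  case (Cons i js)
  have i: "v i = v' i" using Cons.prems by simp
  have "corr js (\<lambda>w. \<theta> (mode M (v' i) k w)) v x \<psi> = corr js (\<lambda>w. \<theta> (mode M (v' i) k w)) v' x \<psi>" for k
    by (rule Cons.IH) (use Cons.prems in auto)
  moreover have "corr js \<theta> v x \<psi>' = corr js \<theta> v' x \<psi>'" for \<psi>'
    by (rule Cons.IH) (use Cons.prems in auto)
  moreover have "corr js \<theta> (v(l := mode V (v' i) k (v l))) x \<psi> = corr js \<theta> (v'(l := mode V (v' i) k (v' l))) x \<psi>"
    if "l \<in> set js" for l k
    by (rule Cons.IH) (use Cons.prems that in auto)
  ultimately show ?case by (simp add: i)
qed simp

text \<open>The commutator formula holds termwise in the expansion on the radially ordered domain, and both sides are rational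
  functions of the points.\<close>

lemma ward_identity:
  assumes js: "sorted_wrt (<) js" and adm: "admissible js \<theta> v \<psi>" and u: "u \<in> carr V"
    and N: "\<And>l j. l \<in> set js \<Longrightarrow> j \<ge> N \<Longrightarrow> mode V u (int j) (v l) = 0" and x: "x \<in> config (set js)"
  shows "corr js (\<lambda>w. \<theta> (mode M u m w)) v x \<psi> = corr js \<theta> v x (mode M u m \<psi>) +
    (\<Sum>l\<in>set js. \<Sum>j<N. (of_int m gchoose j) * x l powi (m - int j) *
        corr js \<theta> (v(l := mode V u (int j) (v l))) x \<psi>)" (is "?L x = ?R x")
proof (rule rat_on_eqI[OF _ _ finite_set radial_config _ x])
  have dist: "distinct js" using js strict_sorted_iff by blast
  have v: "v l \<in> carr V" if "l \<in> set js" for l using adm that by (auto simp: admissible_def)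
  have \<psi>: "\<psi> \<in> carr M" and \<theta>: "dualvec \<theta>" using adm by (auto simp: admissible_def)
  have adm3: "admissible js \<theta> (v(l := mode V u (int j) (v l))) \<psi>" if "l \<in> set js" for l j
    using adm u that by (auto simp: admissible_def intro: dualvec_mode mode_closed[OF M] mode_closed[OF V_module])
  have adm1: "admissible js (\<lambda>w. \<theta> (mode M u m w)) v \<psi>" and adm2: "admissible js \<theta> v (mode M u m \<psi>)"
    using adm u by (auto simp: admissible_def intro: dualvec_mode mode_closed[OF M])
  show "rat_on (config (set js)) ?L" by (rule rat_on_corr[OF dist adm1])
  have "rat_on (config (set js)) (\<lambda>x. x l powi n)" if "l \<in> set js" for l n
    by (intro rat_on_powi rat_on_var) (use that in \<open>auto simp: config_def\<close>)
  then show "rat_on (config (set js)) ?R"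
    by (intro rat_on_add rat_on_sum rat_on_mult rat_on_const rat_on_corr dist adm2 adm3)
  fix x assume x: "x \<in> radially_ordered (set js)"
  let ?P = "PiE (set js) (\<lambda>_. UNIV :: int set)"
  have x0: "x l \<noteq> 0" if "l \<in> set js" for l using x that by (auto simp: radially_ordered_def)
  let ?T = "\<lambda>l j \<kappa>. \<theta> (vprod M js (v(l := mode V u (int j) (v l))) \<kappa> \<psi>)"
  have shifted: "((\<lambda>\<kappa>. (of_int m gchoose j) * x l powi (m - int j) * (?T l j (\<kappa>(l := \<kappa> l + (m - int j))) * laurent_monom (set js) x (\<kappa>(l := \<kappa> l + (m - int j)))))
     has_sum (of_int m gchoose j) * x l powi (m - int j) * corr js \<theta> (v(l := mode V u (int j) (v l))) x \<psi>) ?P"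
    if l: "l \<in> set js" for l j
    by (intro has_sum_cmult_right
        iffD2[OF has_sum_reindex_bij_betw[OF bij_betw_PiE_shift[OF l], where f = "\<lambda>\<kappa>. ?T l j \<kappa> * laurent_monom (set js) x \<kappa>"]]
        has_sum_corr js adm3 l x)
  have "((\<lambda>\<kappa>. \<theta> (vprod M js v \<kappa> (mode M u m \<psi>)) * laurent_monom (set js) x \<kappa> + (\<Sum>l\<in>set js. \<Sum>j<N.
       (of_int m gchoose j) * x l powi (m - int j) * (?T l j (\<kappa>(l := \<kappa> l + (m - int j))) * laurent_monom (set js) x (\<kappa>(l := \<kappa> l + (m - int j))))))
     has_sum ?R x) ?P"
    by (intro has_sum_add has_sum_sum has_sum_corr js adm2 x shifted)
  moreover have "\<theta> (vprod M js v \<kappa> (mode M u m \<psi>)) * laurent_monom (set js) x \<kappa> + (\<Sum>l\<in>set js. \<Sum>j<N.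
       (of_int m gchoose j) * x l powi (m - int j) * (?T l j (\<kappa>(l := \<kappa> l + (m - int j))) * laurent_monom (set js) x (\<kappa>(l := \<kappa> l + (m - int j)))))
     = \<theta> (mode M u m (vprod M js v \<kappa> \<psi>)) * laurent_monom (set js) x \<kappa>" for \<kappa>
  proof -
    have cl: "vprod M js (v(l := mode V u (int j) (v l))) \<kappa>' \<psi> \<in> carr M" if "l \<in> set js" for l j \<kappa>'
      by (rule vprod_closed[OF M]) (use v \<psi> u that mode_closed[OF V_module] in auto)
    have cl2: "vprod M js v \<kappa> (mode M u m \<psi>) \<in> carr M"
      by (rule vprod_closed[OF M]) (use v \<psi> u mode_closed[OF M] in auto)
    have "\<theta> (mode M u m (vprod M js v \<kappa> \<psi>)) = \<theta> (vprod M js v \<kappa> (mode M u m \<psi>)) +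
       (\<Sum>l\<in>set js. \<Sum>j<N. (of_int m gchoose j) * ?T l j (\<kappa>(l := \<kappa> l + (m - int j))))"
      using cl cl2 by (subst commutator_vprod[OF M dist u v \<psi> N]) (simp_all add: dualvec_add[OF \<theta>] dualvec_sum[OF \<theta>] dualvec_scale[OF \<theta>] subspace_sum subspace_scale carr_subspace[OF M])
    moreover have "(of_int m gchoose j) * x l powi (m - int j) * (?T l j (\<kappa>(l := \<kappa> l + (m - int j))) * laurent_monom (set js) x (\<kappa>(l := \<kappa> l + (m - int j))))
       = ((of_int m gchoose j) * ?T l j (\<kappa>(l := \<kappa> l + (m - int j)))) * laurent_monom (set js) x \<kappa>" if "l \<in> set js" for l j
      using laurent_monom_shift[of "set js" l x "m - int j" \<kappa>, symmetric] x0[OF that] that by (simp add: mult_ac)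
    ultimately show ?thesis
      by (simp only: ring_distribs sum_distrib_right cong: sum.cong)
  qed
  ultimately show "?L x = ?R x"
    using has_sum_unique[OF has_sum_corr[OF js adm1 x]] by simp
qed

end

section \<open>Moving the points\<close>

context graded_module
begin

text \<open>Inserting \<open>L(-1)v\<^sub>l\<close> differentiates in the position of \<open>v\<^sub>l\<close>. The recursion for the correlator is
  compatible with this because \<open>(L(-1)v)\<^sub>k = -k v\<^sub>k\<^sub>-\<^sub>1\<close> and
  \<open>L(-1)(v\<^sub>j u) = v\<^sub>j (L(-1)u) - j v\<^sub>j\<^sub>-\<^sub>1 u\<close>.\<close>

theorem corr_derivative:
  assumes "sorted_wrt (<) js" "admissible js \<theta> v \<psi>"
    and "\<And>l. l \<in> set js \<Longrightarrow> ((\<lambda>q. X q l) has_field_derivative D l) (at q0)" and "X q0 \<in> config (set js)"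
  shows "((\<lambda>q. corr js \<theta> v (X q) \<psi>) has_field_derivative
     (\<Sum>l\<in>set js. D l * corr js \<theta> (v(l := vir V V (-1) (v l))) (X q0) \<psi>)) (at q0)"
  using assms(1,2,4) assms(3)
proof (induction js arbitrary: \<theta> v \<psi>)
  case Nil
  show ?case by simp
next
  case (Cons i js)
  note adm = admissible_tail[OF Cons.prems(2)]
  have js: "sorted_wrt (<) js" and dist: "distinct (i # js)" using Cons.prems(1) strict_sorted_iff by auto
  have i: "i \<notin> set js" using dist by simp
  define x where "x = X q0"
  have x: "x \<in> config (set js)" using Cons.prems(3) config_Cons unfolding x_def by blast
  have xi: "x i \<noteq> 0" and xil: "x i - x l \<noteq> 0" if "l \<in> set js" for l
    using Cons.prems(3) that dist by (auto simp: config_def inj_on_def x_def)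
  have xi: "x i \<noteq> 0" using Cons.prems(3) by (auto simp: config_def x_def)
  have v: "v l \<in> carr V" if "l \<in> set (i # js)" for l using Cons.prems(2) that by (auto simp: admissible_def)
  have \<psi>: "\<psi> \<in> carr M" and \<theta>: "dualvec \<theta>" using Cons.prems(2) by (auto simp: admissible_def)
  define T where "T = vir V V (-1)"
  have T: "T u \<in> carr V" if "u \<in> carr V" for u unfolding T_def by (rule vir_in[OF V_module that])
  have Tmode: "mode M (T u) k w = (- of_int k) \<odot> mode M u (k - 1) w" if "u \<in> carr V" "w \<in> carr M" for u k w
    unfolding T_def by (rule translation[OF M that])
  have TmodeV: "mode V (T u) k w = (- of_int k) \<odot> mode V u (k - 1) w" if "u \<in> carr V" "w \<in> carr V" for u k w
    unfolding T_def by (rule translation[OF V_module that])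
  obtain K1 where K1: "mode_bound K1 \<theta> (v i) v js \<psi>"
    using mode_bound_exists[of \<theta> "v i" js v \<psi>] \<theta> v \<psi> by auto
  obtain K2 where K2: "mode_bound K2 \<theta> (T (v i)) v js \<psi>"
    using mode_bound_exists[of \<theta> "T (v i)" js v \<psi>] \<theta> v \<psi> T by auto
  have "\<exists>K. mode_bound K \<theta> (v i) (v(l := T (v l))) js \<psi>" if "l \<in> set js" for l
    by (rule mode_bound_exists[OF \<theta>]) (use v \<psi> T that in auto)
  then obtain K3 where K3: "\<And>l. l \<in> set js \<Longrightarrow> mode_bound (K3 l) \<theta> (v i) (v(l := T (v l))) js \<psi>" by metis
  define K where "K = K1 + K2 + (\<Sum>l\<in>set js. K3 l)"
  have K3': "K3 l \<le> (\<Sum>l\<in>set js. K3 l)" if "l \<in> set js" for l by (rule member_le_sum) (use that in auto)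
  have b0: "mode_bound K \<theta> (v i) v js \<psi>" by (rule mode_bound_mono[OF K1]) (simp add: K_def)
  have b1: "mode_bound (Suc K) \<theta> (v i) v js \<psi>" by (rule mode_bound_mono[OF b0]) simp
  have b2: "mode_bound (Suc K) \<theta> (T (v i)) v js \<psi>" by (rule mode_bound_mono[OF K2]) (simp add: K_def)
  have b3: "mode_bound (Suc K) \<theta> (v i) (v(l := T (v l))) js \<psi>" if "l \<in> set js" for l
    by (rule mode_bound_mono[OF K3[OF that]]) (use K3'[OF that] in \<open>simp add: K_def\<close>)
  define A where "A = (\<lambda>a q. corr js (\<lambda>w. \<theta> (mode M (v i) (- 1 - int a) w)) v (X q) \<psi>)"
  define Bf where "Bf = (\<lambda>k q. corr js \<theta> v (X q) (mode M (v i) (int k) \<psi>))"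
  define C where "C = (\<lambda>l j q. corr js \<theta> (v(l := mode V (v i) (int j) (v l))) (X q) \<psi>)"
  define A' where "A' = (\<lambda>l a. corr js (\<lambda>w. \<theta> (mode M (v i) (- 1 - int a) w)) (v(l := T (v l))) x \<psi>)"
  define B' where "B' = (\<lambda>l k. corr js \<theta> (v(l := T (v l))) x (mode M (v i) (int k) \<psi>))"
  define C' where "C' = (\<lambda>l l' j. corr js \<theta> ((v(l' := mode V (v i) (int j) (v l')))(l := T ((v(l' := mode V (v i) (int j) (v l'))) l))) x \<psi>)"
  have DX: "((\<lambda>q. X q l) has_field_derivative D l) (at q0)" if "l \<in> set (i # js)" for l
    by (rule Cons.prems(4)[OF that])
  have IH: "((\<lambda>q. corr js \<theta>' v' (X q) \<psi>') has_field_derivative (\<Sum>l\<in>set js. D l * corr js \<theta>' (v'(l := T (v' l))) x \<psi>')) (at q0)"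
    if "admissible js \<theta>' v' \<psi>'" for \<theta>' v' \<psi>'
    unfolding T_def x_def by (rule Cons.IH[OF js that]) (use x DX in \<open>auto simp: x_def\<close>)
  have dA: "(A a has_field_derivative (\<Sum>l\<in>set js. D l * A' l a)) (at q0)" for a
    unfolding A_def A'_def by (rule IH[OF adm(2)])
  have dB: "(Bf k has_field_derivative (\<Sum>l\<in>set js. D l * B' l k)) (at q0)" for k
    unfolding Bf_def B'_def by (rule IH[OF adm(3)])
  have dC: "(C l' j has_field_derivative (\<Sum>l\<in>set js. D l * C' l l' j)) (at q0)" if "l' \<in> set js" for l' j
    unfolding C_def C'_def by (rule IH[OF adm(4)[OF that]])
  have expand: "corr (i # js) \<theta> v (X q) \<psi> = (\<Sum>a<Suc K. X q i ^ a * A a q) + (\<Sum>k<Suc K. (1 / X q i) ^ Suc k * Bf k q) +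
     (\<Sum>l\<in>set js. \<Sum>j<Suc K. (1 / (X q i - X q l)) ^ Suc j * C l j q)" for q
    unfolding A_def Bf_def C_def by (rule corr_Cons[OF Cons.prems(2) dist b1])
  have Di: "((\<lambda>q. X q i) has_field_derivative D i) (at q0)" by (rule DX) simp
  have dterm1: "((\<lambda>q. X q i ^ a * A a q) has_field_derivative
      (D i * (of_nat a * (x i ^ (a - 1) * A a q0)) + x i ^ a * (\<Sum>l\<in>set js. D l * A' l a))) (at q0)" for a
    by (rule DERIV_cong[OF DERIV_mult[OF DERIV_power[OF Di] dA]]) (simp add: x_def mult_ac)
  have dterm2: "((\<lambda>q. (1 / X q i) ^ Suc k * Bf k q) has_field_derivative
      (- D i * (of_nat (Suc k) * ((1 / x i) ^ Suc (Suc k) * Bf k q0)) + (1 / x i) ^ Suc k * (\<Sum>l\<in>set js. D l * B' l k))) (at q0)" for k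
    by (rule DERIV_cong[OF DERIV_mult[OF has_field_derivative_reciprocal_power[OF Di] dB]])
       (use xi in \<open>simp_all add: x_def mult_ac del: power_Suc of_nat_Suc\<close>)
  have dterm3: "((\<lambda>q. (1 / (X q i - X q l)) ^ Suc j * C l j q) has_field_derivative
      (- (D i - D l) * (of_nat (Suc j) * ((1 / (x i - x l)) ^ Suc (Suc j) * C l j q0)) +
        (1 / (x i - x l)) ^ Suc j * (\<Sum>l'\<in>set js. D l' * C' l' l j))) (at q0)" if l: "l \<in> set js" for l j
  proof -
    have Lminus: "((\<lambda>q. X q i - X q l) has_field_derivative D i - D l) (at q0)"
      by (intro DERIV_diff Di DX) (use l in simp)
    show ?thesis
      by (rule DERIV_cong[OF DERIV_mult[OF has_field_derivative_reciprocal_power[OF Lminus] dC[OF l]]])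
         (use xil[OF l] in \<open>simp_all add: x_def algebra_simps del: power_Suc of_nat_Suc\<close>)
  qed
  have deriv: "((\<lambda>q. corr (i # js) \<theta> v (X q) \<psi>) has_field_derivative
     ((\<Sum>a<Suc K. D i * (of_nat a * (x i ^ (a - 1) * A a q0)) + x i ^ a * (\<Sum>l\<in>set js. D l * A' l a)) +
     (\<Sum>k<Suc K. - D i * (of_nat (Suc k) * ((1 / x i) ^ Suc (Suc k) * Bf k q0)) + (1 / x i) ^ Suc k * (\<Sum>l\<in>set js. D l * B' l k)) +
     (\<Sum>l\<in>set js. \<Sum>j<Suc K. - (D i - D l) * (of_nat (Suc j) * ((1 / (x i - x l)) ^ Suc (Suc j) * C l j q0)) +
        (1 / (x i - x l)) ^ Suc j * (\<Sum>l'\<in>set js. D l' * C' l' l j)))) (at q0)"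
    (is "(_ has_field_derivative ?D1) _")
    unfolding expand by (intro DERIV_add DERIV_sum dterm1 dterm2 dterm3)
  \<comment> \<open>the coefficient of the derivative of the first position\<close>
  have Ei: "corr (i # js) \<theta> (v(i := T (v i))) x \<psi> =
     (\<Sum>a<Suc K. of_nat a * (x i ^ (a - 1) * A a q0)) - (\<Sum>k<Suc K. of_nat (Suc k) * ((1 / x i) ^ Suc (Suc k) * Bf k q0)) -
     (\<Sum>l\<in>set js. \<Sum>j<Suc K. of_nat (Suc j) * ((1 / (x i - x l)) ^ Suc (Suc j) * C l j q0))"
  proof -
    have 1: "corr js (\<lambda>w. \<theta> (mode M (T (v i)) (- 1 - int a) w)) (v(i := T (v i))) x \<psi> = of_nat (Suc a) * A (Suc a) q0" for a
    proof -
      have "corr js (\<lambda>w. \<theta> (mode M (T (v i)) (- 1 - int a) w)) (v(i := T (v i))) x \<psi> =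
          corr js (\<lambda>w. \<theta> (mode M (T (v i)) (- 1 - int a) w)) v x \<psi>"
        by (rule corr_cong_fields) (use i in auto)
      also have "\<dots> = of_nat (Suc a) * corr js (\<lambda>w. \<theta> (mode M (v i) (- 1 - int (Suc a)) w)) v x \<psi>"
      proof (rule corr_functional_scale[OF js _ _ _ x])
        show "admissible js (\<lambda>w. \<theta> (mode M (T (v i)) (- 1 - int a) w)) v \<psi>"
          using adm(1) T v by (auto simp: admissible_def intro: dualvec_mode)
        show "\<theta> (mode M (T (v i)) (- 1 - int a) w) = of_nat (Suc a) * \<theta> (mode M (v i) (- 1 - int (Suc a)) w)"
          if "w \<in> carr M" for w
        proof -
          have e: "- 1 - int a - 1 = - 1 - int (Suc a)" "- of_int (- 1 - int a) = (of_nat (Suc a) :: complex)" by simp_all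
          show ?thesis using that v by (simp only: Tmode e dualvec_scale[OF \<theta>] mode_closed[OF M] list.set_intros)
        qed
      qed (use \<theta> v in \<open>auto intro: dualvec_mode\<close>)
      finally show ?thesis by (simp add: A_def x_def)
    qed
    have 2: "corr js \<theta> (v(i := T (v i))) x (mode M (T (v i)) (int k) \<psi>) = - (of_nat k * Bf (k - 1) q0)" for k
    proof -
      have "corr js \<theta> (v(i := T (v i))) x (mode M (T (v i)) (int k) \<psi>) = corr js \<theta> v x (mode M (T (v i)) (int k) \<psi>)"
        by (rule corr_cong_fields) (use i in auto)
      also have "\<dots> = - of_nat k * corr js \<theta> v x (mode M (v i) (int k - 1) \<psi>)"
        using corr_vector_scale[OF js _ x, of \<theta> v _ "- of_nat k"] adm(3) v \<psi> by (simp add: Tmode)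
      finally show ?thesis by (cases k) (auto simp: Bf_def x_def algebra_simps)
    qed
    have 3: "corr js \<theta> ((v(i := T (v i)))(l := mode V (T (v i)) (int j) ((v(i := T (v i))) l))) x \<psi> = - (of_nat j * C l (j - 1) q0)"
      if l: "l \<in> set js" for l j
    proof -
      have "corr js \<theta> ((v(i := T (v i)))(l := mode V (T (v i)) (int j) ((v(i := T (v i))) l))) x \<psi> =
          corr js \<theta> (v(l := 0 + (- of_nat j) \<odot> mode V (v i) (int j - 1) (v l))) x \<psi>"
        by (rule corr_cong_fields) (use i l v in \<open>auto simp: TmodeV\<close>)
      also have "\<dots> = corr js \<theta> (v(l := 0)) x \<psi> + (- of_nat j) * corr js \<theta> (v(l := mode V (v i) (int j - 1) (v l))) x \<psi>"
        by (rule corr_field_lin[OF js adm(1) x l])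
           (use v l subspace_0[OF carr_subspace[OF V_module]] in \<open>auto intro: mode_closed[OF V_module]\<close>)
      also have "corr js \<theta> (v(l := 0)) x \<psi> = 0"
        by (rule corr_0_field[where l = l])
           (use v l \<psi> dist dualvec_zero[OF \<theta>] subspace_0[OF carr_subspace[OF V_module]] in auto)
      finally show ?thesis by (cases j) (auto simp: C_def x_def algebra_simps simp del: fun_upd_apply)
    qed
    have zA: "A (Suc K) q0 = 0"
      unfolding A_def by (rule corr_0_functional) (use b1 v \<psi> in \<open>auto simp: mode_bound_def\<close>)
    have zB: "Bf K q0 = 0"
    proof -
      have "mode M (v i) (int K) \<psi> = 0" using b0 by (auto simp: mode_bound_def)
      then show ?thesis unfolding Bf_def using corr_0_vector[of \<theta> js v, OF dualvec_zero[OF \<theta>]] v by simp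
    qed
    have zC: "C l K q0 = 0" if "l \<in> set js" for l
      unfolding C_def
      by (rule corr_0_field[where l = l])
         (use b0 v \<psi> that dist dualvec_zero[OF \<theta>] subspace_0[OF carr_subspace[OF V_module]] in \<open>auto simp: mode_bound_def\<close>)
    have sA: "(\<Sum>a<Suc K. x i ^ a * (of_nat (Suc a) * A (Suc a) q0)) = (\<Sum>a<Suc K. of_nat a * (x i ^ (a - 1) * A a q0))"
    proof -
      have "(\<Sum>a<Suc (Suc K). of_nat a * (x i ^ (a - 1) * A a q0)) = (\<Sum>a<Suc K. of_nat (Suc a) * (x i ^ (Suc a - 1) * A (Suc a) q0))"
        by (subst sum.lessThan_Suc_shift) simp
      then show ?thesis using zA by (simp add: mult_ac)
    qed
    have sB: "(\<Sum>k<Suc K. (1 / x i) ^ Suc k * - (of_nat k * Bf (k - 1) q0)) = - (\<Sum>k<Suc K. of_nat (Suc k) * ((1 / x i) ^ Suc (Suc k) * Bf k q0))"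
      using sum_shift_derivative[of "\<lambda>k. Bf k q0" K "\<lambda>k. (1 / x i) ^ k", OF zB]
      by (simp only: mult_minus_right mult_minus_left sum_negf mult_ac)
    have sC: "(\<Sum>j<Suc K. (1 / (x i - x l)) ^ Suc j * - (of_nat j * C l (j - 1) q0)) = - (\<Sum>j<Suc K. of_nat (Suc j) * ((1 / (x i - x l)) ^ Suc (Suc j) * C l j q0))"
      if "l \<in> set js" for l
      using sum_shift_derivative[of "\<lambda>k. C l k q0" K "\<lambda>k. (1 / (x i - x l)) ^ k", OF zC[OF that]]
      by (simp only: mult_minus_right mult_minus_left sum_negf mult_ac)
    have "corr (i # js) \<theta> (v(i := T (v i))) x \<psi> =
      (\<Sum>a<Suc K. x i ^ a * corr js (\<lambda>w. \<theta> (mode M ((v(i := T (v i))) i) (- 1 - int a) w)) (v(i := T (v i))) x \<psi>) +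
      (\<Sum>k<Suc K. (1 / x i) ^ Suc k * corr js \<theta> (v(i := T (v i))) x (mode M ((v(i := T (v i))) i) (int k) \<psi>)) +
      (\<Sum>l\<in>set js. \<Sum>j<Suc K. (1 / (x i - x l)) ^ Suc j *
         corr js \<theta> ((v(i := T (v i)))(l := mode V ((v(i := T (v i))) i) (int j) ((v(i := T (v i))) l))) x \<psi>)"
    proof (rule corr_Cons[OF _ dist])
      show "admissible (i # js) \<theta> (v(i := T (v i))) \<psi>" using Cons.prems(2) T by (auto simp: admissible_def)
      show "mode_bound (Suc K) \<theta> ((v(i := T (v i))) i) (v(i := T (v i))) js \<psi>"
        using b2 i unfolding mode_bound_def by auto
    qed
    then show ?thesis
      using sA sB sC by (simp only: fun_upd_same 1 2 3 cong: sum.cong) (simp only: sum_negf add_uminus_conv_diff)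
  qed
  \<comment> \<open>the coefficients of the derivatives of the other positions\<close>
  have El: "corr (i # js) \<theta> (v(l := T (v l))) x \<psi> =
     (\<Sum>a<Suc K. x i ^ a * A' l a) + (\<Sum>k<Suc K. (1 / x i) ^ Suc k * B' l k) +
     (\<Sum>l'\<in>set js. \<Sum>j<Suc K. (1 / (x i - x l')) ^ Suc j * C' l l' j) +
     (\<Sum>j<Suc K. of_nat (Suc j) * ((1 / (x i - x l)) ^ Suc (Suc j) * C l j q0))"
    if l: "l \<in> set js" for l
  proof -
    have li: "l \<noteq> i" using l i by auto
    have eq: "(v(l := T (v l))) i = v i" using li by simp
    have 3: "corr js \<theta> ((v(l := T (v l)))(l' := mode V (v i) (int j) ((v(l := T (v l))) l'))) x \<psi> =
        C' l l' j + (if l' = l then of_nat j * C l (j - 1) q0 else 0)" if l': "l' \<in> set js" for l' j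
    proof (cases "l' = l")
      case False
      then have "(v(l := T (v l)))(l' := mode V (v i) (int j) ((v(l := T (v l))) l')) =
          (v(l' := mode V (v i) (int j) (v l')))(l := T ((v(l' := mode V (v i) (int j) (v l'))) l))"
        by (auto simp: fun_eq_iff)
      then show ?thesis using False by (simp add: C'_def)
    next
      case True
      have com: "mode V (v i) (int j) (T (v l)) = T (mode V (v i) (int j) (v l)) + of_nat j \<odot> mode V (v i) (int j - 1) (v l)"
        unfolding T_def using vir_mode_minus1[OF V_module, of "v i" "v l" "int j"] v l by simp
      have "corr js \<theta> (v(l := T (mode V (v i) (int j) (v l)) + of_nat j \<odot> mode V (v i) (int j - 1) (v l))) x \<psi> =
         corr js \<theta> (v(l := T (mode V (v i) (int j) (v l)))) x \<psi> + of_nat j * corr js \<theta> (v(l := mode V (v i) (int j - 1) (v l))) x \<psi>"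
        by (rule corr_field_lin[OF js adm(1) x l]) (use v l in \<open>auto intro!: T mode_closed[OF V_module]\<close>)
      moreover have "of_nat j * corr js \<theta> (v(l := mode V (v i) (int j - 1) (v l))) x \<psi> = of_nat j * C l (j - 1) q0"
        by (cases j) (auto simp: C_def x_def simp del: fun_upd_apply)
      ultimately show ?thesis using True by (simp add: C'_def com)
    qed
    have "corr (i # js) \<theta> (v(l := T (v l))) x \<psi> =
      (\<Sum>a<Suc K. x i ^ a * corr js (\<lambda>w. \<theta> (mode M ((v(l := T (v l))) i) (- 1 - int a) w)) (v(l := T (v l))) x \<psi>) +
      (\<Sum>k<Suc K. (1 / x i) ^ Suc k * corr js \<theta> (v(l := T (v l))) x (mode M ((v(l := T (v l))) i) (int k) \<psi>)) +
      (\<Sum>l'\<in>set js. \<Sum>j<Suc K. (1 / (x i - x l')) ^ Suc j *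
         corr js \<theta> ((v(l := T (v l)))(l' := mode V ((v(l := T (v l))) i) (int j) ((v(l := T (v l))) l'))) x \<psi>)"
    proof (rule corr_Cons[OF _ dist])
      show "admissible (i # js) \<theta> (v(l := T (v l))) \<psi>" using Cons.prems(2) T by (auto simp: admissible_def)
      show "mode_bound (Suc K) \<theta> ((v(l := T (v l))) i) (v(l := T (v l))) js \<psi>" using b3[OF l] li by simp
    qed
    also have "(\<Sum>l'\<in>set js. \<Sum>j<Suc K. (1 / (x i - x l')) ^ Suc j *
         corr js \<theta> ((v(l := T (v l)))(l' := mode V ((v(l := T (v l))) i) (int j) ((v(l := T (v l))) l'))) x \<psi>)
       = (\<Sum>l'\<in>set js. (\<Sum>j<Suc K. (1 / (x i - x l')) ^ Suc j * C' l l' j) +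
           (if l' = l then (\<Sum>j<Suc K. of_nat j * ((1 / (x i - x l)) ^ Suc j * C l (j - 1) q0)) else 0))"
      unfolding eq by (intro sum.cong refl) (auto simp: 3 ring_distribs sum.distrib mult_ac simp del: sum.lessThan_Suc power_Suc fun_upd_apply)
    also have "\<dots> = (\<Sum>l'\<in>set js. \<Sum>j<Suc K. (1 / (x i - x l')) ^ Suc j * C' l l' j) +
           (\<Sum>j<Suc K. of_nat j * ((1 / (x i - x l)) ^ Suc j * C l (j - 1) q0))"
      using l by (simp add: sum.distrib sum.delta del: sum.lessThan_Suc)
    also have "(\<Sum>j<Suc K. of_nat j * ((1 / (x i - x l)) ^ Suc j * C l (j - 1) q0)) =
       (\<Sum>j<Suc K. of_nat (Suc j) * ((1 / (x i - x l)) ^ Suc (Suc j) * C l j q0))"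
    proof (rule sum_shift_derivative[of "\<lambda>k. C l k q0" K "\<lambda>k. (1 / (x i - x l)) ^ k"])
      show "C l K q0 = 0"
        unfolding C_def
        by (rule corr_0_field[where l = l])
           (use b0 v \<psi> l dist dualvec_zero[OF \<theta>] subspace_0[OF carr_subspace[OF V_module]] in \<open>auto simp: mode_bound_def\<close>)
    qed
    finally show ?thesis unfolding eq A'_def B'_def by (simp only: add.assoc)
  qed
  have D1: "?D1 = D i * corr (i # js) \<theta> (v(i := T (v i))) x \<psi> + (\<Sum>l\<in>set js. D l * corr (i # js) \<theta> (v(l := T (v l))) x \<psi>)"
  proof -
    have swap: "(\<Sum>a\<in>I. c a * (\<Sum>l\<in>J. D l * F l a)) = (\<Sum>l\<in>J. D l * (\<Sum>a\<in>I. c a * F l a))"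
      for I J :: "nat set" and c :: "nat \<Rightarrow> complex" and F
      unfolding sum_distrib_left by (subst sum.swap) (simp only: mult.left_commute)
    define SA SB where "SA = (\<Sum>a<Suc K. of_nat a * (x i ^ (a - 1) * A a q0))"
      and "SB = (\<Sum>k<Suc K. of_nat (Suc k) * ((1 / x i) ^ Suc (Suc k) * Bf k q0))"
    define SC where "SC = (\<lambda>l. \<Sum>j<Suc K. of_nat (Suc j) * ((1 / (x i - x l)) ^ Suc (Suc j) * C l j q0))"
    have "?D1 = (D i * SA + (\<Sum>l\<in>set js. D l * (\<Sum>a<Suc K. x i ^ a * A' l a))) +
        (- D i * SB + (\<Sum>l\<in>set js. D l * (\<Sum>k<Suc K. (1 / x i) ^ Suc k * B' l k))) +
        (\<Sum>l\<in>set js. - (D i - D l) * SC l + (\<Sum>l'\<in>set js. D l' * (\<Sum>j<Suc K. (1 / (x i - x l)) ^ Suc j * C' l' l j)))"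
      unfolding SA_def SB_def SC_def by (simp only: sum.distrib sum_distrib_left[symmetric] swap)
    also have "\<dots> = D i * (SA - SB - (\<Sum>l\<in>set js. SC l)) + (\<Sum>l\<in>set js. D l * ((\<Sum>a<Suc K. x i ^ a * A' l a) +
         (\<Sum>k<Suc K. (1 / x i) ^ Suc k * B' l k) + (\<Sum>l'\<in>set js. \<Sum>j<Suc K. (1 / (x i - x l')) ^ Suc j * C' l l' j) + SC l))"
    proof -
      have "(\<Sum>l\<in>set js. \<Sum>l'\<in>set js. D l' * (\<Sum>j<Suc K. (1 / (x i - x l)) ^ Suc j * C' l' l j)) =
         (\<Sum>l\<in>set js. D l * (\<Sum>l'\<in>set js. \<Sum>j<Suc K. (1 / (x i - x l')) ^ Suc j * C' l l' j))"
        by (subst sum.swap) (simp only: sum_distrib_left)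
      then show ?thesis
        by (simp add: sum.distrib ring_distribs sum_subtractf sum_distrib_left[symmetric] sum_negf del: sum.lessThan_Suc)
    qed
    finally show ?thesis by (simp only: Ei El SA_def SB_def SC_def cong: sum.cong)
  qed
  also have "\<dots> = (\<Sum>l\<in>set (i # js). D l * corr (i # js) \<theta> (v(l := vir V V (-1) (v l))) (X q0) \<psi>)"
    unfolding list.set sum.insert[OF finite_set i] T_def x_def ..
  finally show ?case by (rule DERIV_cong[OF deriv])
qed

end

section \<open>Moebius covariance of quasiprimary fields\<close>

lemma laurent_monom_scale:
  assumes "c \<noteq> 0" "finite I"
  shows "laurent_monom I (\<lambda>i. c * x i) \<kappa> = c powi (\<Sum>i\<in>I. - \<kappa> i - 1) * laurent_monom I x \<kappa>"
  using assms(2)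
proof (induction I rule: finite_induct)
  case (insert i I)
  then show ?case using assms(1)
    by (simp add: laurent_monom_def power_int_mult_distrib power_int_add mult_ac)
qed (simp add: laurent_monom_def)

context graded_module
begin

text \<open>The correlator is homogeneous: the powers of the variables in each term are determined by
  the difference of the weights on the two sides.\<close>

lemma corr_scaling:
  assumes js: "sorted_wrt (<) js" and \<theta>: "dualvec \<theta>" and \<theta>a: "\<And>n w. n \<noteq> a \<Longrightarrow> w \<in> lev n \<Longrightarrow> \<theta> w = 0"
    and \<psi>: "\<psi> \<in> lev d" and v: "\<And>l. l \<in> set js \<Longrightarrow> v l \<in> wspace V V (of_nat (wt l))"
    and c: "c \<noteq> 0" and x: "x \<in> config (set js)"
  shows "corr js \<theta> v (\<lambda>i. c * x i) \<psi> =
     c powi (int a - int d - (\<Sum>l\<in>set js. int (wt l))) * corr js \<theta> v x \<psi>"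
proof (rule rat_on_eqI[OF _ _ finite_set radial_config _ x])
  have dist: "distinct js" using js strict_sorted_iff by blast
  have adm: "admissible js \<theta> v \<psi>" using \<theta> v \<psi> by (auto simp: admissible_def wspace_def)
  show "rat_on (config (set js)) (\<lambda>x. c powi (int a - int d - (\<Sum>l\<in>set js. int (wt l))) * corr js \<theta> v x \<psi>)"
    by (intro rat_intros rat_on_corr dist adm)
  show "rat_on (config (set js)) (\<lambda>x. corr js \<theta> v (\<lambda>i. c * x i) \<psi>)"
    by (rule rat_on_compose[OF rat_on_corr[OF dist adm], where \<sigma> = "\<lambda>x i. c * x i"])
       (use c in \<open>auto intro!: rat_intros simp: config_def inj_on_def\<close>)
  fix x assume x: "x \<in> radially_ordered (set js)"
  then have cx: "(\<lambda>i. c * x i) \<in> radially_ordered (set js)"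
    using c by (auto simp: radially_ordered_def norm_mult)
  have weight: "vprod M js v \<kappa> \<psi> \<in> wspace V M (h + of_int (int d + (\<Sum>l\<in>set js. int (wt l) - \<kappa> l - 1)))" for \<kappa>
    using v dist
  proof (induction js)
    case (Cons i js)
    have "mode M (v i) (\<kappa> i) (vprod M js v \<kappa> \<psi>) \<in>
        wspace V M (h + of_int (int d + (\<Sum>l\<in>set js. int (wt l) - \<kappa> l - 1)) + of_nat (wt i) - of_int (\<kappa> i) - 1)"
      by (rule mode_wspace[OF M]) (use Cons in auto)
    then show ?case using Cons.prems(2) by (simp add: algebra_simps)
  qed (use \<psi> in simp)
  have vanish: "\<theta> (vprod M js v \<kappa> \<psi>) = 0" if "int d + (\<Sum>l\<in>set js. int (wt l) - \<kappa> l - 1) \<noteq> int a" for \<kappa>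
  proof -
    let ?e = "int d + (\<Sum>l\<in>set js. int (wt l) - \<kappa> l - 1)"
    show ?thesis
    proof (cases "?e \<ge> 0")
      case True
      then obtain m where m: "?e = int m" by (rule nonneg_int_cases)
      show ?thesis by (rule \<theta>a[of m]) (use that weight[of \<kappa>] in \<open>auto simp: m\<close>)
    next
      case False
      have "h + of_int ?e \<noteq> h + of_nat n" for n :: nat
      proof
        assume "h + of_int ?e = h + of_nat n"
        then have "(of_int ?e :: complex) = of_int (int n)" by simp
        then have "?e = int n" by (simp only: of_int_eq_iff)
        with False show False by simp
      qed
      then have "wspace V M (h + of_int ?e) = {0}" by (rule wspace_trivial)
      then show ?thesis using weight[of \<kappa>] dualvec_zero[OF \<theta>] by auto
    qed
  qed
  have "((\<lambda>\<kappa>. c powi (int a - int d - (\<Sum>l\<in>set js. int (wt l))) * (\<theta> (vprod M js v \<kappa> \<psi>) * laurent_monom (set js) x \<kappa>))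
      has_sum c powi (int a - int d - (\<Sum>l\<in>set js. int (wt l))) * corr js \<theta> v x \<psi>) (PiE (set js) (\<lambda>_. UNIV))"
    by (intro has_sum_cmult_right has_sum_corr js adm x)
  also have "(\<lambda>\<kappa>. c powi (int a - int d - (\<Sum>l\<in>set js. int (wt l))) * (\<theta> (vprod M js v \<kappa> \<psi>) * laurent_monom (set js) x \<kappa>))
      = (\<lambda>\<kappa>. \<theta> (vprod M js v \<kappa> \<psi>) * laurent_monom (set js) (\<lambda>i. c * x i) \<kappa>)"
  proof
    fix \<kappa>
    have "int a - int d - (\<Sum>l\<in>set js. int (wt l)) = (\<Sum>i\<in>set js. - \<kappa> i - 1)" if "\<theta> (vprod M js v \<kappa> \<psi>) \<noteq> 0"
    proof -
      have "int d + (\<Sum>l\<in>set js. int (wt l) - \<kappa> l - 1) = int a" using vanish[of \<kappa>] that by blast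
      moreover have "(\<Sum>l\<in>set js. int (wt l) - \<kappa> l - 1) = (\<Sum>l\<in>set js. int (wt l)) + (\<Sum>i\<in>set js. - \<kappa> i - 1)"
        by (subst sum.distrib[symmetric]) (simp add: algebra_simps)
      ultimately show ?thesis by simp
    qed
    then show "c powi (int a - int d - (\<Sum>l\<in>set js. int (wt l))) * (\<theta> (vprod M js v \<kappa> \<psi>) * laurent_monom (set js) x \<kappa>) =
        \<theta> (vprod M js v \<kappa> \<psi>) * laurent_monom (set js) (\<lambda>i. c * x i) \<kappa>"
      using laurent_monom_scale[OF c finite_set, of js x \<kappa>] by (cases "\<theta> (vprod M js v \<kappa> \<psi>) = 0") auto
  qed
  finally show "corr js \<theta> v (\<lambda>i. c * x i) \<psi> = c powi (int a - int d - (\<Sum>l\<in>set js. int (wt l))) * corr js \<theta> v x \<psi>"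
    using has_sum_corr[OF js adm cx] has_sum_unique by blast
qed

context
  fixes js :: "nat list" and v :: "nat \<Rightarrow> 'u" and wt :: "nat \<Rightarrow> nat"
  assumes js: "sorted_wrt (<) js" and qp: "\<And>l. l \<in> set js \<Longrightarrow> quasiprimary V (wt l) (v l)"
begin

lemma qp_wspace: "l \<in> set js \<Longrightarrow> v l \<in> wspace V V (of_nat (wt l))"
  and qp_vir1: "l \<in> set js \<Longrightarrow> vir V V 1 (v l) = 0"
  using qp by (auto simp: quasiprimary_def)

lemma qp_carr: "l \<in> set js \<Longrightarrow> v l \<in> carr V"
  using qp_wspace by (auto simp: wspace_def)

lemma qp_admissible: "dualvec \<theta> \<Longrightarrow> \<psi> \<in> carr M \<Longrightarrow> admissible js \<theta> v \<psi>"
  using qp_carr by (auto simp: admissible_def)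

text \<open>For quasiprimary fields the Ward identities of \<open>L(-1)\<close> and \<open>L(1)\<close> involve only derivatives in the positions and the
  weights.\<close>

lemma ward_conf:
  assumes "dualvec \<theta>" "\<psi> \<in> carr M" and x: "x \<in> config (set js)" and m: "m \<in> {0,2}"
  shows "corr js (\<lambda>w. \<theta> (mode M (conf V) m w)) v x \<psi> = corr js \<theta> v x (mode M (conf V) m \<psi>) +
    (\<Sum>l\<in>set js. x l powi m * corr js \<theta> (v(l := vir V V (-1) (v l))) x \<psi> +
       (of_int m * of_nat (wt l)) * x l powi (m - 1) * corr js \<theta> v x \<psi>)"
proof -
  have dist: "distinct js" using js strict_sorted_iff by blast
  note adm = qp_admissible[OF assms(1,2)]
  have "\<forall>l\<in>set js. \<exists>N. \<forall>j\<ge>N. mode V (conf V) (int j) (v l) = 0"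
    using mode_truncation[OF V_module conf_in qp_carr] by blast
  then obtain N0 where N0: "\<And>l j. l \<in> set js \<Longrightarrow> j \<ge> N0 l \<Longrightarrow> mode V (conf V) (int j) (v l) = 0" by metis
  define N where "N = (\<Sum>l\<in>set js. N0 l)"
  have N: "mode V (conf V) (int j) (v l) = 0" if "l \<in> set js" "j \<ge> Suc (Suc (Suc N))" for l j
  proof -
    have "N0 l \<le> N" unfolding N_def by (rule member_le_sum) (use that in auto)
    then show ?thesis using N0[of l j] that by simp
  qed
  have zero_field: "corr js \<theta> (v(l := 0)) x \<psi> = 0" if "l \<in> set js" for l
    by (rule corr_0_field[where l = l])
       (use adm that dist dualvec_zero subspace_0[OF carr_subspace[OF V_module]] in \<open>auto simp: admissible_def\<close>)
  have "(\<Sum>j<Suc (Suc (Suc N)). (of_int m gchoose j) * x l powi (m - int j) * corr js \<theta> (v(l := mode V (conf V) (int j) (v l))) x \<psi>)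
     = x l powi m * corr js \<theta> (v(l := vir V V (-1) (v l))) x \<psi> +
       (of_int m * of_nat (wt l)) * x l powi (m - 1) * corr js \<theta> v x \<psi>" if l: "l \<in> set js" for l
  proof -
    let ?t = "\<lambda>j. (of_int m gchoose j) * x l powi (m - int j) * corr js \<theta> (v(l := mode V (conf V) (int j) (v l))) x \<psi>"
    have "?t (Suc (Suc j)) = 0" for j
    proof (cases "j = 0")
      case True
      have "mode V (conf V) (int (Suc (Suc 0))) (v l) = 0" using qp_vir1[OF l] by (simp add: mode_conf)
      then show ?thesis using True zero_field[OF l] by simp
    next
      case False
      have "(of_int m gchoose Suc (Suc j) :: complex) = of_nat (nat m choose Suc (Suc j))"
        using m by (auto simp: binomial_gbinomial)
      also have "nat m choose Suc (Suc j) = 0" by (rule binomial_eq_0) (use m False in auto)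
      finally show ?thesis by simp
    qed
    then have "(\<Sum>j<Suc N. ?t (Suc (Suc j))) = 0" by (intro sum.neutral ballI)
    then have "(\<Sum>j<Suc (Suc (Suc N)). ?t j) = ?t 0 + ?t 1"
      using sum.lessThan_Suc_shift[of ?t "Suc (Suc N)"] sum.lessThan_Suc_shift[of "\<lambda>j. ?t (Suc j)" "Suc N"]
      by (simp only: add_0_right One_nat_def)
    also have "corr js \<theta> (v(l := mode V (conf V) (int 1) (v l))) x \<psi> = of_nat (wt l) * corr js \<theta> v x \<psi>"
    proof -
      have "mode V (conf V) (int 1) (v l) = 0 + of_nat (wt l) \<odot> v l"
        using qp_wspace[OF l] by (simp add: mode_conf wspace_def)
      then show ?thesis
        using corr_field_lin[OF js adm x l, of 0 "v l" "of_nat (wt l)"] qp_carr[OF l] zero_field[OF l]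
          subspace_0[OF carr_subspace[OF V_module]] by (simp del: add_0)
    qed
    finally show ?thesis by (simp add: mode_conf mult_ac del: sum.lessThan_Suc fun_upd_apply)
  qed
  then show ?thesis
    using ward_identity[OF js adm conf_in N x, where m = m] by (simp del: sum.lessThan_Suc fun_upd_apply)
qed

text \<open>Along a curve in a one-parameter family of Moebius maps, with the Jacobian factors of the
  quasiprimary fields, the correlator changes by the action of \<open>sl\<^sub>2\<close> on the two sides.\<close>

theorem primary_flow:
  assumes \<theta>: "dualvec \<theta>" and \<psi>: "\<psi> \<in> carr M"
    and X: "\<And>l. l \<in> set js \<Longrightarrow> ((\<lambda>q. X q l) has_field_derivative a * X q0 l ^ 2 + b) (at q0)"
    and g: "\<And>l. l \<in> set js \<Longrightarrow> ((\<lambda>q. g q l) has_field_derivative 2 * a * X q0 l * g q0 l) (at q0)"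
    and x: "X q0 \<in> config (set js)"
  shows "((\<lambda>q. (\<Prod>l\<in>set js. g q l ^ wt l) * corr js \<theta> v (X q) \<psi>) has_field_derivative
     (\<Prod>l\<in>set js. g q0 l ^ wt l) *
       (a * (corr js (\<lambda>w. \<theta> (vir V M 1 w)) v (X q0) \<psi> - corr js \<theta> v (X q0) (vir V M 1 \<psi>)) +
        b * (corr js (\<lambda>w. \<theta> (vir V M (-1) w)) v (X q0) \<psi> - corr js \<theta> v (X q0) (vir V M (-1) \<psi>)))) (at q0)"
proof -
  have dist: "distinct js" using js strict_sorted_iff by blast
  note adm = qp_admissible[OF \<theta> \<psi>]
  let ?x = "X q0" let ?G = "\<Prod>l\<in>set js. g q0 l ^ wt l"
  have "((\<lambda>q. \<Prod>l\<in>I. g q l ^ wt l) has_field_derivative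
      (\<Prod>l\<in>I. g q0 l ^ wt l) * (\<Sum>l\<in>I. 2 * a * of_nat (wt l) * ?x l)) (at q0)" if "finite I" "I \<subseteq> set js" for I
    using that
  proof (induction I rule: finite_induct)
    case (insert i I)
    have gi: "((\<lambda>q. g q i ^ wt i) has_field_derivative of_nat (wt i) * (2 * a * ?x i * g q0 i * g q0 i ^ (wt i - 1))) (at q0)"
      using DERIV_power[OF g, of i "wt i"] insert.prems by simp
    have p: "of_nat (wt i) * (g q0 i * g q0 i ^ (wt i - 1)) = of_nat (wt i) * g q0 i ^ wt i"
      by (cases "wt i") auto
    have "((\<lambda>q. g q i ^ wt i * (\<Prod>l\<in>I. g q l ^ wt l)) has_field_derivative
       of_nat (wt i) * (2 * a * ?x i * g q0 i * g q0 i ^ (wt i - 1)) * (\<Prod>l\<in>I. g q0 l ^ wt l) +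
       (\<Prod>l\<in>I. g q0 l ^ wt l) * (\<Sum>l\<in>I. 2 * a * of_nat (wt l) * ?x l) * g q0 i ^ wt i) (at q0)"
      by (rule DERIV_mult[OF gi insert.IH]) (use insert.prems in auto)
    also have "of_nat (wt i) * (2 * a * ?x i * g q0 i * g q0 i ^ (wt i - 1)) * (\<Prod>l\<in>I. g q0 l ^ wt l) =
       2 * a * ?x i * (of_nat (wt i) * (g q0 i * g q0 i ^ (wt i - 1))) * (\<Prod>l\<in>I. g q0 l ^ wt l)"
      by (simp only: mult_ac)
    finally show ?case using insert.hyps unfolding p by (simp add: algebra_simps)
  qed simp
  then have dG: "((\<lambda>q. \<Prod>l\<in>set js. g q l ^ wt l) has_field_derivative ?G * (\<Sum>l\<in>set js. 2 * a * of_nat (wt l) * ?x l)) (at q0)"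
    by blast
  have dC: "((\<lambda>q. corr js \<theta> v (X q) \<psi>) has_field_derivative
     (\<Sum>l\<in>set js. (a * ?x l ^ 2 + b) * corr js \<theta> (v(l := vir V V (-1) (v l))) ?x \<psi>)) (at q0)"
    by (rule corr_derivative[OF js adm X x])
  have W1: "corr js (\<lambda>w. \<theta> (vir V M 1 w)) v ?x \<psi> - corr js \<theta> v ?x (vir V M 1 \<psi>) =
     (\<Sum>l\<in>set js. ?x l ^ 2 * corr js \<theta> (v(l := vir V V (-1) (v l))) ?x \<psi> + 2 * of_nat (wt l) * ?x l * corr js \<theta> v ?x \<psi>)"
    using ward_conf[OF \<theta> \<psi> x, of 2] by (simp add: vir_def[of V M] del: fun_upd_apply)
  have Wm: "corr js (\<lambda>w. \<theta> (vir V M (-1) w)) v ?x \<psi> - corr js \<theta> v ?x (vir V M (-1) \<psi>) =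
     (\<Sum>l\<in>set js. corr js \<theta> (v(l := vir V V (-1) (v l))) ?x \<psi>)"
    using ward_conf[OF \<theta> \<psi> x, of 0] by (simp add: vir_def[of V M] del: fun_upd_apply)
  show ?thesis
    by (rule DERIV_cong[OF DERIV_mult[OF dG dC]], unfold W1 Wm)
       (simp add: sum.distrib sum_distrib_left ring_distribs mult_ac del: fun_upd_apply)
qed

end

end

lemma higher_deriv_chain:
  fixes F :: "nat \<Rightarrow> complex \<Rightarrow> complex"
  assumes S: "open S" and F: "\<And>p s. s \<in> S \<Longrightarrow> (F p has_field_derivative F (Suc p) s) (at s)" and "s \<in> S"
  shows "(deriv ^^ p) (F 0) s = F p s"
  using assms(3)
proof (induction p arbitrary: s)
  case (Suc p)
  have "\<forall>\<^sub>F w in nhds s. (deriv ^^ p) (F 0) w = F p w"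
    using eventually_nhds_in_open[OF S Suc.prems] by eventually_elim (rule Suc.IH)
  then have "deriv ((deriv ^^ p) (F 0)) s = deriv (F p) s" by (rule deriv_cong_ev) simp
  also have "\<dots> = F (Suc p) s" by (rule DERIV_imp_deriv[OF F[OF Suc.prems]])
  finally show ?case by simp
qed simp

context graded_module
begin

lemma vir1_lev: "w \<in> lev n \<Longrightarrow> i \<le> n \<Longrightarrow> (vir V M 1 ^^ i) w \<in> lev (n - i)"
proof (induction i)
  case (Suc i)
  then have "vir V M 1 ((vir V M 1 ^^ i) w) \<in> wspace V M (h + of_nat (n - i) - 1)"
    by (intro vir_wspace[OF M]) auto
  also have "h + of_nat (n - i) - 1 = h + of_nat (n - Suc i)"
    using Suc.prems(2) by (simp add: of_nat_diff algebra_simps)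
  finally show ?case by simp
qed simp

lemma vir1_lev0: "w \<in> lev 0 \<Longrightarrow> vir V M 1 w = 0"
proof -
  assume "w \<in> lev 0"
  then have "vir V M 1 w \<in> wspace V M (h - 1)" using vir_wspace(1)[OF M, of w h] by simp
  moreover have "h - 1 \<noteq> h + of_nat n" for n :: nat
  proof
    assume "h - 1 = h + of_nat n"
    then have "(of_nat (Suc n) :: complex) = 0" by (simp add: algebra_simps add_eq_0_iff2)
    then show False by (simp only: of_nat_eq_0_iff)
  qed
  ultimately show ?thesis using wspace_trivial[of "h - 1"] by auto
qed

lemma vir_diff: "w \<in> carr M \<Longrightarrow> w' \<in> carr M \<Longrightarrow> vir V M n (w - w') = vir V M n w - vir V M n w'"
  unfolding vir_def by (rule mode_diff[OF M conf_in])

lemma funpow_vir_in: "w \<in> carr M \<Longrightarrow> (vir V M n ^^ i) w \<in> carr M"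
  by (induction i) (auto intro: vir_in[OF M])

lemma funpow_vir_zero: "(vir V M n ^^ i) 0 = 0"
  by (induction i) (auto simp: vir_zero[OF M])

lemma funpow_vir_add: "w \<in> carr M \<Longrightarrow> w' \<in> carr M \<Longrightarrow> (vir V M n ^^ i) (w + w') = (vir V M n ^^ i) w + (vir V M n ^^ i) w'"
  by (induction i) (auto simp: vir_add[OF M] funpow_vir_in)

lemma funpow_vir_scale: "w \<in> carr M \<Longrightarrow> (vir V M n ^^ i) (c \<odot> w) = c \<odot> (vir V M n ^^ i) w"
  by (induction i) (auto simp: vir_scale[OF M] funpow_vir_in)

lemma vir1_lev_nilpotent: assumes "w \<in> lev n" "i > n" shows "(vir V M 1 ^^ i) w = 0"
proof -
  have "(vir V M 1 ^^ Suc n) w = 0"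
    using vir1_lev0[of "(vir V M 1 ^^ n) w"] vir1_lev[OF assms(1) order_refl] by simp
  moreover have "(vir V M 1 ^^ i) w = (vir V M 1 ^^ (i - Suc n)) ((vir V M 1 ^^ Suc n) w)"
    using assms(2) by (metis Suc_leI comp_apply funpow_add le_add_diff_inverse2)
  ultimately show ?thesis by (simp add: funpow_vir_zero)
qed

lemma vir1_nilpotent: assumes "w \<in> carr M" shows "\<exists>N. \<forall>i\<ge>N. (vir V M 1 ^^ i) w = 0"
proof -
  obtain N g where g: "\<And>n. g n \<in> lev n" "w = (\<Sum>n<N::nat. g n)"
    using level_decomposition[OF assms] by blast
  have gc: "g n \<in> carr M" for n using g(1) by (simp add: wspace_def)
  have "(vir V M 1 ^^ i) (\<Sum>n<K. g n) = (\<Sum>n<K. (vir V M 1 ^^ i) (g n))" for i K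
    by (induction K) (auto simp: funpow_vir_zero funpow_vir_add gc subspace_sum carr_subspace[OF M])
  then have "(vir V M 1 ^^ i) w = 0" if "i \<ge> N" for i
    unfolding g(2) using vir1_lev_nilpotent[OF g(1)] that by (simp add: sum.neutral)
  then show ?thesis by blast
qed

lemma dualvec_vir: "dualvec \<theta> \<Longrightarrow> dualvec (\<lambda>w. \<theta> (vir V M n w))"
  unfolding vir_def by (rule dualvec_mode) (auto simp: conf_in)

lemma dualvec_funpow_vir: "dualvec \<theta> \<Longrightarrow> dualvec (\<lambda>w. \<theta> ((vir V M n ^^ p) w))"
proof (induction p)
  case (Suc p)
  from dualvec_vir[OF Suc.IH[OF Suc.prems], of n] show ?case by (simp add: funpow_swap1)
qed simp

text \<open>The special conformal transformation \<open>x \<mapsto> x/(1-tx)\<close>: the Taylor series in \<open>t\<close> of the transformed correlator is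
  generated by \<open>L(1)\<close> acting on the left. Differentiating in \<open>t\<close> produces \<open>L(1)\<close> on the left and, with opposite sign, on
  \<open>\<psi>\<close>; the factor \<open>e\<^bsup>tL(1)\<^esup>\<close> on \<open>\<psi>\<close> cancels the second term.\<close>

lemma special_conformal_sums:
  assumes js: "sorted_wrt (<) js" and qp: "\<And>l. l \<in> set js \<Longrightarrow> quasiprimary V (wt l) (v l)"
    and \<theta>: "dualvec \<theta>" and \<psi>: "\<psi> \<in> carr M" and d: "(vir V M 1 ^^ Suc d) \<psi> = 0"
    and x: "x \<in> config (set js)" and t: "\<And>l. l \<in> set js \<Longrightarrow> norm (t * x l) < 1"
  shows "(\<lambda>p. t ^ p / fact p * corr js (\<lambda>w. \<theta> ((vir V M 1 ^^ p) w)) v x \<psi>) sums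
    ((\<Prod>l\<in>set js. (1 / (1 - t * x l) ^ 2) ^ wt l) *
      (\<Sum>i\<le>d. t ^ i / fact i * corr js \<theta> v (\<lambda>l. x l / (1 - t * x l)) ((vir V M 1 ^^ i) \<psi>)))"
proof -
  define b where "b = Max (insert 0 ((\<lambda>l. norm (x l)) ` set js))"
  \<comment> \<open>a disc in \<open>s\<close> on which no \<open>1 - s x\<^sub>l\<close> vanishes; it contains \<open>t\<close>\<close>
  define r where "r = (if b = 0 then norm t + 1 else 1 / b)"
  have bge: "norm (x l) \<le> b" if "l \<in> set js" for l unfolding b_def by (rule Max_ge) (use that in auto)
  have b0: "b \<ge> 0" unfolding b_def by (rule Max_ge) auto
  have "b = 0 \<or> (\<exists>l\<in>set js. b = norm (x l))"
    using Max_in[of "insert 0 ((\<lambda>l. norm (x l)) ` set js)"] unfolding b_def by auto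
  then have tr: "norm t < r"
    using t b0 by (auto simp: r_def norm_mult field_simps)
  have small: "norm (s * x l) < 1" if "s \<in> ball 0 r" "l \<in> set js" for s l
  proof (cases "b = 0")
    case True
    then have "norm (x l) = 0" using bge[OF that(2)] norm_ge_zero[of "x l"] by linarith
    then show ?thesis by simp
  next
    case False
    then have "norm s * b < 1" using that(1) b0 by (simp add: r_def field_simps)
    moreover have "norm s * norm (x l) \<le> norm s * b" by (rule mult_left_mono[OF bge[OF that(2)]]) simp
    ultimately show ?thesis by (simp add: norm_mult)
  qed
  have ne: "1 - s * x l \<noteq> 0" if "s \<in> ball 0 r" "l \<in> set js" for s l
    using small[OF that] by auto
  define X where "X = (\<lambda>s l. x l / (1 - s * x l))"
  define g where "g = (\<lambda>s l. 1 / (1 - s * x l) ^ 2)"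
  have Xconf: "X s \<in> config (set js)" if s: "s \<in> ball 0 r" for s
  proof -
    have "x l = x l'" if "X s l = X s l'" "l \<in> set js" "l' \<in> set js" for l l'
      using that ne[OF s that(2)] ne[OF s that(3)] by (simp add: X_def frac_eq_eq algebra_simps)
    then show ?thesis using x ne[OF s] by (auto simp: config_def inj_on_def X_def)
  qed
  define P where "P = (\<lambda>\<theta> i s. (\<Prod>l\<in>set js. g s l ^ wt l) * corr js \<theta> v (X s) ((vir V M 1 ^^ i) \<psi>))"
  \<comment> \<open>\<open>\<Phi> (p + 1)\<close> is the derivative of \<open>\<Phi> p\<close>, so these are the Taylor coefficients of \<open>\<Phi> 0\<close>\<close>
  define \<Phi> where "\<Phi> = (\<lambda>p s. \<Sum>i\<le>d. s ^ i / fact i * P (\<lambda>w. \<theta> ((vir V M 1 ^^ p) w)) i s)"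
  have dP: "(P \<theta>' i has_field_derivative P (\<lambda>w. \<theta>' (vir V M 1 w)) i s - P \<theta>' (Suc i) s) (at s)"
    if \<theta>': "dualvec \<theta>'" and s: "s \<in> ball 0 r" for \<theta>' i s
  proof -
    have dX: "((\<lambda>s. X s l) has_field_derivative 1 * X s l ^ 2 + 0) (at s)" if l: "l \<in> set js" for l
      unfolding X_def by (rule derivative_eq_intros refl ne[OF s l])+ (use ne[OF s l] in \<open>simp add: field_simps power2_eq_square\<close>)
    have dg: "((\<lambda>s. g s l) has_field_derivative 2 * 1 * X s l * g s l) (at s)" if l: "l \<in> set js" for l
    proof -
      have "((\<lambda>s. (1 / (1 - s * x l)) ^ Suc 1) has_field_derivative - (of_nat (Suc 1) * (1 / (1 - s * x l)) ^ Suc (Suc 1) * (- x l))) (at s)"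
        by (rule has_field_derivative_reciprocal_power) (use ne[OF s l] in \<open>auto intro!: derivative_eq_intros\<close>)
      moreover have "(\<lambda>s. (1 / (1 - s * x l)) ^ Suc 1) = (\<lambda>s. g s l)"
        by (simp add: g_def fun_eq_iff power2_eq_square)
      ultimately have "((\<lambda>s. g s l) has_field_derivative - (of_nat (Suc 1) * (1 / (1 - s * x l)) ^ Suc (Suc 1) * (- x l))) (at s)"
        by simp
      then show ?thesis by (rule DERIV_cong) (simp add: g_def X_def power2_eq_square)
    qed
    have "(P \<theta>' i has_field_derivative (\<Prod>l\<in>set js. g s l ^ wt l) *
       (1 * (corr js (\<lambda>w. \<theta>' (vir V M 1 w)) v (X s) ((vir V M 1 ^^ i) \<psi>) - corr js \<theta>' v (X s) (vir V M 1 ((vir V M 1 ^^ i) \<psi>))) +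
        0 * (corr js (\<lambda>w. \<theta>' (vir V M (-1) w)) v (X s) ((vir V M 1 ^^ i) \<psi>) - corr js \<theta>' v (X s) (vir V M (-1) ((vir V M 1 ^^ i) \<psi>))))) (at s)"
      unfolding P_def
      by (rule primary_flow[OF js qp \<theta>' funpow_vir_in[OF \<psi>] dX dg Xconf[OF s]])
    then show ?thesis by (rule DERIV_cong) (simp add: P_def algebra_simps)
  qed
  have Pd: "P \<theta>' (Suc d) s = 0" if "dualvec \<theta>'" for \<theta>' s
  proof -
    have "corr js \<theta>' v (X s) 0 = 0"
      by (rule corr_0_vector) (use qp dualvec_zero[OF that] in \<open>auto simp: quasiprimary_def wspace_def\<close>)
    then show ?thesis unfolding P_def d by simp
  qed
  have chain: "(\<Phi> p has_field_derivative \<Phi> (Suc p) s) (at s)" if s: "s \<in> ball 0 r" for p s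
  proof -
    let ?\<theta> = "\<lambda>w. \<theta> ((vir V M 1 ^^ p) w)"
    have \<theta>p: "dualvec ?\<theta>" by (rule dualvec_funpow_vir[OF \<theta>])
    have "(\<Phi> p has_field_derivative (\<Sum>i\<le>d. of_nat i * s ^ (i - 1) / fact i * P ?\<theta> i s +
        s ^ i / fact i * (P (\<lambda>w. ?\<theta> (vir V M 1 w)) i s - P ?\<theta> (Suc i) s))) (at s)"
      unfolding \<Phi>_def
    proof (rule DERIV_sum)
      fix i
      have "((\<lambda>s. s ^ i / fact i) has_field_derivative of_nat i * s ^ (i - 1) / fact i) (at s)"
        by (rule derivative_eq_intros refl)+ (simp_all add: field_simps)
      from DERIV_mult[OF this dP[OF \<theta>p s, of i]]
      show "((\<lambda>s. s ^ i / fact i * P ?\<theta> i s) has_field_derivative of_nat i * s ^ (i - 1) / fact i * P ?\<theta> i s +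
        s ^ i / fact i * (P (\<lambda>w. ?\<theta> (vir V M 1 w)) i s - P ?\<theta> (Suc i) s)) (at s)"
        by (rule DERIV_cong) (simp add: mult_ac)
    qed
    also have "(\<Sum>i\<le>d. of_nat i * s ^ (i - 1) / fact i * P ?\<theta> i s +
        s ^ i / fact i * (P (\<lambda>w. ?\<theta> (vir V M 1 w)) i s - P ?\<theta> (Suc i) s)) =
       (\<Sum>i\<le>d. s ^ i / fact i * P (\<lambda>w. ?\<theta> (vir V M 1 w)) i s) +
       ((\<Sum>i\<le>d. of_nat i * s ^ (i - 1) / fact i * P ?\<theta> i s) - (\<Sum>i\<le>d. s ^ i / fact i * P ?\<theta> (Suc i) s))"
      by (simp add: sum.distrib sum_subtractf ring_distribs)
    also have "(\<Sum>i\<le>d. of_nat i * s ^ (i - 1) / fact i * P ?\<theta> i s) = (\<Sum>i<d. s ^ i / fact i * P ?\<theta> (Suc i) s)"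
    proof -
      have "of_nat (Suc i) * s ^ (Suc i - 1) / fact (Suc i) = s ^ i / (fact i :: complex)" for i
        by (simp add: field_simps del: of_nat_Suc)
      then show ?thesis by (subst sum.atMost_shift) simp
    qed
    also have "\<dots> - (\<Sum>i\<le>d. s ^ i / fact i * P ?\<theta> (Suc i) s) = 0"
      using Pd[OF \<theta>p, of s] by (simp add: lessThan_Suc_atMost[symmetric])
    finally show ?thesis unfolding \<Phi>_def by (simp add: funpow_swap1)
  qed
  have hol: "\<Phi> 0 holomorphic_on ball 0 r"
    by (auto simp: holomorphic_on_open intro!: exI[of _ "\<Phi> 1 _"] chain[of _ 0, simplified])
  have "(\<lambda>n. (deriv ^^ n) (\<Phi> 0) 0 / fact n * (t - 0) ^ n) sums \<Phi> 0 t"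
    by (rule holomorphic_power_series[OF hol]) (use tr in simp)
  moreover have "(deriv ^^ n) (\<Phi> 0) 0 = corr js (\<lambda>w. \<theta> ((vir V M 1 ^^ n) w)) v x \<psi>" for n
  proof -
    have r0: "(0::complex) \<in> ball 0 r" using le_less_trans[OF norm_ge_zero tr] by simp
    have "(deriv ^^ n) (\<Phi> 0) 0 = \<Phi> n 0" by (rule higher_deriv_chain[where F = \<Phi>, OF open_ball chain r0])
    also have "\<dots> = P (\<lambda>w. \<theta> ((vir V M 1 ^^ n) w)) 0 0"
      unfolding \<Phi>_def by (subst sum.remove[of _ 0]) (auto intro!: sum.neutral)
    also have "\<dots> = corr js (\<lambda>w. \<theta> ((vir V M 1 ^^ n) w)) v x \<psi>"
      by (simp add: P_def g_def X_def)
    finally show ?thesis .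
  qed
  moreover have "\<Phi> 0 t = (\<Prod>l\<in>set js. (1 / (1 - t * x l) ^ 2) ^ wt l) *
      (\<Sum>i\<le>d. t ^ i / fact i * corr js \<theta> v (\<lambda>l. x l / (1 - t * x l)) ((vir V M 1 ^^ i) \<psi>))"
    by (simp add: \<Phi>_def P_def g_def X_def sum_distrib_left mult_ac)
  ultimately show ?thesis by (simp add: mult_ac)
qed

subsection \<open>The exponential of \<open>-s L(1)\<close>\<close>

text \<open>This is \<open>e\<^bsup>-s L(1)\<^esup> w\<close>, a finite sum because \<open>L(1)\<close> lowers the level.\<close>

definition exp_L1 :: "complex \<Rightarrow> 'u \<Rightarrow> 'u" where
  "exp_L1 s w = Sum_any (\<lambda>i. ((- s) ^ i / fact i) \<odot> (vir V M 1 ^^ i) w)"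

lemma exp_L1_eq:
  assumes "\<And>i. i \<ge> N \<Longrightarrow> (vir V M 1 ^^ i) w = 0"
  shows "exp_L1 s w = (\<Sum>i<N. ((- s) ^ i / fact i) \<odot> (vir V M 1 ^^ i) w)"
  unfolding exp_L1_def by (rule Sum_any_bounded) (simp add: assms)

lemma exp_L1_in: assumes "w \<in> carr M" shows "exp_L1 s w \<in> carr M"
proof -
  obtain N where "\<And>i. i \<ge> N \<Longrightarrow> (vir V M 1 ^^ i) w = 0" using vir1_nilpotent[OF assms] by blast
  then show ?thesis
    by (subst exp_L1_eq) (auto intro!: subspace_sum subspace_scale carr_subspace[OF M] funpow_vir_in assms)
qed

lemma exp_L1_0: "exp_L1 0 w = w"
  unfolding exp_L1_def by (subst Sum_any.expand_superset[of "{0}"]) (auto simp: power_0_left split: if_splits)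

lemma exp_L1_lin:
  assumes w: "w \<in> carr M" "w' \<in> carr M"
  shows exp_L1_add: "exp_L1 s (w + w') = exp_L1 s w + exp_L1 s w'" and exp_L1_scale': "exp_L1 s (c \<odot> w) = c \<odot> exp_L1 s w"
proof -
  obtain N1 where N1: "\<And>i. i \<ge> N1 \<Longrightarrow> (vir V M 1 ^^ i) w = 0" using vir1_nilpotent[OF w(1)] by blast
  obtain N2 where N2: "\<And>i. i \<ge> N2 \<Longrightarrow> (vir V M 1 ^^ i) w' = 0" using vir1_nilpotent[OF w(2)] by blast
  define N where "N = max N1 N2"
  have N: "(vir V M 1 ^^ i) w = 0" "(vir V M 1 ^^ i) w' = 0" "(vir V M 1 ^^ i) (w + w') = 0" "(vir V M 1 ^^ i) (c \<odot> w) = 0"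
    if "i \<ge> N" for i
    using that N1 N2 by (auto simp: N_def funpow_vir_add funpow_vir_scale w)
  show "exp_L1 s (w + w') = exp_L1 s w + exp_L1 s w'"
    using N by (simp add: exp_L1_eq[of N] funpow_vir_add w scale_right_distrib sum.distrib)
  show "exp_L1 s (c \<odot> w) = c \<odot> exp_L1 s w"
    using N by (simp add: exp_L1_eq[of N] funpow_vir_scale w scale_sum_right mult.commute)
qed

lemma exp_L1_scale: "w \<in> carr M \<Longrightarrow> exp_L1 s (c \<odot> w) = c \<odot> exp_L1 s w"
  by (rule exp_L1_scale')

lemma vir1_exp_L1: assumes w: "w \<in> carr M" shows "vir V M 1 (exp_L1 s w) = exp_L1 s (vir V M 1 w)"
proof -
  obtain N where N: "\<And>i. i \<ge> N \<Longrightarrow> (vir V M 1 ^^ i) w = 0" using vir1_nilpotent[OF w] by blast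
  then have N': "(vir V M 1 ^^ i) (vir V M 1 w) = 0" if "i \<ge> N" for i
    using N[OF that] vir_zero[OF M] by (metis funpow_swap1)
  have "vir V M 1 (\<Sum>i\<in>A. c i \<odot> (vir V M 1 ^^ i) w) = (\<Sum>i\<in>A. c i \<odot> vir V M 1 ((vir V M 1 ^^ i) w))" for A and c :: "nat \<Rightarrow> complex"
    by (induction A rule: infinite_finite_induct)
       (auto simp: vir_zero[OF M] vir_add[OF M] vir_scale[OF M] funpow_vir_in w subspace_sum subspace_scale carr_subspace[OF M])
  then show ?thesis using N N' by (simp add: exp_L1_eq[of N] funpow_swap1)
qed

text \<open>Commuting \<open>L(-1)\<close> past \<open>L(1)\<^sup>i\<close> in \<open>sl\<^sub>2\<close>.\<close>

lemma virm1_power: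
  assumes w: "w \<in> carr M"
  shows "vir V M (-1) ((vir V M 1 ^^ i) w) = (vir V M 1 ^^ i) (vir V M (-1) w)
     - (2 * of_nat i) \<odot> (vir V M 1 ^^ (i - 1)) (vir V M 0 w) + (of_nat i * of_nat (i - 1)) \<odot> (vir V M 1 ^^ (i - 1)) w"
proof (induction i)
  case (Suc i)
  let ?L = "vir V M 1"
  have L0: "vir V M 0 ((?L ^^ i) w) = (?L ^^ i) (vir V M 0 w) - of_nat i \<odot> (?L ^^ i) w" for i
  proof (induction i)
    case (Suc i)
    have "vir V M 0 (?L ((?L ^^ i) w)) = ?L (vir V M 0 ((?L ^^ i) w)) - ?L ((?L ^^ i) w)"
      by (rule vir_commute(3)[OF M funpow_vir_in[OF w]])
    also have "?L (vir V M 0 ((?L ^^ i) w)) = ?L ((?L ^^ i) (vir V M 0 w)) - of_nat i \<odot> ?L ((?L ^^ i) w)"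
      unfolding Suc.IH using w by (simp add: vir_diff vir_scale[OF M] funpow_vir_in vir_in[OF M] subspace_scale carr_subspace[OF M])
    finally show ?case by (simp add: scale_left_distrib)
  qed simp
  have "vir V M (-1) (?L ((?L ^^ i) w)) = ?L (vir V M (-1) ((?L ^^ i) w)) - 2 \<odot> vir V M 0 ((?L ^^ i) w)"
    using vir_commute(1)[OF M funpow_vir_in[OF w, where n = 1 and i = i]] by (simp add: algebra_simps)
  also have "?L (vir V M (-1) ((?L ^^ i) w)) = ?L ((?L ^^ i) (vir V M (-1) w))
     - (2 * of_nat i) \<odot> ?L ((?L ^^ (i - 1)) (vir V M 0 w)) + (of_nat i * of_nat (i - 1)) \<odot> ?L ((?L ^^ (i - 1)) w)"
    unfolding Suc.IH
    using vir_in[OF M w] w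
    by (simp add: vir_add[OF M] vir_diff vir_scale[OF M] funpow_vir_in vir_in[OF M] subspace_scale subspace_diff carr_subspace[OF M])
  also have "(2 * of_nat i) \<odot> ?L ((?L ^^ (i - 1)) (vir V M 0 w)) = (2 * of_nat i) \<odot> (?L ^^ i) (vir V M 0 w)"
    by (cases i) auto
  also have "(of_nat i * of_nat (i - 1)) \<odot> ?L ((?L ^^ (i - 1)) w) = (of_nat i * of_nat (i - 1)) \<odot> (?L ^^ i) w"
    by (cases i) auto
  finally have eq: "vir V M (-1) (?L ((?L ^^ i) w)) = ?L ((?L ^^ i) (vir V M (-1) w)) - (2 * of_nat i) \<odot> (?L ^^ i) (vir V M 0 w)
      + (of_nat i * of_nat (i - 1)) \<odot> (?L ^^ i) w - 2 \<odot> ((?L ^^ i) (vir V M 0 w) - of_nat i \<odot> (?L ^^ i) w)"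
    by (simp only: L0)
  have c: "of_nat (Suc i) * of_nat i = of_nat i * of_nat (i - 1) + (2 * of_nat i :: complex)"
    by (cases i) (auto simp: algebra_simps)
  show ?case
    unfolding funpow.simps o_apply eq diff_Suc_1 c by (simp add: algebra_simps)
qed simp

text \<open>The adjoint action \<open>e\<^bsup>L(1)\<^esup> L(-1) e\<^bsup>-L(1)\<^esup> = L(-1) + 2 L(0) + L(1)\<close>.\<close>

lemma virm1_exp_L1:
  assumes w: "w \<in> carr M"
  shows "vir V M (-1) (exp_L1 1 w) = exp_L1 1 (vir V M (-1) w + 2 \<odot> vir V M 0 w + vir V M 1 w)"
proof -
  note c = vir_in[OF M w]
  obtain N0 where N0: "\<And>i. i \<ge> N0 \<Longrightarrow> (vir V M 1 ^^ i) w = 0" using vir1_nilpotent[OF w] by blast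
  obtain N1 where N1: "\<And>i. i \<ge> N1 \<Longrightarrow> (vir V M 1 ^^ i) (vir V M (-1) w) = 0" using vir1_nilpotent[OF c] by blast
  obtain N2 where N2: "\<And>i. i \<ge> N2 \<Longrightarrow> (vir V M 1 ^^ i) (vir V M 0 w) = 0" using vir1_nilpotent[OF c] by blast
  define N where "N = N0 + N1 + N2"
  let ?L = "vir V M 1" and ?e = "\<lambda>i. ((- 1) ^ i / fact i :: complex)"
  have N: "(?L ^^ i) w = 0" "(?L ^^ i) (vir V M (-1) w) = 0" "(?L ^^ i) (vir V M 0 w) = 0" if "i \<ge> N" for i
    using that N0 N1 N2 by (auto simp: N_def)
  have N3: "(?L ^^ i) (?L w) = 0" if "i \<ge> N" for i
    using N(1)[OF that] vir_zero[OF M] by (metis funpow_swap1)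
  have "vir V M (-1) (\<Sum>i\<in>A. d i \<odot> (?L ^^ i) w) = (\<Sum>i\<in>A. d i \<odot> vir V M (-1) ((?L ^^ i) w))" for A and d :: "nat \<Rightarrow> complex"
    by (induction A rule: infinite_finite_induct)
       (auto simp: vir_zero[OF M] vir_add[OF M] vir_scale[OF M] funpow_vir_in w subspace_sum subspace_scale carr_subspace[OF M])
  then have "vir V M (-1) (exp_L1 1 w) = (\<Sum>i<Suc (Suc N). ?e i \<odot> vir V M (-1) ((?L ^^ i) w))"
    by (subst exp_L1_eq[of "Suc (Suc N)"]) (auto simp: N simp del: sum.lessThan_Suc)
  also have "\<dots> = (\<Sum>i<Suc (Suc N). ?e i \<odot> (?L ^^ i) (vir V M (-1) w))
      - (\<Sum>i<Suc (Suc N). (?e i * (2 * of_nat i)) \<odot> (?L ^^ (i - 1)) (vir V M 0 w))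
      + (\<Sum>i<Suc (Suc N). (?e i * (of_nat i * of_nat (i - 1))) \<odot> (?L ^^ (i - 1)) w)"
    unfolding virm1_power[OF w]
    by (simp add: scale_right_distrib scale_right_diff_distrib sum.distrib sum_subtractf del: sum.lessThan_Suc)
  also have "(\<Sum>i<Suc (Suc N). ?e i \<odot> (?L ^^ i) (vir V M (-1) w)) = exp_L1 1 (vir V M (-1) w)"
    by (subst exp_L1_eq[of "Suc (Suc N)"]) (auto simp: N simp del: sum.lessThan_Suc)
  also have "(\<Sum>i<Suc (Suc N). (?e i * (2 * of_nat i)) \<odot> (?L ^^ (i - 1)) (vir V M 0 w)) = - (2 \<odot> exp_L1 1 (vir V M 0 w))"
  proof -
    have e: "?e (Suc i) * (2 * of_nat (Suc i)) = - 2 * ?e i" for i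
      by (simp add: field_simps del: of_nat_Suc)
    have "(\<Sum>i<Suc (Suc N). (?e i * (2 * of_nat i)) \<odot> (?L ^^ (i - 1)) (vir V M 0 w)) =
       (\<Sum>i<Suc N. (- 2 * ?e i) \<odot> (?L ^^ i) (vir V M 0 w))"
      unfolding sum.lessThan_Suc_shift[of _ "Suc N"] e by simp
    also have "\<dots> = - 2 \<odot> (\<Sum>i<Suc N. ?e i \<odot> (?L ^^ i) (vir V M 0 w))"
      by (simp only: scale_sum_right scale_scale)
    also have "(\<Sum>i<Suc N. ?e i \<odot> (?L ^^ i) (vir V M 0 w)) = exp_L1 1 (vir V M 0 w)"
      by (subst exp_L1_eq[of "Suc N"]) (auto simp: N simp del: sum.lessThan_Suc)
    finally show ?thesis by simp
  qed
  also have "(\<Sum>i<Suc (Suc N). (?e i * (of_nat i * of_nat (i - 1))) \<odot> (?L ^^ (i - 1)) w) = exp_L1 1 (?L w)"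
  proof -
    have e: "?e (Suc (Suc i)) * (of_nat (Suc (Suc i)) * of_nat (Suc i)) = ?e i" for i
      by (simp add: field_simps del: of_nat_Suc)
    have "(\<Sum>i<Suc (Suc N). (?e i * (of_nat i * of_nat (i - 1))) \<odot> (?L ^^ (i - 1)) w) =
       (\<Sum>i<N. ?e i \<odot> (?L ^^ i) (?L w))"
      unfolding sum.lessThan_Suc_shift[of _ "Suc N"] sum.lessThan_Suc_shift[of _ N] diff_Suc_1 e
      by (simp add: funpow_swap1)
    also have "\<dots> = exp_L1 1 (?L w)"
      by (subst exp_L1_eq[of N]) (auto simp: N3)
    finally show ?thesis .
  qed
  finally show ?thesis
    using c by (simp add: exp_L1_add exp_L1_scale subspace_add subspace_scale carr_subspace[OF M])
qed

end

section \<open>Dual pairs of modules and the trace functional\<close>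

text \<open>The conformal vector is quasiprimary of weight \<open>2\<close>, so only the term \<open>j = 0\<close> of the adjoint formula survives.\<close>

lemma (in voa_space) contragredient_vir:
  fixes M M' :: "'u vmod"
  assumes M: "weak_module V M" and M': "weak_module V M'" and pairing: "contragredient_pairing V M M' f"
    and w: "w \<in> carr M" "w' \<in> carr M'"
  shows "f w (vir V M' n w') = f (vir V M (- n) w) w'"
proof -
  have f0: "f 0 w' = 0"
    by (rule lin_on_complex_zero[OF _ carr_subspace[OF M], of "\<lambda>w. f w w'"])
       (use pairing w in \<open>auto simp: contragredient_pairing_def\<close>)
  have "f w (mode M' (conf V) (n + 1) w') =
      (\<Sum>j\<le>2. (-1) ^ 2 / fact j * f (mode M ((vir V V 1 ^^ j) (conf V)) (2 * int 2 - int j - (n + 1) - 2) w) w')"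
    using pairing w conf_wspace unfolding contragredient_pairing_def by fastforce
  then have "f w (mode M' (conf V) (n + 1) w') = f (mode M (conf V) (1 - n) w) w'"
    using w by (simp add: numeral_2_eq_2 mode_zero_left[OF M] f0 conf_primary vir_zero[OF V_module])
  then show ?thesis by (simp add: vir_def)
qed

text \<open>The graded module of the ambient locale is the contragredient \<open>M'\<close>: fields act on it, while \<open>M\<close> supplies the
  functionals \<open>\<langle>\<phi>,\<cdot>\<rangle>\<close>.\<close>

locale dual_pair = graded_module scale V M' h
  for scale :: "complex \<Rightarrow> 'u::ab_group_add \<Rightarrow> 'u" (infixr \<open>\<odot>\<close> 75) and V :: "'u voa"
    and M' :: "'u vmod" and h :: complex +
  fixes M :: "'u vmod" and f :: "'u \<Rightarrow> 'u \<Rightarrow> complex" and B :: "nat \<Rightarrow> 'u set" and B' :: "'u \<Rightarrow> 'u"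
  assumes Mw: "weak_module V M" and Mgraded: "carr M = span (\<Union>n::nat. wspace V M (h + of_nat n))"
    and pairing: "contragredient_pairing V M M' f"
    and B_span: "span (B m) = wspace V M (h + of_nat m)" and B_finite: "finite (B m)"
    and B'_in: "b \<in> B m \<Longrightarrow> B' b \<in> carr M'"
    and B_dual: "b \<in> B m \<Longrightarrow> c \<in> B l \<Longrightarrow> f c (B' b) = (if c = b then 1 else 0)"
begin

sublocale left: graded_module scale V M h
  by unfold_locales (rule Mw Mgraded)+

lemma f_lin: "w' \<in> carr M' \<Longrightarrow> lin_on (*) (carr M) (\<lambda>w. f w w')" "w \<in> carr M \<Longrightarrow> lin_on (*) (carr M') (f w)"
  using pairing by (auto simp: contragredient_pairing_def)

lemmas f_add = lin_onD(1)[OF f_lin(2)] and f_scale = lin_onD(2)[OF f_lin(2)]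
  and f_add_left = lin_onD(1)[OF f_lin(1)] and f_scale_left = lin_onD(2)[OF f_lin(1)]

lemma f_zero: "w \<in> carr M \<Longrightarrow> f w 0 = 0" "w' \<in> carr M' \<Longrightarrow> f 0 w' = 0"
  using lin_on_complex_zero[OF f_lin(2) carr_subspace[OF M]] lin_on_complex_zero[OF f_lin(1) carr_subspace[OF Mw]] by auto

lemma f_sum: "w \<in> carr M \<Longrightarrow> (\<And>a. a \<in> A \<Longrightarrow> g a \<in> carr M') \<Longrightarrow> f w (\<Sum>a\<in>A. g a) = (\<Sum>a\<in>A. f w (g a))"
  by (rule lin_on_complex_sum[OF f_lin(2) carr_subspace[OF M]])

lemma f_sum_left: "w' \<in> carr M' \<Longrightarrow> (\<And>a. a \<in> A \<Longrightarrow> g a \<in> carr M) \<Longrightarrow> f (\<Sum>a\<in>A. g a) w' = (\<Sum>a\<in>A. f (g a) w')"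
  by (rule lin_on_complex_sum[OF f_lin(1) carr_subspace[OF Mw]])

lemma f_adjoint:
  "w \<in> carr M \<Longrightarrow> w' \<in> carr M' \<Longrightarrow> f w (vir V M' n w') = f (vir V M (- n) w) w'"
  by (rule contragredient_vir[OF Mw M pairing])

lemma f_orthogonal:
  assumes "w \<in> wspace V M \<mu>" "w' \<in> wspace V M' \<nu>" "\<mu> \<noteq> \<nu>" shows "f w w' = 0"
proof -
  have "f w (vir V M' 0 w') = f (vir V M 0 w) w'" using f_adjoint[of w w' 0] assms by (simp add: wspace_def)
  then have "\<nu> * f w w' = \<mu> * f w w'" using assms by (simp add: wspace_def f_scale f_scale_left)
  then show ?thesis using assms(3) by simp
qed

lemma f_nondegenerate:
  assumes w': "w' \<in> carr M'" and z: "\<And>w. w \<in> carr M \<Longrightarrow> f w w' = 0" shows "w' = 0"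
proof -
  have inj: "inj_on (\<lambda>w' w. if w \<in> carr M then f w w' else 0) (carr M')"
    using pairing by (auto simp: contragredient_pairing_def bij_betw_def)
  show ?thesis
    by (rule inj_onD[OF inj]) (use z w' subspace_0[OF carr_subspace[OF M]] in \<open>auto simp: fun_eq_iff f_zero\<close>)
qed

lemma f_dualvec: assumes "w \<in> carr M" shows "dualvec (f w)"
proof -
  obtain N g where g: "\<And>n. g n \<in> left.lev n" "w = (\<Sum>n<N::nat. g n)"
    using left.level_decomposition[OF assms] by blast
  have "f w w' = 0" if n: "n \<ge> N" and w': "w' \<in> lev n" for n w'
  proof -
    have "f w w' = (\<Sum>k<N. f (g k) w')" unfolding g(2) using g(1) w' by (intro f_sum_left) (auto simp: wspace_def)
    also have "\<dots> = 0" by (intro sum.neutral ballI f_orthogonal[OF g(1) w']) (use n in auto)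
    finally show ?thesis .
  qed
  then show ?thesis unfolding dualvec_def using f_lin(2)[OF assms] by blast
qed

lemma B_lev: "b \<in> B m \<Longrightarrow> b \<in> left.lev m" using B_span span_base by blast
lemma B_in: "b \<in> B m \<Longrightarrow> b \<in> carr M" using B_lev by (auto simp: wspace_def)

lemma left_expand:
  assumes "w \<in> left.lev m" shows "w = (\<Sum>b\<in>B m. f w (B' b) \<odot> b)"
proof -
  have "w \<in> span (B m)" using assms B_span by simp
  then obtain u where u: "w = (\<Sum>b\<in>B m. u b \<odot> b)" unfolding span_finite[OF B_finite] by auto
  have "f w (B' b) = u b" if "b \<in> B m" for b
  proof -
    have "f w (B' b) = (\<Sum>c\<in>B m. u c * f c (B' b))"
      unfolding u using that by (simp add: f_sum_left f_scale_left B'_in B_in subspace_scale carr_subspace[OF Mw])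
    also have "\<dots> = (\<Sum>c\<in>B m. if c = b then u c else 0)" by (intro sum.cong) (auto simp: B_dual[OF that])
    finally show ?thesis using that B_finite by simp
  qed
  then show ?thesis using u by simp
qed

lemma right_eqI:
  assumes "w \<in> carr M'" "w' \<in> carr M'" "\<And>m b. b \<in> B m \<Longrightarrow> f b w = f b w'" shows "w = w'"
proof -
  have "f \<phi> (w - w') = 0" if \<phi>: "\<phi> \<in> carr M" for \<phi>
  proof -
    obtain N g where g: "\<And>n. g n \<in> left.lev n" "\<phi> = (\<Sum>n<N::nat. g n)"
      using left.level_decomposition[OF \<phi>] by blast
    have gM: "g n \<in> carr M" for n using g(1) by (simp add: wspace_def)
    have "f (g n) w = f (g n) w'" for n
    proof -
      have "f (\<Sum>b\<in>B n. c b \<odot> b) w = f (\<Sum>b\<in>B n. c b \<odot> b) w'" for c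
        using assms by (simp add: f_sum_left f_scale_left B_in subspace_scale carr_subspace[OF Mw])
      then show ?thesis using left_expand[OF g(1)] by metis
    qed
    then have "f \<phi> w = f \<phi> w'" unfolding g(2) using assms gM by (simp add: f_sum_left)
    then show ?thesis using lin_on_complex_diff[OF f_lin(2)[OF \<phi>] carr_subspace[OF M] assms(1,2)] by simp
  qed
  then have "w - w' = 0" using assms by (intro f_nondegenerate) (auto intro: subspace_diff carr_subspace[OF M])
  then show ?thesis by simp
qed

text \<open>Both sides of the eigenvalue equation pair equally with all basis vectors, by invariance of \<open>L(0)\<close>.\<close>

lemma B'_lev: assumes b: "b \<in> B m" shows "B' b \<in> lev m"
proof -
  have "vir V M' 0 (B' b) = (h + of_nat m) \<odot> B' b"
  proof (rule right_eqI)
    fix l c assume c: "c \<in> B l"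
    have "f c (vir V M' 0 (B' b)) = (h + of_nat l) * f c (B' b)"
      using f_adjoint[OF B_in[OF c] B'_in[OF b], of 0] B_lev[OF c] B'_in[OF b] B_in[OF c]
      by (simp add: wspace_def f_scale_left)
    moreover have "f c (B' b) = 0" if "l \<noteq> m"
    proof (cases "c = b")
      case True
      have "(if a = l then b else (-1) \<odot> b) \<in> left.lev a" if "a \<in> {l, m}" for a
        using that B_lev[OF c] True subspace_scale[OF subspace_wspace[OF Mw] B_lev[OF b], of "-1"] by auto
      then have "(if l = l then b else (-1) \<odot> b) = 0"
        by (intro wspace_independent[OF Mw, of "{l, m}" "\<lambda>n. h + of_nat n" "\<lambda>n. if n = l then b else (-1) \<odot> b" l])
           (use that in \<open>auto simp: inj_on_def\<close>)
      then have "b = 0" by simp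
      then show ?thesis using True B'_in[OF b] by (simp add: f_zero)
    qed (use B_dual[OF b c] in simp)
    ultimately show "f c (vir V M' 0 (B' b)) = f c ((h + of_nat m) \<odot> B' b)"
      using B_in[OF c] B'_in[OF b] by (cases "l = m") (auto simp: f_scale)
  qed (use B'_in[OF b] in \<open>auto intro: vir_in[OF M] subspace_scale carr_subspace[OF M]\<close>)
  then show ?thesis using B'_in[OF b] by (simp add: wspace_def)
qed

lemma right_expand:
  assumes "w \<in> lev m" shows "w = (\<Sum>b\<in>B m. f b w \<odot> B' b)"
proof (rule right_eqI)
  show "(\<Sum>b\<in>B m. f b w \<odot> B' b) \<in> carr M'"
    by (intro subspace_sum subspace_scale carr_subspace[OF M] B'_in)
  fix l c assume c: "c \<in> B l"
  have *: "f c (\<Sum>b\<in>B m. f b w \<odot> B' b) = (\<Sum>b\<in>B m. f b w * f c (B' b))"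
    using B_in[OF c] by (simp add: f_sum f_scale B'_in subspace_scale carr_subspace[OF M])
  show "f c w = f c (\<Sum>b\<in>B m. f b w \<odot> B' b)"
  proof (cases "l = m")
    case True
    have "(\<Sum>b\<in>B m. f b w * f c (B' b)) = (\<Sum>b\<in>B m. if b = c then f b w else 0)"
      by (intro sum.cong refl) (auto simp: B_dual[OF _ c])
    then show ?thesis unfolding * using c True B_finite by simp
  next
    case False
    have "f c w = 0" by (rule f_orthogonal[OF B_lev[OF c] assms]) (use False in simp)
    moreover have "(\<Sum>b\<in>B m. f b w * f c (B' b)) = 0"
      by (intro sum.neutral ballI) (use f_orthogonal[OF B_lev[OF c] B'_lev] False in auto)
    ultimately show ?thesis unfolding * by simp
  qed
qed (use assms in \<open>simp add: wspace_def\<close>)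

subsection \<open>Bilinear forms\<close>

definition bil :: "('u \<Rightarrow> 'u \<Rightarrow> complex) \<Rightarrow> bool" where
  "bil \<beta> \<longleftrightarrow> (\<forall>\<phi>\<in>carr M. lin_on (*) (carr M') (\<beta> \<phi>)) \<and> (\<forall>\<psi>\<in>carr M'. lin_on (*) (carr M) (\<lambda>\<phi>. \<beta> \<phi> \<psi>))"

text \<open>The value of a form on the canonical tensor of level \<open>m\<close>, i.e. a trace over that level.\<close>

definition level_trace :: "nat \<Rightarrow> ('u \<Rightarrow> 'u \<Rightarrow> complex) \<Rightarrow> complex" where
  "level_trace m \<beta> = (\<Sum>b\<in>B m. \<beta> b (B' b))"

definition act :: "int \<Rightarrow> ('u \<Rightarrow> 'u \<Rightarrow> complex) \<Rightarrow> 'u \<Rightarrow> 'u \<Rightarrow> complex" where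
  "act n \<beta> \<phi> \<psi> = \<beta> (vir V M n \<phi>) \<psi> + \<beta> \<phi> (vir V M' n \<psi>)"

abbreviation Lminus where "Lminus \<equiv> act (-1)"
abbreviation Lplus where "Lplus \<equiv> act 1"

lemma bilD:
  assumes "bil \<beta>"
  shows "\<phi> \<in> carr M \<Longrightarrow> \<phi>' \<in> carr M \<Longrightarrow> \<psi> \<in> carr M' \<Longrightarrow> \<beta> (\<phi> + \<phi>') \<psi> = \<beta> \<phi> \<psi> + \<beta> \<phi>' \<psi>"
    "\<phi> \<in> carr M \<Longrightarrow> \<psi> \<in> carr M' \<Longrightarrow> \<beta> (c \<odot> \<phi>) \<psi> = c * \<beta> \<phi> \<psi>"
    "\<phi> \<in> carr M \<Longrightarrow> \<psi> \<in> carr M' \<Longrightarrow> \<psi>' \<in> carr M' \<Longrightarrow> \<beta> \<phi> (\<psi> + \<psi>') = \<beta> \<phi> \<psi> + \<beta> \<phi> \<psi>'"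
    "\<phi> \<in> carr M \<Longrightarrow> \<psi> \<in> carr M' \<Longrightarrow> \<beta> \<phi> (c \<odot> \<psi>) = c * \<beta> \<phi> \<psi>"
  using assms by (auto simp: bil_def lin_on_def)

lemma bil_sum:
  assumes "bil \<beta>"
  shows "\<psi> \<in> carr M' \<Longrightarrow> (\<And>a. a \<in> A \<Longrightarrow> g a \<in> carr M) \<Longrightarrow> \<beta> (\<Sum>a\<in>A. g a) \<psi> = (\<Sum>a\<in>A. \<beta> (g a) \<psi>)"
    and "\<phi> \<in> carr M \<Longrightarrow> (\<And>a. a \<in> A \<Longrightarrow> g' a \<in> carr M') \<Longrightarrow> \<beta> \<phi> (\<Sum>a\<in>A. g' a) = (\<Sum>a\<in>A. \<beta> \<phi> (g' a))"
  subgoal using assms by (intro lin_on_complex_sum[OF _ carr_subspace[OF Mw], of "\<lambda>\<phi>. \<beta> \<phi> \<psi>"]) (auto simp: bil_def)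
  subgoal using assms by (intro lin_on_complex_sum[OF _ carr_subspace[OF M], of "\<beta> \<phi>"]) (auto simp: bil_def)
  done

lemma bil_zero: "bil \<beta> \<Longrightarrow> \<psi> \<in> carr M' \<Longrightarrow> \<beta> 0 \<psi> = 0" "bil \<beta> \<Longrightarrow> \<phi> \<in> carr M \<Longrightarrow> \<beta> \<phi> 0 = 0"
  using bil_sum(1)[of \<beta> \<psi> "{}"] bil_sum(2)[of \<beta> \<phi> "{}"] by auto

lemma vir_in_both: "\<phi> \<in> carr M \<Longrightarrow> vir V M n \<phi> \<in> carr M" "\<psi> \<in> carr M' \<Longrightarrow> vir V M' n \<psi> \<in> carr M'"
  by (rule vir_in[OF Mw], assumption) (rule vir_in[OF M])

lemma bil_act: assumes "bil \<beta>" shows "bil (act n \<beta>)"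
  unfolding bil_def lin_on_def act_def
  using assms
  by (auto simp: bilD[OF assms] vir_in_both vir_add[OF M] vir_add[OF Mw] vir_scale[OF M] vir_scale[OF Mw] ring_distribs
      subspace_add subspace_scale carr_subspace[OF M] carr_subspace[OF Mw])

lemma bil_funpow: "bil \<beta> \<Longrightarrow> bil ((act n ^^ k) \<beta>)"
  by (induction k) (auto intro: bil_act)

text \<open>Expand \<open>A b\<close> in the basis of level \<open>m'\<close> and \<open>A' (B' c)\<close> in the dual basis of level \<open>m\<close>: by adjointness the coefficients
  form the same matrix.\<close>

lemma level_trace_transfer:
  assumes bil: "bil \<beta>" and A: "\<And>b. b \<in> B m \<Longrightarrow> A b \<in> left.lev m'" and A': "\<And>b. b \<in> B m' \<Longrightarrow> A' (B' b) \<in> lev m"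
    and adj: "\<And>b c. b \<in> B m \<Longrightarrow> c \<in> B m' \<Longrightarrow> f (A b) (B' c) = f b (A' (B' c))"
  shows "(\<Sum>b\<in>B m. \<beta> (A b) (B' b)) = (\<Sum>c\<in>B m'. \<beta> c (A' (B' c)))"
proof -
  have "(\<Sum>b\<in>B m. \<beta> (A b) (B' b)) = (\<Sum>b\<in>B m. \<Sum>c\<in>B m'. f (A b) (B' c) * \<beta> c (B' b))"
  proof (intro sum.cong refl)
    fix b assume b: "b \<in> B m"
    have "\<beta> (A b) (B' b) = \<beta> (\<Sum>c\<in>B m'. f (A b) (B' c) \<odot> c) (B' b)" using left_expand[OF A[OF b]] by simp
    also have "\<dots> = (\<Sum>c\<in>B m'. f (A b) (B' c) * \<beta> c (B' b))"
      using b by (simp add: bil_sum[OF bil] bilD[OF bil] B'_in B_in subspace_scale carr_subspace[OF Mw])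
    finally show "\<beta> (A b) (B' b) = (\<Sum>c\<in>B m'. f (A b) (B' c) * \<beta> c (B' b))" .
  qed
  also have "\<dots> = (\<Sum>c\<in>B m'. \<Sum>b\<in>B m. f b (A' (B' c)) * \<beta> c (B' b))"
    by (subst sum.swap) (simp add: adj)
  also have "\<dots> = (\<Sum>c\<in>B m'. \<beta> c (A' (B' c)))"
  proof (intro sum.cong refl)
    fix c assume c: "c \<in> B m'"
    have "\<beta> c (A' (B' c)) = \<beta> c (\<Sum>b\<in>B m. f b (A' (B' c)) \<odot> B' b)" using right_expand[OF A'[OF c]] by simp
    also have "\<dots> = (\<Sum>b\<in>B m. f b (A' (B' c)) * \<beta> c (B' b))"
      using c by (simp add: bil_sum[OF bil] bilD[OF bil] B'_in B_in subspace_scale carr_subspace[OF M])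
    finally show "(\<Sum>b\<in>B m. f b (A' (B' c)) * \<beta> c (B' b)) = \<beta> c (A' (B' c))" ..
  qed
  finally show ?thesis .
qed

text \<open>By the transfer of operators, \<open>L(1) \<otimes> 1\<close> on the tensor of level \<open>m\<close> is \<open>1 \<otimes> L(-1)\<close> on that of level \<open>m - 1\<close>, and
  likewise with the factors exchanged.\<close>

lemma level_trace_Lplus:
  assumes bil: "bil \<beta>"
  shows "level_trace m (Lplus \<beta>) = (if m = 0 then 0 else level_trace (m - 1) (Lminus \<beta>))"
proof (cases m)
  case 0
  have "vir V M 1 b = 0" "vir V M' 1 (B' b) = 0" if "b \<in> B 0" for b
    using left.vir1_lev0[OF B_lev[OF that]] vir1_lev0[OF B'_lev[OF that]] by auto
  then show ?thesis using 0 by (simp add: level_trace_def act_def bil_zero[OF bil] B_in B'_in)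
next
  case (Suc k)
  have up: "vir V M (-1) b \<in> left.lev (Suc k)" if "b \<in> B k" for b
    using vir_wspace(2)[OF Mw B_lev[OF that]] by (simp add: algebra_simps)
  have up': "vir V M' (-1) (B' b) \<in> lev (Suc k)" if "b \<in> B k" for b
    using vir_wspace(2)[OF M B'_lev[OF that]] by (simp add: algebra_simps)
  have dn: "vir V M 1 b \<in> left.lev k" if "b \<in> B (Suc k)" for b
    using vir_wspace(1)[OF Mw B_lev[OF that]] by (simp add: algebra_simps)
  have dn': "vir V M' 1 (B' b) \<in> lev k" if "b \<in> B (Suc k)" for b
    using vir_wspace(1)[OF M B'_lev[OF that]] by (simp add: algebra_simps)
  have "(\<Sum>b\<in>B (Suc k). \<beta> (vir V M 1 b) (B' b)) = (\<Sum>c\<in>B k. \<beta> c (vir V M' (-1) (B' c)))"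
    by (rule level_trace_transfer[where A = "vir V M 1" and A' = "vir V M' (-1)", OF bil dn up']) (simp_all add: f_adjoint B_in B'_in)
  moreover have "(\<Sum>b\<in>B k. \<beta> (vir V M (-1) b) (B' b)) = (\<Sum>c\<in>B (Suc k). \<beta> c (vir V M' 1 (B' c)))"
    by (rule level_trace_transfer[where A = "vir V M (-1)" and A' = "vir V M' 1", OF bil up dn']) (simp_all add: f_adjoint B_in B'_in)
  ultimately show ?thesis using Suc by (simp add: level_trace_def act_def sum.distrib)
qed

lemma level_trace_act0: "bil \<beta> \<Longrightarrow> level_trace m (act 0 \<beta>) = 2 * (h + of_nat m) * level_trace m \<beta>"
  unfolding level_trace_def act_def sum_distrib_left
  by (intro sum.cong refl) (use B_lev B'_lev in \<open>simp add: wspace_def bilD\<close>)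

lemma Lminus_Lplus:
  assumes "bil \<beta>" "\<phi> \<in> carr M" "\<psi> \<in> carr M'"
  shows "Lminus (Lplus \<beta>) \<phi> \<psi> = Lplus (Lminus \<beta>) \<phi> \<psi> + 2 * act 0 \<beta> \<phi> \<psi>"
  using assms unfolding act_def
  by (simp add: vir_commute(1)[OF M] vir_commute(1)[OF Mw] bilD[OF assms(1)] vir_in_both subspace_scale carr_subspace[OF M] carr_subspace[OF Mw])

lemma Lminus_act0:
  assumes "bil \<beta>" "\<phi> \<in> carr M" "\<psi> \<in> carr M'"
  shows "Lminus (act 0 \<beta>) \<phi> \<psi> = act 0 (Lminus \<beta>) \<phi> \<psi> + Lminus \<beta> \<phi> \<psi>"
  using assms unfolding act_def
  by (simp add: vir_commute(2)[OF M] vir_commute(2)[OF Mw] bilD[OF assms(1)] vir_in_both)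

lemma Lminus_power_act0:
  assumes "bil \<beta>" "\<phi> \<in> carr M" "\<psi> \<in> carr M'"
  shows "(Lminus ^^ n) (act 0 \<beta>) \<phi> \<psi> = act 0 ((Lminus ^^ n) \<beta>) \<phi> \<psi> + of_nat n * (Lminus ^^ n) \<beta> \<phi> \<psi>"
  using assms(2,3)
proof (induction n arbitrary: \<phi> \<psi>)
  case (Suc n)
  have e: "Lminus X \<phi> \<psi> = X (vir V M (-1) \<phi>) \<psi> + X \<phi> (vir V M' (-1) \<psi>)" for X by (simp add: act_def)
  have "(Lminus ^^ Suc n) (act 0 \<beta>) \<phi> \<psi> = Lminus (act 0 ((Lminus ^^ n) \<beta>)) \<phi> \<psi> + of_nat n * Lminus ((Lminus ^^ n) \<beta>) \<phi> \<psi>"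
    by (simp only: funpow.simps o_apply e Suc.IH vir_in_both Suc.prems ring_distribs) (simp only: add_ac)
  then show ?case using Suc.prems Lminus_act0[OF bil_funpow[OF assms(1)]] by (simp add: ring_distribs)
qed simp

lemma Lminus_power_Lplus:
  assumes "bil \<beta>" "\<phi> \<in> carr M" "\<psi> \<in> carr M'"
  shows "(Lminus ^^ n) (Lplus \<beta>) \<phi> \<psi> = Lplus ((Lminus ^^ n) \<beta>) \<phi> \<psi> + 2 * of_nat n * act 0 ((Lminus ^^ (n - 1)) \<beta>) \<phi> \<psi>
     + of_nat n * of_nat (n - 1) * (Lminus ^^ (n - 1)) \<beta> \<phi> \<psi>"
  using assms(2,3)
proof (induction n arbitrary: \<phi> \<psi>)
  case (Suc n)
  let ?b = "\<lambda>k. (Lminus ^^ k) \<beta>"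
  note bil = bil_funpow[OF assms(1)]
  have e: "Lminus X \<phi> \<psi> = X (vir V M (-1) \<phi>) \<psi> + X \<phi> (vir V M' (-1) \<psi>)" for X by (simp add: act_def)
  have "(Lminus ^^ Suc n) (Lplus \<beta>) \<phi> \<psi> = Lminus (Lplus (?b n)) \<phi> \<psi> + 2 * of_nat n * Lminus (act 0 (?b (n - 1))) \<phi> \<psi>
      + of_nat n * of_nat (n - 1) * Lminus (?b (n - 1)) \<phi> \<psi>"
    by (simp only: funpow.simps o_apply e Suc.IH vir_in_both Suc.prems ring_distribs) (simp only: add_ac)
  also have "Lminus (Lplus (?b n)) \<phi> \<psi> = Lplus (?b (Suc n)) \<phi> \<psi> + 2 * act 0 (?b n) \<phi> \<psi>"
    using Lminus_Lplus[OF bil Suc.prems] by simp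
  also have "Lminus (act 0 (?b (n - 1))) \<phi> \<psi> = act 0 (Lminus (?b (n - 1))) \<phi> \<psi> + Lminus (?b (n - 1)) \<phi> \<psi>"
    by (rule Lminus_act0[OF bil Suc.prems])
  finally show ?case by (cases n) (simp_all add: algebra_simps)
qed simp

lemma level_trace_Lminus_act0: "bil \<beta> \<Longrightarrow> level_trace m ((Lminus ^^ n) (act 0 \<beta>)) = (2 * (h + of_nat m) + of_nat n) * level_trace m ((Lminus ^^ n) \<beta>)"
proof -
  assume bil: "bil \<beta>"
  have "level_trace m ((Lminus ^^ n) (act 0 \<beta>)) = level_trace m (act 0 ((Lminus ^^ n) \<beta>)) + of_nat n * level_trace m ((Lminus ^^ n) \<beta>)"
    unfolding level_trace_def sum_distrib_left sum.distrib[symmetric]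
    by (intro sum.cong refl Lminus_power_act0[OF bil] B_in B'_in)
  then show ?thesis by (simp add: level_trace_act0[OF bil_funpow[OF bil]] algebra_simps)
qed

text \<open>Commuting the action of \<open>L(1)\<close> out through the powers of that of \<open>L(-1)\<close>, where it lowers the level by one; the
  commutators involve \<open>L(0)\<close>, which is a scalar on each level.\<close>

lemma level_trace_Lminus_Lplus:
  assumes bil: "bil \<beta>"
  shows "level_trace m ((Lminus ^^ n) (Lplus \<beta>)) = (if m = 0 then 0 else level_trace (m - 1) ((Lminus ^^ Suc n) \<beta>)) +
    of_nat n * (4 * (h + of_nat m) + of_nat n - 1) * level_trace m ((Lminus ^^ (n - 1)) \<beta>)"
proof -
  have "level_trace m ((Lminus ^^ n) (Lplus \<beta>)) = level_trace m (Lplus ((Lminus ^^ n) \<beta>)) + 2 * of_nat n * level_trace m (act 0 ((Lminus ^^ (n - 1)) \<beta>))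
     + of_nat n * of_nat (n - 1) * level_trace m ((Lminus ^^ (n - 1)) \<beta>)"
    unfolding level_trace_def sum_distrib_left sum.distrib[symmetric]
    by (intro sum.cong refl Lminus_power_Lplus[OF bil] B_in B'_in)
  then show ?thesis
    unfolding level_trace_Lplus[OF bil_funpow[OF bil]] level_trace_act0[OF bil_funpow[OF bil]]
    by (cases n) (simp_all add: algebra_simps)
qed

end

section \<open>The sewing identity\<close>

lemma gchoose_step:
  fixes x :: complex
  shows "of_nat (Suc k) * (x gchoose Suc k) = (x - of_nat k) * (x gchoose k)"
  using gbinomial_mult_1[of x k] by (simp add: algebra_simps)

context dual_pair
begin

definition twist :: "complex \<Rightarrow> ('u \<Rightarrow> 'u \<Rightarrow> complex) \<Rightarrow> 'u \<Rightarrow> 'u \<Rightarrow> complex" where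
  "twist s \<beta> \<phi> \<psi> = \<beta> (left.exp_L1 s \<phi>) (exp_L1 s \<psi>)"

lemma bil_twist: "bil \<beta> \<Longrightarrow> bil (twist s \<beta>)"
  unfolding bil_def lin_on_def twist_def
  by (auto simp: left.exp_L1_add left.exp_L1_scale exp_L1_add exp_L1_scale left.exp_L1_in exp_L1_in)

lemma twist_0: "twist 0 \<beta> = \<beta>"
  by (simp add: twist_def fun_eq_iff left.exp_L1_0 exp_L1_0)

lemma twist_derivative:
  assumes bil: "bil \<beta>" and \<phi>: "\<phi> \<in> carr M" and \<psi>: "\<psi> \<in> carr M'"
  shows "((\<lambda>s. twist s \<beta> \<phi> \<psi>) has_field_derivative - Lplus (twist s \<beta>) \<phi> \<psi>) (at s)"
proof -
  obtain N1 where N1: "\<And>i. i \<ge> N1 \<Longrightarrow> (vir V M 1 ^^ i) \<phi> = 0" using left.vir1_nilpotent[OF \<phi>] by blast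
  obtain N2 where N2: "\<And>i. i \<ge> N2 \<Longrightarrow> (vir V M' 1 ^^ i) \<psi> = 0" using vir1_nilpotent[OF \<psi>] by blast
  define N where "N = N1 + N2"
  have N: "(vir V M 1 ^^ i) \<phi> = 0" "(vir V M' 1 ^^ i) \<psi> = 0" if "i \<ge> N" for i
    using N1 N2 that by (auto simp: N_def)
  have NS: "(vir V M 1 ^^ i) (vir V M 1 \<phi>) = 0" "(vir V M' 1 ^^ i) (vir V M' 1 \<psi>) = 0" if "i \<ge> N" for i
    using N[OF that] vir_zero[OF M] vir_zero[OF Mw] by (metis funpow_swap1)+
  define A :: "nat \<Rightarrow> complex \<Rightarrow> complex" where "A = (\<lambda>i s. (- s) ^ i / fact i)"
  define g where "g = (\<lambda>i j. \<beta> ((vir V M 1 ^^ i) \<phi>) ((vir V M' 1 ^^ j) \<psi>))"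
  have expand: "\<beta> (left.exp_L1 s \<phi>') (exp_L1 s \<psi>') = (\<Sum>i<N. \<Sum>j<N. A i s * A j s * \<beta> ((vir V M 1 ^^ i) \<phi>') ((vir V M' 1 ^^ j) \<psi>'))"
    if "\<And>i. i \<ge> N \<Longrightarrow> (vir V M 1 ^^ i) \<phi>' = 0" "\<And>i. i \<ge> N \<Longrightarrow> (vir V M' 1 ^^ i) \<psi>' = 0" "\<phi>' \<in> carr M" "\<psi>' \<in> carr M'" for \<phi>' \<psi>' s
  proof -
    have c: "(vir V M 1 ^^ i) \<phi>' \<in> carr M" "(vir V M' 1 ^^ i) \<psi>' \<in> carr M'" for i
      by (rule left.funpow_vir_in[OF that(3)] funpow_vir_in[OF that(4)])+
    have e: "left.exp_L1 s \<phi>' = (\<Sum>i<N. A i s \<odot> (vir V M 1 ^^ i) \<phi>')" "exp_L1 s \<psi>' = (\<Sum>i<N. A i s \<odot> (vir V M' 1 ^^ i) \<psi>')"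
      unfolding A_def by (rule left.exp_L1_eq exp_L1_eq; rule that; assumption)+
    show ?thesis
      unfolding e by (subst sum.swap) (simp add: bil_sum[OF bil] bilD[OF bil] c subspace_sum subspace_scale carr_subspace[OF M] carr_subspace[OF Mw] sum_distrib_left mult_ac)
  qed
  have dA: "(A i has_field_derivative - (if i = 0 then 0 else A (i - 1) s)) (at s)" for i
  proof (cases i)
    case (Suc k)
    have "((\<lambda>s. (- s) ^ Suc k / fact (Suc k)) has_field_derivative of_nat (Suc k) * (- 1 * (- s) ^ k) / fact (Suc k)) (at s)"
      by (rule derivative_eq_intros refl)+ (simp_all add: field_simps del: of_nat_Suc)
    moreover have "of_nat (Suc k) * (- 1 * (- s) ^ k) / fact (Suc k) = - ((- s) ^ k / fact k)"
      by (simp add: field_simps del: of_nat_Suc)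
    ultimately show ?thesis using Suc by (simp add: A_def)
  qed (simp add: A_def)
  have shift: "(\<Sum>i<N. (if i = 0 then 0 else A (i - 1) s) * u i) = (\<Sum>i<N. A i s * u (Suc i))" if "u N = 0" for u
  proof (cases N)
    case (Suc K)
    have "(\<Sum>i<Suc K. (if i = 0 then 0 else A (i - 1) s) * u i) = (\<Sum>i<K. A i s * u (Suc i))"
      unfolding sum.lessThan_Suc_shift by simp
    then show ?thesis using Suc that by simp
  qed simp
  have g0: "g N j = 0" "g i N = 0" for i j
    unfolding g_def using N[OF order_refl] bil_zero[OF bil] funpow_vir_in[OF \<psi>] left.funpow_vir_in[OF \<phi>] by auto
  have "((\<lambda>s. \<Sum>i<N. \<Sum>j<N. A i s * A j s * g i j) has_field_derivative
     (\<Sum>i<N. \<Sum>j<N. - ((if i = 0 then 0 else A (i - 1) s) * (A j s * g i j)) - (A i s * ((if j = 0 then 0 else A (j - 1) s) * g i j)))) (at s)"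
  proof (intro DERIV_sum)
    fix i j
    show "((\<lambda>s. A i s * A j s * g i j) has_field_derivative
        - ((if i = 0 then 0 else A (i - 1) s) * (A j s * g i j)) - (A i s * ((if j = 0 then 0 else A (j - 1) s) * g i j))) (at s)"
      by (rule DERIV_cong[OF DERIV_cmult_right[OF DERIV_mult[OF dA dA]]]) (simp add: algebra_simps)
  qed
  also have "(\<Sum>i<N. \<Sum>j<N. - ((if i = 0 then 0 else A (i - 1) s) * (A j s * g i j)) - (A i s * ((if j = 0 then 0 else A (j - 1) s) * g i j)))
     = - (\<Sum>j<N. \<Sum>i<N. (if i = 0 then 0 else A (i - 1) s) * (A j s * g i j)) - (\<Sum>i<N. A i s * (\<Sum>j<N. (if j = 0 then 0 else A (j - 1) s) * g i j))"
    by (subst (2) sum.swap) (simp only: sum_subtractf sum_negf sum_distrib_left)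
  also have "(\<Sum>j<N. \<Sum>i<N. (if i = 0 then 0 else A (i - 1) s) * (A j s * g i j)) = (\<Sum>j<N. \<Sum>i<N. A i s * (A j s * g (Suc i) j))"
    by (intro sum.cong refl shift) (simp add: g0)
  also have "(\<Sum>i<N. A i s * (\<Sum>j<N. (if j = 0 then 0 else A (j - 1) s) * g i j)) = (\<Sum>i<N. A i s * (\<Sum>j<N. A j s * g i (Suc j)))"
    by (intro sum.cong refl arg_cong2[where f = "(*)"] shift) (simp add: g0)
  also have "- (\<Sum>j<N. \<Sum>i<N. A i s * (A j s * g (Suc i) j)) - (\<Sum>i<N. A i s * (\<Sum>j<N. A j s * g i (Suc j))) = - Lplus (twist s \<beta>) \<phi> \<psi>"
  proof -
    have "twist s \<beta> (vir V M 1 \<phi>) \<psi> = (\<Sum>j<N. \<Sum>i<N. A i s * (A j s * g (Suc i) j))"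
      unfolding twist_def g_def by (subst expand, (use N NS \<phi> \<psi> vir_in_both in auto)[4], subst sum.swap) (simp add: funpow_swap1 mult_ac)
    moreover have "twist s \<beta> \<phi> (vir V M' 1 \<psi>) = (\<Sum>i<N. A i s * (\<Sum>j<N. A j s * g i (Suc j)))"
      unfolding twist_def g_def by (subst expand) (use N NS \<phi> \<psi> vir_in_both in \<open>auto simp: funpow_swap1 mult_ac sum_distrib_left\<close>)
    ultimately show ?thesis by (simp add: act_def)
  qed
  finally show ?thesis
    unfolding twist_def by (subst expand) (use N \<phi> \<psi> in \<open>auto simp: g_def\<close>)
qed

lemma funpow_Lminus_derivative:
  assumes "\<And>\<phi> \<psi>. \<phi> \<in> carr M \<Longrightarrow> \<psi> \<in> carr M' \<Longrightarrow> ((\<lambda>s. \<gamma> s \<phi> \<psi>) has_field_derivative \<gamma>' \<phi> \<psi>) (at s)"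
    and "\<phi> \<in> carr M" "\<psi> \<in> carr M'"
  shows "((\<lambda>s. (Lminus ^^ n) (\<gamma> s) \<phi> \<psi>) has_field_derivative (Lminus ^^ n) \<gamma>' \<phi> \<psi>) (at s)"
  using assms(2,3)
proof (induction n arbitrary: \<phi> \<psi>)
  case (Suc n)
  then show ?case unfolding funpow.simps o_apply
    by (subst (1 2) act_def) (intro DERIV_add Suc.IH vir_in_both)
qed (use assms(1) in simp)

lemma level_trace_Lminus_derivative:
  assumes "\<And>\<phi> \<psi>. \<phi> \<in> carr M \<Longrightarrow> \<psi> \<in> carr M' \<Longrightarrow> ((\<lambda>s. \<gamma> s \<phi> \<psi>) has_field_derivative \<gamma>' \<phi> \<psi>) (at s)"
  shows "((\<lambda>s. level_trace m ((Lminus ^^ n) (\<gamma> s))) has_field_derivative level_trace m ((Lminus ^^ n) \<gamma>')) (at s)"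
  unfolding level_trace_def by (intro DERIV_sum funpow_Lminus_derivative[OF assms]) (auto intro: B_in B'_in)

lemma level_trace_uminus: "level_trace m (\<lambda>\<phi> \<psi>. - \<beta> \<phi> \<psi>) = - level_trace m \<beta>"
  by (simp add: level_trace_def sum_negf)

lemma Lminus_linear: "(Lminus ^^ n) (\<lambda>\<phi> \<psi>. a * \<beta> \<phi> \<psi> + b * \<gamma> \<phi> \<psi>) = (\<lambda>\<phi> \<psi>. a * (Lminus ^^ n) \<beta> \<phi> \<psi> + b * (Lminus ^^ n) \<gamma> \<phi> \<psi>)"
  by (induction n) (auto simp: act_def fun_eq_iff algebra_simps)

lemma level_trace_linear: "level_trace m (\<lambda>\<phi> \<psi>. a * \<beta> \<phi> \<psi> + b * \<gamma> \<phi> \<psi>) = a * level_trace m \<beta> + b * level_trace m \<gamma>"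
  by (simp add: level_trace_def sum.distrib sum_distrib_left)

text \<open>The coefficient of \<open>q\<^bsup>N-m\<^esup>\<close>, attached to the \<open>l\<close>-th power of \<open>L(-1)\<close>, that \<open>flow_trace_coefficients\<close> below
  produces at level \<open>m\<close>.\<close>

definition sewing_coeff :: "nat \<Rightarrow> nat \<Rightarrow> nat \<Rightarrow> complex" where
  "sewing_coeff N m l = (2 * (h + of_nat m) + of_nat (N - m) - 1) gchoose (N - m - l)"

text \<open>The cancellation of the coefficients in the derivative of the deformed sum below.\<close>

lemma sewing_coeff_recurrence:
  assumes "m \<le> N" "l \<le> N - m"
  shows "of_nat (2 * (N - m) - l) * sewing_coeff N m l =
     (if l = 0 then 0 else of_nat l * sewing_coeff N (Suc m) (l - 1)) +
     (if l = N - m then 0 else (4 * (h + of_nat m) + of_nat l) * sewing_coeff N m (Suc l))"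
proof -
  define k where "k = N - m - l"
  define x where "x = 2 * (h + of_nat m) + of_nat (N - m) - 1"
  have Nm: "N - m = l + k" using assms(2) by (simp add: k_def)
  have s0: "sewing_coeff N m l = x gchoose k" by (simp add: sewing_coeff_def x_def k_def)
  have s1: "sewing_coeff N (Suc m) (l - 1) = (x + 1) gchoose k" if "l \<noteq> 0"
  proof -
    have "N - Suc m - (l - 1) = k" using that Nm by simp
    moreover have "2 * (h + of_nat (Suc m)) + of_nat (N - Suc m) - 1 = x + 1"
    proof -
      have "N - m = Suc (N - Suc m)" using that Nm by simp
      then show ?thesis by (simp add: x_def)
    qed
    ultimately show ?thesis by (simp add: sewing_coeff_def add.commute)
  qed
  show ?thesis
  proof (cases k)
    case 0
    then show ?thesis using s0 s1 Nm by simp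
  next
    case (Suc k')
    have s2: "sewing_coeff N m (Suc l) = x gchoose k'" using Nm Suc by (simp add: sewing_coeff_def x_def)
    have "of_nat (Suc k') * (x gchoose Suc k') = (x - of_nat k') * (x gchoose k')" by (rule gchoose_step)
    also have "x - of_nat k' = 2 * (h + of_nat m) + of_nat l" using Nm Suc by (simp add: x_def)
    finally have e: "of_nat (Suc k') * (x gchoose Suc k') = (2 * (h + of_nat m) + of_nat l) * (x gchoose k')" .
    have p: "(x + 1) gchoose Suc k' = (x gchoose k') + (x gchoose Suc k')" by (rule gbinomial_Suc_Suc)
    have "of_nat (2 * (N - m) - l) = (2 * of_nat (Suc k') + of_nat l :: complex)" using Nm Suc by simp
    then have "of_nat (2 * (N - m) - l) * sewing_coeff N m l = 2 * (of_nat (Suc k') * (x gchoose Suc k')) + of_nat l * (x gchoose Suc k')"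
      unfolding s0 Suc by (simp add: algebra_simps)
    also have "\<dots> = of_nat l * ((x + 1) gchoose Suc k') + (4 * (h + of_nat m) + of_nat l) * (x gchoose k')"
      unfolding e p by (simp add: algebra_simps)
    finally show ?thesis using s1 s2 Suc Nm by (cases "l = 0") auto
  qed
qed

text \<open>The \<open>sl\<^sub>2\<close> identity behind the sewing: transporting the canonical tensor by the two
  exponentials and resumming gives back the canonical tensor. The left-hand side, with the
  parameter \<open>s\<close> inserted, has zero derivative in \<open>s\<close>, and at \<open>s = 0\<close> only one term is left.\<close>

theorem sewing_identity:
  assumes bil: "bil \<beta>"
  shows "(\<Sum>m\<le>N. \<Sum>l\<le>N - m. sewing_coeff N m l * (level_trace m ((Lminus ^^ l) (twist 1 \<beta>)) / fact l)) = level_trace N \<beta>"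
proof -
  define a where "a = (\<lambda>m l s. level_trace m ((Lminus ^^ l) (twist s \<beta>)) / fact l)"
  \<comment> \<open>the power of \<open>s\<close> makes all terms homogeneous of degree \<open>2N\<close> when \<open>s\<close> has degree \<open>1\<close> and level \<open>m\<close> degree \<open>2m\<close>, with \<open>L(-1)\<close> of degree \<open>1\<close>\<close>
  define E where "E = (\<lambda>s. \<Sum>m\<le>N. \<Sum>l\<le>N - m. sewing_coeff N m l * (s ^ (2 * (N - m) - l) * a m l s))"
  have da: "(a m l has_field_derivative - ((if m = 0 then 0 else of_nat (Suc l) * a (m - 1) (Suc l) s) +
      (if l = 0 then 0 else (4 * (h + of_nat m) + of_nat l - 1) * a m (l - 1) s))) (at s)" for m l s
  proof -
    have "((\<lambda>s. level_trace m ((Lminus ^^ l) (twist s \<beta>))) has_field_derivative level_trace m ((Lminus ^^ l) (\<lambda>\<phi> \<psi>. - Lplus (twist s \<beta>) \<phi> \<psi>))) (at s)"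
      by (rule level_trace_Lminus_derivative) (rule twist_derivative[OF bil])
    also have "level_trace m ((Lminus ^^ l) (\<lambda>\<phi> \<psi>. - Lplus (twist s \<beta>) \<phi> \<psi>)) = - level_trace m ((Lminus ^^ l) (Lplus (twist s \<beta>)))"
      using Lminus_linear[of l "-1" "Lplus (twist s \<beta>)" 0 "Lplus (twist s \<beta>)"] by (simp add: level_trace_uminus)
    finally have "((\<lambda>s. level_trace m ((Lminus ^^ l) (twist s \<beta>)) / fact l) has_field_derivative - level_trace m ((Lminus ^^ l) (Lplus (twist s \<beta>))) / fact l) (at s)"
      by (rule DERIV_cdivide)
    moreover have "level_trace m ((Lminus ^^ l) (Lplus (twist s \<beta>))) / fact l = (if m = 0 then 0 else of_nat (Suc l) * a (m - 1) (Suc l) s) +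
      (if l = 0 then 0 else (4 * (h + of_nat m) + of_nat l - 1) * a m (l - 1) s)"
      unfolding level_trace_Lminus_Lplus[OF bil_twist[OF bil]] a_def
      by (cases l) (simp_all add: field_simps del: of_nat_Suc funpow.simps)
    ultimately show ?thesis unfolding a_def by simp
  qed
  have dE: "(E has_field_derivative 0) (at s)" for s
  proof -
    let ?p = "\<lambda>m l. s ^ (2 * (N - m) - l)" and ?p' = "\<lambda>m l. s ^ (2 * (N - m) - l - 1)"
    let ?u = "\<lambda>m l. if m = 0 then 0 else of_nat (Suc l) * a (m - 1) (Suc l) s"
    let ?w = "\<lambda>m l. if l = 0 then 0 else (4 * (h + of_nat m) + of_nat l - 1) * a m (l - 1) s"
    have "(E has_field_derivative (\<Sum>m\<le>N. \<Sum>l\<le>N - m. sewing_coeff N m l *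
        (of_nat (2 * (N - m) - l) * ?p' m l * a m l s + - (?u m l + ?w m l) * ?p m l))) (at s)"
      unfolding E_def
    proof (rule DERIV_sum, rule DERIV_sum, rule DERIV_cmult)
      fix m l
      show "((\<lambda>s. s ^ (2 * (N - m) - l) * a m l s) has_field_derivative
        (of_nat (2 * (N - m) - l) * ?p' m l * a m l s + - (?u m l + ?w m l) * ?p m l)) (at s)"
        by (rule DERIV_mult[OF _ da]) (rule derivative_eq_intros refl | simp)+
    qed
    also have "(\<Sum>m\<le>N. \<Sum>l\<le>N - m. sewing_coeff N m l * (of_nat (2 * (N - m) - l) * ?p' m l * a m l s + - (?u m l + ?w m l) * ?p m l))
      = (\<Sum>m\<le>N. \<Sum>l\<le>N - m. of_nat (2 * (N - m) - l) * sewing_coeff N m l * (?p' m l * a m l s))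
        - (\<Sum>m\<le>N. \<Sum>l\<le>N - m. sewing_coeff N m l * ?p m l * ?u m l) - (\<Sum>m\<le>N. \<Sum>l\<le>N - m. sewing_coeff N m l * ?p m l * ?w m l)"
      by (simp only: sum_subtractf[symmetric]) (intro sum.cong refl, simp add: algebra_simps)
    also have "(\<Sum>m\<le>N. \<Sum>l\<le>N - m. sewing_coeff N m l * ?p m l * ?u m l) =
       (\<Sum>m\<le>N. \<Sum>l\<le>N - m. (if l = 0 then 0 else of_nat l * sewing_coeff N (Suc m) (l - 1)) * (?p' m l * a m l s))"
    proof -
      have "(\<Sum>m\<le>N. \<Sum>l\<le>N - m. sewing_coeff N m l * ?p m l * ?u m l) =
          (\<Sum>m<N. \<Sum>l\<le>N - Suc m. sewing_coeff N (Suc m) l * ?p (Suc m) l * (of_nat (Suc l) * a m (Suc l) s))"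
        unfolding sum.atMost_shift[of _ N] by simp
      also have "\<dots> = (\<Sum>m<N. \<Sum>l\<le>N - m. (if l = 0 then 0 else of_nat l * sewing_coeff N (Suc m) (l - 1)) * (?p' m l * a m l s))"
      proof (rule sum.cong[OF refl])
        fix m assume "m \<in> {..<N}"
        then have Nm: "N - m = Suc (N - Suc m)" by auto
        have "2 * (N - Suc m) - l = 2 * (N - m) - Suc l - 1" for l using Nm by simp
        then show "(\<Sum>l\<le>N - Suc m. sewing_coeff N (Suc m) l * ?p (Suc m) l * (of_nat (Suc l) * a m (Suc l) s)) =
          (\<Sum>l\<le>N - m. (if l = 0 then 0 else of_nat l * sewing_coeff N (Suc m) (l - 1)) * (?p' m l * a m l s))"
          unfolding sum.atMost_shift[of _ "N - m"] unfolding Nm lessThan_Suc_atMost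
          by (simp add: mult_ac del: of_nat_Suc)
      qed
      also have "\<dots> = (\<Sum>m\<le>N. \<Sum>l\<le>N - m. (if l = 0 then 0 else of_nat l * sewing_coeff N (Suc m) (l - 1)) * (?p' m l * a m l s))"
        by (simp add: lessThan_Suc_atMost[symmetric])
      finally show ?thesis .
    qed
    also have "(\<Sum>m\<le>N. \<Sum>l\<le>N - m. sewing_coeff N m l * ?p m l * ?w m l) =
       (\<Sum>m\<le>N. \<Sum>l\<le>N - m. (if l = N - m then 0 else (4 * (h + of_nat m) + of_nat l) * sewing_coeff N m (Suc l)) * (?p' m l * a m l s))"
    proof (rule sum.cong[OF refl])
      fix m
      have "(\<Sum>l\<le>N - m. sewing_coeff N m l * ?p m l * ?w m l) =
         (\<Sum>l<N - m. (4 * (h + of_nat m) + of_nat l) * sewing_coeff N m (Suc l) * (?p' m l * a m l s))"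
        unfolding sum.atMost_shift[of _ "N - m"] by (simp add: mult_ac add.assoc)
      also have "\<dots> = (\<Sum>l\<le>N - m. (if l = N - m then 0 else (4 * (h + of_nat m) + of_nat l) * sewing_coeff N m (Suc l)) * (?p' m l * a m l s))"
        unfolding lessThan_Suc_atMost[symmetric] sum.lessThan_Suc by simp
      finally show "(\<Sum>l\<le>N - m. sewing_coeff N m l * ?p m l * ?w m l) = \<dots>" .
    qed
    also have "(\<Sum>m\<le>N. \<Sum>l\<le>N - m. of_nat (2 * (N - m) - l) * sewing_coeff N m l * (?p' m l * a m l s))
        - (\<Sum>m\<le>N. \<Sum>l\<le>N - m. (if l = 0 then 0 else of_nat l * sewing_coeff N (Suc m) (l - 1)) * (?p' m l * a m l s))
        - (\<Sum>m\<le>N. \<Sum>l\<le>N - m. (if l = N - m then 0 else (4 * (h + of_nat m) + of_nat l) * sewing_coeff N m (Suc l)) * (?p' m l * a m l s)) = 0"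
      unfolding sum_subtractf[symmetric]
    proof (intro sum.neutral ballI)
      fix m l assume "m \<in> {..N}" "l \<in> {..N - m}"
      then show "of_nat (2 * (N - m) - l) * sewing_coeff N m l * (?p' m l * a m l s)
        - (if l = 0 then 0 else of_nat l * sewing_coeff N (Suc m) (l - 1)) * (?p' m l * a m l s)
        - (if l = N - m then 0 else (4 * (h + of_nat m) + of_nat l) * sewing_coeff N m (Suc l)) * (?p' m l * a m l s) = 0"
        by (subst sewing_coeff_recurrence) (auto simp: ring_distribs)
    qed
    finally show ?thesis .
  qed
  have "E 1 = E 0"
  proof -
    have "\<exists>c. \<forall>x\<in>UNIV. E x = c"
      by (rule has_field_derivative_zero_constant[OF convex_UNIV]) (use dE in simp)
    then show ?thesis by auto
  qed
  moreover have "E 0 = a N 0 0"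
  proof -
    have "(\<Sum>l\<le>N - m. sewing_coeff N m l * (0 ^ (2 * (N - m) - l) * a m l 0)) = 0" if "m < N" for m
      by (intro sum.neutral ballI) (use that in auto)
    then have "E 0 = sewing_coeff N N 0 * a N 0 0" unfolding E_def
      by (subst lessThan_Suc_atMost[symmetric]) simp
    then show ?thesis by (simp add: sewing_coeff_def)
  qed
  ultimately show ?thesis by (simp add: E_def a_def twist_0)
qed

end

section \<open>The flow equation\<close>

lemma fps_binomial_ode: "(1 + fps_X) * fps_deriv (fps_binomial c) = fps_const (c::complex) * fps_binomial c"
proof -
  have inv: "inverse (1 + fps_X) * (1 + fps_X) = (1 :: complex fps)" by (rule inverse_mult_eq_1) simp
  have "fps_const c * fps_binomial c / (1 + fps_X) = fps_const c * fps_binomial c * inverse (1 + fps_X)"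
    by (rule fps_divide_unit) simp
  then have "(1 + fps_X) * fps_deriv (fps_binomial c) = fps_const c * fps_binomial c * (inverse (1 + fps_X) * (1 + fps_X))"
    unfolding fps_binomial_deriv by (simp only: mult_ac)
  then show ?thesis by (simp only: inv mult_1_right)
qed

context dual_pair
begin

text \<open>The Taylor coefficients in \<open>q\<close> of a solution of the flow equation, after taking the trace over one level
  and multiplying by the factor \<open>(1+q)\<^sup>-\<^sup>2\<^sup>(\<^sup>h\<^sup>+\<^sup>m\<^sup>)\<close> of the sewing parameter. With \<open>z\<^sub>n\<close> the series of
  \<open>(1+q)\<^sup>-\<^sup>a\<^sup>-\<^sup>n\<close> times the trace of \<open>(L(-1)\<otimes>1 + 1\<otimes>L(-1))\<^sup>n\<close>, \<open>a = 2(h+m)\<close>, the flow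
  equation becomes \<open>(1-q) z\<^sub>n' = (a+n) z\<^sub>n + z\<^sub>n\<^sub>+\<^sub>1\<close>.\<close>

theorem flow_trace_coefficients:
  assumes \<delta>: "0 < \<delta>" "\<delta> \<le> 1" and bil: "\<And>q. q \<in> ball 0 \<delta> \<Longrightarrow> bil (\<Theta> q)"
    and flow: "\<And>q \<phi> \<psi>. q \<in> ball 0 \<delta> \<Longrightarrow> \<phi> \<in> carr M \<Longrightarrow> \<psi> \<in> carr M' \<Longrightarrow>
       ((\<lambda>q. \<Theta> q \<phi> \<psi>) has_field_derivative (1 / (1 - q ^ 2)) * (Lminus (\<Theta> q) \<phi> \<psi> - Lplus (\<Theta> q) \<phi> \<psi>)) (at q)"
  shows "\<exists>r. (\<lambda>q. level_trace m (twist 1 (\<Theta> q))) has_fps_expansion r \<and>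
    (\<forall>i. (fps_binomial (- (2 * (h + of_nat m))) * r) $ i =
      (\<Sum>l\<le>i. ((2 * (h + of_nat m) + of_nat i - 1) gchoose (i - l)) * (level_trace m ((Lminus ^^ l) (twist 1 (\<Theta> 0))) / fact l)))"
proof -
  define a where "a = 2 * (h + of_nat m)"
  define F where "F = (\<lambda>n q. level_trace m ((Lminus ^^ n) (twist 1 (\<Theta> q))))"
  have dtw: "((\<lambda>q. twist 1 (\<Theta> q) \<phi> \<psi>) has_field_derivative
      (1 / (1 - q ^ 2)) * Lminus (twist 1 (\<Theta> q)) \<phi> \<psi> + (2 / (1 - q ^ 2)) * act 0 (twist 1 (\<Theta> q)) \<phi> \<psi>) (at q)"
    if q: "q \<in> ball 0 \<delta>" and \<phi>: "\<phi> \<in> carr M" and \<psi>: "\<psi> \<in> carr M'" for q \<phi> \<psi>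
  proof -
    note b = bil[OF q]
    have "Lminus (\<Theta> q) (left.exp_L1 1 \<phi>) (exp_L1 1 \<psi>) - Lplus (\<Theta> q) (left.exp_L1 1 \<phi>) (exp_L1 1 \<psi>)
       = Lminus (twist 1 (\<Theta> q)) \<phi> \<psi> + 2 * act 0 (twist 1 (\<Theta> q)) \<phi> \<psi>"
      using \<phi> \<psi>
      by (simp add: act_def twist_def left.virm1_exp_L1 virm1_exp_L1 left.vir1_exp_L1 vir1_exp_L1 left.exp_L1_add left.exp_L1_scale
          exp_L1_add exp_L1_scale vir_in_both bilD[OF b] left.exp_L1_in exp_L1_in subspace_add subspace_scale carr_subspace[OF M] carr_subspace[OF Mw])
    then show ?thesis
      using flow[OF q left.exp_L1_in[OF \<phi>, of 1] exp_L1_in[OF \<psi>, of 1]] by (simp add: twist_def add_divide_distrib)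
  qed
  have dF: "(F n has_field_derivative (1 / (1 - q ^ 2)) * (F (Suc n) q + 2 * (a + of_nat n) * F n q)) (at q)"
    if q: "q \<in> ball 0 \<delta>" for n q
  proof -
    have "(F n has_field_derivative level_trace m ((Lminus ^^ n) (\<lambda>\<phi> \<psi>. (1 / (1 - q ^ 2)) * Lminus (twist 1 (\<Theta> q)) \<phi> \<psi> + (2 / (1 - q ^ 2)) * act 0 (twist 1 (\<Theta> q)) \<phi> \<psi>))) (at q)"
      unfolding F_def by (rule level_trace_Lminus_derivative[OF dtw[OF q]])
    also have "level_trace m ((Lminus ^^ n) (\<lambda>\<phi> \<psi>. (1 / (1 - q ^ 2)) * Lminus (twist 1 (\<Theta> q)) \<phi> \<psi> + (2 / (1 - q ^ 2)) * act 0 (twist 1 (\<Theta> q)) \<phi> \<psi>))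
       = (1 / (1 - q ^ 2)) * F (Suc n) q + (2 / (1 - q ^ 2)) * ((a + of_nat n) * F n q)"
      unfolding Lminus_linear level_trace_linear level_trace_Lminus_act0[OF bil_twist[OF bil[OF q]]] F_def a_def
      by (simp add: funpow_swap1)
    finally show ?thesis by (rule DERIV_cong) (simp add: algebra_simps add_divide_distrib)
  qed
  have q2: "1 - q ^ 2 \<noteq> 0" if "q \<in> ball 0 \<delta>" for q :: complex
  proof
    assume "1 - q ^ 2 = 0"
    then have "norm q ^ 2 = 1" by (metis eq_iff_diff_eq_0 norm_one norm_power)
    moreover have "norm q < 1" using that \<delta> by simp
    ultimately show False by (simp add: abs_square_eq_1)
  qed
  have near0: "\<forall>\<^sub>F q in nhds 0. q \<in> ball 0 \<delta>" by (rule eventually_nhds_in_open) (use \<delta> in auto)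
  have "\<exists>r. F n has_fps_expansion r" for n
  proof -
    have "F n holomorphic_on ball 0 \<delta>" unfolding holomorphic_on_open[OF open_ball] using dF by blast
    then have "F n analytic_on {0}" using \<delta> by (intro analytic_at[THEN iffD2]) (auto intro!: exI[of _ "ball 0 \<delta>"])
    then show ?thesis using analytic_at_imp_has_fps_expansion_0 by blast
  qed
  then obtain R where R: "\<And>n. F n has_fps_expansion R n" by metis
  have ode: "fps_deriv (R n) * (1 - fps_X ^ 2) = R (Suc n) + fps_const (2 * (a + of_nat n)) * R n" for n
  proof (rule fps_expansion_unique_complex)
    show "(\<lambda>q. F (Suc n) q + 2 * (a + of_nat n) * F n q) has_fps_expansion R (Suc n) + fps_const (2 * (a + of_nat n)) * R n"
      by (intro has_fps_expansion_add has_fps_expansion_cmult_left R)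
    have "(\<lambda>q. deriv (F n) q * (1 - q ^ 2)) has_fps_expansion fps_deriv (R n) * (1 - fps_X ^ 2)"
      by (intro fps_expansion_intros R)
    moreover have "\<forall>\<^sub>F q in nhds 0. deriv (F n) q * (1 - q ^ 2) = F (Suc n) q + 2 * (a + of_nat n) * F n q"
      using near0 by eventually_elim (use q2 in \<open>simp add: DERIV_imp_deriv[OF dF]\<close>)
    ultimately show "(\<lambda>q. F (Suc n) q + 2 * (a + of_nat n) * F n q) has_fps_expansion fps_deriv (R n) * (1 - fps_X ^ 2)"
      by (simp add: has_fps_expansion_cong)
  qed
  \<comment> \<open>the factor \<open>(1+q)\<^bsup>-(a+n)\<^esup>\<close> removes the singular point \<open>q = -1\<close> of the equation\<close>
  define z where "z = (\<lambda>n. fps_binomial (- (a + of_nat n)) * R n)"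
  have zode: "(1 - fps_X) * fps_deriv (z n) = fps_const (a + of_nat n) * z n + z (Suc n)" for n
  proof -
    let ?b = "fps_binomial (- (a + of_nat n))" and ?b' = "fps_binomial (- (a + of_nat (Suc n)))"
    have bb: "(1 + fps_X) * ?b' = ?b"
    proof -
      have "fps_binomial 1 * ?b' = fps_binomial (1 + (- (a + of_nat (Suc n))))" by (rule fps_binomial_add_mult[symmetric])
      moreover have "1 + (- (a + of_nat (Suc n))) = - (a + of_nat n)" by simp
      ultimately show ?thesis by (simp only: fps_binomial_1)
    qed
    have c2: "fps_const (2 * (a + of_nat n)) = 2 * fps_const (a + of_nat n)" by (simp flip: fps_const_mult fps_numeral_fps_const)
    define k where "k = fps_const (a + of_nat n)"
    define b where "b = ?b"
    have ode1: "(1 + fps_X) * fps_deriv b = - k * b"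
      unfolding b_def k_def fps_const_neg by (rule fps_binomial_ode)
    have ode2: "fps_deriv (R n) * (1 - fps_X ^ 2) = R (Suc n) + 2 * k * R n"
      unfolding k_def using ode[of n] c2 by simp
    have "(1 + fps_X) * ((1 - fps_X) * fps_deriv (b * R n)) =
       (1 - fps_X) * ((1 + fps_X) * fps_deriv b) * R n + b * (fps_deriv (R n) * (1 - fps_X ^ 2))"
      by (simp add: algebra_simps power2_eq_square)
    also have "\<dots> = (1 - fps_X) * (- k * b) * R n + b * (R (Suc n) + 2 * k * R n)"
      unfolding ode1 ode2 by simp
    also have "\<dots> = (1 + fps_X) * (k * (b * R n)) + b * R (Suc n)"
      by (simp add: algebra_simps)
    also have "b * R (Suc n) = (1 + fps_X) * (?b' * R (Suc n))"
      unfolding b_def bb[symmetric] by (rule mult.assoc)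
    finally have "(1 + fps_X) * ((1 - fps_X) * fps_deriv (z n)) = (1 + fps_X) * (fps_const (a + of_nat n) * z n + z (Suc n))"
      unfolding z_def b_def[symmetric] k_def[symmetric] by (simp only: distrib_left)
    moreover have "(1 + fps_X :: complex fps) \<noteq> 0"
      by (metis fps_binomial_1 fps_binomial_nth fps_zero_nth gbinomial_0(1) zero_neq_one)
    ultimately show ?thesis by simp
  qed
  have rec: "of_nat (Suc i) * z n $ Suc i = (a + of_nat n + of_nat i) * z n $ i + z (Suc n) $ i" for n i
  proof -
    have "((1 - fps_X) * fps_deriv (z n)) $ i = of_nat (Suc i) * z n $ Suc i - of_nat i * z n $ i"
      by (cases i) (simp_all add: left_diff_distrib)
    then have "of_nat (Suc i) * z n $ Suc i - of_nat i * z n $ i = (a + of_nat n) * z n $ i + z (Suc n) $ i"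
      unfolding zode by simp
    then show ?thesis by (simp add: algebra_simps)
  qed
  have z0: "z n $ 0 = F n 0" for n
    using has_fps_expansion_imp_0_eq_fps_nth_0[OF R[of n]] by (simp add: z_def)
  have sol: "z n $ i = (\<Sum>l\<le>i. ((a + of_nat n + of_nat i - 1) gchoose (i - l)) * (F (n + l) 0 / fact l))" for n i
  proof (induction i arbitrary: n)
    case 0
    show ?case by (simp add: z0)
  next
    case (Suc i)
    let ?x = "a + of_nat n + of_nat i"
    have "of_nat (Suc i) * z n $ Suc i = ?x * (\<Sum>l\<le>i. ((?x - 1) gchoose (i - l)) * (F (n + l) 0 / fact l))
       + (\<Sum>l\<le>i. (?x gchoose (i - l)) * (F (Suc n + l) 0 / fact l))"
      unfolding rec Suc.IH by (simp add: algebra_simps)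
    also have "?x * (\<Sum>l\<le>i. ((?x - 1) gchoose (i - l)) * (F (n + l) 0 / fact l)) =
       (\<Sum>l\<le>Suc i. of_nat (Suc i - l) * (?x gchoose (Suc i - l)) * (F (n + l) 0 / fact l))"
    proof -
      have "?x * ((?x - 1) gchoose (i - l)) = of_nat (Suc i - l) * (?x gchoose (Suc i - l))" if "l \<le> i" for l
        using gbinomial_absorption[of "i - l" ?x] that by (simp add: Suc_diff_le)
      then have "?x * (\<Sum>l\<le>i. ((?x - 1) gchoose (i - l)) * (F (n + l) 0 / fact l)) =
         (\<Sum>l\<le>i. of_nat (Suc i - l) * (?x gchoose (Suc i - l)) * (F (n + l) 0 / fact l))"
        unfolding sum_distrib_left by (intro sum.cong refl) (simp only: mult.assoc[symmetric] atMost_iff)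
      then show ?thesis by simp
    qed
    also have "(\<Sum>l\<le>i. (?x gchoose (i - l)) * (F (Suc n + l) 0 / fact l)) =
       (\<Sum>l\<le>Suc i. of_nat l * (?x gchoose (Suc i - l)) * (F (n + l) 0 / fact l))"
      unfolding sum.atMost_Suc_shift by (simp add: field_simps del: of_nat_Suc)
    also have "(\<Sum>l\<le>Suc i. of_nat (Suc i - l) * (?x gchoose (Suc i - l)) * (F (n + l) 0 / fact l)) +
       (\<Sum>l\<le>Suc i. of_nat l * (?x gchoose (Suc i - l)) * (F (n + l) 0 / fact l)) =
       of_nat (Suc i) * (\<Sum>l\<le>Suc i. (?x gchoose (Suc i - l)) * (F (n + l) 0 / fact l))"
      unfolding sum.distrib[symmetric] sum_distrib_left
      by (intro sum.cong refl) (simp only: ring_distribs[symmetric] of_nat_add[symmetric] atMost_iff le_add_diff_inverse2 mult.assoc)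
    finally have "z n $ Suc i = (\<Sum>l\<le>Suc i. (?x gchoose (Suc i - l)) * (F (n + l) 0 / fact l))"
      by (simp del: of_nat_Suc)
    moreover have "a + of_nat n + of_nat (Suc i) - 1 = ?x" by simp
    ultimately show ?case by (simp only:)
  qed
  have "F 0 has_fps_expansion R 0" by (rule R)
  then show ?thesis
    using sol[of 0] by (intro exI[of _ "R 0"]) (simp add: F_def z_def a_def)
qed

end

section \<open>Genus zero correlators with two module insertions\<close>

text \<open>Radial order in which the last point may be \<open>0\<close>. The right insertion will be placed there.\<close>

definition nested :: "nat set \<Rightarrow> (nat \<Rightarrow> complex) set" where
  "nested I = {x. \<forall>i\<in>I. \<forall>j\<in>I. i < j \<longrightarrow> norm (x j) < norm (x i)}"

definition distinct_points :: "nat set \<Rightarrow> (nat \<Rightarrow> complex) set" where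
  "distinct_points I = {x. inj_on x I}"

lemma radial_nested: "radially_ordered I \<subseteq> nested I"
  by (auto simp: radially_ordered_def nested_def)

lemma nested_distinct: "nested I \<subseteq> distinct_points I"
proof
  fix x assume x: "x \<in> nested I"
  have "x i \<noteq> x j" if "i \<in> I" "j \<in> I" "i \<noteq> j" for i j
    using x that by (cases i j rule: linorder_cases) (force simp: nested_def)+
  then show "x \<in> distinct_points I" by (auto simp: distinct_points_def inj_on_def)
qed

text \<open>The shift of a mode index at a point that may be \<open>0\<close>: harmless as long as no negative power of the coordinate
  occurs.\<close>

lemma laurent_monom_shift_nonneg:
  assumes "finite I" "l \<in> I" "d \<ge> 0" "\<kappa> l + d < 0"
  shows "x l powi d * laurent_monom I x (\<kappa>(l := \<kappa> l + d)) = laurent_monom I x \<kappa>"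
proof -
  have I: "I = insert l (I - {l})" using assms(2) by auto
  have "laurent_monom I x (\<kappa>(l := \<kappa> l + d)) = x l powi (- (\<kappa> l + d) - 1) * laurent_monom (I - {l}) x \<kappa>"
    by (subst I, subst laurent_monom_insert) (use assms in auto)
  moreover have "laurent_monom I x \<kappa> = x l powi (- \<kappa> l - 1) * laurent_monom (I - {l}) x \<kappa>"
    using laurent_monom_insert[of "I - {l}" l x \<kappa> "\<kappa> l"] I assms(1) by simp
  moreover have "x l powi d * x l powi (- (\<kappa> l + d) - 1) = x l powi (- \<kappa> l - 1)"
  proof (cases "d = 0")
    case False
    have "x l powi (d + (- (\<kappa> l + d) - 1)) = x l powi d * x l powi (- (\<kappa> l + d) - 1)"
      by (rule power_int_add) (use assms False in auto)
    moreover have "d + (- (\<kappa> l + d) - 1) = - \<kappa> l - 1" by simp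
    ultimately show ?thesis by (simp only:)
  qed simp
  ultimately show ?thesis by (metis mult.assoc)
qed

text \<open>\<open>Y0\<close>, \<open>Y1\<close> and \<open>Y2\<close> are the intertwiners of types \<open>(V; M M')\<close>, \<open>(M; M V)\<close> and \<open>(M'; M' V)\<close>, and \<open>\<kappa>'\<close> is the logarithm
  of \<open>-1\<close> that fixes \<open>(-1)\<^sup>h\<close>.\<close>

locale sphere = dual_pair scale V M' h M f B B'
  for scale :: "complex \<Rightarrow> 'u::ab_group_add \<Rightarrow> 'u" (infixr \<open>\<odot>\<close> 75) and V :: "'u voa"
    and M' :: "'u vmod" and h :: complex
    and M :: "'u vmod" and f :: "'u \<Rightarrow> 'u \<Rightarrow> complex" and B :: "nat \<Rightarrow> 'u set" and B' :: "'u \<Rightarrow> 'u" +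
  fixes \<kappa>' :: complex and fV :: "'u \<Rightarrow> 'u \<Rightarrow> complex"
    and Y0 Y1 Y2 :: "'u \<Rightarrow> complex \<Rightarrow> 'u \<Rightarrow> 'u"
  assumes pairingV: "contragredient_pairing V (vmod.truncate V) (vmod.truncate V) fV"
    and fV_vac: "fV (vac V) (vac V) = 1"
    and Y0: "Y0 \<in> intertwiners V (vmod.truncate V) M M'"
    and Y2: "Y2 \<in> intertwiners V M' M' (vmod.truncate V)"
    and Y1_creative: "creative_normalized V M Y1" and Y2_creative: "creative_normalized V M' Y2"
    and Y0_pairing: "pairing_normalized V \<kappa>' M M' fV f Y1 Y0"
    and exp_\<kappa>': "exp \<kappa>' = -1"
begin

abbreviation "one \<equiv> vac V"
abbreviation "V0 \<equiv> vmod.truncate V"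

lemma V0_simps [simp]: "carr V0 = carr V" "mode V0 = mode V" "vir V V0 = vir V V"
  by (simp_all add: vmod.truncate_def vir_def fun_eq_iff)

lemma V0_module: "weak_module V V0"
  using V_module unfolding weak_module_def by simp

lemma fV_lin: "w' \<in> carr V \<Longrightarrow> lin_on (*) (carr V) (\<lambda>w. fV w w')" "w \<in> carr V \<Longrightarrow> lin_on (*) (carr V) (fV w)"
  using pairingV by (auto simp: contragredient_pairing_def)

lemma fV_one_vir: "w \<in> carr V \<Longrightarrow> n \<le> 1 \<Longrightarrow> fV one (vir V V n w) = 0"
  using contragredient_vir[OF V0_module V0_module pairingV, of one w n] vac_in vir_vac[of "- n"]
    lin_on_complex_zero[OF fV_lin(1) carr_subspace[OF V_module]] by simp

text \<open>The covector \<open>\<langle>1,\<cdot>\<rangle>\<close> annihilates the modes \<open>u(k)\<close>, \<open>k < 0\<close>, of fields of positive weight: this is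
  regularity of correlators at infinity.\<close>

lemma fV_one_mode:
  assumes u: "u \<in> carr V" and X: "X \<in> carr V" and k: "k < 0"
  shows "fV one (mode V u k X) = (if k = -1 then fV one u * fV one X else 0)"
proof -
  note l2 = lin_onD[OF fV_lin(2)[OF vac_in]]
  have zero: "fV one 0 = 0" by (rule lin_on_complex_zero[OF fV_lin(2)[OF vac_in] carr_subspace[OF V_module]])
  have zero': "fV 0 Z = 0" if "Z \<in> carr V" for Z
    using lin_on_complex_zero[OF fV_lin(1)[OF that] carr_subspace[OF V_module]] .
  have pos: "fV one (mode V u k Z) = 0" if u: "u \<in> wspace V V (of_nat c)" and c: "c > 0" and Z: "Z \<in> carr V" and k: "k < 0" for u c Z k
  proof -
    have "fV one (mode V u k Z) = (\<Sum>j\<le>c. (-1) ^ c / fact j * fV (mode V ((vir V V 1 ^^ j) u) (2 * int c - int j - k - 2) one) Z)"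
      using pairingV u Z vac_in unfolding contragredient_pairing_def V0_simps by blast
    also have "\<dots> = 0"
    proof (intro sum.neutral ballI)
      fix j assume "j \<in> {..c}"
      then have "2 * int c - int j - k - 2 \<ge> 0" using c k by simp
      moreover have "(vir V V 1 ^^ j) u \<in> carr V"
        using u by (induction j) (auto simp: wspace_def intro: vir_in[OF V_module])
      ultimately have "mode V ((vir V V 1 ^^ j) u) (2 * int c - int j - k - 2) one = 0" by (intro vac_annihilate)
      then show "(-1) ^ c / fact j * fV (mode V ((vir V V 1 ^^ j) u) (2 * int c - int j - k - 2) one) Z = 0"
        using zero'[OF Z] by simp
    qed
    finally show ?thesis .
  qed
  show ?thesis using u
  proof (induction rule: V_induct)
    case (hom c u)
    have u: "u \<in> carr V" using hom by (simp add: wspace_def)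
    show ?case
    proof (cases "c > 0")
      case True
      have "fV one u = 0" using pos[OF hom True vac_in, of "-1"] vac_create[OF u] by simp
      then show ?thesis using pos[OF hom True X k] by simp
    next
      case False
      then have "u \<in> span {one}" using hom cft by (simp add: strong_CFT_type_def)
      then obtain a where "u = a \<odot> one" by (auto simp: span_singleton)
      then show ?thesis using X vac_in fV_vac zero l2
        by (simp add: mode_scale_left[OF V_module] vac_mode[OF V_module])
    qed
  next
    case zero
    then show ?case using X zero \<open>fV one 0 = 0\<close> by (simp add: mode_zero_left[OF V_module])
  next
    case (add v w)
    then show ?case using X l2 by (simp add: mode_add_left[OF V_module] mode_closed[OF V_module] ring_distribs)
  next
    case (scale c v)
    then show ?case using X l2 by (simp add: mode_scale_left[OF V_module] mode_closed[OF V_module])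
  qed
qed

text \<open>The last fact is the Jacobi identity with \<open>l = 0\<close>, i.e. the commutator of a mode with an intertwiner.\<close>

lemma intertwiner_facts:
  fixes M1 M2 M3 :: "'u vmod"
  assumes Y: "Y \<in> intertwiners V M3 M1 M2" and M1: "weak_module V M1"
  shows "w \<in> carr M1 \<Longrightarrow> x \<in> carr M2 \<Longrightarrow> Y w s x \<in> carr M3"
    and "w \<in> carr M1 \<Longrightarrow> lin_on scale (carr M2) (Y w s)"
    and "x \<in> carr M2 \<Longrightarrow> lin_on scale (carr M1) (\<lambda>w. Y w s x)"
    and "w \<in> carr M1 \<Longrightarrow> x \<in> carr M2 \<Longrightarrow> Y (vir V M1 (-1) w) s x = (- s) \<odot> Y w (s - 1) x"
    and "u \<in> carr V \<Longrightarrow> w \<in> carr M1 \<Longrightarrow> x \<in> carr M2 \<Longrightarrow> (\<And>i. i \<ge> N \<Longrightarrow> mode M1 u (int i) w = 0) \<Longrightarrow>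
      mode M3 u m (Y w s x) = Y w s (mode M2 u m x) +
        (\<Sum>i<N. (of_int m gchoose i) \<odot> Y (mode M1 u (int i) w) (of_int m + s - of_nat i) x)"
proof -
  show "w \<in> carr M1 \<Longrightarrow> x \<in> carr M2 \<Longrightarrow> Y w s x \<in> carr M3"
    "w \<in> carr M1 \<Longrightarrow> lin_on scale (carr M2) (Y w s)"
    "w \<in> carr M1 \<Longrightarrow> x \<in> carr M2 \<Longrightarrow> Y (vir V M1 (-1) w) s x = (- s) \<odot> Y w (s - 1) x"
    using Y unfolding intertwiners_def by simp_all
  have lin1: "lin_on scale (carr M1) (\<lambda>w. Y w s x)" if "x \<in> carr M2" for x s
    using Y that unfolding intertwiners_def by simp
  then show "x \<in> carr M2 \<Longrightarrow> lin_on scale (carr M1) (\<lambda>w. Y w s x)" .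
  assume u: "u \<in> carr V" and w: "w \<in> carr M1" and x: "x \<in> carr M2" and N: "\<And>i. i \<ge> N \<Longrightarrow> mode M1 u (int i) w = 0"
  have z: "Y 0 s' x = 0" for s'
    using lin_onD(2)[OF lin1[OF x], of w 0 s'] w by simp
  have "Sum_any (\<lambda>i::nat. (of_int m gchoose i) \<odot> Y (mode M1 u (0 + int i) w) (of_int m + s - of_nat i) x) =
      Sum_any (\<lambda>i::nat. ((-1) ^ i * (of_int 0 gchoose i)) \<odot>
        (mode M3 u (m + 0 - int i) (Y w (s + of_nat i) x)
         - ((-1) powi 0) \<odot> Y w (s + of_int 0 - of_nat i) (mode M2 u (m + int i) x)))"
    using Y u w x unfolding intertwiners_def mem_Collect_eq by blast
  moreover have "Sum_any (\<lambda>i::nat. (of_int m gchoose i) \<odot> Y (mode M1 u (0 + int i) w) (of_int m + s - of_nat i) x) =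
      (\<Sum>i<N. (of_int m gchoose i) \<odot> Y (mode M1 u (int i) w) (of_int m + s - of_nat i) x)"
    by (subst Sum_any_bounded[of N]) (auto simp: N z)
  moreover have "Sum_any (\<lambda>i::nat. ((-1) ^ i * (of_int 0 gchoose i)) \<odot>
        (mode M3 u (m + 0 - int i) (Y w (s + of_nat i) x)
         - ((-1) powi 0) \<odot> Y w (s + of_int 0 - of_nat i) (mode M2 u (m + int i) x))) =
      mode M3 u m (Y w s x) - Y w s (mode M2 u m x)"
    by (subst Sum_any_bounded[of 1]) (auto simp: gbinomial_0_left)
  ultimately show "mode M3 u m (Y w s x) = Y w s (mode M2 u m x) +
        (\<Sum>i<N. (of_int m gchoose i) \<odot> Y (mode M1 u (int i) w) (of_int m + s - of_nat i) x)"
    by (simp add: algebra_simps)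
qed

lemmas Y0_in = intertwiner_facts(1)[OF Y0 Mw, unfolded V0_simps]
  and Y0_lin = intertwiner_facts(2)[OF Y0 Mw, unfolded V0_simps]
  and Y0_lin_left = intertwiner_facts(3)[OF Y0 Mw, unfolded V0_simps]
  and Y0_derivative = intertwiner_facts(4)[OF Y0 Mw, unfolded V0_simps]
  and Y0_commutator = intertwiner_facts(5)[OF Y0 Mw, unfolded V0_simps]
  and Y2_commutator = intertwiner_facts(5)[OF Y2 M, unfolded V0_simps]
  and Y2_in = intertwiner_facts(1)[OF Y2 M, unfolded V0_simps]
  and Y2_lin_left = intertwiner_facts(3)[OF Y2 M, unfolded V0_simps]
  and Y2_lin = intertwiner_facts(2)[OF Y2 M, unfolded V0_simps]

text \<open>The creative intertwiner on the vacuum is \<open>e\<^sup>z\<^sup>L\<^sup>(\<^sup>-\<^sup>1\<^sup>)\<close>.\<close>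

lemma creative_vacuum:
  fixes N :: "'u vmod"
  assumes N: "weak_module V N" and Y: "creative_normalized V N Y" and w: "w \<in> carr N"
  shows "Y w (of_int k) one = (if k < 0 then (1 / fact (nat (- 1 - k))) \<odot> (vir V N (-1) ^^ nat (- 1 - k)) w else 0)"
proof -
  have fz: "(vir V N (-1) ^^ j) 0 = 0" for j by (induction j) (auto simp: vir_zero[OF N])
  have "Y w (of_int k) one = Sum_any (\<lambda>j::nat. ((-1) powi (k + int j + 1) / fact j) \<odot>
      (vir V N (-1) ^^ j) (mode N one (k + int j) w))"
    using Y w vac_in unfolding creative_normalized_def by blast
  also have "\<dots> = Sum_any (\<lambda>j::nat. if k + int j = -1 then (1 / fact j) \<odot> (vir V N (-1) ^^ j) w else 0)"
    by (rule Sum_any.cong) (auto simp: vac_mode[OF N w] fz)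
  also have "\<dots> = (if k < 0 then (1 / fact (nat (- 1 - k))) \<odot> (vir V N (-1) ^^ nat (- 1 - k)) w else 0)"
  proof (cases "k < 0")
    case True
    then have "(k + int j = - 1) = (j = nat (- 1 - k))" for j by auto
    then show ?thesis using True by simp
  next
    case False
    then have "k + int j \<noteq> -1" for j by simp
    then show ?thesis using False by (simp add: Sum_any.expand_superset[of "{}"])
  qed
  finally show ?thesis .
qed

text \<open>The covector obtained from the mode \<open>2h + k\<close> of the left insertion. The shift by \<open>2h\<close> removes the branch factor
  \<open>y\<^sub>1\<^bsup>-2h\<^esup>\<close>, so that integers index all modes.\<close>

definition cov :: "'u \<Rightarrow> int \<Rightarrow> 'u \<Rightarrow> complex" where
  "cov b k X = fV one (Y0 b (2 * h + of_int k) X)"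

text \<open>The mode \<open>k\<close> of the right insertion, applied to the vacuum.\<close>

definition vec :: "'u \<Rightarrow> int \<Rightarrow> 'u" where
  "vec b' k = Y2 b' (of_int k) one"

lemma vec_in: "b' \<in> carr M' \<Longrightarrow> vec b' k \<in> carr M'"
  unfolding vec_def by (rule Y2_in) (auto simp: vac_in)

lemma vec_nonneg: "b' \<in> carr M' \<Longrightarrow> k \<ge> 0 \<Longrightarrow> vec b' k = 0"
  unfolding vec_def by (subst creative_vacuum[OF M Y2_creative]) auto

lemma vec_eq: "b' \<in> carr M' \<Longrightarrow> vec b' (- 1 - int r) = (1 / fact r) \<odot> (vir V M' (-1) ^^ r) b'"
  unfolding vec_def by (subst creative_vacuum[OF M Y2_creative]) auto

lemma vec_add: "b \<in> carr M' \<Longrightarrow> b' \<in> carr M' \<Longrightarrow> vec (b + b') k = vec b k + vec b' k"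
  unfolding vec_def using lin_onD(1)[OF Y2_lin_left[OF vac_in]] .

lemma vec_mode:
  assumes u: "u \<in> carr V" and b': "b' \<in> carr M'" and N: "\<And>i. i \<ge> N \<Longrightarrow> mode M' u (int i) b' = 0" and m: "m \<ge> 0"
  shows "mode M' u m (vec b' k) = (\<Sum>i<N. (of_int m gchoose i) \<odot> vec (mode M' u (int i) b') (k + (m - int i)))"
proof -
  have "Y2 b' s 0 = 0" for s
    using lin_onD(2)[OF Y2_lin[OF b'] vac_in, of s 0] by simp
  then have "mode M' u m (vec b' k) = (\<Sum>i<N. (of_int m gchoose i) \<odot> Y2 (mode M' u (int i) b') (of_int m + of_int k - of_nat i) one)"
    unfolding vec_def using Y2_commutator[OF u b' vac_in N, where m = m and s = "of_int k"] vac_annihilate[OF u m] by simp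
  moreover have "of_int m + of_int k - of_nat i = (of_int (k + (m - int i)) :: complex)" for i by simp
  ultimately show ?thesis unfolding vec_def by (simp only:)
qed

lemma cov_lin: "b \<in> carr M \<Longrightarrow> lin_on (*) (carr M') (cov b k)"
  unfolding cov_def
  using lin_onD[OF Y0_lin] lin_onD[OF fV_lin(2)[OF vac_in]] Y0_in by (simp add: lin_on_def)

lemma cov_add_left: "b \<in> carr M \<Longrightarrow> b' \<in> carr M \<Longrightarrow> X \<in> carr M' \<Longrightarrow> cov (b + b') k X = cov b k X + cov b' k X"
  unfolding cov_def using lin_onD(1)[OF Y0_lin_left] lin_onD(1)[OF fV_lin(2)[OF vac_in]] Y0_in by simp

lemma cov_zero: "b \<in> carr M \<Longrightarrow> cov b k 0 = 0"
  by (rule lin_on_complex_zero[OF cov_lin carr_subspace[OF M]])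

text \<open>Creation modes disappear to the left, up to their action on the inserted vector \<open>b\<close>, because the vacuum covector
  annihilates them.\<close>

lemma cov_mode:
  assumes u: "u \<in> carr V" and b: "b \<in> carr M" and X: "X \<in> carr M'" and N: "\<And>i. i \<ge> N \<Longrightarrow> mode M u (int i) b = 0" and a: "a < 0"
  shows "cov b k (mode M' u a X) = (if a = -1 then fV one u * cov b k X else 0)
     - (\<Sum>i<N. (of_int a gchoose i) * cov (mode M u (int i) b) (k + (a - int i)) X)"
proof -
  note l = lin_onD[OF fV_lin(2)[OF vac_in]]
  let ?s = "2 * h + of_int k :: complex"
  have in1: "Y0 b ?s (mode M' u a X) \<in> carr V" by (rule Y0_in[OF b mode_closed[OF M u X]])
  have in2: "Y0 (mode M u (int i) b) s X \<in> carr V" for i s by (rule Y0_in[OF mode_closed[OF Mw u b] X])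
  have eq: "mode V u a (Y0 b ?s X) = Y0 b ?s (mode M' u a X) +
     (\<Sum>i<N. (of_int a gchoose i) \<odot> Y0 (mode M u (int i) b) (of_int a + ?s - of_nat i) X)"
    by (rule Y0_commutator[OF u b X N])
  have "fV one (mode V u a (Y0 b ?s X)) = fV one (Y0 b ?s (mode M' u a X)) +
     (\<Sum>i<N. (of_int a gchoose i) * fV one (Y0 (mode M u (int i) b) (of_int a + ?s - of_nat i) X))"
    unfolding eq using in1 in2 by (simp add: l lin_on_complex_sum[OF fV_lin(2)[OF vac_in] carr_subspace[OF V_module]]
        subspace_sum subspace_scale carr_subspace[OF V_module])
  moreover have "of_int a + ?s - of_nat i = 2 * h + of_int (k + (a - int i))" for i by simp
  ultimately show ?thesis
    using fV_one_mode[OF u Y0_in[OF b X] a] unfolding cov_def by (simp only: eq_diff_eq)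
qed

text \<open>Invariance of the vacuum covector under \<open>L(-1)\<close>.\<close>

lemma cov_translation:
  assumes b: "b \<in> carr M" and X: "X \<in> carr M'"
  shows "cov b k (vir V M' (-1) X) = (2 * h + of_int k) * cov b (k - 1) X"
proof -
  note l = lin_onD[OF fV_lin(2)[OF vac_in]]
  obtain N where N: "\<And>i. i \<ge> N \<Longrightarrow> mode M (conf V) (int i) b = 0" using mode_truncation[OF Mw conf_in b] by blast
  let ?s = "2 * h + of_int k :: complex"
  have N': "mode M (conf V) (int i) b = 0" if "i \<ge> Suc N" for i by (rule N) (use that in simp)
  have "mode V (conf V) 0 (Y0 b ?s X) = Y0 b ?s (mode M' (conf V) 0 X) +
     (\<Sum>i<Suc N. (of_int 0 gchoose i) \<odot> Y0 (mode M (conf V) (int i) b) (of_int 0 + ?s - of_nat i) X)"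
    by (rule Y0_commutator[OF conf_in b X N'])
  also have "(\<Sum>i<Suc N. (of_int 0 gchoose i) \<odot> Y0 (mode M (conf V) (int i) b) (of_int 0 + ?s - of_nat i) X) = Y0 (vir V M (-1) b) ?s X"
    unfolding sum.lessThan_Suc_shift by (simp add: gbinomial_0_left vir_def)
  finally have "vir V V (-1) (Y0 b ?s X) = Y0 b ?s (vir V M' (-1) X) + (- ?s) \<odot> Y0 b (?s - 1) X"
    unfolding Y0_derivative[OF b X] by (simp add: vir_def)
  then have "0 = cov b k (vir V M' (-1) X) + (- ?s) * fV one (Y0 b (?s - 1) X)"
    using fV_one_vir[OF Y0_in[OF b X], of "-1" ?s] Y0_in[OF b vir_in[OF M X, of "-1"]] Y0_in[OF b X]
    by (simp add: cov_def l subspace_scale carr_subspace[OF V_module] del: scale_minus_left)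
  moreover have "?s - 1 = 2 * h + of_int (k - 1)" by simp
  ultimately show ?thesis unfolding cov_def by (simp only:) algebra
qed

text \<open>Invariance of the vacuum covector under \<open>L(0)\<close>.\<close>

lemma cov_weight:
  assumes b: "b \<in> left.lev m" and X: "X \<in> lev d" and k: "k \<noteq> int m + int d - 1"
  shows "cov b k X = 0"
proof -
  have bM: "b \<in> carr M" and XM: "X \<in> carr M'" using b X by (auto simp: wspace_def)
  note l = lin_onD[OF fV_lin(2)[OF vac_in]]
  obtain N where N: "\<And>i. i \<ge> N \<Longrightarrow> mode M (conf V) (int i) b = 0" using mode_truncation[OF Mw conf_in bM] by blast
  let ?s = "2 * h + of_int k :: complex"
  have N': "mode M (conf V) (int i) b = 0" if "i \<ge> Suc (Suc N)" for i by (rule N) (use that in simp)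
  have g1: "(of_int 1 gchoose Suc (Suc i) :: complex) = 0" for i
    using binomial_gbinomial[of 1 "Suc (Suc i)", where ?'a = complex] by (simp add: binomial_eq_0)
  have "mode V (conf V) 1 (Y0 b ?s X) = Y0 b ?s (mode M' (conf V) 1 X) +
     (\<Sum>i<Suc (Suc N). (of_int 1 gchoose i) \<odot> Y0 (mode M (conf V) (int i) b) (of_int 1 + ?s - of_nat i) X)"
    by (rule Y0_commutator[OF conf_in bM XM N'])
  also have "(\<Sum>i<Suc (Suc N). (of_int 1 gchoose i) \<odot> Y0 (mode M (conf V) (int i) b) (of_int 1 + ?s - of_nat i) X)
     = Y0 (vir V M (-1) b) (1 + ?s) X + Y0 (vir V M 0 b) ?s X"
    unfolding sum.lessThan_Suc_shift g1 by (simp add: vir_def)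
  also have "vir V M 0 b = (h + of_nat m) \<odot> b" using b by (simp add: wspace_def)
  also have "mode M' (conf V) 1 X = (h + of_nat d) \<odot> X" using X by (simp add: wspace_def vir_def)
  finally have "vir V V 0 (Y0 b ?s X) = (h + of_nat d) \<odot> Y0 b ?s X + ((- (1 + ?s)) \<odot> Y0 b ?s X + (h + of_nat m) \<odot> Y0 b ?s X)"
    unfolding Y0_derivative[OF bM XM]
    using lin_onD(2)[OF Y0_lin[OF bM] XM] lin_onD(2)[OF Y0_lin_left[OF XM] bM] by (simp add: vir_def)
  also have "\<dots> = (of_nat d + of_nat m - 1 - of_int k) \<odot> Y0 b ?s X"
    by (simp add: scale_left_distrib[symmetric] del: scale_minus_left)
  finally have "0 = (of_nat d + of_nat m - 1 - of_int k) * cov b k X"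
    using fV_one_vir[OF Y0_in[OF bM XM], of 0 ?s] Y0_in[OF bM XM] by (simp add: cov_def l)
  moreover have "(of_nat d + of_nat m - 1 - of_int k :: complex) \<noteq> 0"
  proof
    assume "(of_nat d + of_nat m - 1 - of_int k :: complex) = 0"
    then have "(of_int (int d + int m - 1 - k) :: complex) = 0" by simp
    then show False using k by (simp only: of_int_eq_0_iff)
  qed
  ultimately show ?thesis by simp
qed

end

section \<open>Existence of the genus zero correlators\<close>

context sphere
begin

definition sphere_terms :: "nat list \<Rightarrow> nat \<Rightarrow> (nat \<Rightarrow> 'u) \<Rightarrow> 'u \<Rightarrow> 'u \<Rightarrow> (nat \<Rightarrow> complex) \<Rightarrow> (nat \<Rightarrow> int) \<Rightarrow> complex" where
  "sphere_terms js e v b b' x \<kappa> = (1 - x e / x 0) powr (2 * h) *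
     cov b (\<kappa> 0) (vprod M' js v \<kappa> (vec b' (\<kappa> e))) * laurent_monom (insert 0 (insert e (set js))) x \<kappa>"

text \<open>\<open>R\<close> is the rational extension, regular for distinct points, of the series \<open>sphere_terms\<close>. Translation invariance is
  carried along because it moves the right insertion to \<open>0\<close>, where the series is still required to converge.\<close>

definition sphere_corr :: "nat list \<Rightarrow> nat \<Rightarrow> (nat \<Rightarrow> 'u) \<Rightarrow> 'u \<Rightarrow> 'u \<Rightarrow> ((nat \<Rightarrow> complex) \<Rightarrow> complex) \<Rightarrow> bool" where
  "sphere_corr js e v b b' R \<longleftrightarrow> (let I = insert 0 (insert e (set js)) in
     rat_on (distinct_points I) R \<and>
     (\<forall>x\<in>distinct_points I. \<forall>c. R (\<lambda>i. x i + c) = R x) \<and>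
     (\<forall>x\<in>nested I. (sphere_terms js e v b b' x has_sum R x) (PiE I (\<lambda>_. UNIV))))"

lemma cov_sum_left:
  assumes "\<And>m. g m \<in> carr M" "X \<in> carr M'"
  shows "cov (\<Sum>m<N::nat. g m) k X = (\<Sum>m<N. cov (g m) k X)"
proof (induction N)
  case 0
  have "cov (0 + 0) k X = cov 0 k X + cov 0 k X"
    by (rule cov_add_left) (use assms subspace_0[OF carr_subspace[OF Mw]] in auto)
  then show ?case by simp
next
  case (Suc N)
  then show ?case using assms by (simp add: cov_add_left subspace_sum[OF carr_subspace[OF Mw]])
qed

lemma vec_sum:
  assumes "\<And>m. g m \<in> carr M'"
  shows "vec (\<Sum>m<N::nat. g m) k = (\<Sum>m<N. vec (g m) k)"
proof (induction N)
  case 0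
  have "vec (0 + 0) k = vec 0 k + vec 0 k"
    by (rule vec_add) (use subspace_0[OF carr_subspace[OF M]] in auto)
  then show ?case by simp
next
  case (Suc N)
  then show ?case using assms by (simp add: vec_add subspace_sum[OF carr_subspace[OF M]])
qed

lemma cov_sum: "b \<in> carr M \<Longrightarrow> (\<And>a. a \<in> A \<Longrightarrow> g a \<in> carr M') \<Longrightarrow> cov b k (\<Sum>a\<in>A. g a) = (\<Sum>a\<in>A. cov b k (g a))"
  by (rule lin_on_complex_sum[OF cov_lin carr_subspace[OF M]])

text \<open>By weight only one mode of the left insertion pairs with each mode of the right one, and translation covariance gives
  a two-term recursion for these numbers; its solution is the expansion of \<open>(1 - x\<^sub>e/x\<^sub>0)\<^bsup>-2h-K\<^esup>\<close>.\<close>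

lemma two_point_homogeneous:
  assumes e: "e > 0" and b: "b \<in> left.lev m" and b': "b' \<in> lev m'"
  shows "\<exists>R. sphere_corr [] e v b b' R"
proof -
  define K where "K = m + m'"
  define \<tau> where "\<tau> r = cov b (int K - 1 + int r) (vec b' (- 1 - int r))" for r :: nat
  have bM: "b \<in> carr M" and b'M: "b' \<in> carr M'" using b b' by (auto simp: wspace_def)
  have pw: "(vir V M' (-1) ^^ r) b' \<in> lev (m' + r)" for r
  proof (induction r)
    case (Suc r)
    from vir_wspace(2)[OF M Suc] show ?case by (simp add: add_ac)
  qed (use b' in simp)
  have vlev: "vec b' (- 1 - int r) \<in> lev (m' + r)" for r
    unfolding vec_eq[OF b'M] by (rule subspace_scale[OF subspace_wspace[OF M] pw])
  have vSuc: "vec b' (- 1 - int (Suc r)) = (1 / of_nat (Suc r)) \<odot> vir V M' (-1) (vec b' (- 1 - int r))" for r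
  proof -
    have "(vir V M' (-1) ^^ r) b' \<in> carr M'" using pw by (simp add: wspace_def)
    then show ?thesis unfolding vec_eq[OF b'M] using lin_onD(2)[OF vir_lin[OF M]] by (simp add: field_simps)
  qed
  have \<tau>Suc: "\<tau> (Suc r) = (2 * h + of_nat K + of_nat r) / of_nat (Suc r) * \<tau> r" for r
  proof -
    have in1: "vec b' (- 1 - int r) \<in> carr M'" by (rule vec_in[OF b'M])
    have "\<tau> (Suc r) = (1 / of_nat (Suc r)) * cov b (int K - 1 + int (Suc r)) (vir V M' (-1) (vec b' (- 1 - int r)))"
      unfolding \<tau>_def vSuc using lin_onD(2)[OF cov_lin[OF bM]] vir_in[OF M in1] by blast
    also have "cov b (int K - 1 + int (Suc r)) (vir V M' (-1) (vec b' (- 1 - int r))) = (2 * h + of_int (int K + int r)) * \<tau> r"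
      unfolding cov_translation[OF bM in1] \<tau>_def by (simp add: algebra_simps)
    finally show ?thesis by simp
  qed
  have \<tau>: "\<tau> r = ((2 * h + of_nat K + of_nat r - 1) gchoose r) * \<tau> 0" for r
  proof (induction r)
    case (Suc r)
    have "(2 * h + of_nat K + of_nat (Suc r) - 1) gchoose Suc r =
        (2 * h + of_nat K + of_nat r) / of_nat (Suc r) * ((2 * h + of_nat K + of_nat r - 1) gchoose r)"
    proof -
      have eq: "2 * h + of_nat K + of_nat (Suc r) - 1 = 2 * h + of_nat K + of_nat r" by simp
      show ?thesis unfolding eq using gbinomial_absorption'[of "Suc r" "2 * h + of_nat K + of_nat r"] by simp
    qed
    then show ?case unfolding \<tau>Suc Suc by simp
  qed simp
  define R where "R x = \<tau> 0 * (1 / (x 0 - x e)) ^ K" for x :: "nat \<Rightarrow> complex"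
  \<comment> \<open>the only multi-indices with a non-zero term\<close>
  define \<phi> where "\<phi> r = (\<lambda>i. if i = 0 then int K - 1 + int r else if i = e then - 1 - int r else undefined)" for r :: nat
  have "(sphere_terms [] e v b b' x has_sum R x) (PiE {0,e} (\<lambda>_. UNIV))" if x: "x \<in> nested {0,e}" for x
  proof -
    have lt: "norm (x e) < norm (x 0)" using x e by (auto simp: nested_def)
    then have x0: "x 0 \<noteq> 0" by auto
    let ?y = "x e / x 0"
    have y: "norm ?y < 1" using lt x0 by (simp add: norm_divide)
    then have y1: "1 - ?y \<noteq> 0" by auto
    have tm: "sphere_terms [] e v b b' x (\<phi> r) =
        ((1 - ?y) powr (2 * h) * x 0 powi (- int K) * \<tau> 0) * (((2 * h + of_nat K + of_nat r - 1) gchoose r) * ?y ^ r)" for r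
    proof -
      have "x 0 powi (- (int K - 1 + int r) - 1) = x 0 powi (- int K) * (1 / x 0) ^ r"
      proof -
        have "- (int K - 1 + int r) - 1 = - int K + (- int r)" by simp
        then have "x 0 powi (- (int K - 1 + int r) - 1) = x 0 powi (- int K) * x 0 powi (- int r)"
          by (simp only: power_int_add[OF disjI1[OF x0]])
        then show ?thesis by (simp only: power_int_minus power_int_of_nat) (simp add: power_one_over inverse_eq_divide)
      qed
      moreover have "laurent_monom {0,e} x (\<phi> r) = x 0 powi (- (int K - 1 + int r) - 1) * x e ^ r"
        using e by (simp add: laurent_monom_def \<phi>_def)
      moreover have "cov b (\<phi> r 0) (vec b' (\<phi> r e)) = \<tau> r"
        using e by (simp add: \<phi>_def \<tau>_def)
      then have "cov b (\<phi> r 0) (vec b' (\<phi> r e)) = ((2 * h + of_nat K + of_nat r - 1) gchoose r) * \<tau> 0"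
        using \<tau>[of r] by (simp only:)
      ultimately show ?thesis unfolding sphere_terms_def by (simp add: power_divide)
    qed
    have "((\<lambda>r. sphere_terms [] e v b b' x (\<phi> r)) has_sum
        ((1 - ?y) powr (2 * h) * x 0 powi (- int K) * \<tau> 0) * (1 - ?y) powr (- (2 * h + of_nat K))) UNIV"
      unfolding tm by (intro has_sum_cmult_right negative_binomial_sums y)
    also have "((1 - ?y) powr (2 * h) * x 0 powi (- int K) * \<tau> 0) * (1 - ?y) powr (- (2 * h + of_nat K)) = R x"
    proof -
      have "(1 - ?y) powr (2 * h) * (1 - ?y) powr (- (2 * h + of_nat K)) = (1 - ?y) powr (- of_nat K)"
        by (simp flip: powr_add)
      also have "\<dots> = (1 / (1 - ?y)) ^ K"
        using y1 by (simp add: powr_minus powr_nat' power_divide divide_inverse power_inverse)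
      finally have *: "(1 - ?y) powr (2 * h) * (1 - ?y) powr (- (2 * h + of_nat K)) = (1 / (1 - ?y)) ^ K" .
      have "x 0 powi (- int K) * (1 / (1 - ?y)) ^ K = (1 / x 0) ^ K * (1 / (1 - ?y)) ^ K"
        by (simp only: power_int_minus power_int_of_nat power_one_over inverse_eq_divide)
      also have "\<dots> = (1 / (x 0 - x e)) ^ K"
        unfolding power_mult_distrib[symmetric] using x0 by (simp add: field_simps)
      finally have "\<tau> 0 * (x 0 powi (- int K) * (1 / (1 - ?y)) ^ K) = R x" by (simp add: R_def)
      then show ?thesis unfolding *[symmetric] by (simp add: mult_ac)
    qed
    finally have "(sphere_terms [] e v b b' x \<circ> \<phi> has_sum R x) UNIV" by (simp add: o_def)
    moreover have "inj \<phi>" 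
    proof (rule injI)
      fix r s assume "\<phi> r = \<phi> s"
      then have "\<phi> r 0 = \<phi> s 0" by simp
      then show "r = s" by (simp add: \<phi>_def)
    qed
    ultimately have "(sphere_terms [] e v b b' x has_sum R x) (range \<phi>)" by (simp add: has_sum_reindex)
    also have "?this \<longleftrightarrow> ?thesis"
    proof (rule has_sum_cong_neutral)
      fix \<kappa> assume \<kappa>: "\<kappa> \<in> PiE {0,e} (\<lambda>_. UNIV) - range \<phi>"
      show "sphere_terms [] e v b b' x \<kappa> = 0"
      proof (cases "\<kappa> e < 0")
        case True
        then obtain r where r: "\<kappa> e = - 1 - int r" using that[of "nat (- 1 - \<kappa> e)"] by simp
        have "\<kappa> 0 \<noteq> int K - 1 + int r"
        proof
          assume "\<kappa> 0 = int K - 1 + int r"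
          then have "\<kappa> = \<phi> r" using \<kappa> r by (auto simp: \<phi>_def PiE_iff extensional_def fun_eq_iff)
          then show False using \<kappa> by blast
        qed
        then have "cov b (\<kappa> 0) (vec b' (\<kappa> e)) = 0"
          unfolding r by (intro cov_weight[OF b vlev]) (simp add: K_def)
        then show ?thesis by (simp add: sphere_terms_def)
      next
        case False
        then show ?thesis by (simp add: sphere_terms_def vec_nonneg[OF b'M] cov_zero[OF bM])
      qed
    next
      fix \<kappa> assume \<kappa>: "\<kappa> \<in> range \<phi> - PiE {0,e} (\<lambda>_. UNIV)"
      then show "sphere_terms [] e v b b' x \<kappa> = 0" by (auto simp: \<phi>_def PiE_iff extensional_def)
    qed simp
    finally show ?thesis .
  qed
  moreover have "rat_on (distinct_points {0,e}) R"
    unfolding R_def by (intro rat_on_divide rat_intros) (use e in \<open>auto simp: distinct_points_def inj_on_def\<close>)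
  ultimately show ?thesis unfolding sphere_corr_def by (auto simp: R_def Let_def)
qed

lemma two_point:
  assumes e: "e > 0" and b: "b \<in> carr M" and b': "b' \<in> carr M'"
  shows "\<exists>R. sphere_corr [] e v b b' R"
proof -
  obtain N g where g: "\<And>m. g m \<in> left.lev m" "b = (\<Sum>m<N::nat. g m)" using left.level_decomposition[OF b] by blast
  obtain N' g' where g': "\<And>m. g' m \<in> lev m" "b' = (\<Sum>m<N'::nat. g' m)" using level_decomposition[OF b'] by blast
  have gM: "g m \<in> carr M" "g' m \<in> carr M'" for m using g g' by (auto simp: wspace_def)
  obtain R where R: "\<And>m m'. sphere_corr [] e v (g m) (g' m') (R m m')"
    using two_point_homogeneous[OF e g(1) g'(1)] by metis
  have split: "sphere_terms [] e v b b' x \<kappa> = (\<Sum>m<N. \<Sum>m'<N'. sphere_terms [] e v (g m) (g' m') x \<kappa>)" for x \<kappa>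
    unfolding g(2) g'(2) sphere_terms_def vprod_simps
    by (simp add: vec_sum cov_sum_left cov_sum gM vec_in subspace_sum[OF carr_subspace[OF M]] sum_distrib_left sum_distrib_right)
  have "sphere_corr [] e v b b' (\<lambda>x. \<Sum>m<N. \<Sum>m'<N'. R m m' x)"
    using R unfolding sphere_corr_def Let_def split[abs_def]
    by (auto intro!: rat_on_sum has_sum_sum sum.cong)
  then show ?thesis by blast
qed

text \<open>Negative modes of the first field move to the left insertion, non-negative ones through the fields to the right
  insertion. Since the vacuum covector and the vacuum absorb them, only poles at differences of points appear, in
  contrast to \<open>corr\<close>; this is the source of translation invariance.\<close>

theorem sphere_corr_exists:
  assumes "sorted_wrt (<) js" "\<forall>l\<in>set js. 0 < l \<and> l < e" "e > 0"
    and "\<And>l. l \<in> set js \<Longrightarrow> v l \<in> carr V" "b \<in> carr M" "b' \<in> carr M'"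
  shows "\<exists>R. sphere_corr js e v b b' R"
  using assms
proof (induction js arbitrary: v b b')
  case Nil
  then show ?case using two_point by simp
next
  case (Cons i js)
  have dist: "distinct (i # js)" using Cons.prems(1) strict_sorted_iff by blast
  have ie: "i \<noteq> 0" "i \<noteq> e" "0 \<notin> set js" "e \<notin> set js" using Cons.prems(2) by auto
  let ?I = "insert 0 (insert e (set js))"
  let ?P = "PiE ?I (\<lambda>_. UNIV :: int set)"
  have iI: "i \<notin> ?I" using dist ie by auto
  have II: "insert 0 (insert e (set (i # js))) = insert i ?I" by auto
  define R where "R v b b' = (SOME R. sphere_corr js e v b b' R)" for v b b'
  let ?ok = "\<lambda>v b b'. (\<forall>l\<in>set js. v l \<in> carr V) \<and> b \<in> carr M \<and> b' \<in> carr M'"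
  have R: "sphere_corr js e v b b' (R v b b')" if "?ok v b b'" for v b b'
  proof -
    have "\<exists>R. sphere_corr js e v b b' R" by (rule Cons.IH) (use Cons.prems that in auto)
    then show ?thesis unfolding R_def by (rule someI_ex)
  qed
  have v: "v l \<in> carr V" if "l \<in> set (i # js)" for l using Cons.prems(4) that .
  note b = Cons.prems(5) and b' = Cons.prems(6)
  have "dualvec (\<lambda>_. 0)" by (simp add: dualvec_def lin_on_def)
  then obtain K1 where K1: "mode_bound K1 (\<lambda>_. 0) (v i) v js b'"
    using mode_bound_exists[of "\<lambda>_. 0" "v i" js v b'] v b' by auto
  obtain K2 where K2: "\<forall>k\<ge>K2. mode M (v i) (int k) b = 0" using mode_truncation[OF Mw v b] by auto
  define K where "K = max K1 K2"
  have Kb: "mode M (v i) (int k) b = 0" and Kb': "mode M' (v i) (int k) b' = 0"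
    and Kv: "l \<in> set js \<Longrightarrow> mode V (v i) (int k) (v l) = 0" if "k \<ge> K" for k l
    using K1 K2 that by (auto simp: K_def mode_bound_def)
  let ?b = "\<lambda>j. mode M (v i) (int j) b" and ?b' = "\<lambda>j. mode M' (v i) (int j) b'"
    and ?v = "\<lambda>l j. v(l := mode V (v i) (int j) (v l))"
  have ok: "?ok v b b'" "?ok v (?b j) b'" "?ok v b (?b' j)" "?ok (?v l j) b b'" if "l \<in> set js \<or> l = i" for l j
    using v b b' that mode_closed[OF Mw] mode_closed[OF M] mode_closed[OF V_module] by auto
  define S where "S x = fV one (v i) * R v b b' x + (\<Sum>j<K. (1 / (x i - x 0)) ^ Suc j * R v (?b j) b' x)
      + (\<Sum>j<K. (1 / (x i - x e)) ^ Suc j * R v b (?b' j) x)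
      + (\<Sum>l\<in>set js. \<Sum>j<K. (1 / (x i - x l)) ^ Suc j * R (?v l j) b b' x)" for x
  have dp: "x \<in> distinct_points ?I" if "x \<in> distinct_points (insert i ?I)" for x
    using that by (auto simp: distinct_points_def)
  have neq: "x i \<noteq> x l" if "x \<in> distinct_points (insert i ?I)" "l \<in> ?I" for x l
    using that iI by (auto simp: distinct_points_def)
  have "rat_on (distinct_points (insert i ?I)) S"
  proof -
    have 1: "rat_on (distinct_points (insert i ?I)) (R v b b')" if "?ok v b b'" for v b b'
      by (rule rat_on_subset) (use R[OF that] dp in \<open>auto simp: sphere_corr_def Let_def\<close>)
    have 2: "rat_on (distinct_points (insert i ?I)) (\<lambda>x. 1 / (x i - x l))" if "l \<in> ?I" for l
      by (intro rat_on_divide rat_intros) (use that neq in auto)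
    show ?thesis unfolding S_def
      by (intro rat_on_add rat_on_sum rat_on_mult rat_on_power rat_on_const 1 2 ok) auto
  qed
  moreover have "S (\<lambda>i. x i + c) = S x" if "x \<in> distinct_points (insert i ?I)" for x c
  proof -
    have 1: "R v b b' (\<lambda>i. x i + c) = R v b b' x" if "?ok v b b'" for v b b'
      using R[OF that] dp[OF \<open>x \<in> _\<close>] by (auto simp: sphere_corr_def Let_def)
    have "R v b b' (\<lambda>i. x i + c) = R v b b' x" "R v (?b j) b' (\<lambda>i. x i + c) = R v (?b j) b' x"
       "R v b (?b' j) (\<lambda>i. x i + c) = R v b (?b' j) x" for j
      using 1 ok[of i] by auto
    moreover have "R (?v l j) b b' (\<lambda>i. x i + c) = R (?v l j) b b' x" if "l \<in> set js" for l j
      using 1 ok(4)[of l j] that by blast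
    ultimately show ?thesis unfolding S_def by simp
  qed
  moreover have "(sphere_terms (i # js) e v b b' x has_sum S x) (PiE (insert i ?I) (\<lambda>_. UNIV))"
    if x: "x \<in> nested (insert i ?I)" for x
  proof -
    have x': "x \<in> nested ?I" using x by (auto simp: nested_def)
    let ?T = "\<lambda>v b b' \<kappa>. sphere_terms js e v b b' x \<kappa>"
    have T: "(?T v b b' has_sum R v b b' x) ?P" if "?ok v b b'" for v b b'
      using R[OF that] x' by (auto simp: sphere_corr_def Let_def)
    have x0: "norm (x i) < norm (x 0)" using x ie by (auto simp: nested_def)
    then have x0': "x 0 \<noteq> 0" by auto
    have xl: "norm (x l) < norm (x i)" if "l \<in> set js \<or> l = e" for l
      using x Cons.prems(1,2) that by (auto simp: nested_def)
    have xl': "x l \<noteq> 0" if "l \<in> set js" for l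
    proof -
      have "norm (x e) < norm (x l)" using x Cons.prems(2) that by (auto simp: nested_def)
      then show ?thesis by auto
    qed
    let ?c = "\<lambda>l j k. if k \<ge> 0 then (of_int k gchoose j) * x l powi (k - int j) * x i powi (- k - 1) else 0"
    let ?F0 = "\<lambda>(a,\<kappa>). (if a = - 1 then fV one (v i) else 0) * ?T v b b' \<kappa>"
    let ?F1 = "\<lambda>j (a,\<kappa>). (if a < 0 then (of_int a gchoose j) * x 0 powi (a - int j) * x i powi (- a - 1) else 0) *
        ?T v (?b j) b' (\<kappa>(0 := \<kappa> 0 + (a - int j)))"
    let ?F2 = "\<lambda>j (a,\<kappa>). ?c e j a * ?T v b (?b' j) (\<kappa>(e := \<kappa> e + (a - int j)))"
    let ?F3 = "\<lambda>l j (a,\<kappa>). ?c l j a * ?T (?v l j) b b' (\<kappa>(l := \<kappa> l + (a - int j)))"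
    have F0: "(?F0 has_sum fV one (v i) * R v b b' x) (UNIV \<times> ?P)"
      by (rule has_sum_times[OF has_sum_single_index T[OF ok(1)[of i]]]) simp
    have F1: "(?F1 j has_sum (- ((1 / (x i - x 0)) ^ Suc j)) * R v (?b j) b' x) (UNIV \<times> ?P)" for j
      by (rule has_sum_twisted_product[OF has_sum_neg_modes[OF x0] T[OF ok(2)[of i]] bij_betw_PiE_shift]) auto
    have F2: "(?F2 j has_sum (1 / (x i - x e)) ^ Suc j * R v b (?b' j) x) (UNIV \<times> ?P)" for j
      by (rule has_sum_twisted_product[OF has_sum_nonneg_modes[OF xl] T[OF ok(3)[of i]] bij_betw_PiE_shift]) auto
    have F3: "(?F3 l j has_sum (1 / (x i - x l)) ^ Suc j * R (?v l j) b b' x) (UNIV \<times> ?P)" if "l \<in> set js" for l j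
      by (rule has_sum_twisted_product[OF has_sum_nonneg_modes[OF xl] T[OF ok(4)[of l]] bij_betw_PiE_shift]) (use that in auto)
    have F1': "((\<lambda>p. - (\<Sum>j<K. ?F1 j p)) has_sum - (\<Sum>j<K. (- ((1 / (x i - x 0)) ^ Suc j)) * R v (?b j) b' x)) (UNIV \<times> ?P)"
      unfolding has_sum_uminus minus_minus by (intro has_sum_sum F1)
    have "((\<lambda>p. ?F0 p + - (\<Sum>j<K. ?F1 j p) + (\<Sum>j<K. ?F2 j p) + (\<Sum>l\<in>set js. \<Sum>j<K. ?F3 l j p)) has_sum
       fV one (v i) * R v b b' x + - (\<Sum>j<K. (- ((1 / (x i - x 0)) ^ Suc j)) * R v (?b j) b' x)
       + (\<Sum>j<K. (1 / (x i - x e)) ^ Suc j * R v b (?b' j) x)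
       + (\<Sum>l\<in>set js. \<Sum>j<K. (1 / (x i - x l)) ^ Suc j * R (?v l j) b b' x)) (UNIV \<times> ?P)"
      by (intro has_sum_add has_sum_sum F0 F1' F2 F3)
    also have "fV one (v i) * R v b b' x + - (\<Sum>j<K. (- ((1 / (x i - x 0)) ^ Suc j)) * R v (?b j) b' x)
       + (\<Sum>j<K. (1 / (x i - x e)) ^ Suc j * R v b (?b' j) x)
       + (\<Sum>l\<in>set js. \<Sum>j<K. (1 / (x i - x l)) ^ Suc j * R (?v l j) b b' x) = S x"
      by (simp add: S_def sum_negf)
    also have "(\<lambda>p. ?F0 p + - (\<Sum>j<K. ?F1 j p) + (\<Sum>j<K. ?F2 j p) + (\<Sum>l\<in>set js. \<Sum>j<K. ?F3 l j p)) =
        (\<lambda>(a,\<kappa>). sphere_terms (i # js) e v b b' x (\<kappa>(i := a)))"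
    proof (rule ext)
      fix p :: "int \<times> (nat \<Rightarrow> int)"
      obtain a \<kappa> where p: "p = (a, \<kappa>)" by (cases p)
      define X where "X = vprod M' js v \<kappa> (vec b' (\<kappa> e))"
      define Q where "Q = (1 - x e / x 0) powr (2 * h)"
      define L where "L = laurent_monom ?I x \<kappa>"
      have X: "X \<in> carr M'" unfolding X_def by (rule vprod_closed[OF M]) (use v vec_in[OF b'] in auto)
      have vi: "v i \<in> carr V" using v by simp
      have rhs: "sphere_terms (i # js) e v b b' x (\<kappa>(i := a)) =
          Q * cov b (\<kappa> 0) (mode M' (v i) a X) * (x i powi (- a - 1) * L)"
        unfolding sphere_terms_def II laurent_monom_insert[OF _ iI, of x \<kappa> a, simplified] vprod_Cons_upd[OF dist]
        using ie by (simp add: X_def Q_def L_def)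
      have "?F0 (a,\<kappa>) + - (\<Sum>j<K. ?F1 j (a,\<kappa>)) + (\<Sum>j<K. ?F2 j (a,\<kappa>)) + (\<Sum>l\<in>set js. \<Sum>j<K. ?F3 l j (a,\<kappa>)) =
          sphere_terms (i # js) e v b b' x (\<kappa>(i := a))"
      proof (cases "a < 0")
        case True
        have "?F1 j (a,\<kappa>) = Q * ((of_int a gchoose j) * cov (?b j) (\<kappa> 0 + (a - int j)) X) * (x i powi (- a - 1) * L)" for j
        proof -
          have "x 0 powi (a - int j) * laurent_monom ?I x (\<kappa>(0 := \<kappa> 0 + (a - int j))) = L"
            unfolding L_def by (rule laurent_monom_shift) (use x0' in auto)
          moreover have "vprod M' js v (\<kappa>(0 := \<kappa> 0 + (a - int j))) (vec b' ((\<kappa>(0 := \<kappa> 0 + (a - int j))) e)) = X"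
            unfolding X_def using Cons.prems(3) by (simp, intro vprod_cong) (use ie in auto)
          ultimately show ?thesis using True by (simp add: sphere_terms_def Q_def mult_ac)
        qed
        moreover have "(\<Sum>j<K. ?F2 j (a,\<kappa>)) = 0" "(\<Sum>l\<in>set js. \<Sum>j<K. ?F3 l j (a,\<kappa>)) = 0"
          using True by simp_all
        moreover have "?F0 (a,\<kappa>) = Q * (if a = -1 then fV one (v i) * cov b (\<kappa> 0) X else 0) * (x i powi (- a - 1) * L)"
          by (simp add: sphere_terms_def Q_def X_def L_def)
        moreover have "cov b (\<kappa> 0) (mode M' (v i) a X) = (if a = -1 then fV one (v i) * cov b (\<kappa> 0) X else 0)
           - (\<Sum>j<K. (of_int a gchoose j) * cov (?b j) (\<kappa> 0 + (a - int j)) X)"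
          by (rule cov_mode[OF vi b X _ True]) (rule Kb)
        ultimately show ?thesis unfolding rhs
          by (simp add: sum_distrib_left sum_distrib_right right_diff_distrib left_diff_distrib)
      next
        case False
        then have a: "a \<ge> 0" by simp
        have F2': "?F2 j (a,\<kappa>) = Q * ((of_int a gchoose j) * cov b (\<kappa> 0) (vprod M' js v \<kappa> (vec (?b' j) (\<kappa> e + (a - int j))))) * (x i powi (- a - 1) * L)" for j
        proof -
          let ?d = "a - int j"
          have eq: "vprod M' js v (\<kappa>(e := \<kappa> e + ?d)) w = vprod M' js v \<kappa> w" for w
            by (intro vprod_cong) (use ie in auto)
          have b'j: "?b' j \<in> carr M'" by (rule mode_closed[OF M vi b'])
          \<comment> \<open>if \<open>x e = 0\<close>, the powers of \<open>x e\<close> are only meaningful in the third case; in the other two both sides vanish\<close>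
          consider "?d < 0" | "?d \<ge> 0" "\<kappa> e + ?d \<ge> 0" | "?d \<ge> 0" "\<kappa> e + ?d < 0" by linarith
          then show ?thesis
          proof cases
            case 1
            then have "(of_int a gchoose j :: complex) = 0"
              using a by (metis binomial_eq_0 binomial_gbinomial nonneg_int_cases of_int_of_nat_eq of_nat_0 of_nat_less_iff diff_less_0_iff_less)
            then show ?thesis by simp
          next
            case 2
            then show ?thesis using v ie
              by (simp add: sphere_terms_def vec_nonneg[OF b'j] vprod_zero[OF M] cov_zero[OF b])
          next
            case 3
            have "x e powi ?d * laurent_monom ?I x (\<kappa>(e := \<kappa> e + ?d)) = L"
              unfolding L_def by (rule laurent_monom_shift_nonneg) (use 3 in auto)
            then show ?thesis using a Cons.prems(3) by (simp add: sphere_terms_def eq Q_def mult_ac)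
          qed
        qed
        have F3': "?F3 l j (a,\<kappa>) = Q * ((of_int a gchoose j) * cov b (\<kappa> 0) (vprod M' js (?v l j) (\<kappa>(l := \<kappa> l + (a - int j))) (vec b' (\<kappa> e)))) * (x i powi (- a - 1) * L)"
          if l: "l \<in> set js" for l j
        proof -
          have "x l powi (a - int j) * laurent_monom ?I x (\<kappa>(l := \<kappa> l + (a - int j))) = L"
            unfolding L_def by (rule laurent_monom_shift) (use xl' l in auto)
          moreover have "l \<noteq> 0" "l \<noteq> e" using l ie by metis+
          ultimately show ?thesis using a by (simp add: sphere_terms_def Q_def mult_ac)
        qed
        have mode: "mode M' (v i) a X = (\<Sum>j<K. (of_int a gchoose j) \<odot> vprod M' js v \<kappa> (vec (?b' j) (\<kappa> e + (a - int j)))) +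
           (\<Sum>l\<in>set js. \<Sum>j<K. (of_int a gchoose j) \<odot> vprod M' js (?v l j) (\<kappa>(l := \<kappa> l + (a - int j))) (vec b' (\<kappa> e)))"
        proof -
          have sub: "vprod M' js v \<kappa> (\<Sum>j<K. c j \<odot> y j) = (\<Sum>j<K. c j \<odot> vprod M' js v \<kappa> (y j))" if "\<And>j. y j \<in> carr M'" for c and y :: "nat \<Rightarrow> 'u"
          proof (induction K)
            case 0
            show ?case using v by (simp add: vprod_zero[OF M])
          next
            case (Suc K)
            then show ?case using that v
              by (simp add: vprod_add[OF M] vprod_scale[OF M] subspace_sum subspace_scale carr_subspace[OF M])
          qed
          have "mode M' (v i) a X = vprod M' js v \<kappa> (mode M' (v i) a (vec b' (\<kappa> e))) +
             (\<Sum>l\<in>set js. \<Sum>j<K. (of_int a gchoose j) \<odot> vprod M' js (?v l j) (\<kappa>(l := \<kappa> l + (a - int j))) (vec b' (\<kappa> e)))"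
            unfolding X_def by (rule commutator_vprod[OF M]) (use dist v vec_in[OF b'] Kv in auto)
          also have "mode M' (v i) a (vec b' (\<kappa> e)) = (\<Sum>j<K. (of_int a gchoose j) \<odot> vec (?b' j) (\<kappa> e + (a - int j)))"
            by (rule vec_mode[OF vi b' Kb' a])
          also have "vprod M' js v \<kappa> \<dots> = (\<Sum>j<K. (of_int a gchoose j) \<odot> vprod M' js v \<kappa> (vec (?b' j) (\<kappa> e + (a - int j))))"
            by (rule sub) (rule vec_in[OF mode_closed[OF M vi b']])
          finally show ?thesis .
        qed
        have in1: "vprod M' js v \<kappa> (vec (?b' j) k) \<in> carr M'" for j k
          by (rule vprod_closed[OF M]) (use v vec_in[OF mode_closed[OF M vi b']] in auto)
        have in2: "vprod M' js (?v l j) \<kappa>' (vec b' k) \<in> carr M'" if "l \<in> set js" for l j \<kappa>' k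
          by (rule vprod_closed[OF M]) (use v vec_in[OF b'] that mode_closed[OF V_module] in auto)
        have cmode: "cov b (\<kappa> 0) (mode M' (v i) a X) =
            (\<Sum>j<K. (of_int a gchoose j) * cov b (\<kappa> 0) (vprod M' js v \<kappa> (vec (?b' j) (\<kappa> e + (a - int j))))) +
            (\<Sum>l\<in>set js. \<Sum>j<K. (of_int a gchoose j) * cov b (\<kappa> 0) (vprod M' js (?v l j) (\<kappa>(l := \<kappa> l + (a - int j))) (vec b' (\<kappa> e))))"
          unfolding mode using in1 in2
          by (simp add: lin_onD[OF cov_lin[OF b]] cov_sum[OF b] subspace_sum subspace_scale carr_subspace[OF M])
        have Z: "?F0 (a,\<kappa>) = 0" "(\<Sum>j<K. ?F1 j (a,\<kappa>)) = 0" using a by simp_all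
        have S3: "(\<Sum>l\<in>set js. \<Sum>j<K. ?F3 l j (a,\<kappa>)) = (\<Sum>l\<in>set js. \<Sum>j<K. Q * ((of_int a gchoose j) *
            cov b (\<kappa> 0) (vprod M' js (?v l j) (\<kappa>(l := \<kappa> l + (a - int j))) (vec b' (\<kappa> e)))) * (x i powi (- a - 1) * L))"
          by (intro sum.cong refl F3')
        show ?thesis unfolding rhs cmode F2' S3 Z
          by (simp only: sum_distrib_left sum_distrib_right ring_distribs minus_zero add_0)
      qed
      then show "?F0 p + - (\<Sum>j<K. ?F1 j p) + (\<Sum>j<K. ?F2 j p) + (\<Sum>l\<in>set js. \<Sum>j<K. ?F3 l j p) =
          (case p of (a,\<kappa>) \<Rightarrow> sphere_terms (i # js) e v b b' x (\<kappa>(i := a)))"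
        unfolding p by (simp only: prod.case)
    qed
    finally show ?thesis unfolding has_sum_PiE_insert[OF iI] .
  qed
  ultimately have "sphere_corr (i # js) e v b b' S" unfolding sphere_corr_def II Let_def by blast
  then show ?case by blast
qed

end

section \<open>Values of the genus zero correlators\<close>

lemma (in graded_module) corr_cong_points:
  assumes "\<And>l. l \<in> set js \<Longrightarrow> x l = y l"
  shows "corr js \<theta> v x \<psi> = corr js \<theta> v y \<psi>"
  using assms
proof (induction js arbitrary: \<theta> v \<psi>)
  case (Cons i js)
  have i: "x i = y i" and IH: "corr js \<theta>' v' x \<psi>' = corr js \<theta>' v' y \<psi>'" for \<theta>' v' \<psi>'
    using Cons by auto
  show ?case unfolding corr.simps i IH using Cons.prems by (auto intro!: sum.cong)
qed simp

context sphere
begin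

lemma funpow_adjoint: "\<phi> \<in> carr M \<Longrightarrow> w \<in> carr M' \<Longrightarrow> f ((vir V M (-1) ^^ p) \<phi>) w = f \<phi> ((vir V M' 1 ^^ p) w)"
proof (induction p arbitrary: w)
  case (Suc p)
  have "f ((vir V M (-1) ^^ Suc p) \<phi>) w = f ((vir V M (-1) ^^ p) \<phi>) (vir V M' 1 w)"
    using f_adjoint[OF left.funpow_vir_in[OF Suc.prems(1), where n = "-1" and i = p] Suc.prems(2), of 1] by simp
  then show ?case using Suc.IH[OF Suc.prems(1) vir_in_both(2)[OF Suc.prems(2)]] by (simp add: funpow_swap1)
qed simp

text \<open>The normalisation of \<open>Y0\<close> through the creative intertwiner \<open>Y1\<close>, whose action on the vacuum is \<open>e\<^bsup>zL(-1)\<^esup>\<close>; the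
  powers of \<open>L(-1)\<close> then pass to \<open>M'\<close> as powers of \<open>L(1)\<close>.\<close>

lemma cov_expand:
  assumes b: "b \<in> left.lev m" and X: "X \<in> carr M'"
  shows "cov b k X = (\<Sum>j\<le>m. (if k + 1 - 2 * int m + int j \<ge> 0
     then exp (\<kappa>' * (h + of_nat m)) / (fact j * fact (nat (k + 1 - 2 * int m + int j))) else 0) *
       f ((vir V M 1 ^^ j) b) ((vir V M' 1 ^^ nat (k + 1 - 2 * int m + int j)) X))"
proof -
  have bM: "b \<in> carr M" using b by (simp add: wspace_def)
  let ?E = "exp (\<kappa>' * (h + of_nat m))"
  let ?p = "\<lambda>j. k + 1 - 2 * int m + int j"
  let ?g = "\<lambda>j. ?E / fact j * f (Y1 ((vir V M 1 ^^ j) b) (2 * (h + of_nat m) - of_nat j - (2 * h + of_int k) - 2) one) X"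
  have g: "?g j = (if ?p j \<ge> 0 then ?E / (fact j * fact (nat (?p j))) else 0) * f ((vir V M 1 ^^ j) b) ((vir V M' 1 ^^ nat (?p j)) X)" for j
  proof -
    have idx: "2 * (h + of_nat m) - of_nat j - (2 * h + of_int k) - 2 = (of_int (2 * int m - int j - k - 2) :: complex)" by simp
    have c: "(vir V M 1 ^^ j) b \<in> carr M" by (rule left.funpow_vir_in[OF bM])
    have n: "nat (- 1 - (2 * int m - int j - k - 2)) = nat (?p j)" by (rule arg_cong[where f = nat]) simp
    have "f (Y1 ((vir V M 1 ^^ j) b) (of_int (2 * int m - int j - k - 2)) one) X =
        (if ?p j \<ge> 0 then (1 / fact (nat (?p j))) * f ((vir V M (-1) ^^ nat (?p j)) ((vir V M 1 ^^ j) b)) X else 0)"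
      unfolding creative_vacuum[OF Mw Y1_creative c] n
      using f_scale_left[OF X left.funpow_vir_in[OF c]] f_zero(2)[OF X] by auto
    then show ?thesis unfolding idx funpow_adjoint[OF c X] by simp
  qed
  have "cov b k X = Sum_any ?g"
    using Y0_pairing b X vac_in unfolding pairing_normalized_def cov_def V0_simps by blast
  also have "\<dots> = (\<Sum>j<Suc m. ?g j)"
  proof (rule Sum_any_bounded)
    fix j assume "j \<ge> Suc m"
    then have "(vir V M 1 ^^ j) b = 0" by (intro left.vir1_lev_nilpotent[OF b]) simp
    then show "?g j = 0" unfolding g by (simp add: f_zero funpow_vir_in X)
  qed
  finally show ?thesis unfolding g lessThan_Suc_atMost .
qed

context
  fixes js :: "nat list" and e :: nat and v :: "nat \<Rightarrow> 'u" and wt :: "nat \<Rightarrow> nat"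
  assumes js: "sorted_wrt (<) js" "\<And>l. l \<in> set js \<Longrightarrow> 0 < l \<and> l < e" "e > 0"
    and qp: "\<And>l. l \<in> set js \<Longrightarrow> quasiprimary V (wt l) (v l)"
begin

lemma js_facts: "distinct js" "0 \<notin> set js" "e \<notin> set js" "e \<noteq> 0"
  using js strict_sorted_iff by auto

text \<open>With the right insertion at \<open>0\<close> only its mode \<open>-1\<close> contributes. For fixed mode of the left insertion the sum over the
  modes of the fields is a correlator on \<open>M'\<close>, and the remaining one-variable series is that of
  \<open>special_conformal_sums\<close>, shifted by \<open>m - j\<close>.\<close>

lemma radial_special_value:
  assumes R: "sphere_corr js e v b b' R" and b: "b \<in> left.lev m" and b': "b' \<in> lev m'"
    and x: "x \<in> nested (insert 0 (insert e (set js)))" and xe: "x e = 0" and t: "t = 1 / x 0"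
  shows "R x = exp (\<kappa>' * (h + of_nat m)) * (\<Sum>j\<le>m. t ^ (2 * m - j) / fact j *
     ((\<Prod>l\<in>set js. (1 / (1 - t * x l) ^ 2) ^ wt l) *
      (\<Sum>i\<le>m'. t ^ i / fact i * corr js (f ((vir V M 1 ^^ j) b)) v (\<lambda>l. x l / (1 - t * x l)) ((vir V M' 1 ^^ i) b'))))"
proof -
  have bM: "b \<in> carr M" and b'M: "b' \<in> carr M'" using b b' by (auto simp: wspace_def)
  let ?E = "exp (\<kappa>' * (h + of_nat m))" let ?P = "PiE (set js) (\<lambda>_. UNIV :: int set)"
  let ?p = "\<lambda>j k. k + 1 - 2 * int m + int j"
  let ?c = "\<lambda>j k. if ?p j k \<ge> 0 then ?E / (fact j * fact (nat (?p j k))) else 0"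
  let ?\<theta> = "\<lambda>j p w. f ((vir V M 1 ^^ j) b) ((vir V M' 1 ^^ p) w)"
  let ?I = "insert 0 (insert e (set js))"
  have lt: "norm (x l) < norm (x 0)" if "l \<in> set js" for l using x js(2)[OF that] that by (auto simp: nested_def)
  have ne: "x l \<noteq> 0" if "l \<in> set js" for l
  proof -
    have "norm (x e) < norm (x l)" using x js(2)[OF that] that by (auto simp: nested_def)
    then show ?thesis by auto
  qed
  have "norm (x e) < norm (x 0)" using x js(3) by (auto simp: nested_def)
  then have x0: "x 0 \<noteq> 0" by auto
  have rad: "x \<in> radially_ordered (set js)" using x ne by (auto simp: nested_def radially_ordered_def)
  have conf: "x \<in> config (set js)" using rad radial_config by blast
  have carrV: "v l \<in> carr V" if "l \<in> set js" for l using qp[OF that] by (simp add: quasiprimary_def wspace_def)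
  have dual: "dualvec (f ((vir V M 1 ^^ j) b))" "dualvec (?\<theta> j p)" for j p
    by (auto intro!: dualvec_funpow_vir f_dualvec left.funpow_vir_in bM)
  have adm: "admissible js (?\<theta> j p) v b'" for j p using dual carrV b'M by (auto simp: admissible_def)
  define C where "C j p = corr js (?\<theta> j p) v x b'" for j p
  define S where "S k = x 0 powi (- k - 1) * (\<Sum>j\<le>m. ?c j k * C j (nat (?p j k)))" for k
  have vp: "vprod M' js v \<kappa> b' \<in> carr M'" for \<kappa> by (rule vprod_closed[OF M carrV b'M])
  have row: "((\<lambda>\<kappa>. sphere_terms js e v b b' x (\<kappa>(0 := k))) has_sum S k) (PiE (insert e (set js)) (\<lambda>_. UNIV))" for k
  proof -
    have "((\<lambda>\<kappa>. \<Sum>j\<le>m. ?c j k * (?\<theta> j (nat (?p j k)) (vprod M' js v \<kappa> b') * laurent_monom (set js) x \<kappa>)) has_sum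
        (\<Sum>j\<le>m. ?c j k * C j (nat (?p j k)))) ?P"
      unfolding C_def by (intro has_sum_sum has_sum_cmult_right has_sum_corr js(1) adm rad)
    also have "(\<lambda>\<kappa>. \<Sum>j\<le>m. ?c j k * (?\<theta> j (nat (?p j k)) (vprod M' js v \<kappa> b') * laurent_monom (set js) x \<kappa>)) =
        (\<lambda>\<kappa>. cov b k (vprod M' js v \<kappa> b') * laurent_monom (set js) x \<kappa>)"
      unfolding cov_expand[OF b vp] sum_distrib_right by (simp only: mult.assoc)
    finally have "((\<lambda>(a,\<kappa>). (if a = -1 then x 0 powi (- k - 1) else 0) * (cov b k (vprod M' js v \<kappa> b') * laurent_monom (set js) x \<kappa>)) has_sum S k) (UNIV \<times> ?P)"
      unfolding S_def by (rule has_sum_times[OF has_sum_single_index])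
    also have "(\<lambda>(a,\<kappa>). (if a = -1 then x 0 powi (- k - 1) else 0) * (cov b k (vprod M' js v \<kappa> b') * laurent_monom (set js) x \<kappa>)) =
       (\<lambda>(a,\<kappa>). sphere_terms js e v b b' x (\<kappa>(e := a, 0 := k)))"
    proof (rule ext)
      fix p :: "int \<times> (nat \<Rightarrow> int)"
      obtain a \<kappa> where p: "p = (a, \<kappa>)" by (cases p)
      have vv: "vprod M' js v (\<kappa>(e := a, 0 := k)) w = vprod M' js v \<kappa> w" for w
        by (intro vprod_cong) (use js_facts in auto)
      have "laurent_monom ?I x (\<kappa>(e := a, 0 := k)) = x 0 powi (- k - 1) * (x e powi (- a - 1) * laurent_monom (set js) x \<kappa>)"
        using js_facts by (simp add: laurent_monom_insert del: fun_upd_apply)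
      moreover have "x e powi (- a - 1) = (if a = -1 then 1 else 0)" using xe by (simp add: power_int_0_left_if)
      moreover have "vec b' (-1) = b'" using vec_eq[OF b'M, of 0] by simp
      ultimately show "(case p of (a,\<kappa>) \<Rightarrow> (if a = -1 then x 0 powi (- k - 1) else 0) * (cov b k (vprod M' js v \<kappa> b') * laurent_monom (set js) x \<kappa>)) =
        (case p of (a,\<kappa>) \<Rightarrow> sphere_terms js e v b b' x (\<kappa>(e := a, 0 := k)))"
        using js_facts unfolding p sphere_terms_def vv prod.case by (simp add: xe)
    qed
    finally show ?thesis unfolding has_sum_PiE_insert[OF js_facts(3)] .
  qed
  have "(sphere_terms js e v b b' x has_sum R x) (PiE ?I (\<lambda>_. UNIV))"
    using R x by (simp add: sphere_corr_def Let_def)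
  then have "((\<lambda>(k,\<kappa>). sphere_terms js e v b b' x (\<kappa>(0 := k))) has_sum R x) (UNIV \<times> PiE (insert e (set js)) (\<lambda>_. UNIV))"
    using has_sum_PiE_insert[of 0 "insert e (set js)" "sphere_terms js e v b b' x"] js_facts by simp
  then have "(S has_sum R x) UNIV"
    by (rule has_sum_SigmaD) (use row in auto)
  also have "?this \<longleftrightarrow> (S has_sum R x) (range (\<lambda>n. int n + (int m - 1)))"
  proof (rule has_sum_cong_neutral)
    fix k :: int assume k: "k \<in> UNIV - range (\<lambda>n. int n + (int m - 1))"
    have "k < int m - 1"
    proof (rule ccontr)
      assume "\<not> k < int m - 1"
      then have "k = int (nat (k - (int m - 1))) + (int m - 1)" by simp
      then show False using k by blast
    qed
    then show "S k = 0" unfolding S_def by (simp add: sum.neutral)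
  qed auto
  also have "\<dots> \<longleftrightarrow> ((\<lambda>n. S (int n + (int m - 1))) has_sum R x) UNIV"
    by (subst has_sum_reindex) (auto simp: o_def inj_def)
  finally have sums1: "(\<lambda>n. S (int n + (int m - 1))) sums R x" by (rule has_sum_imp_sums)
  have nt: "norm (t * x l) < 1" if "l \<in> set js" for l using lt[OF that] x0 by (simp add: t norm_mult norm_divide)
  have nil: "(vir V M' 1 ^^ Suc m') b' = 0" by (rule vir1_lev_nilpotent[OF b']) simp
  define Z where "Z j = (\<Prod>l\<in>set js. (1 / (1 - t * x l) ^ 2) ^ wt l) *
      (\<Sum>i\<le>m'. t ^ i / fact i * corr js (f ((vir V M 1 ^^ j) b)) v (\<lambda>l. x l / (1 - t * x l)) ((vir V M' 1 ^^ i) b'))" for j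
  have Z: "(\<lambda>p. t ^ p / fact p * C j p) sums Z j" for j
    unfolding C_def Z_def by (rule special_conformal_sums[OF js(1) qp dual(1) b'M nil conf nt]) auto
  let ?h = "\<lambda>j n. if n < m - j then 0 else t ^ (n - (m - j)) / fact (n - (m - j)) * C j (n - (m - j))"
  have h: "?h j sums Z j" for j
  proof -
    have "(\<lambda>n. ?h j (n + (m - j))) sums Z j" using Z[of j] by simp
    then show ?thesis by (subst (asm) sums_zero_iff_shift) auto
  qed
  have "(\<lambda>n. \<Sum>j\<le>m. ?E * t ^ (2 * m - j) / fact j * ?h j n) sums (\<Sum>j\<le>m. ?E * t ^ (2 * m - j) / fact j * Z j)"
    by (intro sums_sum sums_mult h)
  also have "(\<lambda>n. \<Sum>j\<le>m. ?E * t ^ (2 * m - j) / fact j * ?h j n) = (\<lambda>n. S (int n + (int m - 1)))"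
  proof (rule ext)
    fix n
    have pw: "x 0 powi (- (int n + (int m - 1)) - 1) = t ^ (n + m)"
    proof -
      have "- (int n + (int m - 1)) - 1 = - int (n + m)" by simp
      then show ?thesis by (simp only: power_int_minus power_int_of_nat t power_one_over inverse_eq_divide)
    qed
    have "?E * t ^ (2 * m - j) / fact j * ?h j n = t ^ (n + m) * (?c j (int n + (int m - 1)) * C j (nat (?p j (int n + (int m - 1)))))"
      if "j \<le> m" for j
    proof (cases "n < m - j")
      case True
      then have "\<not> ?p j (int n + (int m - 1)) \<ge> 0" by linarith
      then show ?thesis using True by simp
    next
      case False
      then have p: "?p j (int n + (int m - 1)) = int (n - (m - j))" using that by simp
      have "n + m = (2 * m - j) + (n - (m - j))" using False that by simp
      then have "t ^ (n + m) = t ^ (2 * m - j) * t ^ (n - (m - j))" by (metis power_add)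
      then show ?thesis unfolding p nat_int using False by (simp del: of_nat_diff)
    qed
    then show "(\<Sum>j\<le>m. ?E * t ^ (2 * m - j) / fact j * ?h j n) = S (int n + (int m - 1))"
      unfolding S_def pw sum_distrib_left by (intro sum.cong refl) auto
  qed
  finally have "R x = (\<Sum>j\<le>m. ?E * t ^ (2 * m - j) / fact j * Z j)" using sums1 sums_unique2 by blast
  then show ?thesis by (simp add: Z_def sum_distrib_left mult.assoc)
qed

lemma moebius_config:
  assumes "x \<in> config (insert 0 (set js))"
  shows "(\<lambda>l. x l / (1 - 1 / x 0 * x l)) \<in> config (set js)" and "l \<in> set js \<Longrightarrow> 1 - 1 / x 0 * x l \<noteq> 0"
proof -
  have x: "x 0 \<noteq> 0" "x l \<noteq> 0" "x l \<noteq> x 0" if "l \<in> set js" for l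
    using assms that js_facts by (auto simp: config_def inj_on_def)
  have ne: "1 - 1 / x 0 * x l \<noteq> 0" if "l \<in> set js" for l using x[OF that] by (simp add: field_simps)
  then show "l \<in> set js \<Longrightarrow> 1 - 1 / x 0 * x l \<noteq> 0" .
  have "inj_on (\<lambda>l. x l / (1 - 1 / x 0 * x l)) (set js)"
  proof (rule inj_onI)
    fix k l assume kl: "k \<in> set js" "l \<in> set js" and eq: "x k / (1 - 1 / x 0 * x k) = x l / (1 - 1 / x 0 * x l)"
    then have "x k * (1 - 1 / x 0 * x l) = x l * (1 - 1 / x 0 * x k)" using ne by (simp add: frac_eq_eq)
    then have "x k = x l" by (simp add: algebra_simps)
    then show "k = l" using assms kl by (auto simp: config_def inj_on_def)
  qed
  then show "(\<lambda>l. x l / (1 - 1 / x 0 * x l)) \<in> config (set js)" using x ne by (auto simp: config_def)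
qed

text \<open>Both sides are rational in the points other than \<open>x\<^sub>e\<close>, so the value at \<open>x\<^sub>e = 0\<close> extends from the radially ordered
  points; translation invariance supplies the other values of \<open>x\<^sub>e\<close>.\<close>

theorem sphere_corr_value:
  assumes R: "sphere_corr js e v b b' R" and b: "b \<in> left.lev m" and b': "b' \<in> lev m'"
    and x: "x \<in> distinct_points (insert 0 (insert e (set js)))" and t: "t = 1 / (x 0 - x e)"
  shows "R x = exp (\<kappa>' * (h + of_nat m)) * (\<Sum>j\<le>m. t ^ (2 * m - j) / fact j *
     ((\<Prod>l\<in>set js. (1 / (1 - t * (x l - x e)) ^ 2) ^ wt l) *
      (\<Sum>i\<le>m'. t ^ i / fact i * corr js (f ((vir V M 1 ^^ j) b)) v (\<lambda>l. (x l - x e) / (1 - t * (x l - x e))) ((vir V M' 1 ^^ i) b'))))"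
proof -
  let ?I = "insert 0 (insert e (set js))" and ?J = "insert 0 (set js)"
  have bM: "b \<in> carr M" and b'M: "b' \<in> carr M'" using b b' by (auto simp: wspace_def)
  have carrV: "v l \<in> carr V" if "l \<in> set js" for l using qp[OF that] by (simp add: quasiprimary_def wspace_def)
  define F where "F y = exp (\<kappa>' * (h + of_nat m)) * (\<Sum>j\<le>m. (1 / y 0) ^ (2 * m - j) / fact j *
     ((\<Prod>l\<in>set js. (1 / (1 - 1 / y 0 * y l) ^ 2) ^ wt l) *
      (\<Sum>i\<le>m'. (1 / y 0) ^ i / fact i * corr js (f ((vir V M 1 ^^ j) b)) v (\<lambda>l. y l / (1 - 1 / y 0 * y l)) ((vir V M' 1 ^^ i) b'))))" for y :: "nat \<Rightarrow> complex"
  have "R (y(e := 0)) = F y" if y: "y \<in> config ?J" for y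
  proof (rule rat_on_eqI[where R = "\<lambda>y. R (y(e := 0))" and S = F and I = ?J, OF _ _ _ radial_config _ y])
    show "rat_on (config ?J) (\<lambda>y. R (y(e := 0)))"
    proof (rule rat_on_compose[where R = R and \<sigma> = "\<lambda>y. y(e := 0)"])
      show "rat_on (distinct_points ?I) R" using R by (simp add: sphere_corr_def Let_def)
      show "rat_on (config ?J) (\<lambda>y. (y(e := 0)) i)" for i by (cases "i = e") (auto intro: rat_intros)
      show "y(e := 0) \<in> distinct_points ?I" if "y \<in> config ?J" for y
        using that js_facts by (auto simp: distinct_points_def config_def inj_on_def)
    qed
    have r0: "rat_on (config ?J) (\<lambda>y. 1 / y 0)" by (intro rat_on_divide rat_intros) (auto simp: config_def)
    have r1: "rat_on (config ?J) (\<lambda>y. 1 - 1 / y 0 * y l)" for l by (intro rat_on_diff rat_on_mult rat_on_const r0 rat_on_var)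
    have r2: "rat_on (config ?J) (\<lambda>y. corr js (f ((vir V M 1 ^^ j) b)) v (\<lambda>l. y l / (1 - 1 / y 0 * y l)) ((vir V M' 1 ^^ i) b'))" for i j
    proof -
      have "rat_on (config ?J) (\<lambda>y. corr js (f ((vir V M 1 ^^ j) b)) v (\<lambda>l. if l \<in> set js then y l / (1 - 1 / y 0 * y l) else 0) ((vir V M' 1 ^^ i) b'))"
      proof (rule rat_on_compose[OF rat_on_corr, where \<sigma> = "\<lambda>y l. if l \<in> set js then y l / (1 - 1 / y 0 * y l) else 0"])
        show "distinct js" by (rule js_facts)
        show "admissible js (f ((vir V M 1 ^^ j) b)) v ((vir V M' 1 ^^ i) b')"
          using carrV by (auto simp: admissible_def intro!: f_dualvec left.funpow_vir_in funpow_vir_in bM b'M)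
        show "rat_on (config ?J) (\<lambda>y. if l \<in> set js then y l / (1 - 1 / y 0 * y l) else 0)" for l
        proof (cases "l \<in> set js")
          case True
          have "rat_on (config ?J) (\<lambda>y. y l / (1 - 1 / y 0 * y l))"
            by (rule rat_on_divide[OF rat_on_var r1]) (rule moebius_config(2)[OF _ True])
          then show ?thesis by (simp only: True if_True)
        qed (simp add: rat_on_const)
        show "(\<lambda>l. if l \<in> set js then y l / (1 - 1 / y 0 * y l) else 0) \<in> config (set js)" if "y \<in> config ?J" for y
          using moebius_config(1)[OF that] by (auto simp: config_def inj_on_def)
      qed
      also have "(\<lambda>y. corr js (f ((vir V M 1 ^^ j) b)) v (\<lambda>l. if l \<in> set js then y l / (1 - 1 / y 0 * y l) else 0) ((vir V M' 1 ^^ i) b')) =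
         (\<lambda>y. corr js (f ((vir V M 1 ^^ j) b)) v (\<lambda>l. y l / (1 - 1 / y 0 * y l)) ((vir V M' 1 ^^ i) b'))"
        by (intro ext corr_cong_points) simp
      finally show ?thesis .
    qed
    have r3: "rat_on (config ?J) (\<lambda>y. 1 / (1 - 1 / y 0 * y l) ^ 2)" if "l \<in> set js" for l
      by (intro rat_on_divide rat_on_power rat_on_const r1) (use that in \<open>auto dest: moebius_config(2)\<close>)
    have r4: "rat_on (config ?J) (\<lambda>y. (1 / y 0) ^ k / fact i)" for i k
      by (intro rat_on_divide rat_on_power rat_on_const r0) simp
    show "rat_on (config ?J) F"
      unfolding F_def by (intro rat_on_mult rat_on_sum rat_on_prod rat_on_power rat_on_const r2 r3 r4)
    fix y assume y: "y \<in> radially_ordered ?J"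
    have y': "y(e := 0) \<in> nested ?I"
      unfolding nested_def
    proof (intro CollectI ballI impI)
      fix i j assume ij: "i \<in> ?I" "j \<in> ?I" "i < j"
      have "i \<noteq> e" using ij js(2,3) by fastforce
      then show "norm ((y(e := 0)) j) < norm ((y(e := 0)) i)"
        using ij y by (auto simp: radially_ordered_def)
    qed
    have "R (y(e := 0)) = exp (\<kappa>' * (h + of_nat m)) * (\<Sum>j\<le>m. (1 / y 0) ^ (2 * m - j) / fact j *
     ((\<Prod>l\<in>set js. (1 / (1 - 1 / y 0 * (y(e:=0)) l) ^ 2) ^ wt l) *
      (\<Sum>i\<le>m'. (1 / y 0) ^ i / fact i * corr js (f ((vir V M 1 ^^ j) b)) v (\<lambda>l. (y(e:=0)) l / (1 - 1 / y 0 * (y(e:=0)) l)) ((vir V M' 1 ^^ i) b'))))"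
      by (rule radial_special_value[OF R b b' y']) (use js_facts in auto)
    also have "\<dots> = F y"
    proof -
      have "corr js \<theta> v (\<lambda>l. (y(e:=0)) l / (1 - 1 / y 0 * (y(e:=0)) l)) \<psi> = corr js \<theta> v (\<lambda>l. y l / (1 - 1 / y 0 * y l)) \<psi>" for \<theta> \<psi>
        by (rule corr_cong_points) (use js_facts in auto)
      moreover have "(\<Prod>l\<in>set js. (1 / (1 - 1 / y 0 * (y(e:=0)) l) ^ 2) ^ wt l) = (\<Prod>l\<in>set js. (1 / (1 - 1 / y 0 * y l) ^ 2) ^ wt l)"
        by (rule prod.cong) (use js_facts in auto)
      ultimately show ?thesis unfolding F_def by presburger
    qed
    finally show "R (y(e := 0)) = F y" .
  qed simp
  note this[of "\<lambda>i. x i - x e"]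
  moreover have "(\<lambda>i. x i - x e) \<in> config ?J"
    using x js_facts by (auto simp: config_def distinct_points_def inj_on_def)
  moreover have "(\<lambda>i. x i - x e)(e := 0) = (\<lambda>i. x i - x e)" by auto
  moreover have "R (\<lambda>i. x i + (- x e)) = R x"
  proof -
    have "\<forall>x\<in>distinct_points ?I. \<forall>c. R (\<lambda>i. x i + c) = R x" using R unfolding sphere_corr_def Let_def by blast
    then show ?thesis using x by blast
  qed
  ultimately have "R x = F (\<lambda>i. x i - x e)" by simp
  then show ?thesis unfolding F_def t .
qed

end

end

section \<open>The genus one sum\<close>

text \<open>A family of series whose orders tend to infinity is summed coefficientwise.\<close>

lemma suminf_fps_nth:
  fixes A :: "nat \<Rightarrow> complex fps"
  assumes "\<And>m k. k < m \<Longrightarrow> A m $ k = 0"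
  shows "suminf A $ n = (\<Sum>m\<le>n. A m $ n)"
proof -
  define S where "S = Abs_fps (\<lambda>n. \<Sum>m\<le>n. A m $ n)"
  have "(\<lambda>k. \<Sum>m<k. A m) \<longlonglongrightarrow> S"
  proof (rule tendsto_fpsI)
    fix n
    show "\<forall>\<^sub>F k in sequentially. (\<Sum>m<k. A m) $ n = S $ n"
    proof (rule eventually_mono[OF eventually_ge_at_top[of "Suc n"]])
      fix k assume k: "k \<ge> Suc n"
      have "(\<Sum>m<k. A m $ n) = (\<Sum>m\<le>n. A m $ n)"
        by (rule sum.mono_neutral_right) (use k assms in auto)
      then show "(\<Sum>m<k. A m) $ n = S $ n" by (simp add: S_def fps_sum_nth)
    qed
  qed
  then have "A sums S" by (simp add: sums_def)
  then show ?thesis by (simp add: sums_unique[symmetric] S_def)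
qed

lemma mult_suminf_fps_nth:
  fixes A :: "nat \<Rightarrow> complex fps"
  assumes A: "\<And>m k. k < m \<Longrightarrow> A m $ k = 0"
  shows "(C * suminf A) $ n = (\<Sum>m\<le>n. (C * A m) $ n)"
proof -
  have "(C * suminf A) $ n = (\<Sum>i=0..n. C $ i * (\<Sum>m\<le>n. A m $ (n - i)))"
  proof -
    have "suminf A $ (n - i) = (\<Sum>m\<le>n. A m $ (n - i))" for i
    proof -
      have "suminf A $ (n - i) = (\<Sum>m\<le>n - i. A m $ (n - i))" by (rule suminf_fps_nth) (rule A)
      also have "\<dots> = (\<Sum>m\<le>n. A m $ (n - i))" by (rule sum.mono_neutral_left) (use A in auto)
      finally show ?thesis .
    qed
    then show ?thesis by (simp add: fps_mult_nth)
  qed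
  also have "\<dots> = (\<Sum>m\<le>n. \<Sum>i=0..n. C $ i * A m $ (n - i))"
    unfolding sum_distrib_left by (rule sum.swap)
  finally show ?thesis by (simp add: fps_mult_nth)
qed

context sphere
begin

definition pair_corr :: "nat list \<Rightarrow> (nat \<Rightarrow> 'u) \<Rightarrow> (nat \<Rightarrow> complex) \<Rightarrow> 'u \<Rightarrow> 'u \<Rightarrow> complex" where
  "pair_corr js v X \<phi> \<psi> = corr js (f \<phi>) v X \<psi>"

context
  fixes js :: "nat list" and v :: "nat \<Rightarrow> 'u" and wt :: "nat \<Rightarrow> nat"
  assumes js: "sorted_wrt (<) js" and qp: "\<And>l. l \<in> set js \<Longrightarrow> quasiprimary V (wt l) (v l)"
begin

lemma pair_admissible: "\<phi> \<in> carr M \<Longrightarrow> \<psi> \<in> carr M' \<Longrightarrow> admissible js (f \<phi>) v \<psi>"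
  using qp by (auto simp: admissible_def quasiprimary_def wspace_def intro: f_dualvec)

lemma bil_pair_corr:
  assumes X: "X \<in> config (set js)" shows "bil (pair_corr js v X)"
  unfolding bil_def lin_on_def
proof (intro conjI ballI allI)
  fix \<phi> \<psi> assume in1: "\<phi> \<in> carr M" "\<psi> \<in> carr M'"
  note adm = pair_admissible[OF in1(1)]
  show "pair_corr js v X \<phi> (c \<odot> \<psi>) = c * pair_corr js v X \<phi> \<psi>" for c
    unfolding pair_corr_def by (rule corr_vector_scale[OF js adm[OF in1(2)] X])
  show "pair_corr js v X \<phi> (\<psi> + \<psi>') = pair_corr js v X \<phi> \<psi> + pair_corr js v X \<phi> \<psi>'" if "\<psi>' \<in> carr M'" for \<psi>'
    unfolding pair_corr_def using corr_vector_lin[OF js adm[OF in1(2)] adm[OF that] X, of 1] by simp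
  show "pair_corr js v X (c \<odot> \<phi>) \<psi> = c * pair_corr js v X \<phi> \<psi>" for c
    unfolding pair_corr_def
    by (rule corr_functional_scale[OF js _ f_dualvec[OF in1(1)] _ X])
       (use in1 f_scale_left in \<open>auto intro!: pair_admissible subspace_scale carr_subspace[OF Mw]\<close>)
  show "pair_corr js v X (\<phi> + \<phi>') \<psi> = pair_corr js v X \<phi> \<psi> + pair_corr js v X \<phi>' \<psi>" if \<phi>': "\<phi>' \<in> carr M" for \<phi>'
  proof -
    have "corr js (f (\<phi> + \<phi>')) v X \<psi> = (\<Sum>a\<in>{True,False}. 1 * corr js (f (if a then \<phi> else \<phi>')) v X \<psi>)"
      by (rule corr_functional_sum[OF js _ _ _ X])
         (use in1 \<phi>' f_add_left in \<open>auto intro!: pair_admissible f_dualvec subspace_add carr_subspace[OF Mw]\<close>)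
    then show ?thesis by (simp add: pair_corr_def)
  qed
qed

text \<open>Homogeneity absorbs the factor \<open>-1/t\<close> between the points of \<open>sphere_corr_value\<close> and \<open>X\<close>. The powers of \<open>t\<close> become
  independent of \<open>i\<close> and \<open>j\<close>, and the signs left over are those of \<open>e\<^bsup>-L(1)\<^esup>\<close>.\<close>

lemma sphere_corr_twist:
  assumes e: "\<And>l. l \<in> set js \<Longrightarrow> 0 < l \<and> l < e" "e > 0"
    and R: "sphere_corr js e v b b' R" and b: "b \<in> left.lev m" and b': "b' \<in> lev m"
    and x: "x \<in> distinct_points (insert 0 (insert e (set js)))" and t: "t = 1 / (x 0 - x e)"
    and X: "X = (\<lambda>l. - t * (x l - x e) / (1 - t * (x l - x e)))"
  shows "R x = exp (\<kappa>' * (h + of_nat m)) * t ^ (2 * m) *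
     (\<Prod>l\<in>set js. (- t / (1 - t * (x l - x e)) ^ 2) ^ wt l) * twist 1 (pair_corr js v X) b b'"
proof -
  have bM: "b \<in> carr M" and b'M: "b' \<in> carr M'" using b b' by (auto simp: wspace_def)
  have e': "0 \<notin> set js" "e \<notin> set js" "e \<noteq> 0" using e by auto
  have "x 0 \<noteq> x e" using x e(2) by (auto simp: distinct_points_def)
  then have t0: "t \<noteq> 0" by (simp add: t)
  define y where "y = (\<lambda>l. x l - x e)"
  have "y \<in> config (insert 0 (set js))" using x e' by (auto simp: y_def config_def distinct_points_def inj_on_def)
  from moebius_config(1)[OF js e qp this]
  have Y: "(\<lambda>l. y l / (1 - t * y l)) \<in> config (set js)" by (simp add: t y_def)
  have XY: "y l / (1 - t * y l) = (- 1 / t) * X l" for l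
  proof -
    have "X l = - t * y l / (1 - t * y l)" by (simp add: X y_def)
    then show ?thesis using t0 by simp
  qed
  have Xc: "X \<in> config (set js)"
    using Y t0 unfolding XY by (auto simp: config_def inj_on_def)
  note bil = bil_pair_corr[OF Xc]
  define W where "W = (\<Sum>l\<in>set js. wt l)"
  define pc where "pc j i = pair_corr js v X ((vir V M 1 ^^ j) b) ((vir V M' 1 ^^ i) b')" for i j
  have scal: "t ^ (2 * m - j) * (t ^ i * corr js (f ((vir V M 1 ^^ j) b)) v (\<lambda>l. y l / (1 - t * y l)) ((vir V M' 1 ^^ i) b')) =
      t ^ (2 * m) * (- t) ^ W * ((- 1) ^ j * (- 1) ^ i * pc j i)" if ij: "j \<le> m" "i \<le> m" for i j
  proof -
    have lb: "(vir V M 1 ^^ j) b \<in> left.lev (m - j)" by (rule left.vir1_lev[OF b ij(1)])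
    have "corr js (f ((vir V M 1 ^^ j) b)) v (\<lambda>l. (- 1 / t) * X l) ((vir V M' 1 ^^ i) b') =
        (- 1 / t) powi (int (m - j) - int (m - i) - (\<Sum>l\<in>set js. int (wt l))) * pc j i"
      unfolding pc_def pair_corr_def
    proof (rule corr_scaling[OF js _ _ _ _ _ Xc])
      show "dualvec (f ((vir V M 1 ^^ j) b))" by (intro f_dualvec left.funpow_vir_in bM)
      show "f ((vir V M 1 ^^ j) b) w = 0" if "n \<noteq> m - j" "w \<in> lev n" for n w
        by (rule f_orthogonal[OF lb that(2)]) (use that(1) in auto)
      show "(vir V M' 1 ^^ i) b' \<in> lev (m - i)" by (rule vir1_lev[OF b' ij(2)])
    qed (use qp t0 in \<open>auto simp: quasiprimary_def\<close>)
    also have "(- 1 / t) powi (int (m - j) - int (m - i) - (\<Sum>l\<in>set js. int (wt l))) = (- t) ^ (j + W) / (- t) ^ i"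
    proof -
      have "int (m - j) - int (m - i) - (\<Sum>l\<in>set js. int (wt l)) = - (int (j + W) - int i)"
        using ij by (simp add: W_def of_nat_diff)
      moreover have "- 1 / t = inverse (- t)" using t0 by (simp add: field_simps)
      moreover have "inverse (- t) powi (- (int (j + W) - int i)) = (- t) powi (int (j + W) - int i)"
        by (simp only: power_int_minus power_int_inverse inverse_inverse_eq)
      moreover have "(- t) powi (int (j + W) - int i) = (- t) ^ (j + W) / (- t) ^ i"
        using power_int_diff[of "- t" "int (j + W)" "int i"] t0 by (simp only: power_int_of_nat) simp
      ultimately show ?thesis by (simp only:)
    qed
    finally have c: "corr js (f ((vir V M 1 ^^ j) b)) v (\<lambda>l. y l / (1 - t * y l)) ((vir V M' 1 ^^ i) b') = (- t) ^ (j + W) / (- t) ^ i * pc j i"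
      unfolding XY .
    have "t ^ (2 * m - j) * (t ^ i * ((- t) ^ (j + W) / (- t) ^ i)) = (t ^ (2 * m - j) * t ^ j) * (- t) ^ W * ((- 1) ^ j * (- 1) ^ i)"
    proof -
      have m1: "(- t) ^ k = (- 1) ^ k * t ^ k" for k by (metis mult_minus1 power_mult_distrib)
      have s1: "(- 1) ^ i * (- 1) ^ i = (1 :: complex)" by (simp flip: power_mult_distrib)
      have "t ^ i * ((- t) ^ j / (- t) ^ i) = t ^ j * ((- 1) ^ j * (- 1) ^ i)"
        unfolding m1[of i] m1[of j] using t0 s1 by (simp add: field_simps)
      moreover have "t ^ (2 * m - j) * (t ^ i * ((- t) ^ (j + W) / (- t) ^ i)) = t ^ (2 * m - j) * ((t ^ i * ((- t) ^ j / (- t) ^ i)) * (- t) ^ W)"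
        by (simp add: power_add)
      ultimately show ?thesis by (simp only: mult_ac)
    qed
    moreover have "t ^ (2 * m - j) * t ^ j = t ^ (2 * m)" using ij by (simp flip: power_add)
    ultimately show ?thesis unfolding c by (simp only: mult.assoc[symmetric])
  qed
  have Ein: "left.exp_L1 1 b = (\<Sum>j<Suc m. ((- 1) ^ j / fact j) \<odot> (vir V M 1 ^^ j) b)"
    by (rule left.exp_L1_eq) (auto intro: left.vir1_lev_nilpotent[OF b])
  have Ein': "exp_L1 1 b' = (\<Sum>i<Suc m. ((- 1) ^ i / fact i) \<odot> (vir V M' 1 ^^ i) b')"
    by (rule exp_L1_eq) (auto intro: vir1_lev_nilpotent[OF b'])
  have tw: "twist 1 (pair_corr js v X) b b' = (\<Sum>j\<le>m. \<Sum>i\<le>m. (- 1) ^ j / fact j * ((- 1) ^ i / fact i * pc j i))"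
    unfolding twist_def Ein Ein' lessThan_Suc_atMost pc_def
    by (simp add: bil_sum[OF bil] bilD[OF bil] left.funpow_vir_in funpow_vir_in bM b'M subspace_sum subspace_scale
        carr_subspace[OF M] carr_subspace[OF Mw] sum_distrib_left, subst sum.swap, simp add: mult_ac)
  let ?A = "\<Prod>l\<in>set js. (1 / (1 - t * y l) ^ 2) ^ wt l"
  have "R x = exp (\<kappa>' * (h + of_nat m)) * (\<Sum>j\<le>m. t ^ (2 * m - j) / fact j * (?A *
      (\<Sum>i\<le>m. t ^ i / fact i * corr js (f ((vir V M 1 ^^ j) b)) v (\<lambda>l. y l / (1 - t * y l)) ((vir V M' 1 ^^ i) b'))))"
    using sphere_corr_value[OF js e qp R b b' x t] unfolding y_def .
  also have "\<dots> = exp (\<kappa>' * (h + of_nat m)) * (\<Sum>j\<le>m. \<Sum>i\<le>m. ?A / (fact j * fact i) *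
      (t ^ (2 * m - j) * (t ^ i * corr js (f ((vir V M 1 ^^ j) b)) v (\<lambda>l. y l / (1 - t * y l)) ((vir V M' 1 ^^ i) b'))))"
    by (simp add: sum_distrib_left mult_ac)
  also have "\<dots> = exp (\<kappa>' * (h + of_nat m)) * (\<Sum>j\<le>m. \<Sum>i\<le>m. ?A / (fact j * fact i) * (t ^ (2 * m) * (- t) ^ W * ((- 1) ^ j * (- 1) ^ i * pc j i)))"
    by (simp add: scal)
  also have "\<dots> = exp (\<kappa>' * (h + of_nat m)) * t ^ (2 * m) * ((- t) ^ W * ?A) * twist 1 (pair_corr js v X) b b'"
    unfolding tw by (simp add: sum_distrib_left mult_ac)
  also have "(- t) ^ W * ?A = (\<Prod>l\<in>set js. (- t / (1 - t * y l) ^ 2) ^ wt l)"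
    unfolding W_def power_sum prod.distrib[symmetric] power_mult_distrib[symmetric] by simp
  finally show ?thesis unfolding y_def .
qed

text \<open>The vector field \<open>(X\<^sup>2 - 1)/(1 - q\<^sup>2)\<close> generates \<open>q \<mapsto> (Z-q)/(1-qZ)\<close>, so \<open>primary_flow\<close> applies with
  \<open>a = -b = 1/(1-q\<^sup>2)\<close>; the operators acting on functionals are then moved to \<open>M\<close> by the pairing.\<close>

lemma cayley_flow:
  assumes q: "q ^ 2 \<noteq> 1" and Z: "Z \<in> config (set js)"
    and reg: "\<And>l. l \<in> set js \<Longrightarrow> 1 - q * Z l \<noteq> 0 \<and> Z l - q \<noteq> 0"
  defines "X \<equiv> \<lambda>q l. (Z l - q) / (1 - q * Z l)"
  defines "\<Theta> \<equiv> \<lambda>q \<phi> \<psi>. (\<Prod>l\<in>set js. ((1 - q ^ 2) / (1 - q * Z l) ^ 2) ^ wt l) * pair_corr js v (X q) \<phi> \<psi>"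
  shows "X q \<in> config (set js)"
    and "\<phi> \<in> carr M \<Longrightarrow> \<psi> \<in> carr M' \<Longrightarrow>
      ((\<lambda>q. \<Theta> q \<phi> \<psi>) has_field_derivative (1 / (1 - q ^ 2)) * (Lminus (\<Theta> q) \<phi> \<psi> - Lplus (\<Theta> q) \<phi> \<psi>)) (at q)"
proof -
  have q': "1 - q ^ 2 \<noteq> 0" using q by simp
  have "inj_on (X q) (set js)"
  proof (rule inj_onI)
    fix k l assume kl: "k \<in> set js" "l \<in> set js" "X q k = X q l"
    then have "(Z k - q) * (1 - q * Z l) = (Z l - q) * (1 - q * Z k)" using reg by (simp add: X_def frac_eq_eq)
    then have "(1 - q ^ 2) * (Z k - Z l) = 0" by (simp add: algebra_simps power2_eq_square)
    then have "Z k = Z l" using q' by simp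
    then show "k = l" using Z kl by (auto simp: config_def inj_on_def)
  qed
  then show conf: "X q \<in> config (set js)" using reg by (auto simp: config_def X_def)
  assume \<phi>: "\<phi> \<in> carr M" and \<psi>: "\<psi> \<in> carr M'"
  define a where "a = 1 / (1 - q ^ 2)"
  have dX: "((\<lambda>q. X q l) has_field_derivative a * X q l ^ 2 + - a) (at q)" if l: "l \<in> set js" for l
  proof -
    have D: "1 - q * Z l \<noteq> 0" using reg[OF l] by simp
    have "((\<lambda>q. X q l) has_field_derivative ((- 1) * (1 - q * Z l) - (Z l - q) * (- Z l)) / ((1 - q * Z l) * (1 - q * Z l))) (at q)"
      unfolding X_def by (rule derivative_eq_intros refl D | use D in simp)+
    also have "((- 1) * (1 - q * Z l) - (Z l - q) * (- Z l)) / ((1 - q * Z l) * (1 - q * Z l)) = a * X q l ^ 2 + - a"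
    proof -
      have "a * X q l ^ 2 + - a = a * ((Z l - q) ^ 2 / (1 - q * Z l) ^ 2 - (1 - q * Z l) ^ 2 / (1 - q * Z l) ^ 2)"
        using D by (simp add: X_def power_divide right_diff_distrib)
      also have "(Z l - q) ^ 2 / (1 - q * Z l) ^ 2 - (1 - q * Z l) ^ 2 / (1 - q * Z l) ^ 2 = ((Z l - q) ^ 2 - (1 - q * Z l) ^ 2) / (1 - q * Z l) ^ 2"
        by (simp only: diff_divide_distrib)
      also have "(Z l - q) ^ 2 - (1 - q * Z l) ^ 2 = (1 - q ^ 2) * (Z l ^ 2 - 1)" by (simp add: algebra_simps power2_eq_square)
      also have "a * ((1 - q ^ 2) * (Z l ^ 2 - 1) / (1 - q * Z l) ^ 2) = (Z l ^ 2 - 1) / (1 - q * Z l) ^ 2"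
        using q' by (simp add: a_def)
      finally show ?thesis by (simp add: algebra_simps power2_eq_square)
    qed
    finally show ?thesis .
  qed
  have dg: "((\<lambda>q. (1 - q ^ 2) / (1 - q * Z l) ^ 2) has_field_derivative 2 * a * X q l * ((1 - q ^ 2) / (1 - q * Z l) ^ 2)) (at q)"
    if l: "l \<in> set js" for l
  proof -
    define D where "D = 1 - q * Z l"
    have D: "D \<noteq> 0" using reg[OF l] by (simp add: D_def)
    have "((\<lambda>q. (1 - q ^ 2) / (1 - q * Z l) ^ 2) has_field_derivative
        ((- (2 * q)) * (1 - q * Z l) ^ 2 - (1 - q ^ 2) * (2 * (1 - q * Z l) * (- Z l))) / ((1 - q * Z l) ^ 2 * (1 - q * Z l) ^ 2)) (at q)"
      by (rule derivative_eq_intros refl | use reg[OF l] in simp)+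
    also have "((- (2 * q)) * (1 - q * Z l) ^ 2 - (1 - q ^ 2) * (2 * (1 - q * Z l) * (- Z l))) / ((1 - q * Z l) ^ 2 * (1 - q * Z l) ^ 2) =
        2 * (D * (- q * D + (1 - q ^ 2) * Z l)) / (D * (D * D ^ 2))"
      unfolding D_def[symmetric] by (simp add: algebra_simps power2_eq_square)
    also have "\<dots> = 2 * (- q * D + (1 - q ^ 2) * Z l) / (D * D ^ 2)" using D by simp
    also have "- q * D + (1 - q ^ 2) * Z l = Z l - q" by (simp add: D_def algebra_simps power2_eq_square)
    also have "2 * (Z l - q) / (D * D ^ 2) = 2 * a * X q l * ((1 - q ^ 2) / (1 - q * Z l) ^ 2)"
      unfolding X_def D_def[symmetric] a_def using q' D by simp
    finally show ?thesis .
  qed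
  have adj: "corr js (\<lambda>w. f \<phi> (vir V M' n w)) v (X q) \<psi> = pair_corr js v (X q) (vir V M (- n) \<phi>) \<psi>" for n
  proof -
    have "admissible js (\<lambda>w. f \<phi> (vir V M' n w)) v \<psi>"
      using pair_admissible[OF \<phi> \<psi>] dualvec_vir by (auto simp: admissible_def)
    from corr_functional_scale[OF js this f_dualvec[OF vir_in_both(1)[OF \<phi>]], of 1 "- n" "X q"] conf
    show ?thesis by (simp add: pair_corr_def f_adjoint[OF \<phi>])
  qed
  let ?G = "\<Prod>l\<in>set js. ((1 - q ^ 2) / (1 - q * Z l) ^ 2) ^ wt l"
  from primary_flow[OF js qp f_dualvec[OF \<phi>] \<psi> dX dg conf]
  have "((\<lambda>q. \<Theta> q \<phi> \<psi>) has_field_derivative ?G *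
     (a * (corr js (\<lambda>w. f \<phi> (vir V M' 1 w)) v (X q) \<psi> - corr js (f \<phi>) v (X q) (vir V M' 1 \<psi>)) +
      (- a) * (corr js (\<lambda>w. f \<phi> (vir V M' (-1) w)) v (X q) \<psi> - corr js (f \<phi>) v (X q) (vir V M' (-1) \<psi>)))) (at q)"
    unfolding \<Theta>_def pair_corr_def by simp
  also have "?G * (a * (corr js (\<lambda>w. f \<phi> (vir V M' 1 w)) v (X q) \<psi> - corr js (f \<phi>) v (X q) (vir V M' 1 \<psi>)) +
      (- a) * (corr js (\<lambda>w. f \<phi> (vir V M' (-1) w)) v (X q) \<psi> - corr js (f \<phi>) v (X q) (vir V M' (-1) \<psi>))) =
     (1 / (1 - q ^ 2)) * (Lminus (\<Theta> q) \<phi> \<psi> - Lplus (\<Theta> q) \<phi> \<psi>)"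
    unfolding adj act_def \<Theta>_def a_def pair_corr_def by (simp add: algebra_simps)
  finally show "((\<lambda>q. \<Theta> q \<phi> \<psi>) has_field_derivative (1 / (1 - q ^ 2)) * (Lminus (\<Theta> q) \<phi> \<psi> - Lplus (\<Theta> q) \<phi> \<psi>)) (at q)" .
qed

lemma bil_scale: "bil \<beta> \<Longrightarrow> bil (\<lambda>\<phi> \<psi>. c * \<beta> \<phi> \<psi>)"
  by (auto simp: bil_def lin_on_def algebra_simps)

text \<open>Up to the Jacobian factors \<open>(dZ/dz)\<^bsup>wt\<^esup>\<close>, the sum over a level is \<open>(-1)\<^bsup>h+m\<^esup> t\<^bsup>2m\<^esup>\<close> times the trace of the twisted
  form \<open>\<Theta>\<^sub>q\<close>, and \<open>\<rho> t\<^sup>2 = -q/(1+q)\<^sup>2\<close>. Hence the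
  power \<open>\<rho>\<^bsup>m+h\<^esup>\<close> contributes \<open>q\<^sup>m (1+q)\<^bsup>-2(h+m)\<^esup>\<close>, the factor for which \<open>flow_trace_coefficients\<close> gives the Taylor
  coefficients, and \<open>sewing_identity\<close> sums the levels.\<close>

theorem genus_one_coefficient:
  fixes z :: "nat \<Rightarrow> complex"
  assumes e: "\<And>l. l \<in> set js \<Longrightarrow> 0 < l \<and> l < e" "e > 0" and W: "Wp \<noteq> Wm"
    and z: "inj_on z (set js)" "\<And>l. l \<in> set js \<Longrightarrow> z l \<noteq> Wp \<and> z l \<noteq> Wm"
  defines "I \<equiv> insert 0 (insert e (set js))"
    and "\<xi> \<equiv> \<lambda>i. if i = 0 then (fps_const Wp - fps_X * fps_const Wm) / (1 - fps_X)
       else if i = e then (fps_const Wm - fps_X * fps_const Wp) / (1 - fps_X) else fps_const (z i)"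
    and "\<rho> \<equiv> - (fps_X * fps_const (Wm - Wp) ^ 2) / (1 - fps_X) ^ 2"
    and "Z \<equiv> \<lambda>l. (z l - Wm) / (z l - Wp)"
  shows "(fps_const (exp (- \<kappa>' * h)) * fps_binomial (- 2 * h) *
      suminf (\<lambda>m. \<rho> ^ m * (\<Sum>b\<in>B m. rat_ext fps_const I (sphere_terms js e v b (B' b)) \<xi>))) $ N =
    (\<Prod>l\<in>set js. ((Wm - Wp) / (z l - Wp) ^ 2) ^ wt l) * level_trace N (pair_corr js v Z)"
proof -
  define c where "c = Wp - Wm"
  have c0: "c \<noteq> 0" using W by (simp add: c_def)
  have e': "0 \<notin> set js" "e \<notin> set js" "e \<noteq> 0" using e by auto
  define x where "x = (\<lambda>q i. if i = 0 then (Wp - q * Wm) / (1 - q) else if i = e then (Wm - q * Wp) / (1 - q) else z i)"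
  have zp: "z l - Wp \<noteq> 0" "z l - Wm \<noteq> 0" if "l \<in> set js" for l using z(2)[OF that] by auto
  have Z0: "Z l \<noteq> 0" if "l \<in> set js" for l using zp[OF that] by (simp add: Z_def)
  have zW: "z l - Wm = (z l - Wp) * Z l" if "l \<in> set js" for l using zp[OF that] by (simp add: Z_def)
  have Zc: "Z \<in> config (set js)"
  proof -
    have "inj_on Z (set js)"
    proof (rule inj_onI)
      fix k l assume kl: "k \<in> set js" "l \<in> set js" "Z k = Z l"
      then have "(z k - Wm) * (z l - Wp) = (z l - Wm) * (z k - Wp)" using zp by (simp add: Z_def frac_eq_eq)
      then have "c * (z k - z l) = 0" by (simp add: c_def algebra_simps)
      then show "k = l" using c0 z(1) kl by (auto simp: inj_on_def)
    qed
    then show ?thesis using Z0 by (auto simp: config_def)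
  qed
  have "\<forall>\<^sub>F q in nhds 0. \<forall>l\<in>set js. 1 - q * Z l \<noteq> 0 \<and> Z l - q \<noteq> 0"
  proof (rule eventually_ball_finite, simp, rule ballI, rule eventually_conj)
    fix l assume l: "l \<in> set js"
    have "((\<lambda>q. 1 - q * Z l) \<longlongrightarrow> 1 - 0 * Z l) (nhds 0)" by (intro tendsto_intros filterlim_ident)
    then show "\<forall>\<^sub>F q in nhds 0. 1 - q * Z l \<noteq> 0" by (rule tendsto_imp_eventually_ne) simp
    have "((\<lambda>q. Z l - q) \<longlongrightarrow> Z l - 0) (nhds 0)" by (intro tendsto_intros filterlim_ident)
    then show "\<forall>\<^sub>F q in nhds 0. Z l - q \<noteq> 0" by (rule tendsto_imp_eventually_ne) (use Z0[OF l] in simp)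
  qed
  then obtain d where d: "d > 0" "\<And>q l. dist q 0 < d \<Longrightarrow> l \<in> set js \<Longrightarrow> 1 - q * Z l \<noteq> 0 \<and> Z l - q \<noteq> 0"
    unfolding eventually_nhds_metric by blast
  define \<delta> where "\<delta> = min d 1"
  have \<delta>: "0 < \<delta>" "\<delta> \<le> 1" using d(1) by (auto simp: \<delta>_def)
  have reg: "1 - q * Z l \<noteq> 0 \<and> Z l - q \<noteq> 0" if "q \<in> ball 0 \<delta>" "l \<in> set js" for q l
    using d(2)[of q l] that by (auto simp: \<delta>_def)
  have q1: "q ^ 2 \<noteq> 1" "1 - q \<noteq> 0" "1 + q \<noteq> 0" if "q \<in> ball 0 \<delta>" for q :: complex
  proof -
    have "norm q < 1" using that \<delta> by simp
    then show "1 - q \<noteq> 0" by auto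
    moreover show "1 + q \<noteq> 0" using \<open>norm q < 1\<close> by (metis add_eq_0_iff norm_minus_cancel norm_one order_less_irrefl)
    ultimately show "q ^ 2 \<noteq> 1" by (auto simp: power2_eq_1_iff)
  qed
  define t where "t = (\<lambda>q. (1 / c) * (1 - q) * inverse (1 + q))"
  define X where "X = (\<lambda>q l. (Z l - q) / (1 - q * Z l))"
  define \<Theta> where "\<Theta> = (\<lambda>q \<phi> \<psi>. (\<Prod>l\<in>set js. ((1 - q ^ 2) / (1 - q * Z l) ^ 2) ^ wt l) * pair_corr js v (X q) \<phi> \<psi>)"
  define P where "P = (\<Prod>l\<in>set js. ((Wm - Wp) / (z l - Wp) ^ 2) ^ wt l)"
  have geom: "x q 0 - x q e = c * (1 + q) / (1 - q)"
    "l \<in> set js \<Longrightarrow> x q l - x q e = (z l - Wp) * (Z l - q) / (1 - q)"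
    "l \<in> set js \<Longrightarrow> x q l - x q 0 = (z l - Wp) * (1 - q * Z l) / (1 - q)"
    "l \<in> set js \<Longrightarrow> 1 - t q * (x q l - x q e) = - ((z l - Wp) * (1 - q * Z l) / (c * (1 + q)))"
    if q: "q \<in> ball 0 \<delta>" for q l
  proof -
    note q1 = q1[OF q]
    show "x q 0 - x q e = c * (1 + q) / (1 - q)" using e' by (simp add: x_def c_def algebra_simps flip: diff_divide_distrib)
    assume l: "l \<in> set js"
    then have l': "l \<noteq> 0" "l \<noteq> e" using e' by metis+
    show 1: "x q l - x q e = (z l - Wp) * (Z l - q) / (1 - q)"
    proof -
      have "(z l - Wp) * (Z l - q) = (z l - Wm) - q * (z l - Wp)" unfolding zW[OF l] by (simp add: algebra_simps)
      then show ?thesis using q1 l' e' by (simp add: x_def field_simps)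
    qed
    show "x q l - x q 0 = (z l - Wp) * (1 - q * Z l) / (1 - q)"
    proof -
      have "(z l - Wp) * (1 - q * Z l) = (z l - Wp) - q * (z l - Wm)" unfolding zW[OF l] by (simp add: algebra_simps)
      then show ?thesis using q1 l' e' by (simp add: x_def field_simps)
    qed
    show "1 - t q * (x q l - x q e) = - ((z l - Wp) * (1 - q * Z l) / (c * (1 + q)))"
    proof -
      have "t q * (x q l - x q e) = (z l - Wp) * (Z l - q) / (c * (1 + q))"
      proof -
        have "(1 / c) * w * inverse u * (a / w) = a / (c * u)" if "w \<noteq> 0" for a u w
          using that by (simp add: divide_inverse)
        from this[OF q1(2)] show ?thesis unfolding 1 t_def .
      qed
      moreover have "c * (1 + q) - (z l - Wp) * (Z l - q) = - ((z l - Wp) * (1 - q * Z l))"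
        using zW[OF l] unfolding c_def by algebra
      moreover have "1 - (z l - Wp) * (Z l - q) / (c * (1 + q)) = (c * (1 + q) - (z l - Wp) * (Z l - q)) / (c * (1 + q))"
        using c0 q1 by (simp add: diff_divide_distrib)
      ultimately show ?thesis by simp
    qed
  qed
  have dist: "x q \<in> distinct_points I" if q: "q \<in> ball 0 \<delta>" for q
  proof -
    have "x q 0 - x q e \<noteq> 0" using geom(1)[OF q] c0 q1[OF q] by simp
    moreover have "x q l - x q e \<noteq> 0" "x q l - x q 0 \<noteq> 0" if "l \<in> set js" for l
      using geom(2,3)[OF q that] zp[OF that] reg[OF q that] q1[OF q] by simp_all
    moreover have "x q k \<noteq> x q l" if "k \<in> set js" "l \<in> set js" "k \<noteq> l" for k l
    proof -
      have "x q k = z k" "x q l = z l" using e' that by (auto simp: x_def)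
      then show ?thesis using z(1) that by (auto simp: inj_on_def)
    qed
    ultimately show ?thesis unfolding distinct_points_def I_def inj_on_def by (auto; metis)
  qed
  have tq: "t q = 1 / (x q 0 - x q e)" if "q \<in> ball 0 \<delta>" for q
    unfolding geom(1)[OF that] t_def by (simp add: divide_inverse)
  have Xc: "X q \<in> config (set js)"
    and flow: "\<And>\<phi> \<psi>. \<phi> \<in> carr M \<Longrightarrow> \<psi> \<in> carr M' \<Longrightarrow>
      ((\<lambda>q. \<Theta> q \<phi> \<psi>) has_field_derivative (1 / (1 - q ^ 2)) * (Lminus (\<Theta> q) \<phi> \<psi> - Lplus (\<Theta> q) \<phi> \<psi>)) (at q)"
    if q: "q \<in> ball 0 \<delta>" for q
    using cayley_flow[OF q1(1)[OF q] Zc reg[OF q]] unfolding X_def \<Theta>_def by blast+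
  have bil\<Theta>: "bil (\<Theta> q)" if "q \<in> ball 0 \<delta>" for q
    unfolding \<Theta>_def by (intro bil_scale bil_pair_corr Xc that)
  have carrV: "v l \<in> carr V" if "l \<in> set js" for l using qp[OF that] by (simp add: quasiprimary_def wspace_def)
  have "\<exists>R. sphere_corr js e v b (B' b) R" if "b \<in> B m" for b m
    by (rule sphere_corr_exists[OF js]) (use e carrV B_in[OF that] B'_in[OF that] in auto)
  then obtain R where R: "\<And>b m. b \<in> B m \<Longrightarrow> sphere_corr js e v b (B' b) (R b)" by metis
  have fr: "(\<lambda>q. (a - q * b) / (1 - q)) has_fps_expansion (fps_const a - fps_X * fps_const b) / (1 - fps_X)" for a b :: complex
    by (rule has_fps_expansion_divide') (intro fps_expansion_intros | simp)+
  have xfps: "(\<lambda>q. x q i) has_fps_expansion \<xi> i" for i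
    by (cases "i = 0"; cases "i = e") (simp_all only: x_def \<xi>_def fr if_True if_False has_fps_expansion_const simp_thms)
  have ev: "\<forall>\<^sub>F q in nhds 0. q \<in> ball 0 \<delta>" using \<delta> by (intro eventually_nhds_in_open) auto
  define rb where "rb b = fps_expansion (\<lambda>q. R b (x q)) 0" for b
  have rb: "(\<lambda>q. R b (x q)) has_fps_expansion rb b" if b: "b \<in> B m" for b m
  proof -
    have "(\<lambda>q. R b (x q)) holomorphic_on ball 0 \<delta>"
    proof (rule rat_on_holomorphic[OF _ _ dist])
      show "rat_on (distinct_points I) (R b)" using R[OF b] by (simp add: sphere_corr_def I_def Let_def)
      show "(\<lambda>q. x q i) holomorphic_on ball 0 \<delta>" for i
        unfolding x_def using q1(2) by (cases "i = 0"; cases "i = e") (auto intro!: holomorphic_intros)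
    qed
    then have "(\<lambda>q. R b (x q)) analytic_on {0}"
      by (rule holomorphic_on_imp_analytic_at) (use \<delta> in auto)
    then show ?thesis unfolding rb_def by (rule analytic_at_imp_has_fps_expansion_0)
  qed
  have rat_val: "rat_ext fps_const I (sphere_terms js e v b (B' b)) \<xi> = rb b" if b: "b \<in> B m" for b m
  proof (rule rat_ext_fps[where U = "distinct_points I" and R = "R b" and X = x])
    show "finite I" by (simp add: I_def)
    show "radially_ordered I \<subseteq> distinct_points I" using radial_nested nested_distinct by blast
    show "rat_on (distinct_points I) (R b)" using R[OF b] by (simp add: sphere_corr_def I_def Let_def)
    show "(sphere_terms js e v b (B' b) y has_sum R b y) (PiE I (\<lambda>_. UNIV))" if "y \<in> radially_ordered I" for y
      using R[OF b] that radial_nested unfolding sphere_corr_def I_def Let_def by blast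
    show "\<forall>\<^sub>F q in nhds 0. x q \<in> distinct_points I" using ev by eventually_elim (rule dist)
  qed (rule xfps rb[OF b])+
  define E where "E = (\<lambda>m::nat. exp (\<kappa>' * (h + of_nat m)))"
  have sumR: "(\<Sum>b\<in>B m. R b (x q)) = E m * P * (t q ^ (2 * m) * level_trace m (twist 1 (\<Theta> q)))" if q: "q \<in> ball 0 \<delta>" for q m
  proof -
    let ?X = "\<lambda>l. - t q * (x q l - x q e) / (1 - t q * (x q l - x q e))"
    have one: "?X l = X q l" "- t q / (1 - t q * (x q l - x q e)) ^ 2 = (Wm - Wp) / (z l - Wp) ^ 2 * ((1 - q ^ 2) / (1 - q * Z l) ^ 2)"
      if l: "l \<in> set js" for l
    proof -
      define a where "a = z l - Wp"
      define D where "D = 1 - q * Z l"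
      define u where "u = 1 + q"
      have nz: "a \<noteq> 0" "D \<noteq> 0" "u \<noteq> 0" "1 - q \<noteq> 0" using zp[OF l] reg[OF q l] q1[OF q] by (auto simp: a_def D_def u_def)
      have g: "1 - t q * (x q l - x q e) = - (a * D / (c * u))" "x q l - x q e = a * (Z l - q) / (1 - q)"
        using geom(4,2)[OF q l] by (simp_all add: a_def D_def u_def)
      have tt: "t q = (1 - q) / (c * u)" by (simp add: t_def u_def field_simps)
      show "?X l = X q l"
      proof -
        have "- (w / (c * u)) * (a * n / w) / (- (a * D / (c * u))) = n / D" if "w \<noteq> 0" for w n
          using that nz c0 by (simp add: field_simps)
        from this[OF nz(4)] show ?thesis unfolding g(1) unfolding g(2) X_def D_def[symmetric] tt .
      qed
      have "Wm - Wp = - c" "1 - q ^ 2 = (1 - q) * u" by (simp_all add: c_def u_def algebra_simps power2_eq_square)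
      moreover have "- (w / (c * u)) / (- (a * D / (c * u))) ^ 2 = - c / a ^ 2 * (w * u / D ^ 2)" for w
        using nz c0 by (simp add: power2_eq_square field_simps)
      ultimately show "- t q / (1 - t q * (x q l - x q e)) ^ 2 = (Wm - Wp) / (z l - Wp) ^ 2 * ((1 - q ^ 2) / (1 - q * Z l) ^ 2)"
        unfolding g(1) unfolding tt a_def[symmetric] D_def[symmetric] by (simp only:)
    qed
    have pcX: "pair_corr js v ?X = pair_corr js v (X q)"
    proof (intro ext)
      fix \<phi> \<psi>
      show "pair_corr js v ?X \<phi> \<psi> = pair_corr js v (X q) \<phi> \<psi>"
        unfolding pair_corr_def
      proof (rule corr_cong_points)
        fix l assume "l \<in> set js"
        from one(1)[OF this] show "?X l = X q l" .
      qed
    qed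
    have "R b (x q) = E m * P * (t q ^ (2 * m) * twist 1 (\<Theta> q) b (B' b))" if b: "b \<in> B m" for b
    proof -
      have "R b (x q) = E m * t q ^ (2 * m) * (\<Prod>l\<in>set js. (- t q / (1 - t q * (x q l - x q e)) ^ 2) ^ wt l) * twist 1 (pair_corr js v ?X) b (B' b)"
        unfolding E_def
        by (rule sphere_corr_twist[OF e R[OF b] B_lev[OF b] B'_lev[OF b] dist[OF q, unfolded I_def] tq[OF q] refl])
      also have "(\<Prod>l\<in>set js. (- t q / (1 - t q * (x q l - x q e)) ^ 2) ^ wt l) = P * (\<Prod>l\<in>set js. ((1 - q ^ 2) / (1 - q * Z l) ^ 2) ^ wt l)"
        unfolding P_def prod.distrib[symmetric] by (intro prod.cong refl) (simp only: one(2) power_mult_distrib)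
      finally show ?thesis unfolding pcX \<Theta>_def twist_def by (simp add: mult_ac)
    qed
    then show ?thesis by (simp add: level_trace_def sum_distrib_left)
  qed
  define T :: "complex fps" where "T = fps_const (1 / c) * (1 - fps_X) * inverse (1 + fps_X)"
  have tfps: "t has_fps_expansion T" unfolding t_def T_def by (intro fps_expansion_intros) simp
  have "\<exists>r. (\<lambda>q. level_trace m (twist 1 (\<Theta> q))) has_fps_expansion r \<and>
    (\<forall>i. (fps_binomial (- (2 * (h + of_nat m))) * r) $ i =
      (\<Sum>l\<le>i. ((2 * (h + of_nat m) + of_nat i - 1) gchoose (i - l)) * (level_trace m ((Lminus ^^ l) (twist 1 (\<Theta> 0))) / fact l)))" for m
    by (rule flow_trace_coefficients[OF \<delta> bil\<Theta> flow])
  then obtain r where r: "\<And>m. (\<lambda>q. level_trace m (twist 1 (\<Theta> q))) has_fps_expansion r m"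
    "\<And>m i. (fps_binomial (- (2 * (h + of_nat m))) * r m) $ i =
      (\<Sum>l\<le>i. ((2 * (h + of_nat m) + of_nat i - 1) gchoose (i - l)) * (level_trace m ((Lminus ^^ l) (twist 1 (\<Theta> 0))) / fact l))"
    by metis
  have sumrb: "(\<Sum>b\<in>B m. rb b) = fps_const (E m * P) * (T ^ (2 * m) * r m)" for m
  proof (rule fps_expansion_unique_complex)
    show "(\<lambda>q. \<Sum>b\<in>B m. R b (x q)) has_fps_expansion (\<Sum>b\<in>B m. rb b)"
      by (intro has_fps_expansion_sum rb)
    have "(\<lambda>q. E m * P * (t q ^ (2 * m) * level_trace m (twist 1 (\<Theta> q)))) has_fps_expansion fps_const (E m * P) * (T ^ (2 * m) * r m)"
      by (intro has_fps_expansion_cmult_left has_fps_expansion_mult has_fps_expansion_power tfps r(1))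
    also have "?this \<longleftrightarrow> (\<lambda>q. \<Sum>b\<in>B m. R b (x q)) has_fps_expansion fps_const (E m * P) * (T ^ (2 * m) * r m)"
      by (rule has_fps_expansion_cong[OF eventually_mono[OF ev] refl]) (simp only: sumR)
    finally show "(\<lambda>q. \<Sum>b\<in>B m. R b (x q)) has_fps_expansion fps_const (E m * P) * (T ^ (2 * m) * r m)" .
  qed
  define A where "A = (\<lambda>m. \<rho> ^ m * (\<Sum>b\<in>B m. rb b))"
  define C where "C = fps_const (exp (- \<kappa>' * h)) * fps_binomial (- 2 * h)"
  have inv1: "(1 - fps_X :: complex fps) ^ 2 * inverse ((1 - fps_X) ^ 2) = 1"
    using inverse_mult_eq_1[of "(1 - fps_X :: complex fps) ^ 2"] by (simp add: mult.commute fps_nth_power_0)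
  have rho: "\<rho> = fps_X * (- fps_const (c ^ 2) * inverse ((1 - fps_X) ^ 2))"
  proof -
    have "(Wm - Wp) ^ 2 = c ^ 2" by (simp add: c_def power2_commute)
    then show ?thesis unfolding \<rho>_def
      by (subst fps_divide_unit) (simp_all add: fps_nth_power_0 mult_ac del: fps_const_neg)
  qed
  have A0: "A m $ k = 0" if "k < m" for m k
    unfolding A_def rho power_mult_distrib mult.assoc using that by (simp add: fps_X_power_mult_nth)
  have rhoT: "\<rho> * T ^ 2 = fps_X * (- 1) * inverse (1 + fps_X) ^ 2"
  proof -
    have k: "fps_const (c ^ 2) * fps_const (1 / c) ^ 2 = (1 :: complex fps)"
      using c0 by (simp add: power_divide)
    have gen: "x * (- a * i) * (b ^ 2 * y ^ 2 * k ^ 2) = (a * b ^ 2) * (x * (- 1) * ((y ^ 2 * i) * k ^ 2))" for x a i b y k :: "complex fps"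
      by (simp add: algebra_simps)
    have "\<rho> * T ^ 2 = (fps_const (c ^ 2) * fps_const (1 / c) ^ 2) * (fps_X * (- 1) * (((1 - fps_X) ^ 2 * inverse ((1 - fps_X) ^ 2)) * inverse (1 + fps_X) ^ 2))"
      unfolding rho T_def power_mult_distrib by (rule gen)
    then have "\<rho> * T ^ 2 = fps_X * (- 1) * (((1 - fps_X) ^ 2 * inverse ((1 - fps_X) ^ 2)) * inverse (1 + fps_X) ^ 2)"
      unfolding k by simp
    then show ?thesis unfolding inv1 by simp
  qed
  have CA: "C * A m = fps_const P * (fps_X ^ m * (fps_binomial (- (2 * (h + of_nat m))) * r m))" for m
  proof -
    have bin: "fps_binomial (- 2 * h) * inverse (1 + fps_X) ^ (2 * m) = fps_binomial (- (2 * (h + of_nat m)))"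
      unfolding fps_binomial_minus_one[symmetric] fps_binomial_power fps_binomial_add_mult[symmetric]
      by (rule arg_cong[where f = fps_binomial]) simp
    have "exp (- \<kappa>' * h) * E m = (-1) ^ m"
    proof -
      have "exp (- \<kappa>' * h) * E m = exp (of_nat m * \<kappa>')" unfolding E_def exp_add[symmetric] by (simp add: algebra_simps)
      then show ?thesis by (simp add: exp_of_nat_mult exp_\<kappa>')
    qed
    then have eE: "exp (- \<kappa>' * h) * (E m * P) = (-1) ^ m * P" by (simp only: mult.assoc[symmetric])
    have "fps_const (- 1 :: complex) = - 1" by (metis fps_const_neg fps_const_1_eq_1)
    then have m1: "fps_const ((- 1 :: complex) ^ m) = (- 1) ^ m" by (simp only: fps_const_power[symmetric])
    have sgn: "fps_const (exp (- \<kappa>' * h)) * fps_const (E m * P) = (-1) ^ m * fps_const P"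
      unfolding fps_const_mult eE unfolding fps_const_mult[symmetric] m1 ..
    have "\<rho> ^ m * T ^ (2 * m) = (\<rho> * T ^ 2) ^ m" by (simp add: power_mult power_mult_distrib)
    also have "\<dots> = fps_X ^ m * (-1) ^ m * inverse (1 + fps_X) ^ (2 * m)"
      unfolding rhoT by (simp only: power_mult_distrib power_mult)
    finally have rT: "\<rho> ^ m * T ^ (2 * m) = fps_X ^ m * (-1) ^ m * inverse (1 + fps_X) ^ (2 * m)" .
    have "C * A m = (fps_const (exp (- \<kappa>' * h)) * fps_const (E m * P)) * fps_binomial (- 2 * h) * (\<rho> ^ m * T ^ (2 * m)) * r m"
      unfolding C_def A_def sumrb by (simp only: mult_ac)
    also have "\<dots> = ((-1) ^ m * (-1) ^ m) * (fps_const P * (fps_X ^ m * ((fps_binomial (- 2 * h) * inverse (1 + fps_X) ^ (2 * m)) * r m)))"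
      unfolding sgn rT by (simp only: mult_ac)
    also have "(-1) ^ m * (-1) ^ m = (1 :: complex fps)" by (simp flip: power_mult_distrib)
    finally show ?thesis unfolding bin by simp
  qed
  have nth: "(C * A m) $ N = P * (\<Sum>l\<le>N - m. sewing_coeff N m l * (level_trace m ((Lminus ^^ l) (twist 1 (\<Theta> 0))) / fact l))" if "m \<le> N" for m
    unfolding CA fps_mult_left_const_nth fps_X_power_mult_nth r(2) sewing_coeff_def using that by simp
  have "\<Theta> 0 = pair_corr js v Z" by (simp add: \<Theta>_def X_def fun_eq_iff)
  moreover have "(C * suminf A) $ N = (\<Sum>m\<le>N. (C * A m) $ N)" by (rule mult_suminf_fps_nth) (rule A0)
  moreover have "\<dots> = P * (\<Sum>m\<le>N. \<Sum>l\<le>N - m. sewing_coeff N m l * (level_trace m ((Lminus ^^ l) (twist 1 (\<Theta> 0))) / fact l))"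
    unfolding sum_distrib_left[of P] by (intro sum.cong refl) (simp only: nth atMost_iff sum_distrib_left)
  moreover have "\<dots> = P * level_trace N (\<Theta> 0)"
    using sewing_identity[OF bil\<Theta>[of 0]] \<delta> by simp
  moreover have "(\<lambda>m. \<rho> ^ m * (\<Sum>b\<in>B m. rat_ext fps_const I (sphere_terms js e v b (B' b)) \<xi>)) = A"
    unfolding A_def by (intro ext arg_cong2[where f = "(*)"] refl sum.cong rat_val)
  ultimately show ?thesis by (simp add: C_def P_def)
qed

end

end

section \<open>Traces over levels\<close>

context dual_pair
begin

lemma complement_annihilates:
  assumes b: "b \<in> B N" and y: "y \<in> span (\<Union>\<nu>\<in>- {h + of_nat N}. wspace V M' \<nu>)"
  shows "y \<in> carr M'" "f b y = 0"
proof -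
  have "subspace {y \<in> carr M'. f b y = 0}"
    unfolding subspace_def
    using carr_subspace[OF M] B_in[OF b] by (auto simp: f_zero f_add f_scale subspace_0 subspace_add subspace_scale)
  moreover have "(\<Union>\<nu>\<in>- {h + of_nat N}. wspace V M' \<nu>) \<subseteq> {y \<in> carr M'. f b y = 0}"
    using f_orthogonal[OF B_lev[OF b]] by (auto simp: wspaceD)
  ultimately have "span (\<Union>\<nu>\<in>- {h + of_nat N}. wspace V M' \<nu>) \<subseteq> {y \<in> carr M'. f b y = 0}"
    by (intro span_minimal)
  then show "y \<in> carr M'" "f b y = 0" using y by auto
qed

text \<open>A basis covector \<open>\<langle>b,\<cdot>\<rangle>\<close> of level \<open>N\<close> annihilates all other weight spaces, so it reads off the coordinates of the
  projection to level \<open>N\<close>.\<close>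

lemma wproj_expand:
  assumes w: "w \<in> carr M'"
  shows "wproj V M' (h + of_nat N) w = (\<Sum>b\<in>B N. f b w \<odot> B' b)"
proof -
  let ?S = "span (\<Union>\<nu>\<in>- {h + of_nat N}. wspace V M' \<nu>)"
  obtain L g where g: "\<And>n. g n \<in> lev n" "w = (\<Sum>n<L::nat. g n)" using level_decomposition[OF w] by blast
  define u where "u = (if N < L then g N else 0)"
  have u: "u \<in> lev N" using g(1) subspace_0[OF subspace_wspace[OF M]] by (auto simp: u_def)
  have "w - u = (\<Sum>n\<in>{..<L} - {N}. g n)"
    unfolding g(2) u_def by (auto simp: sum.remove[of "{..<L}" N])
  also have "\<dots> \<in> ?S"
  proof (rule span_sum)
    fix n assume "n \<in> {..<L} - {N}"
    then have "h + of_nat n \<in> - {h + of_nat N}" by simp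
    then show "g n \<in> ?S" using g(1) by (intro span_base UN_I)
  qed
  finally have wu: "w - u \<in> ?S" .
  have expand: "u' = (\<Sum>b\<in>B N. f b w \<odot> B' b)" if u': "u' \<in> lev N" "w - u' \<in> ?S" for u'
  proof -
    have "f b u' = f b w" if b: "b \<in> B N" for b
    proof -
      have "f b (w - u') = 0" by (rule complement_annihilates(2)[OF b u'(2)])
      then show ?thesis
        using lin_on_complex_diff[OF f_lin(2)[OF B_in[OF b]] carr_subspace[OF M] w, of u'] u'(1) by (simp add: wspaceD)
    qed
    then show ?thesis using right_expand[OF u'(1)] by simp
  qed
  show ?thesis unfolding wproj_def
  proof (rule the_equality)
    show "(\<Sum>b\<in>B N. f b w \<odot> B' b) \<in> lev N \<and> w - (\<Sum>b\<in>B N. f b w \<odot> B' b) \<in> ?S"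
      unfolding expand[OF u wu, symmetric] using u wu by (rule conjI)
  qed (rule expand; elim conjE; assumption)
qed

text \<open>Independence of the trace from the basis: expand the projected images in the basis \<open>B'\<close> and exchange the sums.\<close>

lemma wtrace_eq:
  assumes T: "lin_on scale (carr M') T" "\<And>w. w \<in> carr M' \<Longrightarrow> T w \<in> carr M'"
  shows "wtrace V M' (h + of_nat N) T = (\<Sum>b\<in>B N. f b (T (B' b)))"
proof -
  define C where "C = (SOME C. independent C \<and> span C = lev N)"
  have "\<exists>C. independent C \<and> span C = lev N"
  proof -
    obtain C where "C \<subseteq> lev N" "independent C" "lev N \<subseteq> span C"
      using maximal_independent_subset[of "lev N"] by blast
    then show ?thesis using span_minimal[OF _ subspace_wspace[OF M], of C] by blast
  qed
  then have "independent C \<and> span C = lev N" unfolding C_def by (rule someI_ex)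
  then have C: "independent C" "span C = lev N" by auto
  have "lev N \<subseteq> span (B' ` B N)"
  proof
    fix w assume w: "w \<in> lev N"
    show "w \<in> span (B' ` B N)"
      by (subst right_expand[OF w]) (intro span_sum span_scale span_base imageI)
  qed
  then have finC: "finite C"
    using independent_span_bound[OF finite_imageI[OF B_finite, of B' N] C(1)] C(2) span_superset by blast
  have CM: "c \<in> carr M'" if "c \<in> C" for c using that C(2) span_base by (auto simp: wspace_def)
  have rep: "(\<Sum>c\<in>C. representation C (B' b) c \<odot> c) = B' b" if "b \<in> B N" for b
    by (rule sum_representation_eq[OF C(1) _ finC]) (use B'_lev[OF that] C(2) in auto)
  have "wtrace V M' (h + of_nat N) T = (\<Sum>c\<in>C. representation C (wproj V M' (h + of_nat N) (T c)) c)"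
    by (simp add: wtrace_def C_def Let_def)
  also have "\<dots> = (\<Sum>c\<in>C. \<Sum>b\<in>B N. f b (T c) * representation C (B' b) c)"
  proof (intro sum.cong refl)
    fix c assume c: "c \<in> C"
    have "representation C (\<Sum>b\<in>B N. f b (T c) \<odot> B' b) = (\<lambda>a. \<Sum>b\<in>B N. representation C (f b (T c) \<odot> B' b) a)"
      by (rule representation_sum[OF C(1)]) (use B'_lev C(2) subspace_scale[OF subspace_wspace[OF M]] in auto)
    moreover have "representation C (f b (T c) \<odot> B' b) = (\<lambda>a. f b (T c) * representation C (B' b) a)" if "b \<in> B N" for b
      by (rule representation_scale[OF C(1)]) (use B'_lev[OF that] C(2) in auto)
    ultimately show "representation C (wproj V M' (h + of_nat N) (T c)) c = (\<Sum>b\<in>B N. f b (T c) * representation C (B' b) c)"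
      unfolding wproj_expand[OF T(2)[OF CM[OF c]]] by simp
  qed
  also have "\<dots> = (\<Sum>b\<in>B N. \<Sum>c\<in>C. representation C (B' b) c * f b (T c))"
    by (subst sum.swap) (simp add: mult.commute)
  also have "\<dots> = (\<Sum>b\<in>B N. f b (T (B' b)))"
  proof (intro sum.cong refl)
    fix b assume b: "b \<in> B N"
    have fT: "lin_on (*) (carr M') (\<lambda>w. f b (T w))"
      by (rule lin_on_comp[OF f_lin(2)[OF B_in[OF b]] T])
    have "f b (T (\<Sum>c\<in>C. representation C (B' b) c \<odot> c)) = (\<Sum>c\<in>C. f b (T (representation C (B' b) c \<odot> c)))"
      by (rule lin_on_complex_sum[OF fT carr_subspace[OF M]]) (use CM subspace_scale[OF carr_subspace[OF M]] in auto)
    also have "\<dots> = (\<Sum>c\<in>C. representation C (B' b) c * f b (T c))"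
      by (intro sum.cong refl lin_onD(2)[OF fT] CM)
    finally show "(\<Sum>c\<in>C. representation C (B' b) c * f b (T c)) = f b (T (B' b))" unfolding rep[OF b] ..
  qed
  finally show ?thesis .
qed

lemma wtrace_trivial:
  assumes "\<And>n::nat. \<mu> \<noteq> h + of_nat n" shows "wtrace V M' \<mu> T = 0"
proof -
  define C where "C = (SOME C. independent C \<and> span C = wspace V M' \<mu>)"
  have W: "wspace V M' \<mu> = {0}" by (rule wspace_trivial) (use assms in auto)
  have "independent {} \<and> span {} = wspace V M' \<mu>" unfolding W by (simp add: independent_empty)
  then have "independent C \<and> span C = wspace V M' \<mu>" unfolding C_def by (rule someI)
  then have "C \<subseteq> {0}" "0 \<notin> C" unfolding W using span_superset[of C] dependent_zero by auto
  then have "C = {}" by auto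
  then show ?thesis by (simp add: wtrace_def C_def Let_def)
qed

lemma vprod_scale_fields:
  assumes "\<And>l. l \<in> set js \<Longrightarrow> v l \<in> carr V" "w \<in> carr M'" "distinct js"
  shows "vprod M' js (\<lambda>i. c i \<odot> v i) k w = (\<Prod>l\<in>set js. c l) \<odot> vprod M' js v k w"
  using assms
proof (induction js)
  case (Cons i js)
  have "vprod M' js v k w \<in> carr M'" by (rule vprod_closed[OF M]) (use Cons.prems in auto)
  with Cons show ?case
    by (simp add: mode_scale_left[OF M] mode_scale[OF M] subspace_scale[OF carr_subspace[OF V_module]] mult.commute
        subspace_scale[OF carr_subspace[OF M]])
qed simp

end

context sphere
begin

theorem zhu_trace_value:
  assumes qp: "\<And>i. i \<in> {1..n} \<Longrightarrow> quasiprimary V (wt i) (v i)" and \<zeta>: "(\<lambda>i. exp (\<zeta> i)) \<in> config {1..n}"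
  shows "zhu_trace V M' n v wt \<zeta> (h + of_nat N) =
    (\<Prod>i\<in>{1..n}. exp (\<zeta> i) ^ wt i) * level_trace N (pair_corr [1..<Suc n] v (\<lambda>i. exp (\<zeta> i)))"
    and "(\<And>k::nat. \<mu> \<noteq> h + of_nat k) \<Longrightarrow> zhu_trace V M' n v wt \<zeta> \<mu> = 0"
proof -
  define js where "js = [1..<Suc n]"
  have set: "set js = {1..n}" by (auto simp: js_def)
  have js: "sorted_wrt (<) js" "distinct js" by (simp_all add: js_def sorted_wrt_upt del: upt_Suc)
  have carrV: "v l \<in> carr V" if "l \<in> set js" for l using qp[of l] that by (simp add: set quasiprimary_def wspace_def)
  have qp': "quasiprimary V (wt l) (v l)" if "l \<in> set js" for l using qp[of l] that by (simp add: set)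
  have mp: "mode_prod M' n u k w = vprod M' js u k w" for u k w by (simp add: mode_prod_def vprod_def js_def)
  have adm: "admissible js (f b) v (B' b)" if "b \<in> B N" for b
    using carrV B_in[OF that] B'_in[OF that] by (auto simp: admissible_def intro: f_dualvec)
  let ?t = "\<lambda>\<mu> x k. wtrace V M' \<mu> (mode_prod M' n (\<lambda>i. x i ^ wt i \<odot> v i) k) * (\<Prod>i\<in>{1..n}. x i powi (- k i - 1))"
  define R where "R x = (\<Prod>i\<in>{1..n}. x i ^ wt i) * (\<Sum>b\<in>B N. corr js (f b) v x (B' b))" for x
  have "rat_ext id {1..n} (?t (h + of_nat N)) (\<lambda>i. exp (\<zeta> i)) = R (\<lambda>i. exp (\<zeta> i))"
  proof (rule rat_ext_complex[OF _ radial_config _ _ \<zeta>])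
    show "rat_on (config {1..n}) R"
      unfolding R_def set[symmetric]
      by (intro rat_on_mult rat_on_prod rat_on_power rat_on_var rat_on_sum rat_on_corr js adm)
    fix x assume x: "x \<in> radially_ordered {1..n}"
    have tr: "wtrace V M' (h + of_nat N) (mode_prod M' n (\<lambda>i. x i ^ wt i \<odot> v i) k) =
        (\<Prod>i\<in>{1..n}. x i ^ wt i) * (\<Sum>b\<in>B N. f b (vprod M' js v k (B' b)))" for k
    proof -
      have sv: "x l ^ wt l \<odot> v l \<in> carr V" if "l \<in> set js" for l
        by (rule subspace_scale[OF carr_subspace[OF V_module] carrV[OF that]])
      have "wtrace V M' (h + of_nat N) (vprod M' js (\<lambda>i. x i ^ wt i \<odot> v i) k) =
          (\<Sum>b\<in>B N. f b (vprod M' js (\<lambda>i. x i ^ wt i \<odot> v i) k (B' b)))"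
        by (rule wtrace_eq) (use sv in \<open>auto intro: vprod_lin[OF M] vprod_closed[OF M]\<close>)
      also have "\<dots> = (\<Sum>b\<in>B N. (\<Prod>i\<in>{1..n}. x i ^ wt i) * f b (vprod M' js v k (B' b)))"
      proof (intro sum.cong refl)
        fix b assume b: "b \<in> B N"
        have "vprod M' js (\<lambda>i. x i ^ wt i \<odot> v i) k (B' b) = (\<Prod>l\<in>set js. x l ^ wt l) \<odot> vprod M' js v k (B' b)"
          by (rule vprod_scale_fields[OF carrV B'_in[OF b] js(2)])
        moreover have "vprod M' js v k (B' b) \<in> carr M'" by (rule vprod_closed[OF M carrV B'_in[OF b]])
        from f_scale[OF B_in[OF b] this]
        have "f b ((\<Prod>l\<in>set js. x l ^ wt l) \<odot> vprod M' js v k (B' b)) = (\<Prod>l\<in>set js. x l ^ wt l) * f b (vprod M' js v k (B' b))" .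
        ultimately show "f b (vprod M' js (\<lambda>i. x i ^ wt i \<odot> v i) k (B' b)) = (\<Prod>i\<in>{1..n}. x i ^ wt i) * f b (vprod M' js v k (B' b))"
          by (simp only: set)
      qed
      finally show ?thesis unfolding sum_distrib_left mp[abs_def] by simp
    qed
    have "((\<lambda>k. (\<Prod>i\<in>{1..n}. x i ^ wt i) * (\<Sum>b\<in>B N. f b (vprod M' js v k (B' b)) * laurent_monom (set js) x k)) has_sum R x)
        (PiE (set js) (\<lambda>_. UNIV))"
      unfolding R_def by (intro has_sum_cmult_right has_sum_sum has_sum_corr js adm) (use x set in simp_all)
    then show "(?t (h + of_nat N) x has_sum R x) (PiE {1..n} (\<lambda>_. UNIV))"
      unfolding tr set laurent_monom_def sum_distrib_right[symmetric] by (simp only: mult.assoc)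
  qed simp
  then show "zhu_trace V M' n v wt \<zeta> (h + of_nat N) =
    (\<Prod>i\<in>{1..n}. exp (\<zeta> i) ^ wt i) * level_trace N (pair_corr [1..<Suc n] v (\<lambda>i. exp (\<zeta> i)))"
    unfolding zhu_trace_def R_def level_trace_def js_def[symmetric] pair_corr_def .
  assume \<mu>: "\<And>k::nat. \<mu> \<noteq> h + of_nat k"
  have "rat_ext id {1..n} (?t \<mu>) (\<lambda>i. exp (\<zeta> i)) = 0"
    by (rule rat_ext_complex[OF _ radial_config _ _ \<zeta>, where R = "\<lambda>_. 0"]) (use wtrace_trivial[OF \<mu>] in \<open>auto intro: rat_on_const\<close>)
  then show "zhu_trace V M' n v wt \<zeta> \<mu> = 0" unfolding zhu_trace_def .
qed

end

section \<open>Weights of the contragredient module\<close>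

context voa_space
begin

text \<open>A vector of \<open>M'\<close> whose weight is not a weight of \<open>M\<close> pairs to zero with all of \<open>M\<close>, by invariance of \<open>L(0)\<close>.\<close>

lemma contragredient_graded:
  fixes M M' :: "'u vmod"
  assumes M: "weak_module V M" and M': "weak_module V M'" and pairing: "contragredient_pairing V M M' f"
    and gr: "carr M = span (\<Union>n::nat. wspace V M (h + of_nat n))" and gr': "carr M' = span (\<Union>n::nat. wspace V M' (h' + of_nat n))"
  shows "carr M' = span (\<Union>n::nat. wspace V M' (h + of_nat n))"
proof -
  have weights: "w' = 0" if w': "w' \<in> wspace V M' \<nu>" and \<nu>: "\<And>n::nat. \<nu> \<noteq> h + of_nat n" for w' \<nu>
  proof -
    have w'M: "w' \<in> carr M'" using w' by (simp add: wspace_def)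
    have lin: "lin_on (*) (carr M) (\<lambda>w. f w w')" using pairing w'M by (auto simp: contragredient_pairing_def)
    have lin': "lin_on (*) (carr M') (f w)" if "w \<in> carr M" for w using pairing that by (auto simp: contragredient_pairing_def)
    have "subspace {w \<in> carr M. f w w' = 0}"
      unfolding subspace_def using lin_onD[OF lin] carr_subspace[OF M] lin_on_complex_zero[OF lin carr_subspace[OF M]]
      by (auto simp: subspace_0 subspace_add subspace_scale)
    moreover have "f w w' = 0" if w: "w \<in> wspace V M (h + of_nat n)" for w and n :: nat
    proof -
      have wM: "w \<in> carr M" using w by (simp add: wspace_def)
      have "f w (vir V M' 0 w') = f (vir V M 0 w) w'" using contragredient_vir[OF M M' pairing wM w'M, of 0] by simp
      then have "\<nu> * f w w' = (h + of_nat n) * f w w'"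
        using w w' wM w'M lin_onD(2)[OF lin] lin_onD(2)[OF lin'[OF wM]] by (simp add: wspace_def)
      then show ?thesis using \<nu>[of n] by simp
    qed
    then have "(\<Union>n::nat. wspace V M (h + of_nat n)) \<subseteq> {w \<in> carr M. f w w' = 0}" by (auto simp: wspaceD)
    ultimately have "span (\<Union>n::nat. wspace V M (h + of_nat n)) \<subseteq> {w \<in> carr M. f w w' = 0}" by (intro span_minimal)
    then have z: "f w w' = 0" if "w \<in> carr M" for w using that unfolding gr[symmetric] by blast
    have z0: "f w 0 = 0" if "w \<in> carr M" for w by (rule lin_on_complex_zero[OF lin'[OF that] carr_subspace[OF M']])
    have "inj_on (\<lambda>w' w. if w \<in> carr M then f w w' else 0) (carr M')"
      using pairing by (auto simp: contragredient_pairing_def bij_betw_def)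
    then show "w' = 0"
      by (rule inj_onD) (use z z0 w'M subspace_0[OF carr_subspace[OF M']] in \<open>auto simp: fun_eq_iff\<close>)
  qed
  have "wspace V M' \<nu> \<subseteq> span (\<Union>n::nat. wspace V M' (h + of_nat n))" for \<nu>
  proof
    fix w assume w: "w \<in> wspace V M' \<nu>"
    show "w \<in> span (\<Union>n::nat. wspace V M' (h + of_nat n))"
    proof (cases "\<exists>n::nat. \<nu> = h + of_nat n")
      case True
      then show ?thesis using w by (auto intro!: span_base)
    next
      case False
      then have "w = 0" by (intro weights[OF w]) auto
      then show ?thesis by (simp add: span_zero)
    qed
  qed
  then have "carr M' \<subseteq> span (\<Union>n::nat. wspace V M' (h + of_nat n))"
    unfolding gr' by (intro span_minimal subspace_span) auto
  moreover have "span (\<Union>n::nat. wspace V M' (h + of_nat n)) \<subseteq> carr M'"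
    by (intro span_minimal carr_subspace[OF M']) (auto simp: wspaceD)
  ultimately show ?thesis by blast
qed

end

lemma log_derivative:
  fixes \<zeta> :: "complex \<Rightarrow> complex"
  assumes an: "\<zeta> analytic_on {z}" and ev: "eventually (\<lambda>y. exp (\<zeta> y) = (y - Wm) / (y - Wp)) (nhds z)" and z: "z \<noteq> Wp"
  shows "exp (\<zeta> z) = (z - Wm) / (z - Wp)" "exp (\<zeta> z) * deriv \<zeta> z = (Wm - Wp) / (z - Wp) ^ 2"
proof -
  show "exp (\<zeta> z) = (z - Wm) / (z - Wp)" using eventually_nhds_x_imp_x[OF ev] .
  have "(\<zeta> has_field_derivative deriv \<zeta> z) (at z)"
    using an by (simp add: analytic_on_imp_differentiable_at DERIV_deriv_iff_field_differentiable)
  then have "((\<lambda>y. exp (\<zeta> y)) has_field_derivative exp (\<zeta> z) * deriv \<zeta> z) (at z)"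
    by (rule DERIV_fun_exp)
  moreover have "((\<lambda>y. (y - Wm) / (y - Wp)) has_field_derivative (Wm - Wp) / (z - Wp) ^ 2) (at z)"
    by (rule derivative_eq_intros refl | use z in \<open>simp add: field_simps power2_eq_square\<close>)+
  then have "((\<lambda>y. exp (\<zeta> y)) has_field_derivative (Wm - Wp) / (z - Wp) ^ 2) (at z)"
    using DERIV_cong_ev[OF refl ev refl] by blast
  ultimately show "exp (\<zeta> z) * deriv \<zeta> z = (Wm - Wp) / (z - Wp) ^ 2" by (rule DERIV_unique)
qed

theorem theorem5p1:
  fixes scale :: "complex \<Rightarrow> 'u::ab_group_add \<Rightarrow> 'u"
    and D :: "('a::zero, 'u) rep_data" and \<alpha> :: 'a
    and B :: "nat \<Rightarrow> 'u set" and B' :: "'u \<Rightarrow> 'u"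
    and Wp Wm :: complex and n :: nat
    and v :: "nat \<Rightarrow> 'u" and wt :: "nat \<Rightarrow> nat"
    and z dz :: "nat \<Rightarrow> complex" and \<zeta> :: "nat \<Rightarrow> complex \<Rightarrow> complex"
  assumes "complex_space scale"
    and "complex_space.rep_theory scale D"
    and "\<alpha> \<in> labels D"
    and "complex_space.dual_bases scale D \<alpha> B B'"
    and "\<And>i. i \<in> {1..n} \<Longrightarrow> complex_space.quasiprimary scale (VA D) (wt i) (v i)"
    and "Wp \<noteq> Wm"
    and "inj_on z {1..n}"
    and "\<And>i. i \<in> {1..n} \<Longrightarrow> z i \<noteq> Wp \<and> z i \<noteq> Wm"
    and "\<And>i. i \<in> {1..n} \<Longrightarrow> \<zeta> i analytic_on {z i}"
    and "\<And>i. i \<in> {1..n} \<Longrightarrow>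
           eventually (\<lambda>y. exp (\<zeta> i y) = (y - Wm) / (y - Wp)) (nhds (z i))"
  shows "complex_space.genus1 D \<alpha> B B' Wp Wm n v wt z dz =
         (\<lambda>\<mu>. complex_space.zhu_trace scale (VA D) (Wmod D (dual D \<alpha>)) n v wt (\<lambda>i. \<zeta> i (z i)) \<mu> *
               (\<Prod>i\<in>{1..n}. (deriv (\<zeta> i) (z i) * dz i) ^ wt i))"
proof -
  interpret complex_space scale by (rule assms(1))
  \<comment> \<open>the conjuncts of \<open>rep_theory\<close>, in their order\<close>
  note rep1 = assms(2)[unfolded rep_theory_def] note rep2 = rep1[THEN conjunct2] note rep3 = rep2[THEN conjunct2]
  note rep4 = rep3[THEN conjunct2] note rep5 = rep4[THEN conjunct2] note rep6 = rep5[THEN conjunct2]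
  note rep7 = rep6[THEN conjunct2] note rep8 = rep7[THEN conjunct2] note rep9 = rep8[THEN conjunct2]
  note rep10 = rep9[THEN conjunct2] note rep11 = rep10[THEN conjunct2] note rep12 = rep11[THEN conjunct2]
  note rep13 = rep12[THEN conjunct2] note rep14 = rep13[THEN conjunct2] note rep15 = rep14[THEN conjunct2]
  note W0 = rep5[THEN conjunct1]
  note duals = rep9[THEN conjunct1, THEN bspec]
  note intws = rep15[THEN bspec]
  have \<alpha>: "\<alpha> \<in> labels D" by (rule assms(3))
  have \<alpha>': "dual D \<alpha> \<in> labels D" by (rule duals[OF \<alpha>, THEN conjunct1])
  interpret voa_space scale "VA D"
    by unfold_locales (rule rep1[THEN conjunct1], rule rep2[THEN conjunct1])
  have ord: "ordinary_module (VA D) (Wmod D \<beta>) (lowest D \<beta>)" if "\<beta> \<in> labels D" for \<beta>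
    by (rule rep6[THEN conjunct1, THEN bspec, OF that, THEN conjunct1])
  have pair: "contragredient_pairing (VA D) (Wmod D \<alpha>) (Wmod D (dual D \<alpha>)) (pairing D \<alpha>)"
    by (rule duals[OF \<alpha>, THEN conjunct2])
  have mod: "weak_module (VA D) (Wmod D \<beta>)" "carr (Wmod D \<beta>) = span (\<Union>n::nat. wspace (VA D) (Wmod D \<beta>) (lowest D \<beta> + of_nat n))"
    if "\<beta> \<in> labels D" for \<beta>
    by (rule ord[OF that, unfolded ordinary_module_def, THEN conjunct1])
       (rule ord[OF that, unfolded ordinary_module_def, THEN conjunct2, THEN conjunct1])
  have db: "independent (B m)" "span (B m) = wspace (VA D) (Wmod D \<alpha>) (lowest D \<alpha> + of_nat m)"
    "b \<in> B m \<Longrightarrow> B' b \<in> carr (Wmod D (dual D \<alpha>))"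
    "b \<in> B m \<Longrightarrow> c \<in> B l \<Longrightarrow> pairing D \<alpha> c (B' b) = (if c = b then 1 else 0)" for m b c l
    using assms(4) unfolding dual_bases_def by simp_all
  have Y2: "intw D (dual D \<alpha>) (dual D \<alpha>) 0 \<in> intertwiners (VA D) (Wmod D (dual D \<alpha>)) (Wmod D (dual D \<alpha>)) (vmod.truncate (VA D))"
    using intws[OF \<alpha>', THEN conjunct1] unfolding W0 .
  have Y0: "intw D 0 \<alpha> (dual D \<alpha>) \<in> intertwiners (VA D) (vmod.truncate (VA D)) (Wmod D \<alpha>) (Wmod D (dual D \<alpha>))"
    using intws[OF \<alpha>, THEN conjunct2, THEN conjunct2, THEN conjunct1] unfolding W0 .
  have pV: "contragredient_pairing (VA D) (vmod.truncate (VA D)) (vmod.truncate (VA D)) (pairing D 0)"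
    using duals[OF rep4[THEN conjunct1], THEN conjunct2] unfolding rep10[THEN conjunct1] W0 .
  have finB: "finite (B m)" for m
  proof -
    have "fin_dim (wspace (VA D) (Wmod D \<alpha>) (lowest D \<alpha> + of_nat m))"
      by (rule ord[OF \<alpha>, unfolded ordinary_module_def, THEN conjunct2, THEN conjunct2, THEN conjunct1, THEN spec])
    then obtain S where "finite S" "span (B m) \<subseteq> span S" unfolding fin_dim_def db(2) by blast
    then show ?thesis using independent_span_bound[OF _ db(1), of S m] span_superset[of "B m"] by blast
  qed
  interpret sphere scale "VA D" "Wmod D (dual D \<alpha>)" "lowest D \<alpha>" "Wmod D \<alpha>" "pairing D \<alpha>" B B'
    "log_minus1 D" "pairing D 0" "intw D 0 \<alpha> (dual D \<alpha>)" "intw D \<alpha> \<alpha> 0" "intw D (dual D \<alpha>) (dual D \<alpha>) 0"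
  proof unfold_locales
    show "carr (Wmod D (dual D \<alpha>)) = span (\<Union>n::nat. wspace (VA D) (Wmod D (dual D \<alpha>)) (lowest D \<alpha> + of_nat n))"
      by (rule contragredient_graded[OF mod(1)[OF \<alpha>] mod(1)[OF \<alpha>'] pair mod(2)[OF \<alpha>] mod(2)[OF \<alpha>']])
    show "creative_normalized (VA D) (Wmod D \<alpha>) (intw D \<alpha> \<alpha> 0)"
      by (rule intws[OF \<alpha>, THEN conjunct2, THEN conjunct1])
    show "creative_normalized (VA D) (Wmod D (dual D \<alpha>)) (intw D (dual D \<alpha>) (dual D \<alpha>) 0)"
      by (rule intws[OF \<alpha>', THEN conjunct2, THEN conjunct1])
    show "pairing_normalized (VA D) (log_minus1 D) (Wmod D \<alpha>) (Wmod D (dual D \<alpha>)) (pairing D 0) (pairing D \<alpha>)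
       (intw D \<alpha> \<alpha> 0) (intw D 0 \<alpha> (dual D \<alpha>))"
      by (rule intws[OF \<alpha>, THEN conjunct2, THEN conjunct2, THEN conjunct2])
    show "exp (log_minus1 D) = -1" by (rule rep14[THEN conjunct1])
    show "pairing D 0 (vac (VA D)) (vac (VA D)) = 1" by (rule rep11[THEN conjunct1])
  qed (rule mod[OF \<alpha>] mod(1)[OF \<alpha>'] pair pV Y0 Y2 finB db | assumption)+
  define js where "js = [1..<Suc n]"
  have set: "set js = {1..n}" by (auto simp: js_def)
  have js: "sorted_wrt (<) js" by (simp add: js_def sorted_wrt_upt del: upt_Suc)
  have I: "insert 0 (insert (n + 1) (set js)) = {0..n+1}" by (auto simp: set)
  let ?h = "lowest D \<alpha>"
  let ?Z = "\<lambda>l. (z l - Wm) / (z l - Wp)"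
  have qp: "quasiprimary (VA D) (wt l) (v l)" if "l \<in> set js" for l using assms(5) that by (simp add: set)
  have terms: "genus0_terms D \<alpha> n v b b' = sphere_terms js (n + 1) v b b'" for b b'
    unfolding fun_eq_iff genus0_terms_def sphere_terms_def cov_def vec_def laurent_monom_def I
    by (simp add: mode_prod_def vprod_def js_def del: upt_Suc)
  have log: "exp (\<zeta> i (z i)) = ?Z i" "exp (\<zeta> i (z i)) * deriv (\<zeta> i) (z i) = (Wm - Wp) / (z i - Wp) ^ 2" if "i \<in> {1..n}" for i
    using log_derivative[OF assms(9,10)] assms(8) that by blast+
  have conf: "(\<lambda>i. exp (\<zeta> i (z i))) \<in> config {1..n}"
  proof -
    have "inj_on (\<lambda>i. exp (\<zeta> i (z i))) {1..n}"
    proof (rule inj_onI)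
      fix i j assume ij: "i \<in> {1..n}" "j \<in> {1..n}" "exp (\<zeta> i (z i)) = exp (\<zeta> j (z j))"
      then have "(z i - Wm) * (z j - Wp) = (z j - Wm) * (z i - Wp)"
        using assms(8)[OF ij(1)] assms(8)[OF ij(2)] log(1) by (simp add: frac_eq_eq)
      then have "(Wp - Wm) * (z i - z j) = 0" by (simp add: algebra_simps)
      then have "z i = z j" using assms(6) by simp
      then show "i = j" by (rule inj_onD[OF assms(7) _ ij(1,2)])
    qed
    then show ?thesis by (simp add: config_def)
  qed
  show ?thesis
  proof (rule ext)
    fix \<mu>
    show "complex_space.genus1 D \<alpha> B B' Wp Wm n v wt z dz \<mu> =
       zhu_trace (VA D) (Wmod D (dual D \<alpha>)) n v wt (\<lambda>i. \<zeta> i (z i)) \<mu> * (\<Prod>i\<in>{1..n}. (deriv (\<zeta> i) (z i) * dz i) ^ wt i)"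
    proof (cases "\<exists>N::nat. \<mu> = ?h + of_nat N")
      case True
      then obtain N :: nat where N: "\<mu> = ?h + of_nat N" ..
      define G where "G = fps_const (exp (- log_minus1 D * ?h)) * fps_binomial (- 2 * ?h) *
        suminf (\<lambda>m. schottky_rho Wp Wm ^ m * (\<Sum>b\<in>B m. rat_ext fps_const {0..n+1} (genus0_terms D \<alpha> n v b (B' b)) (schottky_point Wp Wm n z)))"
      have G: "G $ N = (\<Prod>l\<in>set js. ((Wm - Wp) / (z l - Wp) ^ 2) ^ wt l) * level_trace N (pair_corr js v ?Z)"
        unfolding G_def terms I[symmetric] schottky_rho_def schottky_point_def[abs_def]
        by (rule genus_one_coefficient[OF js qp]) (use assms(6-8) set in auto)
      have ZZ: "level_trace N (pair_corr js v ?Z) = level_trace N (pair_corr js v (\<lambda>i. exp (\<zeta> i (z i))))"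
      proof -
        have "pair_corr js v ?Z \<phi> \<psi> = pair_corr js v (\<lambda>i. exp (\<zeta> i (z i))) \<phi> \<psi>" for \<phi> \<psi>
          unfolding pair_corr_def by (rule corr_cong_points) (simp add: log(1) set)
        then show ?thesis by (simp add: level_trace_def)
      qed
      have "complex_space.genus1 D \<alpha> B B' Wp Wm n v wt z dz \<mu> = q_shift ?h G \<mu> * (\<Prod>i\<in>{1..n}. dz i ^ wt i)"
        unfolding genus1_def G_def ..
      also have "q_shift ?h G \<mu> = G $ N" by (simp add: q_shift_def N)
      also have "G $ N * (\<Prod>i\<in>{1..n}. dz i ^ wt i) =
          (\<Prod>i\<in>{1..n}. exp (\<zeta> i (z i)) ^ wt i) * level_trace N (pair_corr js v (\<lambda>i. exp (\<zeta> i (z i)))) *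
          (\<Prod>i\<in>{1..n}. (deriv (\<zeta> i) (z i) * dz i) ^ wt i)"
      proof -
        have "(\<Prod>l\<in>{1..n}. ((Wm - Wp) / (z l - Wp) ^ 2) ^ wt l) =
            (\<Prod>l\<in>{1..n}. exp (\<zeta> l (z l)) ^ wt l) * (\<Prod>l\<in>{1..n}. deriv (\<zeta> l) (z l) ^ wt l)"
          unfolding prod.distrib[symmetric] by (intro prod.cong refl) (simp only: log(2)[symmetric] power_mult_distrib)
        then show ?thesis unfolding G ZZ set by (simp add: power_mult_distrib prod.distrib)
      qed
      also have "(\<Prod>i\<in>{1..n}. exp (\<zeta> i (z i)) ^ wt i) * level_trace N (pair_corr js v (\<lambda>i. exp (\<zeta> i (z i)))) =
          zhu_trace (VA D) (Wmod D (dual D \<alpha>)) n v wt (\<lambda>i. \<zeta> i (z i)) \<mu>"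
        unfolding N js_def by (rule zhu_trace_value(1)[OF assms(5) conf, symmetric])
      finally show ?thesis .
    next
      case False
      then have "{k. \<mu> = ?h + of_nat k} = {}" by auto
      then have "complex_space.genus1 D \<alpha> B B' Wp Wm n v wt z dz \<mu> = 0"
        by (simp add: genus1_def q_shift_def)
      moreover have "zhu_trace (VA D) (Wmod D (dual D \<alpha>)) n v wt (\<lambda>i. \<zeta> i (z i)) \<mu> = 0"
        by (rule zhu_trace_value(2)[OF assms(5) conf]) (use False in auto)
      ultimately show ?thesis by simp
    qed
  qed
qed

end
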